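(* Let $E\subset\mathbb{C}$ be an infinite compact set such that $\overline{\mathbb{C}}\setminus E$ is simply connected, let $\mathbf{F}=(F_1,\ldots,F_d)\in\mathcal{H}(E)^d$, let $\mathbf{m}=(m_1,\ldots,m_d)\in\mathbb{N}^d$ be a fixed multi-index with $|\mathbf{m}|=m_1+\cdots+m_d$, and let $\mu\in\mathbf{Reg}_{1,2}^{|\mathbf{m}|}(E)$. Then the following two assertions are equivalent: (a) $\mathbf{F}$ has exactly $|\mathbf{m}|$ system poles with respect to $\mathbf{m}$, counting multiplicities. (b) The polynomials $Q_{n,|\mathbf{m}|}^{\mu}$ (monic denominators of the $(n,\mathbf{m})$ orthogonal Hermite-Padé approximants of $\mathbf{F}$ with respect to $\mu$) are uniquely determined for all sufficiently large $n$, and there exists a polynomial $Q_{|\mathbf{m}|}$ of degree $|\mathbf{m}|$ such that $$\limsup_{n\to\infty}\|Q_{n,|\mathbf{m}|}^{\mu}-Q_{|\mathbf{m}|}\|^{1/n}=\theta<1 .$$ Moreover, if either (a) or (b) takes place, then $Q_{|\mathbf{m}|}=Q_{\mathbf{m}}^{\mathbf{F}}$, $$\theta=\max\left\{\frac{|\Phi(\xi)|}{\boldsymbol\rho_{\xi}(\mathbf{F},\mathbf{m})}:\xi\in\mathcal{P}(\mathbf{F},\mathbf{m})\right\},$$ and, for each $i=1,\ldots,d$ and any compact subset $K$ of $D_{i,0}^{*}(\mathbf{F},\mathbf{m})\setminus\mathcal{P}(\mathbf{F},\mathbf{m})$, $$\limsup_{n\to\infty}\|R_{n,\mathbf{m},i}^{\mu}-F_i\|_{K}^{1/n}\le\frac{\|\Phi\|_K}{\boldsymbol\rho_{i,0}^{*}(\mathbf{F},\mathbf{m})},$$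 where $\|\cdot\|_K$ denotes the sup-norm on $K$ and, if $K\subset E$, then $\|\Phi\|_K$ is replaced by $1$.
   Context: **Basic notation.** $\mathbb{N}=\{1,2,\ldots\}$. $\mathcal{H}(E)$ is the set of functions holomorphic in some neighborhood of $E$, and $\mathcal{H}(E)^d$ the set of $d$-tuples of such functions. $\mathcal{M}(E)$ is the set of finite positive Borel measures with infinite support contained in $E$. For $\mu\in\mathcal{M}(E)$, $\langle g,h\rangle_\mu=\int g(\zeta)\overline{h(\zeta)}\,d\mu(\zeta)$, and $p_n(z)=\kappa_nz^n+\cdots$, $\kappa_n>0$, $n\ge 0$, is the orthonormal polynomial of degree $n$ with respect to $\mu$, i.e. $\langle p_n,p_k\rangle_\mu=\delta_{n,k}$. The second type functions are $s_n(z)=\int\frac{\overline{p_n(\zeta)}}{z-\zeta}\,d\mu(\zeta)$, $z\in\overline{\mathbb{C}}\setminus\mathrm{supp}(\mu)$. The symbol $\|\cdot\|$ without subscript is the coefficient norm on the space of polynomials (e.g. the sum of the absolute values of the coefficients). **Conformal map and canonical domains.** $\Phi$ is the unique conformal map of $\overline{\mathbb{C}}\setminus E$ onto $\overline{\mathbb{C}}\setminus\{|w|\le1\}$ with $\Phi(\infty)=\infty$, $\Phi'(\infty)>0$. For $\rho>1$, $D_\rho=E\cup\{z\in\mathbb{C}\setminus E:|\Phi(z)|<\rho\}$ is the canonical domain of index $\rho$ ($D_\infty=\mathbb{C}$). If $K\not\subset E$, $\|\Phi\|_K$ is the supremum of $|\Phi|$ on $K\setminus E$. Quotients with denominator $\infty$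 are $0$. **Classes of measures.** $\mu\in\mathbf{Reg}_{1,2}(E)$ means $\mu\in\mathcal{M}(E)$ and both $\lim_{n}|p_n(z)|^{1/n}=|\Phi(z)|$ and $\lim_n|s_n(z)|^{1/n}=|\Phi(z)|^{-1}$ hold uniformly on compact subsets of $\mathbb{C}\setminus E$. For $m\in\mathbb{N}$, $\mu\in\mathbf{Reg}_{1,2}^m(E)$ means $\mu\in\mathbf{Reg}_{1,2}(E)$ and there are $c>0$ and $n_0$ such that $\kappa_{n-m}/\kappa_n\ge c$ for all $n\ge n_0$. **Orthogonal Hermite-Padé approximants.** For $n\in\mathbb{N}$ there exist polynomials $Q_{n,|\mathbf{m}|}^\mu\not\equiv0$ with $\deg Q_{n,|\mathbf{m}|}^\mu\le|\mathbf{m}|$ and $P_{n,\mathbf{m},k,i}^\mu$ with $\deg P_{n,\mathbf{m},k,i}^\mu\le n-1$ ($k=0,\ldots,m_i-1$, $i=1,\ldots,d$) such that $$\langle Q_{n,|\mathbf{m}|}^\mu z^kF_i-P_{n,\mathbf{m},k,i}^\mu,\,p_j\rangle_\mu=0,\qquad j=0,1,\ldots,n,$$ for all such $k,i$. $Q_{n,|\mathbf{m}|}^\mu$ is normalized to have leading coefficient $1$, and (if not unique) one solution is chosen for each $n$; given $Q_{n,|\mathbf{m}|}^\mu$, the $P_{n,\mathbf{m},k,i}^\mu$ are unique. The vector $(R_{n,\mathbf{m},1}^\mu,\ldots,R_{n,\mathbf{m},d}^\mu)$ with $R_{n,\mathbf{m},i}^\mu=P_{n,\mathbf{m},0,i}^\mu/Q_{n,|\mathbf{m}|}^\mu$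 is called an $(n,\mathbf{m})$ orthogonal Hermite-Padé approximant of $\mathbf{F}$ with respect to $\mu$. **System poles.** A polynomial combination of $\mathbf{F}$ (with respect to $\mathbf{m}$) is a function $\sum_{i=1}^dv_iF_i$ with $v_i$ polynomials, $\deg v_i<m_i$. A point $\xi\in\mathbb{C}\setminus E$ is a system pole of order $\tau$ of $\mathbf{F}$ with respect to $\mathbf{m}$ if $\tau$ is the largest positive integer such that for each $t=1,\ldots,\tau$ there is at least one polynomial combination which is (extends to be) holomorphic on a neighborhood of $\overline{D}_{|\Phi(\xi)|}$ except for a pole at $z=\xi$ of exact order $t$. System poles are counted with their order. $Q_{\mathbf{m}}^{\mathbf{F}}$ is the monic polynomial whose zeros are the system poles of $\mathbf{F}$ with respect to $\mathbf{m}$, taking account of their order, and $\mathcal{P}(\mathbf{F},\mathbf{m})$ is the set of its distinct zeros. **Characteristic indices.** For $G\in\mathcal{H}(E)$ and an integer $t\ge0$, $\rho_t(G)\in(1,\infty]$ is the index of the largest canonical domain to which $G$ extends as a meromorphic function with at most $t$ poles counting multiplicities. If $\xi$ is a system pole of order $\tau$ and $1\le t\le\tau$, $\rho_{\xi,t}(\mathbf{F},\mathbf{m})$ is the largest of the numbers $\rho_t(G)$, where $G$ runs over the polynomial combinations that are holomorphic on a neighborhood of $\overline{D}_{|\Phi(\xi)|}$ except for a pole at $\xi$ of order $t$. Set $\boldsymbol\rho_{\xi,t}(\mathbf{F},\mathbf{m})=\min_{k=1,\ldots,t}\rho_{\xi,k}(\mathbf{F},\mathbf{m})$ and $\boldsymbol\rho_\xi(\mathbf{F},\mathbf{m})=\boldsymbol\rho_{\xi,\tau}(\mathbf{F},\mathbf{m})$.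 For $i\in\{1,\ldots,d\}$, $k\in\{0,\ldots,m_i-1\}$, $D_{i,k}(\mathbf{F},\mathbf{m})$ is the largest canonical domain in which all the poles of $z^kF_i$ are system poles of $\mathbf{F}$ with respect to $\mathbf{m}$, their order as poles of $z^kF_i$ does not exceed their order as system poles, and $z^kF_i$ has no other singularity; $\boldsymbol\rho_{i,k}(\mathbf{F},\mathbf{m})$ is its index. If $\xi_1,\ldots,\xi_N$ are the poles of $z^kF_i$ in $D_{i,k}(\mathbf{F},\mathbf{m})$ and $\hat\tau_j$ is the order of $\xi_j$ as a pole of $z^kF_i$, then $$\boldsymbol\rho_{i,k}^*(\mathbf{F},\mathbf{m})=\min\Big\{\boldsymbol\rho_{i,k}(\mathbf{F},\mathbf{m}),\ \min_{j=1,\ldots,N}\boldsymbol\rho_{\xi_j,\hat\tau_j}(\mathbf{F},\mathbf{m})\Big\}$$ (the inner minimum is omitted if $N=0$), and $D_{i,k}^*(\mathbf{F},\mathbf{m})$ is the canonical domain with this index. *)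

theory Defs
  imports "HOL-Complex_Analysis.Complex_Analysis"
begin

(* The library's simply_connected, with a subset of a normed space replaced by an abstract
   topological space, so that it applies to subsets of the Riemann sphere. *)
definition simply_connected_space :: "'a topology \<Rightarrow> bool" where
  "simply_connected_space X \<longleftrightarrow>
     (\<forall>p q. pathin X p \<and> p 1 = p 0 \<and> pathin X q \<and> q 1 = q 0 \<longrightarrow>
        homotopic_with (\<lambda>r. r 1 = r 0) (top_of_set {0..1::real}) X p q)"

(* The complement of E in the Riemann sphere; None is the point at infinity. *)
definition sphere_complement :: "complex set \<Rightarrow> complex option topology" where
  "sphere_complement E =
     subtopology (Alexandroff_compactification (euclidean :: complex topology))
       (insert None (Some ` (- E)))"

(* Phi(infinity) = infinity is expressed by the limit, and Phi'(infinity) is the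
   limit of Phi(z)/z. *)
definition is_exterior_map :: "complex set \<Rightarrow> (complex \<Rightarrow> complex) \<Rightarrow> bool" where
  "is_exterior_map E \<Phi> \<longleftrightarrow>
     \<Phi> holomorphic_on (- E) \<and> bij_betw \<Phi> (- E) {w. 1 < norm w} \<and>
     filterlim \<Phi> at_infinity at_infinity \<and>
     (\<exists>c>0. ((\<lambda>z. \<Phi> z / z) \<longlongrightarrow> complex_of_real c) at_infinity)"

(* Determined uniquely on - E; its values on E are never used. *)
definition ext_map :: "complex set \<Rightarrow> complex \<Rightarrow> complex" where
  "ext_map E = (SOME \<Phi>. is_exterior_map E \<Phi>)"

(* The index is extended real, so that canonical_domain E \<infinity> is the whole plane. *)
definition canonical_domain :: "complex set \<Rightarrow> ereal \<Rightarrow> complex set" where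
  "canonical_domain E \<rho> = E \<union> {z. z \<notin> E \<and> ereal (norm (ext_map E z)) < \<rho>}"

(* Inserting 0 only matters for K = {}. *)
definition sup_norm :: "complex set \<Rightarrow> (complex \<Rightarrow> complex) \<Rightarrow> real" where
  "sup_norm K f = Sup (insert 0 ((\<lambda>z. norm (f z)) ` K))"

definition ext_map_norm :: "complex set \<Rightarrow> complex set \<Rightarrow> real" where
  "ext_map_norm E K = (if K \<subseteq> E then 1 else sup_norm (K - E) (ext_map E))"

definition msupport :: "complex measure \<Rightarrow> complex set" where
  "msupport \<mu> = {z. \<forall>r>0. emeasure \<mu> (ball z r) > 0}"

definition measures_on :: "complex set \<Rightarrow> complex measure set" where
  "measures_on E =
     {\<mu>. sets \<mu> = sets borel \<and> finite_measure \<mu> \<and> infinite (msupport \<mu>) \<and> msupport \<mu> \<subseteq> E}"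

(* The measure is concentrated on its support. Integrating over the support, rather than over
   the whole plane, makes the value independent of what g and h do elsewhere (where they need
   not even be measurable). *)
definition inner_prod ::
    "complex measure \<Rightarrow> (complex \<Rightarrow> complex) \<Rightarrow> (complex \<Rightarrow> complex) \<Rightarrow> complex" where
  "inner_prod \<mu> g h = (LINT \<zeta>:msupport \<mu>|\<mu>. g \<zeta> * cnj (h \<zeta>))"

definition orthonormal_polys :: "complex measure \<Rightarrow> (nat \<Rightarrow> complex poly) \<Rightarrow> bool" where
  "orthonormal_polys \<mu> p \<longleftrightarrow>
     (\<forall>n. degree (p n) = n \<and> (\<exists>\<kappa>>0. lead_coeff (p n) = complex_of_real \<kappa>)) \<and>
     (\<forall>n k. inner_prod \<mu> (poly (p n)) (poly (p k)) = (if n = k then 1 else 0))"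

definition orth_poly :: "complex measure \<Rightarrow> nat \<Rightarrow> complex poly" where
  "orth_poly \<mu> = (THE p. orthonormal_polys \<mu> p)"

definition kappa :: "complex measure \<Rightarrow> nat \<Rightarrow> real" where
  "kappa \<mu> n = Re (lead_coeff (orth_poly \<mu> n))"

definition second_type :: "complex measure \<Rightarrow> nat \<Rightarrow> complex \<Rightarrow> complex" where
  "second_type \<mu> n z = (LINT \<zeta>:msupport \<mu>|\<mu>. cnj (poly (orth_poly \<mu> n) \<zeta>) / (z - \<zeta>))"

definition Reg12 :: "complex set \<Rightarrow> complex measure set" where
  "Reg12 E = {\<mu> \<in> measures_on E. \<forall>K. compact K \<and> K \<subseteq> - E \<longrightarrow>
     uniform_limit K (\<lambda>n z. root n (norm (poly (orth_poly \<mu> n) z)))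
       (\<lambda>z. norm (ext_map E z)) sequentially \<and>
     uniform_limit K (\<lambda>n z. root n (norm (second_type \<mu> n z)))
       (\<lambda>z. inverse (norm (ext_map E z))) sequentially}"

definition Reg12m :: "complex set \<Rightarrow> nat \<Rightarrow> complex measure set" where
  "Reg12m E M = {\<mu> \<in> Reg12 E. \<exists>c>0. \<exists>n0\<ge>M. \<forall>n\<ge>n0. kappa \<mu> (n - M) / kappa \<mu> n \<ge> c}"

text \<open>
  A vector of functions is a family indexed by \<open>{1..d}\<close>, and so is a multi-index.
\<close>

definition msize :: "nat \<Rightarrow> (nat \<Rightarrow> nat) \<Rightarrow> nat" where
  "msize d m = (\<Sum>i=1..d. m i)"

(* P k i is the polynomial attached to z^k F_i. *)
definition hermite_pade ::
    "complex measure \<Rightarrow> nat \<Rightarrow> (nat \<Rightarrow> complex \<Rightarrow> complex) \<Rightarrow> (nat \<Rightarrow> nat) \<Rightarrow> nat \<Rightarrow>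
     complex poly \<Rightarrow> (nat \<Rightarrow> nat \<Rightarrow> complex poly) \<Rightarrow> bool" where
  "hermite_pade \<mu> d F m n Q P \<longleftrightarrow>
     Q \<noteq> 0 \<and> degree Q \<le> msize d m \<and> lead_coeff Q = 1 \<and>
     (\<forall>i\<in>{1..d}. \<forall>k<m i. degree (P k i) \<le> n - 1 \<and>
        (\<forall>j\<le>n. inner_prod \<mu> (\<lambda>z. poly Q z * z ^ k * F i z - poly (P k i) z)
                  (poly (orth_poly \<mu> j)) = 0))"

definition coeff_norm :: "complex poly \<Rightarrow> real" where
  "coeff_norm p = (\<Sum>k\<le>degree p. norm (coeff p k))"

definition denominators_limit ::
    "(nat \<Rightarrow> complex poly) \<Rightarrow> nat \<Rightarrow> complex poly \<Rightarrow> ereal \<Rightarrow> bool" where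
  "denominators_limit Q M L \<theta> \<longleftrightarrow>
     degree L = M \<and> limsup (\<lambda>n. ereal (root n (coeff_norm (Q n - L)))) = \<theta> \<and> \<theta> < 1"

(* Two functions define the same germ along E. Functions in H(E) are represented by total
   functions, whose values far from E are meaningless: every notion below depends on
   the germ only, through its continuations. *)
definition same_germ :: "complex set \<Rightarrow> (complex \<Rightarrow> complex) \<Rightarrow> (complex \<Rightarrow> complex) \<Rightarrow> bool" where
  "same_germ E f g \<longleftrightarrow> (\<exists>V. open V \<and> E \<subseteq> V \<and> (\<forall>z\<in>V. f z = g z))"

definition meromorphic_ext ::
    "complex set \<Rightarrow> (complex \<Rightarrow> complex) \<Rightarrow> complex set \<Rightarrow> (complex \<Rightarrow> complex) \<Rightarrow> bool" where
  "meromorphic_ext E G D g \<longleftrightarrow> g meromorphic_on D \<and> same_germ E g G"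

definition pole_order :: "(complex \<Rightarrow> complex) \<Rightarrow> complex \<Rightarrow> nat" where
  "pole_order g z = nat (- zorder g z)"

definition poly_combinations ::
    "nat \<Rightarrow> (nat \<Rightarrow> complex \<Rightarrow> complex) \<Rightarrow> (nat \<Rightarrow> nat) \<Rightarrow> (complex \<Rightarrow> complex) set" where
  "poly_combinations d F m =
     {\<lambda>z. \<Sum>i=1..d. poly (v i) z * F i z | v :: nat \<Rightarrow> complex poly.
        \<forall>i\<in>{1..d}. degree (v i) < m i}"

(* The combinations holomorphic on a neighborhood of the closure of the canonical domain of
   index |Phi(xi)|, except for a pole at xi of exact order t. *)
definition pole_combinations ::
    "complex set \<Rightarrow> nat \<Rightarrow> (nat \<Rightarrow> complex \<Rightarrow> complex) \<Rightarrow> (nat \<Rightarrow> nat) \<Rightarrow> complex \<Rightarrow> nat \<Rightarrow>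
     (complex \<Rightarrow> complex) set" where
  "pole_combinations E d F m \<xi> t =
     {G \<in> poly_combinations d F m. \<exists>g U. same_germ E g G \<and> open U \<and>
        closure (canonical_domain E (ereal (norm (ext_map E \<xi>)))) \<subseteq> U \<and>
        g holomorphic_on (U - {\<xi>}) \<and> is_pole g \<xi> \<and> pole_order g \<xi> = t}"

definition is_system_pole ::
    "complex set \<Rightarrow> nat \<Rightarrow> (nat \<Rightarrow> complex \<Rightarrow> complex) \<Rightarrow> (nat \<Rightarrow> nat) \<Rightarrow> complex \<Rightarrow> nat \<Rightarrow> bool" where
  "is_system_pole E d F m \<xi> \<tau> \<longleftrightarrow> \<xi> \<notin> E \<and> 1 \<le> \<tau> \<and>
     (\<forall>t\<in>{1..\<tau>}. pole_combinations E d F m \<xi> t \<noteq> {}) \<and>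
     (\<forall>\<sigma>. (\<forall>t\<in>{1..\<sigma>}. pole_combinations E d F m \<xi> t \<noteq> {}) \<longrightarrow> \<sigma> \<le> \<tau>)"

definition system_poles ::
    "complex set \<Rightarrow> nat \<Rightarrow> (nat \<Rightarrow> complex \<Rightarrow> complex) \<Rightarrow> (nat \<Rightarrow> nat) \<Rightarrow> complex set" where
  "system_poles E d F m = {\<xi>. \<exists>\<tau>. is_system_pole E d F m \<xi> \<tau>}"

definition system_pole_order ::
    "complex set \<Rightarrow> nat \<Rightarrow> (nat \<Rightarrow> complex \<Rightarrow> complex) \<Rightarrow> (nat \<Rightarrow> nat) \<Rightarrow> complex \<Rightarrow> nat" where
  "system_pole_order E d F m \<xi> = (THE \<tau>. is_system_pole E d F m \<xi> \<tau>)"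

definition has_exactly_system_poles ::
    "complex set \<Rightarrow> nat \<Rightarrow> (nat \<Rightarrow> complex \<Rightarrow> complex) \<Rightarrow> (nat \<Rightarrow> nat) \<Rightarrow> nat \<Rightarrow> bool" where
  "has_exactly_system_poles E d F m N \<longleftrightarrow> finite (system_poles E d F m) \<and>
     (\<Sum>\<xi>\<in>system_poles E d F m. system_pole_order E d F m \<xi>) = N"

definition system_poly ::
    "complex set \<Rightarrow> nat \<Rightarrow> (nat \<Rightarrow> complex \<Rightarrow> complex) \<Rightarrow> (nat \<Rightarrow> nat) \<Rightarrow> complex poly" where
  "system_poly E d F m =
     (\<Prod>\<xi>\<in>system_poles E d F m. [:- \<xi>, 1:] ^ system_pole_order E d F m \<xi>)"

text \<open>
  Canonical domains increase with their index, and continuations along them glue, so the index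
  of the largest canonical domain with a given property is the supremum of the admissible
  indices.
\<close>

definition merom_index :: "complex set \<Rightarrow> nat \<Rightarrow> (complex \<Rightarrow> complex) \<Rightarrow> ereal" where
  "merom_index E t G = Sup {\<rho>. 1 < \<rho> \<and>
     (\<exists>g. meromorphic_ext E G (canonical_domain E \<rho>) g \<and>
        finite {z \<in> canonical_domain E \<rho>. is_pole g z} \<and>
        (\<Sum>z | z \<in> canonical_domain E \<rho> \<and> is_pole g z. pole_order g z) \<le> t)}"

definition rho_pole ::
    "complex set \<Rightarrow> nat \<Rightarrow> (nat \<Rightarrow> complex \<Rightarrow> complex) \<Rightarrow> (nat \<Rightarrow> nat) \<Rightarrow> complex \<Rightarrow> nat \<Rightarrow> ereal" where
  "rho_pole E d F m \<xi> t = Sup (merom_index E t ` pole_combinations E d F m \<xi> t)"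

definition bold_rho_pole ::
    "complex set \<Rightarrow> nat \<Rightarrow> (nat \<Rightarrow> complex \<Rightarrow> complex) \<Rightarrow> (nat \<Rightarrow> nat) \<Rightarrow> complex \<Rightarrow> nat \<Rightarrow> ereal" where
  "bold_rho_pole E d F m \<xi> t = Min (rho_pole E d F m \<xi> ` {1..t})"

definition bold_rho ::
    "complex set \<Rightarrow> nat \<Rightarrow> (nat \<Rightarrow> complex \<Rightarrow> complex) \<Rightarrow> (nat \<Rightarrow> nat) \<Rightarrow> complex \<Rightarrow> ereal" where
  "bold_rho E d F m \<xi> = bold_rho_pole E d F m \<xi> (system_pole_order E d F m \<xi>)"

definition rho_comp ::
    "complex set \<Rightarrow> nat \<Rightarrow> (nat \<Rightarrow> complex \<Rightarrow> complex) \<Rightarrow> (nat \<Rightarrow> nat) \<Rightarrow> nat \<Rightarrow> nat \<Rightarrow> ereal" where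
  "rho_comp E d F m i k = Sup {\<rho>. 1 < \<rho> \<and>
     (\<exists>g. meromorphic_ext E (\<lambda>z. z ^ k * F i z) (canonical_domain E \<rho>) g \<and>
        (\<forall>\<xi>\<in>canonical_domain E \<rho>. is_pole g \<xi> \<longrightarrow>
           \<xi> \<in> system_poles E d F m \<and> pole_order g \<xi> \<le> system_pole_order E d F m \<xi>))}"

(* The infimum of the empty set is \<infinity>, so it has no effect if there are no poles. *)
definition rho_comp_star ::
    "complex set \<Rightarrow> nat \<Rightarrow> (nat \<Rightarrow> complex \<Rightarrow> complex) \<Rightarrow> (nat \<Rightarrow> nat) \<Rightarrow> nat \<Rightarrow> nat \<Rightarrow> ereal" where
  "rho_comp_star E d F m i k = min (rho_comp E d F m i k)
     (Inf {bold_rho_pole E d F m \<xi> (pole_order g \<xi>) | \<xi> g.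
        meromorphic_ext E (\<lambda>z. z ^ k * F i z) (canonical_domain E (rho_comp E d F m i k)) g \<and>
        \<xi> \<in> canonical_domain E (rho_comp E d F m i k) \<and> is_pole g \<xi>})"

end

(* A germ G on E continues holomorphically to the canonical domain of index rho if and only if
   its Fourier coefficients [G]_n with respect to the p_n are O(r^-n) for every r < rho, and the
   denominators Q_n are the solutions of [Q G]_n = 0, G running over the polynomial combinations.

   (a) implies (b): combinations with poles of orders 1, ..., tau at a system pole xi, continued up
   to index rho, show that [Q_n / (z - xi)^k]_n = O(r^-n) for r < rho and k <= tau. As [1 / (z - xi)]_n
   is minus the second type function at xi, which is not much smaller than |Phi(xi)|^-n, the Taylor
   coefficients of Q_n at xi below order tau are O(eta^n) for eta > |Phi(xi)| / rho. These are |m|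
   coefficients in all, and they determine Q_n by Hermite interpolation.

   (b) implies (a): if Q_n - L = O(eta^n), then [L G]_n = [(L - Q_n) G]_n shows that multiplication
   by L enlarges the domain of holomorphy of a combination G by the factor 1 / eta. Order the zeros
   of L by their level |Phi|, and let W_k consist of the combinations that, multiplied by the linear
   factors of all zeros after the k-th, are holomorphic beyond the level of the k-th zero. Then W_0
   contains all combinations, a |m|-dimensional space, W_|m| consists of entire ones, which vanish
   by the lower bound on kappa_(n-|m|) / kappa_n, and each step has codimension at most one. So no
   step is trivial, and an element of W_k outside of W_(k+1) has a pole of the required order. *)

theory Submission
  imports Defs "HOL-Computational_Algebra.Fundamental_Theorem_Algebra"
begin

section \<open>The exterior conformal map\<close>

text \<open>Continuation is never followed along paths. The orthogonal series of a germ on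
  \<open>E\<close> represents its continuation to any canonical domain where one exists, so two
  continuations agree because their coefficients do. For the exact value of \<theta> the zeros of L
  are ordered by level only up to a factor: multiplication by L gains 1 / \<eta>, so levels whose
  ratio is below 1 / \<eta> may come in any order. For each zero \<xi> its copies can be put behind
  all other zeros of level below |\<Phi>(\<xi>)| / \<eta>, and combinations with poles at \<xi> then
  continue to every radius below that one. So every \<eta> > \<theta> bounds the ratios
  |\<Phi>(\<xi>)| / \<rho>_\<xi>, while every \<eta> above these ratios bounds \<theta>. For the
  approximants the principal parts of F_i are split off: the estimates of Taylor coefficients make
  [Q_n F_i]_\<nu> small for all \<nu> \<ge> n, and the remainder Q_n F_i - P_n has no coefficient of
  index up to n.\<close>

lemma exterior_inversion_homotopy:
  fixes E :: "complex set" and a :: complex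
  assumes E: "compact E" and a: "a \<in> E"
    and sc: "simply_connected_space (sphere_complement E)"
  defines "T \<equiv> insert 0 ((\<lambda>z. 1 / (z - a)) ` (- E))"
  shows "open T" "simply_connected T"
proof -
  let ?X = "sphere_complement E"
  let ?f = "\<lambda>w::complex. if w = 0 then None else Some (a + 1 / w)"
  let ?g = "\<lambda>x. case x of None \<Rightarrow> (0::complex) | Some z \<Rightarrow> 1 / (z - a)"
  have Tmem: "w \<in> T \<longleftrightarrow> w = 0 \<or> a + 1 / w \<notin> E" for w
  proof (cases "w = 0")
    case False
    have "w = 1 / ((a + 1 / w) - a)" using False by simp
    moreover have "a + 1 / w = z" if "w = 1 / (z - a)" for z
      using that False by auto
    ultimately show ?thesis unfolding T_def using False by (auto intro!: image_eqI[of w _ "a + 1/w"])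
  qed (simp add: T_def)
  \<comment> \<open>Boundedness of \<open>K\<close> keeps these w away from 0, where a + 1 / w is
    singular. \<open>K = E\<close> gives the openness of \<open>T\<close>, and the compact sets
    \<open>C\<close> below give the continuity of \<open>?f\<close> at 0.\<close>
  have closedK: "closed {w. w \<noteq> 0 \<and> a + 1 / w \<in> K}" if K: "compact K" for K
  proof -
    obtain B where B: "B > 0" "\<And>z. z \<in> K \<Longrightarrow> norm (z - a) \<le> B"
    proof -
      have "compact ((\<lambda>z. z - a) ` K)" by (intro compact_continuous_image K continuous_intros)
      then have "bounded ((\<lambda>z. z - a) ` K)" by (rule compact_imp_bounded)
      then show ?thesis using that by (auto simp: bounded_pos)
    qed
    have eq: "{w. w \<noteq> 0 \<and> a + 1 / w \<in> K} = {w \<in> - ball 0 (1/B). a + 1 / w \<in> K}"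
    proof -
      have "w \<noteq> 0 \<and> a + 1 / w \<in> K \<longleftrightarrow> norm w \<ge> 1 / B \<and> a + 1 / w \<in> K" for w
      proof (cases "w = 0 \<or> a + 1 / w \<notin> K")
        case True then show ?thesis using B(1) by auto
      next
        case False
        then have "norm ((a + 1/w) - a) \<le> B" using B(2) by blast
        then have "1 / norm w \<le> B" by (simp add: norm_divide)
        then have "1 / B \<le> norm w" using False B(1) by (simp add: field_simps)
        then show ?thesis using False by auto
      qed
      then show ?thesis unfolding Compl_iff mem_ball_0 not_less by (rule Collect_cong)
    qed
    have "continuous_on (- ball 0 (1/B)) (\<lambda>w. a + 1 / w)"
      using B(1) by (auto intro!: continuous_intros)
    from continuous_closed_preimage[OF this _ compact_imp_closed[OF K]]
    have "closed (- ball 0 (1/B) \<inter> (\<lambda>w. a + 1 / w) -` K)" by (simp add: closed_Compl)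
    moreover have "{w \<in> - ball 0 (1/B). a + 1 / w \<in> K} = - ball 0 (1/B) \<inter> (\<lambda>w. a + 1 / w) -` K"
      by blast
    ultimately show ?thesis unfolding eq by simp
  qed
  show "open T"
  proof -
    have "- T = {w. w \<noteq> 0 \<and> a + 1 / w \<in> E}" by (auto simp: Tmem)
    then show ?thesis using closedK[OF E] by (metis open_closed)
  qed
  have tX: "topspace ?X = insert None (Some ` (- E))"
    by (auto simp: sphere_complement_def)
  have cf: "continuous_map (top_of_set T) ?X ?f"
    unfolding continuous_map
  proof (intro conjI allI impI)
    show "?f ` topspace (top_of_set T) \<subseteq> topspace ?X"
      by (auto simp: tX Tmem)
    fix U assume "openin ?X U"
    then obtain U' where U': "openin (Alexandroff_compactification euclidean) U'"
        "U = U' \<inter> insert None (Some ` (- E))"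
      unfolding sphere_complement_def openin_subtopology by blast
    have eq: "{w \<in> topspace (top_of_set T). ?f w \<in> U} = T \<inter> {w. ?f w \<in> U'}"
      by (auto simp: U'(2) Tmem)
    have "open {w. ?f w \<in> U'}"
    proof -
      consider (A) V where "open V" "U' = Some ` V"
        | (B) C where "compact C" "U' = insert None (Some ` (UNIV - C))"
        using U'(1) unfolding openin_Alexandroff_compactification by auto
      then show ?thesis
      proof cases
        case A
        have "?f w \<in> U' \<longleftrightarrow> w \<in> - {0} \<inter> (\<lambda>w. a + 1 / w) -` V" for w
          unfolding A(2) by (cases "w = 0") (simp_all add: image_iff)
        then have eq: "{w. ?f w \<in> U'} = - {0} \<inter> (\<lambda>w. a + 1 / w) -` V"
          by (simp add: set_eq_iff)
        have "continuous_on (- {0}) (\<lambda>w. a + 1 / w)" by (intro continuous_intros) simp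
        from continuous_open_preimage[OF this _ A(1)] show ?thesis unfolding eq by (simp add: open_Compl)
      next
        case B
        have "?f w \<in> U' \<longleftrightarrow> \<not> (w \<noteq> 0 \<and> a + 1 / w \<in> C)" for w
          unfolding B(2) by (cases "w = 0") (simp_all add: image_iff)
        then have "- {w. ?f w \<in> U'} = {w. w \<noteq> 0 \<and> a + 1 / w \<in> C}"
          by (simp add: set_eq_iff)
        with closedK[OF B(1)] have "closed (- {w. ?f w \<in> U'})" by (simp only:)
        then show ?thesis by (simp only: open_closed)
      qed
    qed
    then show "openin (top_of_set T) {w \<in> topspace (top_of_set T). ?f w \<in> U}"
      unfolding eq by (simp add: openin_open_Int)
  qed
  have cg: "continuous_map ?X (top_of_set T) ?g"
    unfolding continuous_map
  proof (intro conjI allI impI)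
    have "?g (Some z) \<in> T" if "z \<notin> E" for z using that by (simp add: T_def)
    then show "?g ` topspace ?X \<subseteq> topspace (top_of_set T)"
      by (simp add: tX T_def image_subset_iff)
    fix V assume "openin (top_of_set T) V"
    then obtain W where W: "open W" "V = T \<inter> W" by (auto simp: openin_open)
    have eq: "{x \<in> topspace ?X. ?g x \<in> V} = {x. (case x of None \<Rightarrow> 0 \<in> W | Some z \<Rightarrow> z \<noteq> a \<and> 1 / (z - a) \<in> W)} \<inter> insert None (Some ` (- E))"
    proof -
      have "x \<in> topspace ?X \<and> ?g x \<in> V \<longleftrightarrow> (case x of None \<Rightarrow> 0 \<in> W | Some z \<Rightarrow> z \<noteq> a \<and> 1 / (z - a) \<in> W) \<and> x \<in> insert None (Some ` (- E))" for x
        using a by (cases x) (auto simp: tX W(2) T_def)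
      then show ?thesis by (simp add: set_eq_iff)
    qed
    have "open (- {a} \<inter> (\<lambda>z. 1 / (z - a)) -` W)"
      by (rule continuous_open_preimage[OF _ _ W(1)]) (simp_all add: open_Compl continuous_intros)
    moreover have "- {a} \<inter> (\<lambda>z. 1 / (z - a)) -` W = {z \<in> - {a}. 1 / (z - a) \<in> W}" by blast
    ultimately have oW: "open {z \<in> - {a}. 1 / (z - a) \<in> W}" by simp
    have "openin (Alexandroff_compactification euclidean) {x. (case x of None \<Rightarrow> 0 \<in> W | Some z \<Rightarrow> z \<noteq> a \<and> 1 / (z - a) \<in> W)}"
    proof (cases "0 \<in> W")
      case False
      then have "x \<in> Some ` {z \<in> - {a}. 1 / (z - a) \<in> W} \<longleftrightarrow> (case x of None \<Rightarrow> 0 \<in> W | Some z \<Rightarrow> z \<noteq> a \<and> 1 / (z - a) \<in> W)" for x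
        by (cases x) auto
      then have "{x. (case x of None \<Rightarrow> 0 \<in> W | Some z \<Rightarrow> z \<noteq> a \<and> 1 / (z - a) \<in> W)} = Some ` {z \<in> - {a}. 1 / (z - a) \<in> W}"
        by (simp add: set_eq_iff)
      then show ?thesis using oW by simp
    next
      case True
      then obtain e where e: "e > 0" "ball 0 e \<subseteq> W" using W(1) openE by blast
      let ?C = "- {z \<in> - {a}. 1 / (z - a) \<in> W}"
      have "closed ?C" using oW by (rule closed_Compl)
      moreover have "?C \<subseteq> cball a (1/e)"
      proof
        fix z assume z: "z \<in> ?C"
        show "z \<in> cball a (1/e)"
        proof (cases "z = a")
          case False
          then have "1 / (z - a) \<notin> ball 0 e" using z e(2) by auto
          then have "e \<le> 1 / norm (z - a)" by (auto simp: norm_divide)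
          then show ?thesis using False e(1) by (auto simp: dist_norm norm_minus_commute field_simps)
        qed (use e in auto)
      qed
      ultimately have "compact ?C"
        by (meson bounded_cball bounded_subset compact_eq_bounded_closed)
      have "x \<in> insert None (Some ` (UNIV - ?C)) \<longleftrightarrow> (case x of None \<Rightarrow> 0 \<in> W | Some z \<Rightarrow> z \<noteq> a \<and> 1 / (z - a) \<in> W)" for x
        using True by (cases x) auto
      then have eq: "{x. (case x of None \<Rightarrow> 0 \<in> W | Some z \<Rightarrow> z \<noteq> a \<and> 1 / (z - a) \<in> W)} = insert None (Some ` (UNIV - ?C))"
        by (simp add: set_eq_iff)
      show ?thesis unfolding openin_Alexandroff_compactification eq
        using \<open>compact ?C\<close> \<open>closed ?C\<close> by (intro disjI2 exI[of _ ?C]) simp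
    qed
    then show "openin ?X {x \<in> topspace ?X. ?g x \<in> V}"
      unfolding eq unfolding sphere_complement_def by (rule openin_subtopology_Int)
  qed
  \<comment> \<open>\<open>?f\<close> carries loops of \<open>T\<close> to the sphere complement,
    where they are homotopic. \<open>?g\<close> carries the homotopy back, and \<open>?g\<close>
    after \<open>?f\<close> is the identity.\<close>
  show "simply_connected T"
    unfolding simply_connected_def
  proof (intro allI impI, elim conjE)
    fix p q :: "real \<Rightarrow> complex"
    assume p: "path p" "pathfinish p = pathstart p" "path_image p \<subseteq> T"
      and q: "path q" "pathfinish q = pathstart q" "path_image q \<subseteq> T"
    have "pathin ?X (?f \<circ> p)" "pathin ?X (?f \<circ> q)"
      by (rule pathin_compose[OF _ cf]; use p q in \<open>auto simp: pathin_canon_iff path_image_def\<close>)+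
    moreover have "(?f \<circ> p) 1 = (?f \<circ> p) 0" "(?f \<circ> q) 1 = (?f \<circ> q) 0"
      using p q by (auto simp: pathfinish_def pathstart_def)
    ultimately have "homotopic_with (\<lambda>r. r 1 = r 0) (top_of_set {0..1::real}) ?X (?f \<circ> p) (?f \<circ> q)"
      using sc unfolding simply_connected_space_def by blast
    from homotopic_with_compose_continuous_map_left[OF this cg, of "\<lambda>r. r 1 = r 0"]
    have "homotopic_loops T (?g \<circ> (?f \<circ> p)) (?g \<circ> (?f \<circ> q))"
      unfolding homotopic_loops_def pathfinish_def pathstart_def by auto
    moreover have id: "?g \<circ> (?f \<circ> r) = r" for r :: "real \<Rightarrow> complex"
      by (auto simp: fun_eq_iff)
    ultimately show "homotopic_loops T p q" by simp
  qed
qed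

text \<open>The inversion 1 / (z - a) brings infinity to 0, which makes the Riemann mapping theorem
  of the plane applicable. A Moebius map fixes 0 and a rotation makes the derivative c at 0
  positive. The reciprocal of the resulting map is the exterior map, with \<Phi>(z) / z tending to 1
  / c.\<close>

lemma exists_exterior_map:
  assumes E: "compact E" and inf: "infinite E"
    and sc: "simply_connected_space (sphere_complement E)"
  shows "is_exterior_map E (ext_map E)"
proof -
  obtain a where a: "a \<in> E" using inf by fastforce
  \<comment> \<open>A second point of \<open>E\<close>: its inverse 1 / (b - a) is not in
    \<open>T\<close>, so \<open>T\<close> is not the whole plane.\<close>
  obtain b where b: "b \<in> E" "b \<noteq> a" using inf a by (metis finite.emptyI finite_insert insertCI insert_absorb subsetI subset_singletonD)
  define T where "T = insert 0 ((\<lambda>z. 1 / (z - a)) ` (- E))"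
  have T: "open T" "simply_connected T" using exterior_inversion_homotopy[OF E a sc] by (simp_all add: T_def)
  have "T \<noteq> UNIV"
  proof
    assume "T = UNIV"
    then have "1 / (b - a) \<in> T" by simp
    then show False using b by (auto simp: T_def divide_simps split: if_splits)
  qed
  with T obtain f g where f: "f holomorphic_on T" "g holomorphic_on ball 0 1"
     "\<And>z. z \<in> T \<Longrightarrow> f z \<in> ball 0 1 \<and> g (f z) = z" "\<And>z. z \<in> ball 0 1 \<Longrightarrow> g z \<in> T \<and> f (g z) = z"
  proof -
    have "T \<noteq> {}" by (simp add: T_def)
    then have "\<exists>f g. f holomorphic_on T \<and> g holomorphic_on ball 0 1 \<and>
           (\<forall>z \<in> T. f z \<in> ball 0 1 \<and> g(f z) = z) \<and> (\<forall>z \<in> ball 0 1. g z \<in> T \<and> f(g z) = z)"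
      using Riemann_mapping_theorem[of T] T \<open>T \<noteq> UNIV\<close> by metis
    then show ?thesis using that by metis
  qed
  have 0: "0 \<in> T" by (simp add: T_def)
  define w0 where "w0 = f 0"
  have w0: "norm w0 < 1" using f(3)[OF 0] by (simp add: w0_def)
  define f1 where "f1 = (\<lambda>z. Moebius_function 0 w0 (f z))"
  have f1_hol: "f1 holomorphic_on T" unfolding f1_def
    using holomorphic_on_compose_gen[OF f(1) Moebius_function_holomorphic[OF w0, of 0]] f(3)
    unfolding o_def by blast
  have f1_bij: "bij_betw f1 T (ball 0 1)"
  proof (rule bij_betwI[where g = "\<lambda>z. g (Moebius_function 0 (-w0) z)"])
    show "f1 \<in> T \<rightarrow> ball 0 1" using f(3) w0 by (auto simp: f1_def Moebius_function_norm_lt_1)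
    show "(\<lambda>z. g (Moebius_function 0 (-w0) z)) \<in> ball 0 1 \<rightarrow> T"
      using f(4) w0 by (auto simp: Moebius_function_norm_lt_1)
    show "g (Moebius_function 0 (-w0) (f1 z)) = z" if "z \<in> T" for z
      using f(3)[OF that] w0 by (simp add: f1_def Moebius_function_compose)
    show "f1 (g (Moebius_function 0 (-w0) z)) = z" if "z \<in> ball 0 1" for z
      using f(4)[of "Moebius_function 0 (-w0) z"] that w0 by (simp add: f1_def Moebius_function_compose Moebius_function_norm_lt_1)
  qed
  have f10: "f1 0 = 0" by (simp add: f1_def w0_def Moebius_function_eq_zero)
  have d0: "deriv f1 0 \<noteq> 0"
    using holomorphic_injective_imp_regular[OF f1_hol T(1) _ 0] f1_bij by (simp add: bij_betw_def)
  define u where "u = cnj (sgn (deriv f1 0))"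
  have nu: "norm u = 1" using d0 by (simp add: u_def norm_sgn)
  define f2 where "f2 = (\<lambda>z. u * f1 z)"
  have f2_hol: "f2 holomorphic_on T" unfolding f2_def by (intro holomorphic_intros f1_hol)
  have f2_bij: "bij_betw f2 T (ball 0 1)"
  proof -
    have "bij_betw (\<lambda>z. u * z) (ball 0 1) (ball 0 1)"
      by (rule bij_betwI[where g = "\<lambda>z. z / u"]) (use nu in \<open>auto simp: norm_mult norm_divide\<close>)
    then show ?thesis using bij_betw_trans[OF f1_bij] by (simp add: f2_def o_def)
  qed
  define c where "c = norm (deriv f1 0)"
  have c: "c > 0" using d0 by (simp add: c_def)
  have "(f1 has_field_derivative deriv f1 0) (at 0)"
    using holomorphic_derivI[OF f1_hol T(1) 0] .
  then have "(f2 has_field_derivative u * deriv f1 0) (at 0)"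
    unfolding f2_def by (rule DERIV_cmult)
  moreover have "u * deriv f1 0 = of_real c"
    using d0 unfolding u_def c_def sgn_div_norm
    by (simp add: field_simps complex_norm_square[symmetric] power2_eq_square scaleR_conv_of_real)
  ultimately have f2d: "((\<lambda>w. f2 w / w) \<longlongrightarrow> of_real c) (at 0)"
    by (simp add: has_field_derivative_iff f2_def f10)
  have f2nz: "f2 w = 0 \<longleftrightarrow> w = 0" if "w \<in> T" for w
    using f2_bij that 0 by (metis bij_betw_def f10 f2_def inj_on_def mult_zero_right)
  let ?i = "\<lambda>z. 1 / (z - a)"
  define \<Phi> where "\<Phi> = (\<lambda>z. 1 / f2 (?i z))"
  have za: "z \<noteq> a" if "z \<in> - E" for z using that a by auto
  have iT: "?i z \<in> T - {0}" if "z \<in> - E" for z using that za[OF that] by (auto simp: T_def)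
  have ibij: "bij_betw ?i (- E) (T - {0})"
    unfolding bij_betw_def
  proof
    show "inj_on ?i (- E)" by (auto simp: inj_on_def)
    show "?i ` (- E) = T - {0}" using a by (auto simp: T_def)
  qed
  have b1: "bij_betw f2 (T - {0}) (ball 0 1 - {0})"
  proof -
    have "bij_betw f2 (T - {0}) (f2 ` (T - {0}))" using f2_bij by (metis Diff_subset bij_betw_def bij_betw_subset)
    moreover have "f2 ` (T - {0}) = ball 0 1 - {0}"
      using f2_bij f2nz 0 unfolding bij_betw_def by (auto simp: image_iff set_eq_iff)
    ultimately show ?thesis by simp
  qed
  have b2: "bij_betw (\<lambda>w. 1 / w) (ball 0 1 - {0}) {w::complex. 1 < norm w}"
    by (rule bij_betwI[where g = "\<lambda>w. 1 / w"]) (auto simp: norm_divide divide_simps)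
  have b3: "bij_betw \<Phi> (- E) {w. 1 < norm w}"
    using bij_betw_trans[OF bij_betw_trans[OF ibij b1] b2] by (simp add: o_def \<Phi>_def)
  have hol: "\<Phi> holomorphic_on (- E)"
  proof -
    have "(f2 \<circ> ?i) holomorphic_on (- E)"
      by (rule holomorphic_on_compose_gen[OF _ f2_hol])
         (use iT a in \<open>auto intro!: holomorphic_intros\<close>)
    then show ?thesis unfolding \<Phi>_def
      by (intro holomorphic_intros) (use iT f2nz in \<open>auto simp: o_def\<close>)
  qed
  have ilim: "filterlim ?i (at 0) at_infinity"
  proof -
    have "filterlim (\<lambda>z::complex. z - a) at_infinity at_infinity"
      using tendsto_add_filterlim_at_infinity'[OF filterlim_ident tendsto_const[of "-a"]] by simp
    then show ?thesis by (simp add: divide_inverse filterlim_inverse_at_iff)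
  qed
  have l1: "((\<lambda>z. f2 (?i z) / ?i z) \<longlongrightarrow> of_real c) at_infinity"
    using filterlim_compose[OF f2d ilim] .
  have l2: "((\<lambda>z. ?i z / f2 (?i z)) \<longlongrightarrow> 1 / of_real c) at_infinity"
  proof -
    have "((\<lambda>z. 1 / (f2 (?i z) / ?i z)) \<longlongrightarrow> 1 / of_real c) at_infinity"
      using l1 c by (intro tendsto_intros) auto
    then show ?thesis by (simp add: mult.commute)
  qed
  have l3: "((\<lambda>z::complex. (z - a) / z) \<longlongrightarrow> 1) at_infinity"
  proof -
    have "((\<lambda>z::complex. 1 - a * inverse z) \<longlongrightarrow> 1 - a * 0) at_infinity"
      by (intro tendsto_intros tendsto_inverse_0)
    moreover have "\<forall>\<^sub>F z::complex in at_infinity. 1 - a * inverse z = (z - a) / z"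
      using eventually_not_equal_at_infinity[of 0] by eventually_elim (simp add: field_simps)
    ultimately show ?thesis by (simp add: tendsto_cong)
  qed
  have l4: "((\<lambda>z. \<Phi> z / z) \<longlongrightarrow> complex_of_real (1/c)) at_infinity"
  proof -
    have "((\<lambda>z. (?i z / f2 (?i z)) * ((z - a) / z)) \<longlongrightarrow> 1 / of_real c * 1) at_infinity"
      by (intro tendsto_mult l2 l3)
    moreover have "\<forall>\<^sub>F z in at_infinity. (?i z / f2 (?i z)) * ((z - a) / z) = \<Phi> z / z"
      using eventually_not_equal_at_infinity[of a] by eventually_elim (simp add: \<Phi>_def)
    ultimately show ?thesis using Lim_transform_eventually by fastforce
  qed
  have l5: "filterlim \<Phi> at_infinity at_infinity"
  proof -
    have "filterlim (\<lambda>z. (\<Phi> z / z) * z) at_infinity at_infinity"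
      by (rule tendsto_mult_filterlim_at_infinity[OF l4 _ filterlim_ident]) (use c in auto)
    moreover have "\<forall>\<^sub>F z in at_infinity. (\<Phi> z / z) * z = \<Phi> z"
      using eventually_not_equal_at_infinity[of 0] by eventually_elim simp
    ultimately show ?thesis by (rule filterlim_mono_eventually[OF _ order_refl order_refl])
  qed
  have "is_exterior_map E \<Phi>"
    unfolding is_exterior_map_def using hol b3 l4 l5 c by (auto intro!: exI[of _ "1/c"])
  then show ?thesis unfolding ext_map_def by (rule someI[where P = "is_exterior_map E"])
qed

section \<open>Level sets of the exterior map\<close>

text \<open>|\<Phi>| continued by 1 to \<open>E\<close>. This is a continuous function on the whole
  plane (\<open>lev_cont\<close>) whose sublevel sets are the canonical domains, so that points of
  \<open>E\<close> need no separate treatment.\<close>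

definition level :: "complex set \<Rightarrow> complex \<Rightarrow> real" where
  "level E z = (if z \<in> E then 1 else norm (ext_map E z))"

lemma connected_ereal_annulus:
  assumes "1 < \<rho>"
  shows "connected {w::complex. ereal (norm w) < \<rho> \<and> 1 < norm w}"
proof (cases \<rho>)
  case (real r)
  have "connected {w::complex. 1 < norm (w - 0) \<and> norm (w - 0) < r}"
    by (rule connected_annulus) simp
  moreover have "{w::complex. 1 < norm (w - 0) \<and> norm (w - 0) < r} = {w. ereal (norm w) < \<rho> \<and> 1 < norm w}"
    using real by auto
  ultimately show ?thesis by simp
next
  case PInf
  have "connected (- cball (0::complex) 1)" by (intro connected_complement_bounded_convex) auto
  moreover have "- cball (0::complex) 1 = {w. 1 < norm w}" by (auto simp: not_le)
  ultimately show ?thesis using PInf by simp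
qed (use assms in auto)

locale exterior_domain =
  fixes E :: "complex set"
  assumes compact_E: "compact E" and nonempty_E: "E \<noteq> {}"
    and exterior: "is_exterior_map E (ext_map E)"
begin

abbreviation "\<Phi> \<equiv> ext_map E"
abbreviation "lev \<equiv> level E"
abbreviation "\<D> \<equiv> canonical_domain E"

lemma Phi_hol: "\<Phi> holomorphic_on (- E)" and Phi_bij: "bij_betw \<Phi> (- E) {w. 1 < norm w}"
  and Phi_lim: "filterlim \<Phi> at_infinity at_infinity"
  using exterior by (auto simp: is_exterior_map_def)

lemma open_Compl_E: "open (- E)"
  using compact_E by (simp add: compact_imp_closed open_Compl)

lemma Phi_inj: "inj_on \<Phi> (- E)"
  using Phi_bij by (simp add: bij_betw_def)

lemma Phi_gt_1: "z \<notin> E \<Longrightarrow> norm (\<Phi> z) > 1"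
  using Phi_bij by (auto simp: bij_betw_def)

definition "\<Psi> = the_inv_into (- E) \<Phi>"

lemma Psi_Phi: "z \<notin> E \<Longrightarrow> \<Psi> (\<Phi> z) = z"
  unfolding \<Psi>_def by (rule the_inv_into_f_f[OF Phi_inj]) auto

lemma Phi_Psi: "norm w > 1 \<Longrightarrow> \<Phi> (\<Psi> w) = w" and Psi_notin: "norm w > 1 \<Longrightarrow> \<Psi> w \<notin> E"
proof -
  assume w: "norm w > 1"
  then obtain z where "z \<notin> E" "w = \<Phi> z" using Phi_bij by (auto simp: bij_betw_def)
  then show "\<Phi> (\<Psi> w) = w" "\<Psi> w \<notin> E" by (auto simp: Psi_Phi)
qed

lemma open_exterior_disc: "open {w::complex. 1 < norm w}"
  by (intro open_Collect_less continuous_intros)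

lemma Psi_hol: "\<Psi> holomorphic_on {w. 1 < norm w}"
proof -
  obtain g where g: "g holomorphic_on (\<Phi> ` (- E))" "\<And>z. z \<in> - E \<Longrightarrow> g (\<Phi> z) = z"
    using holomorphic_has_inverse[OF Phi_hol open_Compl_E Phi_inj] by metis
  have "\<Phi> ` (- E) = {w. 1 < norm w}" using Phi_bij by (simp add: bij_betw_def)
  moreover have "g w = \<Psi> w" if "1 < norm w" for w
    using g(2)[of "\<Psi> w"] Phi_Psi[OF that] Psi_notin[OF that] by simp
  ultimately show ?thesis using g(1) holomorphic_cong[of "{w. 1 < norm w}" _ g \<Psi>] by auto
qed

text \<open>1 / \<Phi>(1 / w) extends by 0 to a holomorphic function near 0. By the open mapping
  theorem all large values of \<Phi> are taken near infinity, and by injectivity nowhere else. Hence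
  \<Phi> is bounded near \<open>E\<close>, which the continuity of \<open>lev\<close> at points of
  \<open>E\<close> requires.\<close>

lemma Phi_large_imp_large: "\<exists>R. \<forall>z. z \<notin> E \<longrightarrow> norm (\<Phi> z) > R \<longrightarrow> norm z > B"
proof -
  obtain B0 where B0: "B0 > 0" "\<And>z. z \<in> E \<Longrightarrow> norm z \<le> B0"
    using compact_imp_bounded[OF compact_E] by (auto simp: bounded_pos)
  define B1 where "B1 = max B B0 + 1"
  have B1: "B1 > 0" "B1 > B" "B1 > B0" using B0(1) by (auto simp: B1_def)
  define \<delta> where "\<delta> = 1 / B1"
  have d: "\<delta> > 0" using B1 by (simp add: \<delta>_def)
  have out: "1 / w \<notin> E" if "w \<in> ball 0 \<delta> - {0}" for w
  proof -
    have "norm (1 / w) > B1" using that B1(1) by (auto simp: \<delta>_def norm_divide field_simps)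
    then show ?thesis using B0(2) B1 by fastforce
  qed
  define h where "h = (\<lambda>w. if w = 0 then 0 else 1 / \<Phi> (1 / w))"
  have "(\<Phi> \<circ> (\<lambda>w. 1 / w)) holomorphic_on (ball 0 \<delta> - {0})"
    by (rule holomorphic_on_compose_gen[OF _ Phi_hol]) (use out in \<open>auto intro!: holomorphic_intros\<close>)
  then have "(\<lambda>w. 1 / \<Phi> (1 / w)) holomorphic_on (ball 0 \<delta> - {0})"
    by (intro holomorphic_intros) (use out Phi_gt_1 in \<open>fastforce simp: o_def\<close>)+
  then have h1: "h holomorphic_on (ball 0 \<delta> - {0})"
    by (rule holomorphic_transform) (auto simp: h_def)
  have lim: "(h \<longlongrightarrow> h 0) (at 0)"
  proof -
    have "filterlim (\<lambda>w::complex. inverse w) at_infinity (at 0)"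
      by (rule filterlim_inverse_at_infinity)
    from filterlim_compose[OF Phi_lim this]
    have "filterlim (\<lambda>w. \<Phi> (inverse w)) at_infinity (at 0)" .
    from filterlim_compose[OF tendsto_inverse_0 this]
    have "((\<lambda>w. inverse (\<Phi> (inverse w))) \<longlongrightarrow> 0) (at 0)" .
    moreover have "\<forall>\<^sub>F w in at 0. inverse (\<Phi> (inverse w)) = h w"
      unfolding eventually_at_filter by (auto simp: h_def divide_inverse)
    ultimately show ?thesis by (simp add: h_def tendsto_cong)
  qed
  have hol: "h holomorphic_on ball 0 \<delta>"
  proof (rule no_isolated_singularity[OF _ h1])
    show "continuous_on (ball 0 \<delta>) h"
      unfolding continuous_on_eq_continuous_at[OF open_ball]
    proof
      fix x :: complex assume x: "x \<in> ball 0 \<delta>"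
      show "isCont h x"
      proof (cases "x = 0")
        case False
        have "continuous_on (ball 0 \<delta> - {0}) h" using h1 holomorphic_on_imp_continuous_on by blast
        moreover have "open (ball 0 \<delta> - {0::complex})" by (simp add: open_delete)
        ultimately show ?thesis using x False by (simp add: continuous_on_eq_continuous_at)
      qed (use lim in \<open>simp add: isCont_def\<close>)
    qed
  qed auto
  have nz: "h w \<noteq> 0" if "w \<in> ball 0 \<delta> - {0}" for w
  proof -
    have "\<Phi> (1 / w) \<noteq> 0" using Phi_gt_1[OF out[OF that]] by auto
    then show ?thesis using that by (simp add: h_def)
  qed
  have nc: "\<not> h constant_on ball 0 \<delta>"
  proof
    assume "h constant_on ball 0 \<delta>"
    then obtain c where c: "\<And>w. w \<in> ball 0 \<delta> \<Longrightarrow> h w = c" by (auto simp: constant_on_def)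
    have "c = 0" using c[of 0] d by (simp add: h_def)
    moreover have "complex_of_real (\<delta>/2) \<in> ball 0 \<delta> - {0}" using d by simp
    ultimately show False using c nz by blast
  qed
  have "open (h ` ball 0 \<delta>)"
    by (rule open_mapping_thm[OF hol open_ball connected_ball open_ball order_refl nc])
  moreover have "0 \<in> h ` ball 0 \<delta>" using d by (auto simp: h_def intro!: image_eqI[of _ _ 0])
  ultimately obtain e where e: "e > 0" "ball 0 e \<subseteq> h ` ball 0 \<delta>" using openE by blast
  have "norm z > B" if z: "z \<notin> E" "norm (\<Phi> z) > 1 / e" for z
  proof -
    have p0: "\<Phi> z \<noteq> 0" using Phi_gt_1[OF z(1)] by auto
    have "1 / \<Phi> z \<in> ball 0 e"
      using z(2) e(1) p0 by (simp add: norm_divide field_simps)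
    then obtain w where w: "w \<in> ball 0 \<delta>" "h w = 1 / \<Phi> z" using e(2) by force
    have "w \<noteq> 0" using w(2) p0 by (auto simp: h_def)
    then have "\<Phi> (1 / w) = \<Phi> z" using w(2) by (simp add: h_def)
    then have "z = 1 / w" using inj_onD[OF Phi_inj] z(1) out w(1) \<open>w \<noteq> 0\<close> by auto
    moreover have "norm (1 / w) > B1" using w(1) \<open>w \<noteq> 0\<close> B1(1) by (auto simp: \<delta>_def norm_divide field_simps)
    ultimately have "norm z > B1" by simp
    then show ?thesis using B1 by simp
  qed
  then show ?thesis by blast
qed

lemma lev_ge_1: "1 \<le> lev z"
  using Phi_gt_1[of z] by (auto simp: level_def)

lemma lev_gt_1: "1 < lev z \<longleftrightarrow> z \<notin> E"
  using Phi_gt_1[of z] by (auto simp: level_def)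

lemma lev_E: "z \<in> E \<Longrightarrow> lev z = 1"
  by (simp add: level_def)

lemma lev_notin: "z \<notin> E \<Longrightarrow> lev z = norm (\<Phi> z)"
  by (simp add: level_def)

lemma lev_cont: "continuous_on UNIV lev"
proof -
  have "isCont lev a" for a
  proof (cases "a \<in> E")
    case False
    have "continuous_on (- E) (\<lambda>z. norm (\<Phi> z))"
      by (intro continuous_intros holomorphic_on_imp_continuous_on Phi_hol)
    then have "isCont (\<lambda>z. norm (\<Phi> z)) a"
      using False open_Compl_E by (simp add: continuous_on_eq_continuous_at)
    moreover have "\<forall>\<^sub>F z in nhds a. norm (\<Phi> z) = lev z"
      using eventually_nhds_in_open[OF open_Compl_E, of a] False
      by (auto elim!: eventually_mono simp: level_def)
    ultimately show ?thesis by (simp add: isCont_cong)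
  next
    case True
    obtain R1 where R1: "\<And>z. z \<notin> E \<Longrightarrow> norm (\<Phi> z) > R1 \<Longrightarrow> norm z > norm a + 1"
      using Phi_large_imp_large by blast
    show ?thesis
      unfolding isCont_def LIM_eq real_norm_def
    proof (intro allI impI)
      fix e :: real assume e: "e > 0"
      \<comment> \<open>Near a, |\<Phi>| is at most \<open>R1\<close>, so nearby points of level at
        least 1 + e lie in this image of a compact annulus. It is compact and does not contain
        a.\<close>
      let ?K = "\<Psi> ` {w. 1 + e \<le> norm w \<and> norm w \<le> R1}"
      have "compact (cball 0 R1 \<inter> {w::complex. 1 + e \<le> norm w})"
        by (intro compact_Int_closed compact_cball closed_Collect_le continuous_intros)
      then have "compact {w::complex. 1 + e \<le> norm w \<and> norm w \<le> R1}"
        by (rule back_subst[of compact]) auto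
      then have "compact ?K"
        using e by (intro compact_continuous_image continuous_on_subset[OF holomorphic_on_imp_continuous_on[OF Psi_hol]]) auto
      have "a \<notin> ?K" using True Psi_notin e by fastforce
      obtain \<delta> where \<delta>: "\<delta> > 0" "ball a \<delta> \<subseteq> - ?K"
      proof -
        have "open (- ?K)" using \<open>compact ?K\<close> by (simp add: compact_imp_closed open_Compl)
        moreover have "a \<in> - ?K" using \<open>a \<notin> ?K\<close> by simp
        ultimately show ?thesis using that by (rule openE)
      qed
      have "\<bar>lev z - lev a\<bar> < e" if z: "norm (z - a) < min \<delta> 1" for z
      proof (cases "z \<in> E")
        case True then show ?thesis using \<open>a \<in> E\<close> e by (simp add: lev_E)
      next
        case False
        have "norm z \<le> norm a + norm (z - a)" by (metis add.commute diff_add_cancel norm_triangle_ineq)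
        then have "norm z \<le> norm a + 1" using z by simp
        then have "norm (\<Phi> z) \<le> R1" using R1[OF False] by force
        moreover have "z \<notin> ?K" using \<delta>(2) z by (auto simp: dist_norm norm_minus_commute)
        then have "\<not> (1 + e \<le> norm (\<Phi> z) \<and> norm (\<Phi> z) \<le> R1)"
          using Psi_Phi[OF False] by (metis (mono_tags, lifting) image_eqI mem_Collect_eq)
        ultimately have "lev z < 1 + e" using False by (simp add: lev_notin)
        then show ?thesis using lev_ge_1[of z] \<open>a \<in> E\<close> by (simp add: lev_E)
      qed
      then show "\<exists>d>0. \<forall>x'. x' \<noteq> a \<and> norm (x' - a) < d \<longrightarrow> \<bar>lev x' - lev a\<bar> < e"
        using \<delta>(1) by (intro exI[of _ "min \<delta> 1"]) auto
    qed
  qed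
  then show ?thesis by (simp add: continuous_on_eq_continuous_at)
qed

lemma compact_lev_le: "compact {z. lev z \<le> r}"
proof -
  have "closed {z. lev z \<le> r}" by (intro closed_Collect_le lev_cont continuous_intros)
  moreover have "bounded {z. lev z \<le> r}"
  proof -
    have "filterlim (\<lambda>z. norm (\<Phi> z)) at_top at_infinity"
      using Phi_lim by (rule filterlim_at_infinity_imp_norm_at_top)
    then have "\<forall>\<^sub>F z in at_infinity. norm (\<Phi> z) > r" by (simp add: filterlim_at_top_dense)
    then obtain b where b: "\<And>z. norm z \<ge> b \<Longrightarrow> norm (\<Phi> z) > r" by (auto simp: eventually_at_infinity)
    obtain b' where b': "\<And>z. z \<in> E \<Longrightarrow> norm z \<le> b'"
      using compact_imp_bounded[OF compact_E] by (auto simp: bounded_iff)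
    have "norm z \<le> max b b'" if "lev z \<le> r" for z
      using b[of z] b'[of z] that by (cases "z \<in> E") (force simp: lev_notin lev_E)+
    then show ?thesis by (auto simp: bounded_iff)
  qed
  ultimately show ?thesis by (simp add: compact_eq_bounded_closed)
qed

lemma compact_lev_eq: "compact {z. lev z = r}"
proof -
  have "closed {z. lev z = r}" by (intro closed_Collect_eq lev_cont continuous_intros)
  then have "compact ({z. lev z \<le> r} \<inter> {z. lev z = r})" by (rule compact_Int_closed[OF compact_lev_le])
  moreover have "{z. lev z \<le> r} \<inter> {z. lev z = r} = {z. lev z = r}" by auto
  ultimately show ?thesis by simp
qed

lemma domain_eq: "1 < \<rho> \<Longrightarrow> \<D> \<rho> = {z. ereal (lev z) < \<rho>}"
  by (auto simp: canonical_domain_def level_def one_ereal_def)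

lemma open_domain: "1 < \<rho> \<Longrightarrow> open (\<D> \<rho>)"
proof -
  assume "1 < \<rho>"
  moreover have "open {z. ereal (lev z) < \<rho>}"
    by (intro open_Collect_less continuous_on_ereal lev_cont continuous_intros)
  ultimately show ?thesis by (simp add: domain_eq)
qed

lemma domain_mono: "\<rho> \<le> \<rho>' \<Longrightarrow> \<D> \<rho> \<subseteq> \<D> \<rho>'"
  by (auto simp: canonical_domain_def)

lemma E_subset_domain: "E \<subseteq> \<D> \<rho>"
  by (auto simp: canonical_domain_def)

lemma Psi_lev: "1 < norm w \<Longrightarrow> lev (\<Psi> w) = norm w"
  by (simp add: lev_notin Psi_notin Phi_Psi)

lemma lev_image: "{z. P (lev z) \<and> 1 < lev z} = \<Psi> ` {w. P (norm w) \<and> 1 < norm w}"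
proof (intro equalityI subsetI)
  fix z assume z: "z \<in> {z. P (lev z) \<and> 1 < lev z}"
  then have "z \<notin> E" using lev_gt_1 by simp
  with z show "z \<in> \<Psi> ` {w. P (norm w) \<and> 1 < norm w}"
    by (intro image_eqI[of _ _ "\<Phi> z"]) (auto simp: Psi_Phi lev_notin Phi_gt_1)
qed (auto simp: Psi_lev)

lemma connected_lev_gt: "1 \<le> r \<Longrightarrow> connected {z. r < lev z}"
proof -
  assume r: "1 \<le> r"
  have "connected (- cball (0::complex) r)" by (intro connected_complement_bounded_convex) auto
  moreover have "- cball (0::complex) r = {w. r < norm w}" by (auto simp: not_le)
  ultimately have "connected (\<Psi> ` {w. r < norm w})"
    using r by (intro connected_continuous_image continuous_on_subset[OF holomorphic_on_imp_continuous_on[OF Psi_hol]]) auto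
  moreover have "{z. r < lev z} = \<Psi> ` {w. r < norm w}"
    using lev_image[of "\<lambda>x. r < x"] r by (auto simp: conj_absorb)
  ultimately show ?thesis by simp
qed

text \<open>The part \<open>?A\<close> outside \<open>E\<close> is the image of an annulus, hence
  connected. If one half of a separation contains it, the other half is a subset of \<open>E\<close>
  which is open, and closed as the difference of \<open>E\<close> and an open set; so it would be
  the whole plane, and \<open>E\<close> would be unbounded.\<close>

lemma connected_domain: "1 < \<rho> \<Longrightarrow> connected (\<D> \<rho>)"
proof -
  assume \<rho>: "1 < \<rho>"
  let ?A = "{z. ereal (lev z) < \<rho> \<and> 1 < lev z}"
  have conA: "connected ?A"
  proof -
    have "connected {w::complex. ereal (norm w) < \<rho> \<and> 1 < norm w}"
      using \<rho> by (rule connected_ereal_annulus)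
    then have "connected (\<Psi> ` {w. ereal (norm w) < \<rho> \<and> 1 < norm w})"
      by (intro connected_continuous_image continuous_on_subset[OF holomorphic_on_imp_continuous_on[OF Psi_hol]]) auto
    then show ?thesis using lev_image[of "\<lambda>x. ereal x < \<rho>"] by simp
  qed
  have D: "\<D> \<rho> = E \<union> ?A"
  proof -
    have "z \<in> \<D> \<rho> \<longleftrightarrow> z \<in> E \<or> z \<in> ?A" for z
      using \<rho> lev_gt_1[of z] by (cases "z \<in> E") (simp_all add: domain_eq lev_E flip: one_ereal_def)
    then show ?thesis by blast
  qed
  have key: False if U: "open U" "open V" "\<D> \<rho> \<subseteq> U \<union> V" "U \<inter> V \<inter> \<D> \<rho> = {}" "V \<inter> \<D> \<rho> \<noteq> {}" "?A \<subseteq> U" for U V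
  proof -
    let ?W = "V \<inter> \<D> \<rho>"
    have WE: "z \<in> E" if "z \<in> ?W" for z
    proof (rule ccontr)
      assume "z \<notin> E"
      with that have "z \<in> ?A" unfolding D by blast
      then have "z \<in> U" using U(6) by (rule subsetD[rotated])
      then show False using that U(4) by blast
    qed
    have "?W = E - U"
    proof (intro equalityI subsetI)
      fix z assume "z \<in> ?W" then show "z \<in> E - U" using WE U(4) by blast
    next
      fix z assume z: "z \<in> E - U"
      then have "z \<in> \<D> \<rho>" using E_subset_domain by blast
      then show "z \<in> ?W" using z U(3) by blast
    qed
    then have "closed ?W" using U(1) compact_imp_closed[OF compact_E] by (simp add: closed_Diff)
    moreover have "open ?W" using U(2) open_domain[OF \<rho>] by auto
    ultimately have "?W = UNIV" using U(5) clopen[of ?W] by simp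
    then have "E = UNIV" using WE by (metis UNIV_I UNIV_eq_I)
    then show False using compact_imp_bounded[OF compact_E] not_bounded_UNIV by simp
  qed
  show ?thesis
  proof (rule connectedI)
    fix U V assume UV: "open U" "open V" "U \<inter> \<D> \<rho> \<noteq> {}" "V \<inter> \<D> \<rho> \<noteq> {}" "U \<inter> V \<inter> \<D> \<rho> = {}" "\<D> \<rho> \<subseteq> U \<union> V"
    have AD: "?A \<subseteq> \<D> \<rho>" unfolding D by (rule Un_upper2)
    have i: "U \<inter> V \<inter> ?A = {}" using UV(5) AD by blast
    have ii: "?A \<subseteq> U \<union> V" using UV(6) AD by (rule subset_trans[rotated])
    from connectedD[OF conA UV(1,2) i ii] show False
    proof
      assume "U \<inter> ?A = {}"
      then have "?A \<subseteq> V" using ii by blast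
      moreover have "\<D> \<rho> \<subseteq> V \<union> U" "V \<inter> U \<inter> \<D> \<rho> = {}" using UV(5,6) by (simp_all add: Un_commute Int_commute)
      ultimately show False using key[OF UV(2,1) _ _ UV(3)] by simp
    next
      assume "V \<inter> ?A = {}"
      then have "?A \<subseteq> U" using ii by blast
      then show False using key[OF UV(1,2,6,5,4)] by simp
    qed
  qed
qed

text \<open>On the compact part of {lev \<le> r + 1} outside \<open>U\<close> the level attains a
  minimum, and this exceeds r.\<close>

lemma neighbourhood_contains_domain:
  assumes "open U" "{z. lev z \<le> r} \<subseteq> U"
  obtains \<rho> where "r < \<rho>" "{z. lev z < \<rho>} \<subseteq> U"
proof -
  let ?K = "{z. lev z \<le> r + 1} - U"
  have K: "compact ?K" using compact_lev_le assms(1) by (simp add: compact_diff)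
  show thesis
  proof (cases "?K = {}")
    case True
    then show ?thesis using that[of "r + 1"] by fastforce
  next
    case False
    then obtain x where x: "x \<in> ?K" "\<And>y. y \<in> ?K \<Longrightarrow> lev x \<le> lev y"
      using continuous_attains_inf[OF K False continuous_on_subset[OF lev_cont]] by blast
    then have "lev x > r" using assms(2) by (meson DiffD2 in_mono linorder_not_le mem_Collect_eq)
    moreover have "{z. lev z < min (lev x) (r + 1)} \<subseteq> U"
    proof
      fix z assume z: "z \<in> {z. lev z < min (lev x) (r + 1)}"
      then have "z \<notin> ?K" using x(2)[of z] by auto
      then show "z \<in> U" using z by simp
    qed
    ultimately show ?thesis using that[of "min (lev x) (r + 1)"] by auto
  qed
qed

text \<open>A point z of level exactly r is a limit of points of lower level because \<Phi> is an
  open map: values (1 - s) \<Phi>(z) with small s are taken near z. This turns the neighbourhoods in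
  \<open>pole_combinations\<close> into conditions on levels.\<close>

lemma closure_domain: "\<xi> \<notin> E \<Longrightarrow> closure (\<D> (ereal (norm (\<Phi> \<xi>)))) = {z. lev z \<le> norm (\<Phi> \<xi>)}"
proof (intro equalityI)
  assume \<xi>: "\<xi> \<notin> E"
  let ?r = "norm (\<Phi> \<xi>)"
  have r: "1 < ?r" using Phi_gt_1[OF \<xi>] .
  have D: "\<D> ?r = {z. lev z < ?r}" using domain_eq[of "ereal ?r"] r by (simp add: one_ereal_def)
  show "closure (\<D> ?r) \<subseteq> {z. lev z \<le> ?r}"
    by (rule closure_minimal) (auto simp: D intro: compact_imp_closed compact_lev_le)
  show "{z. lev z \<le> ?r} \<subseteq> closure (\<D> ?r)"
  proof
    fix z assume "z \<in> {z. lev z \<le> ?r}"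
    then consider "lev z < ?r" | "lev z = ?r" by fastforce
    then show "z \<in> closure (\<D> ?r)"
    proof cases
      case 2
      then have z: "z \<notin> E" using lev_gt_1 r by metis
      show ?thesis unfolding closure_approachable
      proof (intro allI impI)
        fix e :: real assume e: "e > 0"
        let ?B = "ball z e \<inter> - E"
        have oB: "open ?B" using open_Compl_E by auto
        then have "open (\<Phi> ` ?B)"
          using Phi_inj open_mapping_thm3[OF holomorphic_on_subset[OF Phi_hol]] by (metis inf_le2 inj_on_subset)
        moreover have "\<Phi> z \<in> \<Phi> ` ?B" using z e by auto
        ultimately obtain \<epsilon> where \<epsilon>: "\<epsilon> > 0" "ball (\<Phi> z) \<epsilon> \<subseteq> \<Phi> ` ?B" using openE by blast
        have nz: "norm (\<Phi> z) = ?r" using 2 z by (simp add: lev_notin)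
        define s where "s = min (\<epsilon> / (2 * ?r)) (1/2)"
        have s: "0 < s" "s < 1" "s * ?r < \<epsilon>"
        proof -
          show "0 < s" "s < 1" using \<epsilon>(1) r by (auto simp: s_def intro!: divide_pos_pos)
          have "s * ?r \<le> \<epsilon> / (2 * ?r) * ?r" using r by (intro mult_right_mono) (auto simp: s_def)
          also have "\<dots> < \<epsilon>" using r \<epsilon>(1) by (simp add: field_simps)
          finally show "s * ?r < \<epsilon>" .
        qed
        let ?w = "of_real (1 - s) * \<Phi> z"
        have "\<Phi> z - ?w = of_real s * \<Phi> z" by (simp add: algebra_simps)
        then have "dist (\<Phi> z) ?w < \<epsilon>" using s nz by (simp add: dist_norm norm_mult)
        then obtain y where y: "y \<in> ?B" "\<Phi> y = ?w" using \<epsilon>(2) by (metis imageE mem_ball subset_eq)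
        have "norm ?w = (1 - s) * ?r" using s nz by (simp only: norm_mult norm_of_real)
        moreover have "(1 - s) * ?r < 1 * ?r" using s r by (intro mult_strict_right_mono) auto
        ultimately have "norm (\<Phi> y) < ?r" using y(2) by simp
        then have "y \<in> \<D> ?r" using y(1) unfolding D by (simp add: lev_notin)
        moreover have "dist y z < e" using y(1) by (simp add: dist_commute)
        ultimately show "\<exists>y\<in>\<D> ?r. dist y z < e" by blast
      qed
    next
      case 1
      then have "z \<in> \<D> ?r" unfolding D by simp
      then show ?thesis by (rule closure_subset[THEN subsetD])
    qed
  qed
qed

text \<open>The contour is the image under \<open>\<Psi>\<close> of the circle of radius r. Its
  winding number about interior points is a constant \<open>w0\<close>, 1 or -1, which is absorbed
  into \<open>k\<close> together with \<open>G\<close> and the derivative of the path. A kernel with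
  continuous \<open>\<gamma>\<close> and \<open>k\<close> is what the interchange with the integral
  over \<mu> needs.\<close>

lemma cauchy_representation:
  assumes r: "1 < r" "ereal r < \<rho>" and G: "G holomorphic_on \<D> \<rho>"
  obtains \<gamma> k :: "real \<Rightarrow> complex" where "continuous_on {0..1} \<gamma>" "continuous_on {0..1} k"
    "\<And>t. t \<in> {0..1} \<Longrightarrow> lev (\<gamma> t) = r"
    "\<And>\<zeta>. lev \<zeta> < r \<Longrightarrow> ((\<lambda>t. k t / (\<gamma> t - \<zeta>)) has_integral G \<zeta>) {0..1}"
proof -
  let ?c = "circlepath 0 r :: real \<Rightarrow> complex"
  define \<gamma> where "\<gamma> = \<Psi> \<circ> ?c"
  have "1 < ereal r" using r(1) by simp
  then have \<rho>: "1 < \<rho>" using r(2) by (rule less_trans)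
  have cim: "path_image ?c = {w. norm w = r}"
    using r(1) unfolding path_image_circlepath by (simp add: sphere_def)
  have csub: "path_image ?c \<subseteq> {w. 1 < norm w}" using cim r by auto
  have vp: "valid_path \<gamma>" unfolding \<gamma>_def
    by (rule valid_path_compose_holomorphic[OF _ Psi_hol open_exterior_disc csub]) auto
  have sp: "simple_path \<gamma>" unfolding \<gamma>_def
  proof (rule simple_path_continuous_image)
    show "simple_path ?c" using r by (simp add: simple_path_circlepath)
    show "continuous_on (path_image ?c) \<Psi>"
      using continuous_on_subset[OF holomorphic_on_imp_continuous_on[OF Psi_hol] csub] .
    show "inj_on \<Psi> (path_image ?c)"
      by (rule inj_on_inverseI[where g = \<Phi>]) (use csub Phi_Psi in auto)
  qed
  have im: "path_image \<gamma> = {z. lev z = r}"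
  proof -
    have "path_image \<gamma> = \<Psi> ` path_image ?c" by (simp add: \<gamma>_def path_image_compose)
    also have "\<dots> = \<Psi> ` {w. norm w = r \<and> 1 < norm w}" using cim r by auto
    also have "\<dots> = {z. lev z = r}" using lev_image[of "\<lambda>x. x = r"] r by auto
    finally show ?thesis .
  qed
  have loop: "pathfinish \<gamma> = pathstart \<gamma>"
    by (simp add: \<gamma>_def pathfinish_compose pathstart_compose)
  have out: "z \<in> outside (path_image \<gamma>)" if z: "lev z > r" for z
  proof -
    have con: "connected {z. r < lev z}" using r by (intro connected_lev_gt) auto
    have "{z. r < lev z} \<subseteq> connected_component_set (- path_image \<gamma>) z"
      by (rule connected_component_maximal) (use z con im in auto)
    moreover have "\<not> bounded {z. r < lev z}"
    proof
      assume "bounded {z. r < lev z}"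
      then have "bounded ({z. lev z \<le> r} \<union> {z. r < lev z})"
        using compact_lev_le compact_imp_bounded by auto
      moreover have "{z. lev z \<le> r} \<union> {z. r < lev z} = UNIV" by auto
      ultimately show False using not_bounded_UNIV by simp
    qed
    ultimately show ?thesis using z im unfolding outside_def by (auto intro: bounded_subset)
  qed
  \<comment> \<open>A component of the complement of the curve cannot pass from levels below r to
    levels above r, since all points of level r lie on the curve. So the component of z is
    bounded.\<close>
  have ins: "z \<in> inside (path_image \<gamma>)" if z: "lev z < r" for z
  proof -
    let ?C = "connected_component_set (- path_image \<gamma>) z"
    have "?C \<subseteq> {z. lev z < r}"
    proof (rule ccontr)
      assume "\<not> ?C \<subseteq> {z. lev z < r}"
      then obtain y where y: "y \<in> ?C" "\<not> lev y < r" by auto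
      have sub: "?C \<subseteq> {z. lev z < r} \<union> {z. lev z > r}"
        using connected_component_subset[of "- path_image \<gamma>" z] im by force
      have "connected ?C" by (rule connected_connected_component)
      moreover have "open {z. lev z < r}" "open {z. r < lev z}"
        by (intro open_Collect_less lev_cont continuous_intros)+
      moreover have "z \<in> ?C" using z im by (auto simp: connected_component_refl_eq)
      ultimately show False using connectedD[of ?C "{z. lev z < r}" "{z. r < lev z}"] sub y z by fastforce
    qed
    then have "bounded ?C" by (rule bounded_subset[rotated]) (rule bounded_subset[OF compact_imp_bounded[OF compact_lev_le[of r]]], auto)
    then show ?thesis using z im unfolding inside_def by auto
  qed
  obtain w0 :: complex where w0: "w0 \<noteq> 0" "\<And>z. lev z < r \<Longrightarrow> winding_number \<gamma> z = w0"
  proof (rule simple_closed_path_winding_number_inside[OF sp])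
    assume "\<And>z. z \<in> inside (path_image \<gamma>) \<Longrightarrow> winding_number \<gamma> z = 1"
    then show thesis using that[of 1] ins by auto
  next
    assume "\<And>z. z \<in> inside (path_image \<gamma>) \<Longrightarrow> winding_number \<gamma> z = - 1"
    then show thesis using that[of "-1"] ins by auto
  qed
  have Dsub: "path_image \<gamma> \<subseteq> \<D> \<rho>" using im r \<rho> by (auto simp: domain_eq)
  have wn0: "winding_number \<gamma> w = 0" if "w \<notin> \<D> \<rho>" for w
  proof (rule winding_number_zero_in_outside[OF valid_path_imp_path[OF vp] loop])
    have "\<not> ereal (lev w) < \<rho>" using that \<rho> by (simp add: domain_eq)
    then have "ereal r < ereal (lev w)" using r by (meson linorder_not_less order_less_le_trans)
    then show "w \<in> outside (path_image \<gamma>)" using out by auto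
  qed
  define \<gamma>' where "\<gamma>' = (\<lambda>t. (2 * pi * \<i> * r * exp (2 * of_real pi * \<i> * of_real t)) * deriv \<Psi> (?c t))"
  have c1: "norm (?c t) = r" for t using r by (simp add: circlepath norm_mult)
  have vd: "vector_derivative \<gamma> (at t within {0..1}) = \<gamma>' t" if t: "t \<in> {0..1}" for t
  proof -
    have "(?c has_vector_derivative (2 * pi * \<i> * r * exp (2 * of_real pi * \<i> * of_real t))) (at t within {0..1})"
      by (rule has_vector_derivative_circlepath)
    moreover have "(\<Psi> has_field_derivative deriv \<Psi> (?c t)) (at (?c t) within (?c ` {0..1}))"
      by (rule has_field_derivative_at_within, rule holomorphic_derivI[OF Psi_hol open_exterior_disc]) (use c1 r in auto)
    ultimately have "(\<gamma> has_vector_derivative \<gamma>' t) (at t within {0..1})"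
      unfolding \<gamma>_def \<gamma>'_def by (rule field_vector_diff_chain_within)
    then show ?thesis using t by (intro vector_derivative_within_cbox[of 0 1, simplified]) auto
  qed
  define k where "k = (\<lambda>t. G (\<gamma> t) * \<gamma>' t / (2 * pi * \<i> * w0))"
  have cc: "continuous_on {0..1} ?c" using path_circlepath path_def by blast
  have c\<gamma>: "continuous_on {0..1} \<gamma>" using valid_path_imp_path[OF vp] path_def by blast
  have \<gamma>lev: "lev (\<gamma> t) = r" if "t \<in> {0..1}" for t
    using im that by (auto simp: path_image_def)
  have "continuous_on {0..1} (\<lambda>t. G (\<gamma> t))"
    by (rule continuous_on_compose2[OF holomorphic_on_imp_continuous_on[OF G] c\<gamma>])
       (use Dsub in \<open>auto simp: path_image_def\<close>)
  moreover have "continuous_on {0..1} (\<lambda>t. deriv \<Psi> (?c t))"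
    by (rule continuous_on_compose2[OF holomorphic_on_imp_continuous_on[OF holomorphic_deriv[OF Psi_hol open_exterior_disc]] cc])
       (use c1 r in auto)
  ultimately have ck: "continuous_on {0..1} k"
    unfolding k_def \<gamma>'_def using w0(1) by (intro continuous_intros) auto
  have int: "((\<lambda>t. k t / (\<gamma> t - \<zeta>)) has_integral G \<zeta>) {0..1}" if \<zeta>: "lev \<zeta> < r" for \<zeta>
  proof -
    have "\<zeta> \<in> \<D> \<rho>" using \<zeta> r(2) \<rho> by (auto simp: domain_eq) (metis ereal_less_eq(3) le_less_trans less_imp_le)
    moreover have "path_image \<gamma> \<subseteq> \<D> \<rho> - {\<zeta>}" using Dsub im \<zeta> by auto
    ultimately have "((\<lambda>w. G w / (w - \<zeta>)) has_contour_integral (2 * pi * \<i> * winding_number \<gamma> \<zeta> * G \<zeta>)) \<gamma>"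
      by (intro Cauchy_integral_formula_global[OF open_domain[OF \<rho>] G _ vp _ loop wn0])
    then have "((\<lambda>t. G (\<gamma> t) / (\<gamma> t - \<zeta>) * vector_derivative \<gamma> (at t within {0..1})) has_integral (2 * pi * \<i> * w0 * G \<zeta>)) {0..1}"
      using w0(2)[OF \<zeta>] by (simp add: has_contour_integral_def)
    then have "((\<lambda>t. G (\<gamma> t) / (\<gamma> t - \<zeta>) * \<gamma>' t) has_integral (2 * pi * \<i> * w0 * G \<zeta>)) {0..1}"
      by (rule has_integral_eq[rotated]) (simp add: vd)
    from has_integral_mult_right[OF this, of "1 / (2 * pi * \<i> * w0)"]
    have "((\<lambda>t. 1 / (2 * pi * \<i> * w0) * (G (\<gamma> t) / (\<gamma> t - \<zeta>) * \<gamma>' t)) has_integral G \<zeta>) {0..1}"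
      using w0(1) by (simp add: field_simps)
    then show ?thesis by (rule has_integral_eq[rotated]) (simp add: k_def)
  qed
  show thesis by (rule that[OF c\<gamma> ck \<gamma>lev int])
qed

end

section \<open>Orthonormal polynomials and Fourier coefficients\<close>

locale compactly_supported =
  fixes \<mu> :: "complex measure"
  assumes sets_mu: "sets \<mu> = sets borel" and finite_mu: "finite_measure \<mu>"
    and infinite_support: "infinite (msupport \<mu>)" and bounded_support: "bounded (msupport \<mu>)"
begin

section \<open>Integration over the support of the measure\<close>

abbreviation "S \<equiv> msupport \<mu>"

definition I :: "(complex \<Rightarrow> complex) \<Rightarrow> complex" where
  "I f = (LINT \<zeta>:S|\<mu>. f \<zeta>)"

interpretation finite_measure \<mu> by (rule finite_mu)

lemma space_mu: "space \<mu> = UNIV"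
  using sets_eq_imp_space_eq[OF sets_mu] by simp

lemma closed_S: "closed S"
proof -
  have "open (- S)"
  proof (rule openI)
    fix z assume "z \<in> - S"
    then obtain r where r: "r > 0" "emeasure \<mu> (ball z r) = 0" by (auto simp: msupport_def)
    have "ball z r \<subseteq> - S"
    proof
      fix y assume y: "y \<in> ball z r"
      have "ball y (r - dist z y) \<subseteq> ball z r"
      proof
        fix x assume "x \<in> ball y (r - dist z y)"
        then show "x \<in> ball z r" using dist_triangle[of z x y] by simp
      qed
      then have "emeasure \<mu> (ball y (r - dist z y)) \<le> emeasure \<mu> (ball z r)"
        by (rule emeasure_mono) (simp add: sets_mu)
      then have "\<not> emeasure \<mu> (ball y (r - dist z y)) > 0" using r by simp
      moreover have "r - dist z y > 0" using y by simp
      ultimately show "y \<in> - S" unfolding msupport_def by blast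
    qed
    then show "\<exists>e>0. ball z e \<subseteq> - S" using r by blast
  qed
  then show ?thesis by (simp add: closed_def)
qed

lemma compact_S: "compact S"
  using closed_S bounded_support by (simp add: compact_eq_bounded_closed)


lemma S_sets [simp]: "S \<in> sets \<mu>"
  using closed_S by (simp add: sets_mu)

text \<open>By the Lindelof property countably many null balls cover the complement of the
  support.\<close>

lemma null_complement: "- S \<in> null_sets \<mu>"
proof -
  let ?F = "{ball z r | z r. r > 0 \<and> emeasure \<mu> (ball z r) = 0}"
  obtain F' where F': "F' \<subseteq> ?F" "countable F'" "\<Union>F' = \<Union>?F"
    by (rule Lindelof[of ?F]) auto
  have "(\<Union>B\<in>F'. B) \<in> null_sets \<mu>"
    using F' by (intro null_sets_UN') (auto simp: null_sets_def sets_mu)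
  moreover have "- S \<subseteq> \<Union>?F"
  proof
    fix z assume "z \<in> - S"
    then obtain r where "r > 0" "emeasure \<mu> (ball z r) = 0" by (auto simp: msupport_def)
    then show "z \<in> \<Union>?F" by (intro UnionI[of "ball z r"]) auto
  qed
  moreover have "- S \<in> sets \<mu>" using closed_S by (simp add: sets_mu)
  ultimately show ?thesis using F'(3) null_sets_subset[of "\<Union>F'" \<mu> "- S"] by simp
qed

lemma set_integrable_cont:
  fixes f :: "complex \<Rightarrow> 'b :: {banach, second_countable_topology}"
  assumes "continuous_on S f"
  shows "set_integrable \<mu> S f"
proof -
  obtain B where B: "\<And>z. z \<in> S \<Longrightarrow> norm (f z) \<le> B"
    using compact_imp_bounded[OF compact_continuous_image[OF assms compact_S]] by (auto simp: bounded_iff)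
  have "(\<lambda>x. indicator S x *\<^sub>R f x) \<in> borel_measurable borel"
    by (rule borel_measurable_continuous_on_indicator[OF _ assms]) (simp add: closed_S)
  then have "(\<lambda>x. indicator S x *\<^sub>R f x) \<in> borel_measurable \<mu>"
    by (simp add: measurable_cong_sets[OF sets_mu refl])
  then show ?thesis unfolding set_integrable_def
    by (rule integrable_const_bound[rotated, of _ "max B 0"]) (auto simp: indicator_def le_max_iff_disj B)
qed

lemma I_add: "continuous_on S f \<Longrightarrow> continuous_on S g \<Longrightarrow> I (\<lambda>z. f z + g z) = I f + I g"
  unfolding I_def by (intro set_integral_add set_integrable_cont)

lemma I_diff: "continuous_on S f \<Longrightarrow> continuous_on S g \<Longrightarrow> I (\<lambda>z. f z - g z) = I f - I g"
  unfolding I_def by (intro set_integral_diff set_integrable_cont)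

lemma I_cmult: "I (\<lambda>z. c * f z) = c * I f"
  unfolding I_def by simp

lemma I_zero: "I (\<lambda>z. 0) = 0"
  unfolding I_def by simp

lemma I_sum: "finite A \<Longrightarrow> (\<And>i. i \<in> A \<Longrightarrow> continuous_on S (f i)) \<Longrightarrow> I (\<lambda>z. \<Sum>i\<in>A. f i z) = (\<Sum>i\<in>A. I (f i))"
  by (induction A rule: finite_induct) (simp_all add: I_zero I_add continuous_on_sum)

lemma I_cong: "(\<And>z. z \<in> S \<Longrightarrow> f z = g z) \<Longrightarrow> I f = I g"
  unfolding I_def by (rule set_lebesgue_integral_cong) auto

lemma I_cnj: "I (\<lambda>z. cnj (f z)) = cnj (I f)"
proof -
  have "(\<lambda>x. indicator S x *\<^sub>R cnj (f x)) = (\<lambda>x. cnj (indicator S x *\<^sub>R f x))" by (auto simp: fun_eq_iff)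
  then show ?thesis unfolding I_def set_lebesgue_integral_def by (simp only: Bochner_Integration.integral_cnj)
qed

definition "mass = measure \<mu> UNIV"

lemma mass_nonneg: "mass \<ge> 0" by (simp add: mass_def)

lemma I_bound:
  assumes f: "continuous_on S f" and B: "\<And>z. z \<in> S \<Longrightarrow> norm (f z) \<le> B" "B \<ge> 0"
  shows "norm (I f) \<le> B * mass"
proof -
  have "norm (I f) \<le> (\<integral>x. norm (indicator S x *\<^sub>R f x) \<partial>\<mu>)"
    unfolding I_def set_lebesgue_integral_def by (rule integral_norm_bound)
  also have "\<dots> \<le> (\<integral>x. B \<partial>\<mu>)"
  proof (rule integral_mono)
    show "integrable \<mu> (\<lambda>x. norm (indicator S x *\<^sub>R f x))"
      using set_integrable_cont[OF f] unfolding set_integrable_def by (rule integrable_norm)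
    show "integrable \<mu> (\<lambda>x. B)" by simp
    show "\<And>x. norm (indicator S x *\<^sub>R f x) \<le> B" using B by (auto simp: indicator_def)
  qed
  also have "\<dots> = B * mass" by (simp add: mass_def space_mu mult.commute)
  finally show ?thesis .
qed

lemma I_norm_sq:
  assumes "continuous_on S f"
  shows "I (\<lambda>z. f z * cnj (f z)) = of_real (LINT z:S|\<mu>. (norm (f z))\<^sup>2)"
proof -
  have "(\<lambda>z. f z * cnj (f z)) = (\<lambda>z. complex_of_real ((norm (f z))\<^sup>2))"
    by (rule ext) (simp only: complex_norm_square)
  then show ?thesis unfolding I_def by (simp only: set_integral_complex_of_real)
qed

text \<open>f vanishes almost everywhere; by continuity a nonzero value at a support point would
  persist on a ball, which has positive measure.\<close>

lemma I_norm_sq_zero: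
  assumes f: "continuous_on S f" and 0: "I (\<lambda>z. f z * cnj (f z)) = 0" and z: "z \<in> S"
  shows "f z = 0"
proof (rule ccontr)
  assume nz: "f z \<noteq> 0"
  have c: "continuous_on S (\<lambda>z. (norm (f z))\<^sup>2)" by (intro continuous_intros f)
  have "(\<integral>x. indicator S x *\<^sub>R (norm (f x))\<^sup>2 \<partial>\<mu>) = 0"
    using 0 unfolding I_norm_sq[OF f] set_lebesgue_integral_def by simp
  then have "AE x in \<mu>. indicator S x *\<^sub>R (norm (f x))\<^sup>2 = 0"
    using set_integrable_cont[OF c] unfolding set_integrable_def
    by (subst (asm) integral_nonneg_eq_0_iff_AE) auto
  then have AE: "AE x in \<mu>. x \<in> S \<longrightarrow> f x = 0"
    by eventually_elim (auto simp: indicator_def)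
  obtain e where e: "e > 0" "\<And>y. y \<in> S \<Longrightarrow> dist y z < e \<Longrightarrow> f y \<noteq> 0"
    using f z nz unfolding continuous_on_iff
    by (metis dist_0_norm dist_commute less_irrefl zero_less_norm_iff)
  have "AE x in \<mu>. x \<notin> - S" using null_complement by (rule AE_not_in)
  with AE have "AE x in \<mu>. x \<notin> ball z e"
    by eventually_elim (use e(2) in \<open>auto simp: dist_commute\<close>)
  then have "emeasure \<mu> (ball z e) = 0"
    by (subst (asm) AE_iff_measurable[of "ball z e"]) (auto simp: sets_mu space_mu)
  moreover have "emeasure \<mu> (ball z e) > 0" using z e(1) by (simp add: msupport_def)
  ultimately show False by simp
qed

section \<open>Existence and uniqueness of the orthonormal polynomials\<close>

definition ip :: "complex poly \<Rightarrow> complex poly \<Rightarrow> complex" where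
  "ip p q = inner_prod \<mu> (poly p) (poly q)"

lemma inner_prod_I: "inner_prod \<mu> g h = I (\<lambda>z. g z * cnj (h z))"
  by (simp add: inner_prod_def I_def)

lemma cont_cnj_poly: "continuous_on A (\<lambda>z. cnj (poly p z))"
  by (intro continuous_intros)

lemma ip_diff: "ip (p - q) r = ip p r - ip q r"
  unfolding ip_def inner_prod_I by (subst I_diff[symmetric]) (auto intro!: continuous_intros simp: algebra_simps)

lemma ip_smult: "ip (smult c p) r = c * ip p r"
  unfolding ip_def inner_prod_I by (subst I_cmult[symmetric]) (simp add: mult.assoc)

lemma ip_sum: "finite A \<Longrightarrow> ip (\<Sum>k\<in>A. f k) r = (\<Sum>k\<in>A. ip (f k) r)"
  unfolding ip_def inner_prod_I by (subst I_sum[symmetric]) (auto intro!: continuous_intros simp: poly_sum sum_distrib_right)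

lemma ip_cnj: "ip p q = cnj (ip q p)"
  unfolding ip_def inner_prod_I by (subst I_cnj[symmetric]) (simp add: mult.commute)

lemma ip_smult_right: "ip p (smult c r) = cnj c * ip p r"
  using ip_cnj[of p "smult c r"] ip_cnj[of p r] by (simp add: ip_smult)

lemma ip_self: "ip p p = of_real (LINT z:S|\<mu>. (norm (poly p z))\<^sup>2)"
  unfolding ip_def inner_prod_I by (rule I_norm_sq) (intro continuous_intros)

lemma ip_self_nz: "p \<noteq> 0 \<Longrightarrow> ip p p \<noteq> 0"
proof
  assume p: "p \<noteq> 0" and "ip p p = 0"
  then have "poly p z = 0" if "z \<in> S" for z
    using that by (intro I_norm_sq_zero[of "poly p"]) (simp_all add: ip_def inner_prod_I continuous_intros)
  then have "S \<subseteq> {z. poly p z = 0}" by blast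
  then show False using poly_roots_finite[OF p] infinite_support finite_subset by blast
qed

lemma ip_self_pos: "p \<noteq> 0 \<Longrightarrow> \<exists>a>0. ip p p = of_real a"
proof -
  assume p: "p \<noteq> 0"
  have "0 \<le> (LINT z:S|\<mu>. (norm (poly p z))\<^sup>2)"
    unfolding set_lebesgue_integral_def by (intro integral_nonneg_AE AE_I2) (auto simp: indicator_def)
  then show ?thesis using ip_self_nz[OF p] ip_self[of p] by (intro exI[of _ "LINT z:S|\<mu>. (norm (poly p z))\<^sup>2"]) auto
qed

declare sum.cong[fundef_cong]

fun gram_schmidt :: "nat \<Rightarrow> complex poly" where
  "gram_schmidt n = monom 1 n -
     (\<Sum>k<n. smult (ip (monom 1 n) (gram_schmidt k) / ip (gram_schmidt k) (gram_schmidt k)) (gram_schmidt k))"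

declare gram_schmidt.simps[simp del]

lemma gram_schmidt_degree: "degree (gram_schmidt n) = n \<and> coeff (gram_schmidt n) n = 1"
proof (induction n rule: less_induct)
  case (less n)
  let ?s = "\<Sum>k<n. smult (ip (monom 1 n) (gram_schmidt k) / ip (gram_schmidt k) (gram_schmidt k)) (gram_schmidt k)"
  have c: "coeff ?s i = 0" if "i \<ge> n" for i
  proof -
    have "coeff (gram_schmidt k) i = 0" if "k < n" for k
      using less[OF that] \<open>i \<ge> n\<close> that by (intro coeff_eq_0) simp
    then show ?thesis unfolding coeff_sum coeff_smult by (intro sum.neutral) simp
  qed
  have "coeff (gram_schmidt n) i = 0" if "i > n" for i
    using c[of i] that by (subst gram_schmidt.simps) simp
  moreover have cn: "coeff (gram_schmidt n) n = 1"
    using c[of n] by (subst gram_schmidt.simps) simp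
  ultimately show ?case by (metis le_antisym degree_le le_degree zero_neq_one)
qed

lemma gram_schmidt_orth: "k < n \<Longrightarrow> ip (gram_schmidt n) (gram_schmidt k) = 0"
proof (induction n arbitrary: k rule: less_induct)
  case (less n)
  have nz: "ip (gram_schmidt k) (gram_schmidt k) \<noteq> 0" for k
    using gram_schmidt_degree[of k] by (intro ip_self_nz) auto
  have o: "ip (gram_schmidt j) (gram_schmidt k) = 0" if "j < n" "j \<noteq> k" for j
  proof (cases "k < j")
    case True then show ?thesis using less.IH that by blast
  next
    case False
    then have "ip (gram_schmidt k) (gram_schmidt j) = 0" using less.IH[of k j] less.prems that by simp
    then show ?thesis using ip_cnj[of "gram_schmidt j" "gram_schmidt k"] by simp
  qed
  have "ip (\<Sum>j<n. smult (ip (monom 1 n) (gram_schmidt j) / ip (gram_schmidt j) (gram_schmidt j)) (gram_schmidt j)) (gram_schmidt k)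
     = (\<Sum>j<n. if j = k then ip (monom 1 n) (gram_schmidt k) else 0)"
    unfolding ip_sum[OF finite_lessThan] using o nz by (intro sum.cong) (auto simp: ip_smult)
  also have "\<dots> = ip (monom 1 n) (gram_schmidt k)" using less.prems by simp
  finally show ?case by (subst gram_schmidt.simps) (simp add: ip_diff)
qed

lemma orthonormal_exists: "\<exists>p. orthonormal_polys \<mu> p"
proof -
  have "\<exists>a>0. ip (gram_schmidt n) (gram_schmidt n) = of_real a" for n
    using gram_schmidt_degree[of n] by (intro ip_self_pos) auto
  then obtain a where a: "\<And>n. a n > 0" "\<And>n. ip (gram_schmidt n) (gram_schmidt n) = of_real (a n)" by metis
  define p where "p n = smult (of_real (1 / sqrt (a n))) (gram_schmidt n)" for n
  have "degree (p n) = n \<and> (\<exists>\<kappa>>0. lead_coeff (p n) = complex_of_real \<kappa>)" for n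
  proof -
    have "1 / sqrt (a n) > 0" using a(1)[of n] by simp
    moreover from this have "degree (p n) = n" using gram_schmidt_degree[of n] by (simp add: p_def)
    moreover from this have "lead_coeff (p n) = of_real (1 / sqrt (a n))"
      using gram_schmidt_degree[of n] by (simp add: p_def)
    ultimately show ?thesis by metis
  qed
  moreover have "ip (p n) (p k) = (if n = k then 1 else 0)" for n k
  proof (cases "n = k")
    case True
    have "sqrt (a n) * sqrt (a n) = a n" using a(1)[of n] by simp
    then have "1 / sqrt (a n) * (1 / sqrt (a n) * a n) = 1" using a(1)[of n] by (simp add: field_simps)
    then have one: "complex_of_real (1 / sqrt (a n) * (1 / sqrt (a n) * a n)) = 1" by (simp only: of_real_1)
    have "ip (p n) (p n) = of_real (1 / sqrt (a n)) * (of_real (1 / sqrt (a n)) * of_real (a n))"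
      unfolding p_def ip_smult ip_smult_right a(2) by simp
    then show ?thesis using True one by (simp only: of_real_mult if_True refl)
  next
    case False
    have "ip (gram_schmidt n) (gram_schmidt k) = 0"
    proof (cases "k < n")
      case False
      then have "ip (gram_schmidt k) (gram_schmidt n) = 0" using \<open>n \<noteq> k\<close> gram_schmidt_orth by simp
      then show ?thesis using ip_cnj[of "gram_schmidt n" "gram_schmidt k"] by simp
    qed (rule gram_schmidt_orth)
    then show ?thesis using False by (simp add: p_def ip_smult ip_smult_right)
  qed
  ultimately have "orthonormal_polys \<mu> p" unfolding orthonormal_polys_def ip_def by blast
  then show ?thesis by (rule exI[of _ p])
qed

lemma orthonormal_ip: "orthonormal_polys \<mu> p \<Longrightarrow> ip (p n) (p k) = (if n = k then 1 else 0)"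
  by (simp add: orthonormal_polys_def ip_def)


lemma orthonormal_lead: "orthonormal_polys \<mu> p \<Longrightarrow> \<exists>\<kappa>>0. lead_coeff (p n) = complex_of_real \<kappa>"
  unfolding orthonormal_polys_def by blast

lemma orthonormal_expand_ex:
  assumes p: "orthonormal_polys \<mu> p" and "degree q \<le> N"
  shows "\<exists>c. q = (\<Sum>k\<le>N. smult (c k) (p k))"
  using assms(2)
proof (induction N arbitrary: q)
  case 0
  have nz: "coeff (p 0) 0 \<noteq> 0" and d: "degree (p 0) = 0"
    using p unfolding orthonormal_polys_def by (metis less_irrefl of_real_eq_0_iff)+
  have "q = smult (coeff q 0 / coeff (p 0) 0) (p 0)"
    using 0 d nz by (metis coeff_smult degree_0_id le_zero_eq mult_eq_0_iff nonzero_eq_divide_eq poly_eqI coeff_eq_0 degree_smult_le gr0I le_antisym)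
  then show ?case by (intro exI[of _ "\<lambda>_. coeff q 0 / coeff (p 0) 0"]) simp
next
  case (Suc N)
  have d: "degree (p (Suc N)) = Suc N" using p by (simp add: orthonormal_polys_def)
  have nz: "coeff (p (Suc N)) (Suc N) \<noteq> 0"
    using p d unfolding orthonormal_polys_def by (metis less_irrefl of_real_eq_0_iff)
  let ?c = "coeff q (Suc N) / coeff (p (Suc N)) (Suc N)"
  have "degree (q - smult ?c (p (Suc N))) \<le> N"
  proof (rule degree_le, intro allI impI)
    fix i assume "N < i"
    then show "coeff (q - smult ?c (p (Suc N))) i = 0"
      using nz d Suc.prems by (cases "i = Suc N") (auto simp: coeff_eq_0)
  qed
  from Suc.IH[OF this] obtain c where c: "q - smult ?c (p (Suc N)) = (\<Sum>k\<le>N. smult (c k) (p k))" by blast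
  have "(\<Sum>k\<le>Suc N. smult ((c(Suc N := ?c)) k) (p k)) = (\<Sum>k\<le>N. smult (c k) (p k)) + smult ?c (p (Suc N))"
    by (simp cong: sum.cong_simp)
  also have "\<dots> = q" by (simp flip: c)
  finally show ?case by metis
qed

lemma orthonormal_expand:
  assumes p: "orthonormal_polys \<mu> p" and "degree q \<le> N"
  shows "q = (\<Sum>k\<le>N. smult (ip q (p k)) (p k))"
proof -
  obtain c where c: "q = (\<Sum>k\<le>N. smult (c k) (p k))" using orthonormal_expand_ex[OF assms] by blast
  have "ip q (p j) = c j" if "j \<le> N" for j
  proof -
    have "ip q (p j) = (\<Sum>k\<le>N. c k * (if k = j then 1 else 0))"
      by (subst c) (simp only: ip_sum[OF finite_atMost] ip_smult orthonormal_ip[OF p])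
    also have "\<dots> = (\<Sum>k\<le>N. if k = j then c k else 0)" by (rule sum.cong) auto
    also have "\<dots> = c j" using that by (subst sum.delta) auto
    finally show ?thesis .
  qed
  then show ?thesis by (subst c) (intro sum.cong, auto)
qed

lemma orthonormal_low:
  assumes p: "orthonormal_polys \<mu> p" and "degree q < n"
  shows "ip q (p n) = 0"
proof -
  have "ip q (p n) = (\<Sum>k\<le>n-1. ip q (p k) * (if k = n then 1 else 0))"
  proof (subst orthonormal_expand[OF p, of q "n-1"])
    show "degree q \<le> n - 1" using assms(2) by simp
    show "ip (\<Sum>k\<le>n-1. smult (ip q (p k)) (p k)) (p n) = (\<Sum>k\<le>n-1. ip q (p k) * (if k = n then 1 else 0))"
      by (simp only: ip_sum[OF finite_atMost] ip_smult orthonormal_ip[OF p])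
  qed
  also have "\<dots> = 0" using assms(2) by (intro sum.neutral) auto
  finally show ?thesis .
qed

text \<open>Once the lower polynomials agree, q_n is orthogonal to them and so a multiple of p_n.
  The factor is positive by the leading coefficients and has modulus 1 by the norms. This justifies
  the definite description in \<open>orth_poly\<close>.\<close>

lemma orthonormal_unique:
  assumes p: "orthonormal_polys \<mu> p" and q: "orthonormal_polys \<mu> q"
  shows "p = q"
proof
  fix n
  show "p n = q n"
  proof (induction n rule: less_induct)
    case (less n)
    have "degree (q n) \<le> n" using q by (simp add: orthonormal_polys_def)
    then have "q n = (\<Sum>k\<le>n. smult (ip (q n) (p k)) (p k))" by (rule orthonormal_expand[OF p])
    also have "\<dots> = (\<Sum>k\<le>n. if k = n then smult (ip (q n) (p n)) (p n) else 0)"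
    proof (rule sum.cong)
      fix k assume k: "k \<in> {..n}"
      show "smult (ip (q n) (p k)) (p k) = (if k = n then smult (ip (q n) (p n)) (p n) else 0)"
      proof (cases "k = n")
        case False
        then have "ip (q n) (p k) = 0" using less[of k] k q by (simp add: ip_def orthonormal_polys_def)
        then show ?thesis using False by simp
      qed simp
    qed simp
    also have "\<dots> = smult (ip (q n) (p n)) (p n)" by simp
    finally have eq: "q n = smult (ip (q n) (p n)) (p n)" .
    define c where "c = ip (q n) (p n)"
    obtain a b where ab: "a > 0" "b > 0" "lead_coeff (p n) = complex_of_real a" "lead_coeff (q n) = complex_of_real b"
      using p q unfolding orthonormal_polys_def by metis
    have "lead_coeff (q n) = c * lead_coeff (p n)" using eq c_def by (metis lead_coeff_smult)
    then have cr: "c = of_real (b / a)" using ab by (simp add: field_simps)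
    have "1 = ip (q n) (q n)" using q by (simp add: ip_def orthonormal_polys_def)
    also have "\<dots> = c * cnj c * ip (p n) (p n)" by (subst eq, subst (2) eq) (simp add: ip_smult ip_smult_right c_def)
    also have "\<dots> = c * cnj c" using p by (simp add: ip_def orthonormal_polys_def)
    finally have "complex_of_real (b / a * (b / a)) = 1" using cr by simp
    then have "(b / a)\<^sup>2 = 1" unfolding power2_eq_square by (simp only: of_real_eq_1_iff)
    then have "b / a = 1" using ab by (simp add: power2_eq_1_iff) (metis divide_pos_pos not_less_iff_gr_or_eq zero_less_one neg_less_0_iff_less less_trans)
    then show "p n = q n" using eq cr c_def by simp
  qed
qed

section \<open>Fourier coefficients\<close>

abbreviation "op \<equiv> orth_poly \<mu>"

lemma op: "orthonormal_polys \<mu> op"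
  unfolding orth_poly_def using orthonormal_exists orthonormal_unique by (metis theI')

lemma degree_op: "degree (op n) = n" and op_nz: "op n \<noteq> 0" and kappa_pos: "kappa \<mu> n > 0"
  and lead_op: "lead_coeff (op n) = of_real (kappa \<mu> n)"
proof -
  show d: "degree (op n) = n" using op by (simp add: orthonormal_polys_def)
  obtain \<kappa> where "\<kappa> > 0" "lead_coeff (op n) = complex_of_real \<kappa>" using orthonormal_lead[OF op] by blast
  then show "op n \<noteq> 0" "kappa \<mu> n > 0" "lead_coeff (op n) = of_real (kappa \<mu> n)" by (auto simp: kappa_def)
qed

text \<open>The coefficient [G]_n of the overview. It sees only the values of G on the
  support.\<close>

definition cf :: "(complex \<Rightarrow> complex) \<Rightarrow> nat \<Rightarrow> complex" where
  "cf G n = inner_prod \<mu> G (poly (op n))"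

lemma cf_I: "cf G n = I (\<lambda>z. G z * cnj (poly (op n) z))"
  by (simp add: cf_def inner_prod_I)

lemma cf_poly: "cf (poly q) n = ip q (op n)"
  by (simp add: cf_def ip_def)

lemma cf_op: "cf (poly (op k)) n = (if k = n then 1 else 0)"
  using op by (simp add: cf_def orthonormal_polys_def)

lemma cf_low: "degree q < n \<Longrightarrow> cf (poly q) n = 0"
  unfolding cf_poly by (rule orthonormal_low[OF op])

lemma cf_expand: "degree q \<le> N \<Longrightarrow> q = (\<Sum>k\<le>N. smult (cf (poly q) k) (op k))"
  unfolding cf_poly by (rule orthonormal_expand[OF op])

lemma cf_cong: "(\<And>z. z \<in> S \<Longrightarrow> f z = g z) \<Longrightarrow> cf f n = cf g n"
  unfolding cf_I by (rule I_cong) simp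

lemma cf_add: "continuous_on S f \<Longrightarrow> continuous_on S g \<Longrightarrow> cf (\<lambda>z. f z + g z) n = cf f n + cf g n"
  unfolding cf_I by (subst I_add[symmetric]) (auto intro!: continuous_intros simp: algebra_simps)

lemma cf_diff: "continuous_on S f \<Longrightarrow> continuous_on S g \<Longrightarrow> cf (\<lambda>z. f z - g z) n = cf f n - cf g n"
  unfolding cf_I by (subst I_diff[symmetric]) (auto intro!: continuous_intros simp: algebra_simps)

lemma cf_cmult: "cf (\<lambda>z. c * f z) n = c * cf f n"
  unfolding cf_I by (subst I_cmult[symmetric]) (simp add: mult.assoc)

lemma cf_sum: "finite A \<Longrightarrow> (\<And>i. i \<in> A \<Longrightarrow> continuous_on S (f i)) \<Longrightarrow> cf (\<lambda>z. \<Sum>i\<in>A. f i z) n = (\<Sum>i\<in>A. cf (f i) n)"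
  unfolding cf_I by (subst I_sum[symmetric]) (auto intro!: continuous_intros simp: sum_distrib_right)

text \<open>C depends on n: the bound serves to pass to uniform limits inside a single coefficient.
  The bound \<open>cf_mult_op_bound\<close> is uniform in both indices.\<close>

lemma cf_sup_bound:
  obtains C where "C \<ge> 0" "\<And>f B. continuous_on S f \<Longrightarrow> (\<And>z. z \<in> S \<Longrightarrow> norm (f z) \<le> B) \<Longrightarrow> B \<ge> 0 \<Longrightarrow> norm (cf f n) \<le> C * B"
proof -
  have "compact ((\<lambda>z. poly (op n) z) ` S)" by (intro compact_continuous_image compact_S continuous_intros)
  then have "bounded ((\<lambda>z. poly (op n) z) ` S)" by (rule compact_imp_bounded)
  then obtain A where A: "A > 0" "\<And>z. z \<in> S \<Longrightarrow> norm (poly (op n) z) \<le> A"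
    by (auto simp: bounded_pos)
  show thesis
  proof (rule that[of "A * mass"])
    fix f :: "complex \<Rightarrow> complex" and B :: real
    assume f: "continuous_on S f" "\<And>z. z \<in> S \<Longrightarrow> norm (f z) \<le> B" "B \<ge> 0"
    have "norm (cf f n) \<le> (B * A) * mass" unfolding cf_I
    proof (rule I_bound)
      show "norm (f z * cnj (poly (op n) z)) \<le> B * A" if "z \<in> S" for z
        using f(2)[OF that] A(2)[OF that] f(3) by (simp add: norm_mult mult_mono)
    qed (use A f in \<open>auto intro!: continuous_intros\<close>)
    then show "norm (cf f n) \<le> A * mass * B" by (simp add: mult_ac)
  qed (use A mass_nonneg in simp)
qed

text \<open>Cauchy--Schwarz is replaced by \<open>2 |p\<^sub>k p\<^sub>n| \<le> |p\<^sub>k|\<^sup>2 + |p\<^sub>n|\<^sup>2\<close>.\<close>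

lemma cf_mult_op_bound:
  assumes f: "continuous_on S f" and B: "\<And>z. z \<in> S \<Longrightarrow> norm (f z) \<le> B" "B \<ge> 0"
  shows "norm (cf (\<lambda>z. f z * poly (op k) z) n) \<le> B"
proof -
  let ?a = "\<lambda>z. poly (op k) z" and ?b = "\<lambda>z. poly (op n) z"
  have one: "(LINT z:S|\<mu>. (norm (poly (op j) z))\<^sup>2) = 1" for j
  proof -
    have "complex_of_real (LINT z:S|\<mu>. (norm (poly (op j) z))\<^sup>2) = 1"
      using op unfolding ip_self[symmetric] by (simp add: ip_def orthonormal_polys_def)
    then show ?thesis by (simp only: of_real_eq_1_iff)
  qed
  have si: "set_integrable \<mu> S (\<lambda>z. (norm (poly (op j) z))\<^sup>2)" for j
    by (intro set_integrable_cont continuous_intros)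
  have cont: "continuous_on S (\<lambda>z. f z * ?a z * cnj (?b z))" by (intro continuous_intros f)
  have "norm (cf (\<lambda>z. f z * ?a z) n) \<le> (\<integral>z. norm (indicator S z *\<^sub>R (f z * ?a z * cnj (?b z))) \<partial>\<mu>)"
    unfolding cf_I I_def set_lebesgue_integral_def by (rule integral_norm_bound)
  also have "\<dots> \<le> (LINT z:S|\<mu>. B / 2 * ((norm (?a z))\<^sup>2 + (norm (?b z))\<^sup>2))"
    unfolding set_lebesgue_integral_def
  proof (rule integral_mono)
    show "integrable \<mu> (\<lambda>z. norm (indicator S z *\<^sub>R (f z * ?a z * cnj (?b z))))"
      using set_integrable_cont[OF cont] unfolding set_integrable_def by (rule integrable_norm)
    have "set_integrable \<mu> S (\<lambda>z. B / 2 * ((norm (?a z))\<^sup>2 + (norm (?b z))\<^sup>2))"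
      by (intro set_integrable_cont continuous_intros)
    then show "integrable \<mu> (\<lambda>z. indicator S z *\<^sub>R (B / 2 * ((norm (?a z))\<^sup>2 + (norm (?b z))\<^sup>2)))"
      unfolding set_integrable_def .
    show "norm (indicator S z *\<^sub>R (f z * ?a z * cnj (?b z))) \<le> indicator S z *\<^sub>R (B / 2 * ((norm (?a z))\<^sup>2 + (norm (?b z))\<^sup>2))" for z
    proof (cases "z \<in> S")
      case True
      have "norm (f z) * (norm (?a z) * norm (?b z)) \<le> B * (((norm (?a z))\<^sup>2 + (norm (?b z))\<^sup>2) / 2)"
        using B(1)[OF True] B(2) sum_squares_bound[of "norm (?a z)" "norm (?b z)"]
        by (intro mult_mono) (auto simp: field_simps)
      then show ?thesis using True by (simp add: norm_mult mult.assoc)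
    qed simp
  qed
  also have "\<dots> = B / 2 * ((LINT z:S|\<mu>. (norm (?a z))\<^sup>2) + (LINT z:S|\<mu>. (norm (?b z))\<^sup>2))"
    using set_integral_add(2)[OF si si] by (simp only: set_integral_mult_right)
  also have "\<dots> = B" by (simp add: one)
  finally show ?thesis .
qed

text \<open>Together with Cauchy's formula for G this writes an integral of G against \<mu> as a
  contour integral of a Cauchy transform. For w the conjugate of p_n the transform is the n-th
  second type function.\<close>

lemma I_fubini:
  fixes \<gamma> k :: "real \<Rightarrow> complex"
  assumes c: "continuous_on {0..1} \<gamma>" "continuous_on {0..1} k" "continuous_on S w"
    and off: "\<And>t. t \<in> {0..1} \<Longrightarrow> \<gamma> t \<notin> S"
    and G: "\<And>\<zeta>. \<zeta> \<in> S \<Longrightarrow> ((\<lambda>t. k t / (\<gamma> t - \<zeta>)) has_integral G \<zeta>) {0..1}"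
  shows "((\<lambda>t. k t * I (\<lambda>\<zeta>. w \<zeta> / (\<gamma> t - \<zeta>))) has_integral I (\<lambda>\<zeta>. G \<zeta> * w \<zeta>)) {0..1}"
proof -
  let ?f = "\<lambda>\<zeta> t. k t * w \<zeta> / (\<gamma> t - \<zeta>)"
  let ?A = "S \<times> {0..1::real}"
  \<comment> \<open>Cut off to the compact set \<open>?A\<close>, on which the integrand is
    continuous and bounded, it is integrable for the product of \<mu> with Lebesgue measure.\<close>
  let ?F = "\<lambda>\<zeta> t. indicator ?A (\<zeta>, t) *\<^sub>R ?f \<zeta> t"
  have contf: "continuous_on ?A (\<lambda>(\<zeta>, t). ?f \<zeta> t)"
    unfolding case_prod_beta
    by (intro continuous_intros continuous_on_compose2[OF c(1)] continuous_on_compose2[OF c(2)] continuous_on_compose2[OF c(3)])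
       (use off in auto)
  have cA: "compact ?A" by (intro compact_Times compact_S compact_Icc)
  obtain B where B: "\<And>x. x \<in> ?A \<Longrightarrow> norm (case x of (\<zeta>, t) \<Rightarrow> ?f \<zeta> t) \<le> B"
    using compact_imp_bounded[OF compact_continuous_image[OF contf cA]] by (auto simp: bounded_iff)
  interpret P: pair_sigma_finite \<mu> lborel
    by (intro pair_sigma_finite.intro sigma_finite_measure_axioms sigma_finite_lborel)
  have setsP: "sets (\<mu> \<Otimes>\<^sub>M lborel) = sets borel"
    using sets_pair_measure_cong[OF sets_mu sets_lborel] unfolding borel_prod .
  have Aset: "?A \<in> sets (\<mu> \<Otimes>\<^sub>M lborel)"
    unfolding setsP using cA by (simp add: borel_compact)
  have meas: "case_prod ?F \<in> borel_measurable (\<mu> \<Otimes>\<^sub>M lborel)"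
  proof -
    have "(\<lambda>x. indicator ?A x *\<^sub>R (case x of (\<zeta>, t) \<Rightarrow> ?f \<zeta> t)) \<in> borel_measurable borel"
      by (rule borel_measurable_continuous_on_indicator[OF _ contf]) (use cA in \<open>simp add: borel_compact\<close>)
    moreover have "(\<lambda>x. indicator ?A x *\<^sub>R (case x of (\<zeta>, t) \<Rightarrow> ?f \<zeta> t)) = case_prod ?F"
      by (rule ext) (simp add: case_prod_beta)
    ultimately show ?thesis by (simp only: measurable_cong_sets[OF setsP refl])
  qed
  have int: "integrable (\<mu> \<Otimes>\<^sub>M lborel) (case_prod ?F)"
  proof (rule Bochner_Integration.integrable_bound[OF _ meas])
    have "emeasure (\<mu> \<Otimes>\<^sub>M lborel) ?A = emeasure \<mu> S * emeasure lborel {0..1::real}"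
      by (rule sigma_finite_measure.emeasure_pair_measure_Times[OF sigma_finite_lborel]) auto
    also have "\<dots> < \<infinity>" by (simp add: ennreal_mult_less_top emeasure_eq_measure)
    finally show "integrable (\<mu> \<Otimes>\<^sub>M lborel) (\<lambda>x. B * indicator ?A x :: real)"
      using Aset by (intro integrable_mult_right integrable_real_indicator) auto
    show "AE x in \<mu> \<Otimes>\<^sub>M lborel. norm (case_prod ?F x) \<le> norm (B * indicator ?A x)"
    proof (rule AE_I2)
      fix x
      show "norm (case_prod ?F x) \<le> norm (B * indicator ?A x :: real)"
      proof (cases "x \<in> ?A")
        case True
        then have "norm (case_prod ?F x) \<le> B" using B[OF True] by (auto simp: case_prod_beta)
        then show ?thesis using True by simp
      qed (auto simp: case_prod_beta)
    qed
  qed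
  have cont_t: "continuous_on {0..1} (?f \<zeta>)" if "\<zeta> \<in> S" for \<zeta>
    by (intro continuous_intros c) (use off that in auto)
  have inner1: "(\<integral>t. ?F \<zeta> t \<partial>lborel) = indicator S \<zeta> *\<^sub>R (G \<zeta> * w \<zeta>)" for \<zeta>
  proof (cases "\<zeta> \<in> S")
    case True
    have "set_integrable lborel {0..1} (?f \<zeta>)"
      by (rule borel_integrable_atLeastAtMost'[OF cont_t[OF True]])
    from set_borel_integral_eq_integral(2)[OF this]
    have "(\<integral>t. indicator {0..1} t *\<^sub>R ?f \<zeta> t \<partial>lborel) = integral {0..1} (?f \<zeta>)"
      by (simp add: set_lebesgue_integral_def)
    also have "(?f \<zeta> has_integral (G \<zeta> * w \<zeta>)) {0..1}"
      using has_integral_mult_left[OF G[OF True], of "w \<zeta>"] by simp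
    then have "integral {0..1} (?f \<zeta>) = G \<zeta> * w \<zeta>" by (rule integral_unique)
    finally show ?thesis using True by (simp add: indicator_times)
  qed (simp add: indicator_times)
  have inner2: "(\<integral>\<zeta>. ?F \<zeta> t \<partial>\<mu>) = indicator {0..1} t *\<^sub>R (k t * I (\<lambda>\<zeta>. w \<zeta> / (\<gamma> t - \<zeta>)))" for t
  proof (cases "t \<in> {0..1}")
    case True
    have "(\<integral>\<zeta>. ?F \<zeta> t \<partial>\<mu>) = I (\<lambda>\<zeta>. k t * (w \<zeta> / (\<gamma> t - \<zeta>)))"
      using True unfolding I_def set_lebesgue_integral_def by (simp add: indicator_times)
    also have "\<dots> = k t * I (\<lambda>\<zeta>. w \<zeta> / (\<gamma> t - \<zeta>))" by (rule I_cmult)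
    finally show ?thesis using True by simp
  qed (simp add: indicator_times)
  have "(\<integral>t. (\<integral>\<zeta>. ?F \<zeta> t \<partial>\<mu>) \<partial>lborel) = (\<integral>\<zeta>. (\<integral>t. ?F \<zeta> t \<partial>lborel) \<partial>\<mu>)"
    by (rule P.Fubini_integral[OF int])
  then have eq: "(\<integral>t. indicator {0..1} t *\<^sub>R (k t * I (\<lambda>\<zeta>. w \<zeta> / (\<gamma> t - \<zeta>))) \<partial>lborel) = I (\<lambda>\<zeta>. G \<zeta> * w \<zeta>)"
    unfolding inner1 inner2 I_def set_lebesgue_integral_def .
  have "integrable lborel (\<lambda>t. \<integral>\<zeta>. ?F \<zeta> t \<partial>\<mu>)" by (rule P.integrable_snd[OF int])
  then have si: "set_integrable lborel {0..1} (\<lambda>t. k t * I (\<lambda>\<zeta>. w \<zeta> / (\<gamma> t - \<zeta>)))"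
    unfolding inner2 set_integrable_def .
  show ?thesis
    using set_borel_integral_eq_integral[OF si] eq
    by (simp add: set_lebesgue_integral_def has_integral_integrable_integral)
qed

end

section \<open>Holomorphic continuation and the decay of Fourier coefficients\<close>

text \<open>The finitely many exceptional terms, divided by their powers of a, are added to the
  constant.\<close>

lemma eventually_geometric_bound:
  fixes f :: "nat \<Rightarrow> 'a :: real_normed_vector"
  assumes "\<forall>\<^sub>F n in sequentially. norm (f n) \<le> A * a ^ n" and a: "a > 0"
  obtains C where "C \<ge> 0" "\<And>n. norm (f n) \<le> C * a ^ n"
proof -
  obtain N where N: "\<And>n. n \<ge> N \<Longrightarrow> norm (f n) \<le> A * a ^ n" using assms(1) by (auto simp: eventually_sequentially)
  define C where "C = \<bar>A\<bar> + (\<Sum>n<N. norm (f n) / a ^ n)"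
  have s: "0 \<le> (\<Sum>n<N. norm (f n) / a ^ n)" using a by (intro sum_nonneg) auto
  have "norm (f n) \<le> C * a ^ n" for n
  proof (cases "n < N")
    case True
    have "norm (f n) / a ^ n \<le> (\<Sum>n<N. norm (f n) / a ^ n)"
      by (rule member_le_sum) (use True a in auto)
    then have "norm (f n) / a ^ n \<le> C" by (simp add: C_def)
    then show ?thesis using a by (simp add: divide_le_eq)
  next
    case False
    then have "norm (f n) \<le> A * a ^ n" using N by simp
    also have "\<dots> \<le> C * a ^ n" using a s by (intro mult_right_mono) (auto simp: C_def)
    finally show ?thesis .
  qed
  moreover have "C \<ge> 0" using s by (simp add: C_def)
  ultimately show thesis using that by blast
qed

lemma ereal_real_between:
  assumes "ereal x < \<rho>"
  obtains y where "x < y" "ereal y < \<rho>"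
  using ereal_dense2[OF assms] by (metis less_ereal.simps(1))

lemma ereal_gt_1_real:
  assumes "1 < (\<rho> :: ereal)"
  obtains r where "1 < r" "ereal r < \<rho>"
proof -
  have "ereal 1 < \<rho>" using assms by (simp flip: one_ereal_def)
  then show thesis using that by (rule ereal_real_between)
qed

lemma root_le_imp_le_power:
  assumes "root n x \<le> a" "x \<ge> 0" "n > 0"
  shows "x \<le> a ^ n"
proof -
  have "x = root n x ^ n" using assms by (simp add: real_root_pow_pos2)
  also have "\<dots> \<le> a ^ n" using assms by (intro power_mono) auto
  finally show ?thesis .
qed

lemma same_germ_refl: "same_germ E f f"
  unfolding same_germ_def by (intro exI[of _ UNIV]) auto

lemma same_germ_sym: "same_germ E f g \<Longrightarrow> same_germ E g f"
  unfolding same_germ_def by metis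

lemma same_germ_trans: "same_germ E f g \<Longrightarrow> same_germ E g h \<Longrightarrow> same_germ E f h"
proof -
  assume "same_germ E f g" "same_germ E g h"
  then obtain U V where "open U" "E \<subseteq> U" "\<And>z. z \<in> U \<Longrightarrow> f z = g z" "open V" "E \<subseteq> V" "\<And>z. z \<in> V \<Longrightarrow> g z = h z"
    unfolding same_germ_def by metis
  then show ?thesis unfolding same_germ_def by (intro exI[of _ "U \<inter> V"]) (simp add: open_Int)
qed

text \<open>One rule for sums, products and multiplication by a fixed function: each is a choice of
  F.\<close>

lemma same_germ_compose2:
  assumes "same_germ E f f'" "same_germ E g g'"
  shows "same_germ E (\<lambda>z. F z (f z) (g z)) (\<lambda>z. F z (f' z) (g' z))"
proof -
  obtain U V where "open U" "E \<subseteq> U" "\<And>z. z \<in> U \<Longrightarrow> f z = f' z" "open V" "E \<subseteq> V" "\<And>z. z \<in> V \<Longrightarrow> g z = g' z"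
    using assms unfolding same_germ_def by metis
  then show ?thesis unfolding same_germ_def by (intro exI[of _ "U \<inter> V"]) (simp add: open_Int)
qed

lemma same_germ_on_E: "same_germ E f g \<Longrightarrow> z \<in> E \<Longrightarrow> f z = g z"
  unfolding same_germ_def by blast

text \<open>Only the germ of G along \<open>E\<close> has to continue; away from \<open>E\<close>
  the values of G itself are arbitrary.\<close>

definition hol_ext :: "complex set \<Rightarrow> ereal \<Rightarrow> (complex \<Rightarrow> complex) \<Rightarrow> bool" where
  "hol_ext E \<rho> G \<longleftrightarrow> (\<exists>h. h holomorphic_on canonical_domain E \<rho> \<and> same_germ E h G)"

locale regular_measure = exterior_domain E for E +
  fixes \<mu> :: "complex measure"
  assumes reg: "\<mu> \<in> Reg12 E"
begin

lemma support_subset: "msupport \<mu> \<subseteq> E"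
  using reg by (simp add: Reg12_def measures_on_def)

sublocale compactly_supported \<mu>
proof (rule compactly_supported.intro)
  show "sets \<mu> = sets borel" "finite_measure \<mu>" "infinite (msupport \<mu>)"
    using reg by (simp_all add: Reg12_def measures_on_def)
  show "bounded (msupport \<mu>)"
    using bounded_subset[OF compact_imp_bounded[OF compact_E] support_subset] .
qed

lemma lev_S: "z \<in> S \<Longrightarrow> lev z = 1"
  using support_subset lev_E by blast

lemma cont_on_S: "f holomorphic_on \<D> \<rho> \<Longrightarrow> continuous_on S f"
  using holomorphic_on_imp_continuous_on support_subset E_subset_domain by (metis continuous_on_subset)

lemma second_type_I: "second_type \<mu> n z = I (\<lambda>\<zeta>. cnj (poly (op n) \<zeta>) / (z - \<zeta>))"
  by (simp add: second_type_def I_def)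

lemma ereal_gt_1: "1 < r \<Longrightarrow> ereal r < \<rho> \<Longrightarrow> 1 < \<rho>"
proof -
  assume "1 < r" and r: "ereal r < \<rho>"
  then have "1 < ereal r" by simp
  then show "1 < \<rho>" using r by (rule less_trans)
qed

text \<open>One constant for all weights w. With w the conjugate of p_n the decay of second type
  functions passes to the coefficients of G; with w the conjugate of G and a vanishing Cauchy
  transform the integral of |G|^2 becomes 0.\<close>

lemma contour_bound:
  assumes r: "1 < r" "ereal r < \<rho>" and G: "G holomorphic_on \<D> \<rho>"
  obtains A where "A \<ge> 0" "\<And>w b. continuous_on S w \<Longrightarrow> b \<ge> 0 \<Longrightarrow> (\<And>z. lev z = r \<Longrightarrow> norm (I (\<lambda>\<zeta>. w \<zeta> / (z - \<zeta>))) \<le> b)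
     \<Longrightarrow> norm (I (\<lambda>\<zeta>. G \<zeta> * w \<zeta>)) \<le> A * b"
proof (rule cauchy_representation[OF r G])
  fix \<gamma> k :: "real \<Rightarrow> complex"
  assume gk: "continuous_on {0..1} \<gamma>" "continuous_on {0..1} k"
    "\<And>t. t \<in> {0..1} \<Longrightarrow> lev (\<gamma> t) = r"
    "\<And>\<zeta>. lev \<zeta> < r \<Longrightarrow> ((\<lambda>t. k t / (\<gamma> t - \<zeta>)) has_integral G \<zeta>) {0..1}"
  have "bounded (k ` {0..1})" by (intro compact_imp_bounded compact_continuous_image gk compact_Icc)
  then obtain A where A: "A > 0" "\<And>t. t \<in> {0..1} \<Longrightarrow> norm (k t) \<le> A" by (auto simp: bounded_pos)
  show thesis
  proof (rule that[of A])
    fix w :: "complex \<Rightarrow> complex" and b :: real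
    assume w: "continuous_on S w" and b: "b \<ge> 0"
      and bnd: "\<And>z. lev z = r \<Longrightarrow> norm (I (\<lambda>\<zeta>. w \<zeta> / (z - \<zeta>))) \<le> b"
    have "((\<lambda>t. k t * I (\<lambda>\<zeta>. w \<zeta> / (\<gamma> t - \<zeta>))) has_integral I (\<lambda>\<zeta>. G \<zeta> * w \<zeta>)) {0..1}"
    proof (rule I_fubini[OF gk(1,2) w])
      show "\<gamma> t \<notin> S" if "t \<in> {0..1}" for t using gk(3)[OF that] lev_S r by fastforce
      show "((\<lambda>t. k t / (\<gamma> t - \<zeta>)) has_integral G \<zeta>) {0..1}" if "\<zeta> \<in> S" for \<zeta>
        using gk(4) lev_S[OF that] r by simp
    qed
    then have "((\<lambda>t. k t * I (\<lambda>\<zeta>. w \<zeta> / (\<gamma> t - \<zeta>))) has_integral I (\<lambda>\<zeta>. G \<zeta> * w \<zeta>)) (cbox 0 1)"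
      by (simp add: cbox_interval)
    moreover have "norm (k t * I (\<lambda>\<zeta>. w \<zeta> / (\<gamma> t - \<zeta>))) \<le> A * b" if "t \<in> cbox 0 1" for t
      unfolding norm_mult using A b gk(3)[of t] bnd that by (intro mult_mono) (auto simp: cbox_interval)
    ultimately have "norm (I (\<lambda>\<zeta>. G \<zeta> * w \<zeta>)) \<le> A * b * measure lborel (cbox 0 (1::real))"
      using A b by (intro has_integral_bound[where B = "A * b"]) auto
    then show "norm (I (\<lambda>\<zeta>. G \<zeta> * w \<zeta>)) \<le> A * b" by simp
  qed (use A in simp)
qed

lemma second_type_bound:
  assumes r: "1 < r" and a: "1 / r < a"
  shows "\<forall>\<^sub>F n in sequentially. \<forall>z. lev z = r \<longrightarrow> norm (second_type \<mu> n z) \<le> a ^ n"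
proof -
  let ?K = "{z. lev z = r}"
  have K: "compact ?K" "?K \<subseteq> - E" using compact_lev_eq r lev_E by fastforce+
  then have "uniform_limit ?K (\<lambda>n z. root n (norm (second_type \<mu> n z))) (\<lambda>z. inverse (norm (\<Phi> z))) sequentially"
    using reg by (simp add: Reg12_def)
  moreover have "a - 1 / r > 0" using a by simp
  ultimately have "\<forall>\<^sub>F n in sequentially. \<forall>z\<in>?K. dist (root n (norm (second_type \<mu> n z))) (inverse (norm (\<Phi> z))) < a - 1 / r"
    by (rule uniform_limitD)
  then show ?thesis using eventually_gt_at_top[of 0]
  proof eventually_elim
    case (elim n)
    show ?case
    proof (intro allI impI)
      fix z assume z: "lev z = r"
      then have "z \<notin> E" using K by auto
      then have "norm (\<Phi> z) = r" using z by (simp add: lev_notin)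
      moreover have "\<bar>root n (norm (second_type \<mu> n z)) - inverse (norm (\<Phi> z))\<bar> < a - 1 / r"
        using elim z by (simp add: dist_real_def)
      ultimately have "root n (norm (second_type \<mu> n z)) \<le> a"
        by (simp add: inverse_eq_divide abs_less_iff)
      then show "norm (second_type \<mu> n z) \<le> a ^ n" by (rule root_le_imp_le_power) (use elim in auto)
    qed
  qed
qed

lemma second_type_lower_bound:
  assumes \<xi>: "\<xi> \<notin> E" and a: "0 < a" "a < 1 / norm (\<Phi> \<xi>)"
  shows "\<forall>\<^sub>F n in sequentially. a ^ n \<le> norm (second_type \<mu> n \<xi>)"
proof -
  have "compact {\<xi>}" "{\<xi>} \<subseteq> - E" using \<xi> by simp_all
  then have "uniform_limit {\<xi>} (\<lambda>n z. root n (norm (second_type \<mu> n z))) (\<lambda>z. inverse (norm (\<Phi> z))) sequentially"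
    using reg unfolding Reg12_def by blast
  moreover have "1 / norm (\<Phi> \<xi>) - a > 0" using a by simp
  ultimately have "\<forall>\<^sub>F n in sequentially. \<forall>z\<in>{\<xi>}. dist (root n (norm (second_type \<mu> n z))) (inverse (norm (\<Phi> z))) < 1 / norm (\<Phi> \<xi>) - a"
    by (rule uniform_limitD)
  then show ?thesis using eventually_gt_at_top[of 0]
  proof eventually_elim
    case (elim n)
    then have "\<bar>root n (norm (second_type \<mu> n \<xi>)) - 1 / norm (\<Phi> \<xi>)\<bar> < 1 / norm (\<Phi> \<xi>) - a"
      by (simp add: dist_real_def inverse_eq_divide)
    then have "a \<le> root n (norm (second_type \<mu> n \<xi>))" by linarith
    then have "a ^ n \<le> root n (norm (second_type \<mu> n \<xi>)) ^ n" using a by (intro power_mono) auto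
    also have "\<dots> = norm (second_type \<mu> n \<xi>)" using elim by (simp add: real_root_pow_pos2)
    finally show ?case .
  qed
qed

text \<open>Regularity speaks of compact sets outside \<open>E\<close> only. It is applied on the
  curve of level r, and the maximum principle carries the bound inside, across
  \<open>E\<close>.\<close>

lemma op_bound:
  assumes r: "1 < r" and a: "r < a"
  shows "\<forall>\<^sub>F n in sequentially. \<forall>z. lev z \<le> r \<longrightarrow> norm (poly (op n) z) \<le> a ^ n"
proof -
  let ?K = "{z. lev z = r}"
  have K: "compact ?K" "?K \<subseteq> - E" using compact_lev_eq r lev_E by fastforce+
  then have "uniform_limit ?K (\<lambda>n z. root n (norm (poly (op n) z))) (\<lambda>z. norm (\<Phi> z)) sequentially"
    using reg by (simp add: Reg12_def)
  moreover have "a - r > 0" using a by simp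
  ultimately have "\<forall>\<^sub>F n in sequentially. \<forall>z\<in>?K. dist (root n (norm (poly (op n) z))) (norm (\<Phi> z)) < a - r"
    by (rule uniform_limitD)
  then show ?thesis using eventually_gt_at_top[of 0]
  proof eventually_elim
    case (elim n)
    have K1: "norm (poly (op n) z) \<le> a ^ n" if z: "lev z = r" for z
    proof -
      have "z \<notin> E" using K z by auto
      then have "norm (\<Phi> z) = r" using z by (simp add: lev_notin)
      moreover have "\<bar>root n (norm (poly (op n) z)) - norm (\<Phi> z)\<bar> < a - r"
        using elim z by (simp add: dist_real_def)
      ultimately have "root n (norm (poly (op n) z)) \<le> a" by (simp add: abs_less_iff)
      then show ?thesis by (rule root_le_imp_le_power) (use elim in auto)
    qed
    let ?T = "{z. lev z < r}"
    have clo: "closure ?T \<subseteq> {z. lev z \<le> r}"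
      by (rule closure_minimal) (auto intro: compact_imp_closed compact_lev_le)
    have op: "open ?T" by (intro open_Collect_less lev_cont continuous_intros)
    have "norm (poly (op n) z) \<le> a ^ n" if z: "lev z < r" for z
    proof (rule maximum_modulus_frontier[of "poly (op n)" ?T])
      show "poly (op n) holomorphic_on interior ?T" by (intro holomorphic_intros)
      show "continuous_on (closure ?T) (poly (op n))" by (intro continuous_intros)
      show "bounded ?T"
        by (rule bounded_subset[OF compact_imp_bounded[OF compact_lev_le[of r]]]) auto
      show "norm (poly (op n) x) \<le> a ^ n" if "x \<in> frontier ?T" for x
      proof -
        have "x \<in> closure ?T" "x \<notin> ?T" using that op by (auto simp: frontier_def interior_open)
        then have "lev x = r" using clo by force
        then show ?thesis by (rule K1)
      qed
    qed (use z in simp)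
    then show ?case using K1 by (metis le_less)
  qed
qed

lemma cf_decay:
  assumes G: "G holomorphic_on \<D> \<rho>" and r: "1 < r" "ereal r < \<rho>"
  obtains C where "C \<ge> 0" "\<And>n. norm (cf G n) \<le> C * (1 / r) ^ n"
proof -
  \<comment> \<open>The contour lies at a slightly larger level, so that the limit 1 / r' of the
    n-th roots leaves room below 1 / r.\<close>
  obtain r' where r': "r < r'" "ereal r' < \<rho>" using r(2) by (rule ereal_real_between)
  obtain A where A: "A \<ge> 0" "\<And>w b. continuous_on S w \<Longrightarrow> b \<ge> 0 \<Longrightarrow> (\<And>z. lev z = r' \<Longrightarrow> norm (I (\<lambda>\<zeta>. w \<zeta> / (z - \<zeta>))) \<le> b)
     \<Longrightarrow> norm (I (\<lambda>\<zeta>. G \<zeta> * w \<zeta>)) \<le> A * b"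
    using contour_bound[of r' \<rho> G] r r' G by auto
  have "1 / r' < 1 / r" using r r' by (simp add: field_simps)
  then have "\<forall>\<^sub>F n in sequentially. \<forall>z. lev z = r' \<longrightarrow> norm (second_type \<mu> n z) \<le> (1 / r) ^ n"
    using r r' by (intro second_type_bound) auto
  then have "\<forall>\<^sub>F n in sequentially. norm (cf G n) \<le> A * (1 / r) ^ n"
  proof eventually_elim
    case (elim n)
    then show ?case unfolding cf_I second_type_I
      using r by (intro A(2) cont_cnj_poly) auto
  qed
  then show thesis using eventually_geometric_bound[of "cf G" A "1 / r"] r that by auto
qed

text \<open>The orthogonal series of G. It depends on the germ of G only (\<open>ser_germ\<close>)
  and equals every holomorphic continuation of it to a canonical domain (\<open>ser_eq\<close>), so
  it serves as the continuation.\<close>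

definition ser :: "(complex \<Rightarrow> complex) \<Rightarrow> complex \<Rightarrow> complex" where
  "ser G z = (\<Sum>n. cf G n * poly (op n) z)"

text \<open>For \<rho> > 1 this says that limsup |[G]_n|^(1/n) is at most 1 / \<rho>. Since each r
  below \<rho> has its own constant, the property passes to suprema of \<rho>.\<close>

definition decays :: "ereal \<Rightarrow> (complex \<Rightarrow> complex) \<Rightarrow> bool" where
  "decays \<rho> G \<longleftrightarrow> (\<forall>r>1. ereal r < \<rho> \<longrightarrow> (\<exists>C\<ge>0. \<forall>n. norm (cf G n) \<le> C * (1 / r) ^ n))"

lemma decaysD:
  assumes "decays \<rho> G" "1 < r" "ereal r < \<rho>"
  shows "\<exists>C\<ge>0. \<forall>n. norm (cf G n) \<le> C * (1 / r) ^ n"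
  using assms unfolding decays_def by blast

lemma hol_decays: "G holomorphic_on \<D> \<rho> \<Longrightarrow> decays \<rho> G"
  unfolding decays_def using cf_decay by metis

lemma ser_uniform_limit:
  assumes d: "decays \<rho> G" and r: "1 < r" "ereal r < \<rho>"
  shows "uniform_limit {z. lev z \<le> r} (\<lambda>N z. \<Sum>n<N. cf G n * poly (op n) z) (ser G) sequentially"
proof -
  obtain b where b: "r < b" "ereal b < \<rho>"
    using r(2) by (rule ereal_real_between)
  \<comment> \<open>With r < a < b, p_n is at most a^n on the level set of r and the coefficients
    are O(b^-n), so (a / b)^n dominates the series.\<close>
  define a where "a = (r + b) / 2"
  have a: "r < a" "a < b" using b by (auto simp: a_def)
  have "1 < b" using r(1) b(1) by simp
  then obtain C where C: "C \<ge> 0" "\<And>n. norm (cf G n) \<le> C * (1 / b) ^ n"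
    using decaysD[OF d _ b(2)] by blast
  show ?thesis unfolding ser_def
  proof (rule Weierstrass_m_test_ev)
    show "\<forall>\<^sub>F n in sequentially. \<forall>z\<in>{z. lev z \<le> r}. norm (cf G n * poly (op n) z) \<le> C * (a / b) ^ n"
      using op_bound[OF r(1) a(1)]
    proof eventually_elim
      case (elim n)
      show ?case
      proof
        fix z assume "z \<in> {z. lev z \<le> r}"
        then have "norm (cf G n * poly (op n) z) \<le> (C * (1 / b) ^ n) * a ^ n"
          unfolding norm_mult using elim C b r by (intro mult_mono) auto
        then show "norm (cf G n * poly (op n) z) \<le> C * (a / b) ^ n"
          by (simp add: power_divide)
      qed
    qed
    show "summable (\<lambda>n. C * (a / b) ^ n)"
      using a r b by (intro summable_mult summable_geometric) auto
  qed
qed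

lemma ser_hol:
  assumes d: "decays \<rho> G" and \<rho>: "1 < \<rho>"
  shows "ser G holomorphic_on \<D> \<rho>"
proof (rule holomorphic_uniform_sequence[where f = "\<lambda>N z. \<Sum>n<N. cf G n * poly (op n) z"])
  show "open (\<D> \<rho>)" using open_domain[OF \<rho>] .
  show "(\<lambda>z. \<Sum>n<N. cf G n * poly (op n) z) holomorphic_on \<D> \<rho>" for N
    by (intro holomorphic_intros)
  fix x assume "x \<in> \<D> \<rho>"
  then have "ereal (lev x) < \<rho>" using \<rho> by (simp add: domain_eq)
  then obtain r where r: "lev x < r" "ereal r < \<rho>" by (rule ereal_real_between)
  have r1: "1 < r" using lev_ge_1[of x] r by simp
  have "open {z. lev z < r}" by (intro open_Collect_less lev_cont continuous_intros)
  then obtain e where e: "e > 0" "cball x e \<subseteq> {z. lev z < r}" using r by (auto simp: open_contains_cball)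
  have "cball x e \<subseteq> {z. lev z \<le> r}" using e by auto
  then have "uniform_limit (cball x e) (\<lambda>N z. \<Sum>n<N. cf G n * poly (op n) z) (ser G) sequentially"
    by (rule uniform_limit_on_subset[OF ser_uniform_limit[OF d r1 r(2)]])
  moreover have "cball x e \<subseteq> \<D> \<rho>"
  proof
    fix z assume "z \<in> cball x e"
    then have "ereal (lev z) < ereal r" using e(2) by auto
    then have "ereal (lev z) < \<rho>" using r(2) by (rule less_trans)
    then show "z \<in> \<D> \<rho>" using \<rho> by (simp add: domain_eq)
  qed
  ultimately show "\<exists>d>0. cball x d \<subseteq> \<D> \<rho> \<and> uniform_limit (cball x d) (\<lambda>N z. \<Sum>n<N. cf G n * poly (op n) z) (ser G) sequentially"
    using e(1) by blast
qed

lemma cauchy_transform_hol: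
  assumes w: "continuous_on S w"
  shows "(\<lambda>z. I (\<lambda>\<zeta>. w \<zeta> / (z - \<zeta>))) holomorphic_on (- E)"
proof -
  let ?\<phi> = "\<lambda>z. I (\<lambda>\<zeta>. w \<zeta> / (z - \<zeta>))"
  have "bounded (w ` S)" by (intro compact_imp_bounded compact_continuous_image w compact_S)
  then obtain W where W: "W > 0" "\<And>z. z \<in> S \<Longrightarrow> norm (w z) \<le> W" by (auto simp: bounded_pos)
  have "\<exists>D. (?\<phi> has_field_derivative D) (at z)" if z: "z \<in> - E" for z
  proof -
    obtain e where e: "e > 0" "ball z e \<subseteq> - E" using open_Compl_E z by (metis openE)
    have zS: "z \<noteq> \<zeta>" if "\<zeta> \<in> S" for \<zeta> using that z support_subset by blast
    have dz: "norm (z - \<zeta>) \<ge> e" if "\<zeta> \<in> S" for \<zeta>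
    proof (rule ccontr)
      assume "\<not> norm (z - \<zeta>) \<ge> e"
      then have "\<zeta> \<in> ball z e" by (simp add: dist_norm)
      then show False using e(2) that support_subset by blast
    qed
    define D where "D = I (\<lambda>\<zeta>. - w \<zeta> / (z - \<zeta>)\<^sup>2)"
    \<comment> \<open>The error of the difference quotient is y - z times the integral of w / ((y -
      \<zeta>) (z - \<zeta>)^2), where |w| \<le> W, |y - \<zeta>| \<ge> e / 2 and |z - \<zeta>|
      \<ge> e.\<close>
    define K where "K = W * (2 / e) * (1 / e) ^ 2 * mass"
    have cD: "continuous_on S (\<lambda>\<zeta>. - w \<zeta> / (z - \<zeta>)\<^sup>2)"
      by (intro continuous_intros w) (use zS in auto)
    have "((\<lambda>y. (?\<phi> y - ?\<phi> z) / (y - z) - D) \<longlongrightarrow> 0) (at z)"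
    proof (rule Lim_null_comparison)
      have "\<forall>\<^sub>F y in at z. dist y z < e / 2 \<and> y \<noteq> z"
        using e(1) by (auto simp: eventually_at intro!: exI[of _ "e/2"])
      then show "\<forall>\<^sub>F y in at z. norm ((?\<phi> y - ?\<phi> z) / (y - z) - D) \<le> K * norm (y - z)"
      proof eventually_elim
        case (elim y)
        have dy: "norm (y - \<zeta>) \<ge> e / 2" if "\<zeta> \<in> S" for \<zeta>
        proof -
          have "norm (z - \<zeta>) \<le> norm (z - y) + norm (y - \<zeta>)" using norm_triangle_ineq[of "z - y" "y - \<zeta>"] by simp
          then show ?thesis using dz[OF that] elim by (simp add: dist_norm norm_minus_commute)
        qed
        have yS: "y \<noteq> \<zeta>" if "\<zeta> \<in> S" for \<zeta> using dy[OF that] e(1) by auto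
        have cy: "continuous_on S (\<lambda>\<zeta>. w \<zeta> / (y - \<zeta>))" "continuous_on S (\<lambda>\<zeta>. w \<zeta> / (z - \<zeta>))"
          by (intro continuous_intros w; use zS yS in force)+
        have "(?\<phi> y - ?\<phi> z) - (y - z) * D = I (\<lambda>\<zeta>. (w \<zeta> / (y - \<zeta>) - w \<zeta> / (z - \<zeta>)) - (y - z) * (- w \<zeta> / (z - \<zeta>)\<^sup>2))"
        proof -
          have c3: "continuous_on S (\<lambda>\<zeta>. (y - z) * (- w \<zeta> / (z - \<zeta>)\<^sup>2))"
            by (rule continuous_on_mult_left[OF cD])
          show ?thesis unfolding I_diff[OF continuous_on_diff[OF cy] c3] I_diff[OF cy] I_cmult D_def ..
        qed
        also have "\<dots> = I (\<lambda>\<zeta>. (y - z)\<^sup>2 * (w \<zeta> / ((y - \<zeta>) * (z - \<zeta>)\<^sup>2)))"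
        proof (rule I_cong)
          fix \<zeta> assume "\<zeta> \<in> S"
          then have "y - \<zeta> \<noteq> 0" "z - \<zeta> \<noteq> 0" using yS zS by auto
          then show "(w \<zeta> / (y - \<zeta>) - w \<zeta> / (z - \<zeta>)) - (y - z) * (- w \<zeta> / (z - \<zeta>)\<^sup>2) = (y - z)\<^sup>2 * (w \<zeta> / ((y - \<zeta>) * (z - \<zeta>)\<^sup>2))"
            by (simp add: divide_simps) (simp add: power2_eq_square algebra_simps)
        qed
        also have "\<dots> = (y - z)\<^sup>2 * I (\<lambda>\<zeta>. w \<zeta> / ((y - \<zeta>) * (z - \<zeta>)\<^sup>2))" by (rule I_cmult)
        finally have eq: "(?\<phi> y - ?\<phi> z) - (y - z) * D = (y - z)\<^sup>2 * I (\<lambda>\<zeta>. w \<zeta> / ((y - \<zeta>) * (z - \<zeta>)\<^sup>2))" .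
        have "(?\<phi> y - ?\<phi> z) / (y - z) - D = ((?\<phi> y - ?\<phi> z) - (y - z) * D) / (y - z)"
          using elim by (simp add: field_simps)
        also have "\<dots> = (y - z) * I (\<lambda>\<zeta>. w \<zeta> / ((y - \<zeta>) * (z - \<zeta>)\<^sup>2))"
          using elim unfolding eq by (simp add: power2_eq_square)
        finally have eq2: "(?\<phi> y - ?\<phi> z) / (y - z) - D = (y - z) * I (\<lambda>\<zeta>. w \<zeta> / ((y - \<zeta>) * (z - \<zeta>)\<^sup>2))" .
        have "norm (I (\<lambda>\<zeta>. w \<zeta> / ((y - \<zeta>) * (z - \<zeta>)\<^sup>2))) \<le> (W * (2 / e) * (1 / e) ^ 2) * mass"
        proof (rule I_bound)
          show "continuous_on S (\<lambda>\<zeta>. w \<zeta> / ((y - \<zeta>) * (z - \<zeta>)\<^sup>2))"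
            by (intro continuous_intros w) (use zS yS in auto)
          show "0 \<le> W * (2 / e) * (1 / e)\<^sup>2" using W e by simp
          fix \<zeta> assume s: "\<zeta> \<in> S"
          have i1: "1 / norm (y - \<zeta>) \<le> 2 / e" using frac_le[of 1 1 "e/2" "norm (y - \<zeta>)"] dy[OF s] e(1) by simp
          have i2: "1 / norm (z - \<zeta>) \<le> 1 / e" using frac_le[of 1 1 e "norm (z - \<zeta>)"] dz[OF s] e(1) by simp
          have "norm (w \<zeta> / ((y - \<zeta>) * (z - \<zeta>)\<^sup>2)) = norm (w \<zeta>) * (1 / norm (y - \<zeta>)) * (1 / norm (z - \<zeta>))^2"
            by (simp add: norm_divide norm_mult norm_power power_divide)
          also have "\<dots> \<le> W * (2 / e) * (1 / e) ^ 2"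
            using W(2)[OF s] i1 i2 W(1) e(1) by (intro mult_mono power_mono) auto
          finally show "norm (w \<zeta> / ((y - \<zeta>) * (z - \<zeta>)\<^sup>2)) \<le> W * (2 / e) * (1 / e) ^ 2" .
        qed
        then have "norm (y - z) * norm (I (\<lambda>\<zeta>. w \<zeta> / ((y - \<zeta>) * (z - \<zeta>)\<^sup>2))) \<le> norm (y - z) * K"
          unfolding K_def by (rule mult_left_mono) simp
        then show ?case unfolding eq2 norm_mult by (simp add: mult.commute)
      qed
      have "((\<lambda>y. K * norm (y - z)) \<longlongrightarrow> K * norm (z - z)) (at z)" by (intro tendsto_intros)
      then show "((\<lambda>y. K * norm (y - z)) \<longlongrightarrow> 0) (at z)" by simp
    qed
    then have "((\<lambda>y. (?\<phi> y - ?\<phi> z) / (y - z)) \<longlongrightarrow> D) (at z)" by (rule LIM_zero_cancel)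
    then show ?thesis by (auto simp: has_field_derivative_iff)
  qed
  then show ?thesis using open_Compl_E by (simp add: holomorphic_on_open)
qed

text \<open>If all coefficients of \<open>u\<close> vanish, then the Cauchy transform of \<open>u\<^sup>*\<mu>\<close> (\<open>u\<^sup>*\<close> the conjugate) vanishes
  near infinity, hence on the connected complement of \<open>E\<close>, and Cauchy's formula gives
  \<open>\<integral>|u|\<^sup>2 d\<mu> = 0\<close>.\<close>

lemma hol_cf_zero_imp_zero:
  assumes u: "u holomorphic_on \<D> \<rho>" and \<rho>: "1 < \<rho>" and cf0: "\<And>n. cf u n = 0" and z: "z \<in> \<D> \<rho>"
  shows "u z = 0"
proof -
  define w where "w = (\<lambda>\<zeta>. cnj (u \<zeta>))"
  have cu: "continuous_on S u" using cont_on_S[OF u] .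
  then have cw: "continuous_on S w" unfolding w_def by (intro continuous_intros)
  let ?\<phi> = "\<lambda>z. I (\<lambda>\<zeta>. w \<zeta> / (z - \<zeta>))"
  \<comment> \<open>\<zeta>^k is a combination of p_0, ..., p_k, so the vanishing coefficients of u
    give vanishing moments of its conjugate.\<close>
  have mom: "I (\<lambda>\<zeta>. w \<zeta> * \<zeta> ^ k) = 0" for k
  proof -
    have "I (\<lambda>\<zeta>. u \<zeta> * cnj (\<zeta> ^ k)) = I (\<lambda>\<zeta>. \<Sum>j\<le>k. cnj (cf (poly (monom 1 k)) j) * (u \<zeta> * cnj (poly (op j) \<zeta>)))"
    proof (rule I_cong)
      fix \<zeta> :: complex
      have "\<zeta> ^ k = poly (monom 1 k) \<zeta>" by (simp add: poly_monom)
      also have "\<dots> = (\<Sum>j\<le>k. cf (poly (monom 1 k)) j * poly (op j) \<zeta>)"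
        by (subst cf_expand[of "monom 1 k" k]) (auto simp: degree_monom_le poly_sum)
      finally show "u \<zeta> * cnj (\<zeta> ^ k) = (\<Sum>j\<le>k. cnj (cf (poly (monom 1 k)) j) * (u \<zeta> * cnj (poly (op j) \<zeta>)))"
        by (simp add: sum_distrib_left mult_ac)
    qed
    also have "\<dots> = (\<Sum>j\<le>k. cnj (cf (poly (monom 1 k)) j) * cf u j)"
      unfolding cf_I[of u] by (subst I_sum) (auto intro!: continuous_intros cu simp: I_cmult)
    also have "\<dots> = 0" by (simp add: cf0)
    finally have "cnj (I (\<lambda>\<zeta>. u \<zeta> * cnj (\<zeta> ^ k))) = 0" by simp
    then show ?thesis unfolding I_cnj[symmetric] by (simp add: w_def)
  qed
  obtain B where B: "B > 0" "\<And>z. z \<in> S \<Longrightarrow> norm z \<le> B" using bounded_support by (auto simp: bounded_pos)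
  have "bounded (w ` S)" by (intro compact_imp_bounded compact_continuous_image cw compact_S)
  then obtain W where W: "W > 0" "\<And>z. z \<in> S \<Longrightarrow> norm (w z) \<le> W" by (auto simp: bounded_pos)
  have large: "?\<phi> y = 0" if y: "norm y > B" for y
  proof -
    have yS: "y \<noteq> \<zeta>" if "\<zeta> \<in> S" for \<zeta> using B(2)[OF that] y by auto
    have y0: "y \<noteq> 0" using y B by auto
    \<comment> \<open>The first N terms of the geometric series for 1 / (y - \<zeta>) contribute
      only moments, which are 0. What is left is O((B / |y|)^N).\<close>
    have bound: "norm (?\<phi> y) \<le> (W / (norm y - B) * mass) * (B / norm y) ^ N" for N
    proof -
      have geo: "1 / (y - \<zeta>) = (\<Sum>k<N. \<zeta> ^ k / y ^ Suc k) + (\<zeta> / y) ^ N / (y - \<zeta>)" if "\<zeta> \<in> S" for \<zeta>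
      proof -
        have "(\<Sum>k<N. \<zeta> ^ k / y ^ Suc k) = (\<Sum>k<N. (\<zeta> / y) ^ k) / y"
          by (simp add: sum_divide_distrib power_divide field_simps)
        also have "(\<Sum>k<N. (\<zeta> / y) ^ k) = (1 - (\<zeta> / y) ^ N) / (1 - \<zeta> / y)"
          using yS[OF that] y0 by (subst sum_gp_strict) (auto simp: field_simps)
        finally have "(\<Sum>k<N. \<zeta> ^ k / y ^ Suc k) = (1 - (\<zeta> / y) ^ N) / (1 - \<zeta> / y) / y" .
        also have "\<dots> = (1 - (\<zeta> / y) ^ N) / (y - \<zeta>)"
          using yS[OF that] y0 by (simp add: field_simps)
        finally show ?thesis by (simp add: diff_divide_distrib)
      qed
      have "?\<phi> y = I (\<lambda>\<zeta>. (\<Sum>k<N. (1 / y ^ Suc k) * (w \<zeta> * \<zeta> ^ k)) + w \<zeta> * (\<zeta> / y) ^ N / (y - \<zeta>))"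
      proof (rule I_cong)
        fix \<zeta> assume s: "\<zeta> \<in> S"
        have "w \<zeta> / (y - \<zeta>) = w \<zeta> * (1 / (y - \<zeta>))" by simp
        also have "\<dots> = w \<zeta> * (\<Sum>k<N. \<zeta> ^ k / y ^ Suc k) + w \<zeta> * ((\<zeta> / y) ^ N / (y - \<zeta>))"
          by (subst geo[OF s]) (rule distrib_left)
        also have "w \<zeta> * (\<Sum>k<N. \<zeta> ^ k / y ^ Suc k) = (\<Sum>k<N. (1 / y ^ Suc k) * (w \<zeta> * \<zeta> ^ k))"
          by (simp add: sum_distrib_left)
        finally show "w \<zeta> / (y - \<zeta>) = (\<Sum>k<N. (1 / y ^ Suc k) * (w \<zeta> * \<zeta> ^ k)) + w \<zeta> * (\<zeta> / y) ^ N / (y - \<zeta>)"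
          by simp
      qed
      also have "\<dots> = (\<Sum>k<N. (1 / y ^ Suc k) * I (\<lambda>\<zeta>. w \<zeta> * \<zeta> ^ k)) + I (\<lambda>\<zeta>. w \<zeta> * (\<zeta> / y) ^ N / (y - \<zeta>))"
      proof (subst I_add)
        show "continuous_on S (\<lambda>\<zeta>. \<Sum>k<N. (1 / y ^ Suc k) * (w \<zeta> * \<zeta> ^ k))"
          by (intro continuous_intros cw)
        show "continuous_on S (\<lambda>\<zeta>. w \<zeta> * (\<zeta> / y) ^ N / (y - \<zeta>))"
          by (intro continuous_intros cw) (use yS y0 in auto)
        show "I (\<lambda>\<zeta>. \<Sum>k<N. (1 / y ^ Suc k) * (w \<zeta> * \<zeta> ^ k)) + I (\<lambda>\<zeta>. w \<zeta> * (\<zeta> / y) ^ N / (y - \<zeta>)) =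
           (\<Sum>k<N. (1 / y ^ Suc k) * I (\<lambda>\<zeta>. w \<zeta> * \<zeta> ^ k)) + I (\<lambda>\<zeta>. w \<zeta> * (\<zeta> / y) ^ N / (y - \<zeta>))"
        proof -
          have "I (\<lambda>\<zeta>. \<Sum>k<N. (1 / y ^ Suc k) * (w \<zeta> * \<zeta> ^ k)) = (\<Sum>k<N. I (\<lambda>\<zeta>. (1 / y ^ Suc k) * (w \<zeta> * \<zeta> ^ k)))"
            by (rule I_sum) (intro finite_lessThan continuous_on_mult_left continuous_on_mult cw continuous_intros)+
          then show ?thesis unfolding I_cmult by simp
        qed
      qed
      also have "\<dots> = I (\<lambda>\<zeta>. w \<zeta> * (\<zeta> / y) ^ N / (y - \<zeta>))" by (simp add: mom)
      finally have eq: "?\<phi> y = I (\<lambda>\<zeta>. w \<zeta> * (\<zeta> / y) ^ N / (y - \<zeta>))" .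
      have "norm (?\<phi> y) \<le> (W * (B / norm y) ^ N / (norm y - B)) * mass" unfolding eq
      proof (rule I_bound)
        show "continuous_on S (\<lambda>\<zeta>. w \<zeta> * (\<zeta> / y) ^ N / (y - \<zeta>))"
          by (intro continuous_intros cw) (use yS y0 in auto)
        show "0 \<le> W * (B / norm y) ^ N / (norm y - B)" using W B y by simp
        fix \<zeta> assume s: "\<zeta> \<in> S"
        have "norm y - B \<le> norm (y - \<zeta>)" using B(2)[OF s] norm_triangle_ineq2[of y \<zeta>] by linarith
        moreover have "norm (\<zeta> / y) \<le> B / norm y" using B(2)[OF s] by (simp add: norm_divide divide_right_mono)
        ultimately show "norm (w \<zeta> * (\<zeta> / y) ^ N / (y - \<zeta>)) \<le> W * (B / norm y) ^ N / (norm y - B)"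
          unfolding norm_divide[of _ "y - \<zeta>"] norm_mult norm_power using W(1) W(2)[OF s] B(1) y
          by (intro frac_le mult_mono power_mono) auto
      qed
      then show ?thesis by (simp add: mult_ac)
    qed
    have "(\<lambda>N. (W / (norm y - B) * mass) * (B / norm y) ^ N) \<longlonglongrightarrow> (W / (norm y - B) * mass) * 0"
    proof (intro tendsto_intros LIMSEQ_power_zero)
      have "norm y > 0" using y B(1) by linarith
      then show "norm (B / norm y) < 1" using y B(1) by simp
    qed
    then have "norm (?\<phi> y) \<le> (W / (norm y - B) * mass) * 0"
      by (rule LIMSEQ_le_const) (use bound in auto)
    then show ?thesis by simp
  qed
  have phi0: "?\<phi> y = 0" if y: "y \<notin> E" for y
  proof -
    have con: "connected (- E)"
    proof -
      have "- E = {z. 1 < lev z}" using lev_gt_1 by auto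
      then show ?thesis using connected_lev_gt[of 1] by simp
    qed
    obtain B' where B': "B' > 0" "\<And>z. z \<in> E \<Longrightarrow> norm z \<le> B'"
      using compact_imp_bounded[OF compact_E] by (auto simp: bounded_pos)
    let ?U = "{z::complex. norm z > max B B'}"
    have oU: "open ?U" by (intro open_Collect_less continuous_intros)
    have UE: "?U \<subseteq> - E" using B' by force
    let ?p = "complex_of_real (max B B' + 1)"
    have "B < max B B' + 1 \<and> B' < max B B' + 1" by linarith
    then have p: "?p \<in> ?U" using B(1) by simp
    have lim: "?p islimpt ?U" by (rule interior_limit_point) (simp only: interior_open[OF oU] p)
    have pE: "?p \<in> - E" using UE p by (rule subsetD)
    have yE: "y \<in> - E" using y by simp
    have U0: "?\<phi> u = 0" if "u \<in> ?U" for u using that by (intro large) simp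
    show ?thesis
      by (rule analytic_continuation[OF cauchy_transform_hol[OF cw] open_Compl_E con UE pE lim U0 yE])
  qed
  obtain r where r: "1 < r" "ereal r < \<rho>"
    using \<rho> by (rule ereal_gt_1_real)
  obtain A where A: "\<And>w b. continuous_on S w \<Longrightarrow> b \<ge> 0 \<Longrightarrow> (\<And>z. lev z = r \<Longrightarrow> norm (I (\<lambda>\<zeta>. w \<zeta> / (z - \<zeta>))) \<le> b)
     \<Longrightarrow> norm (I (\<lambda>\<zeta>. u \<zeta> * w \<zeta>)) \<le> A * b"
    using contour_bound[OF r u] by metis
  have "norm (I (\<lambda>\<zeta>. u \<zeta> * w \<zeta>)) \<le> A * 0"
  proof (rule A[OF cw])
    fix z assume "lev z = r"
    then have "z \<notin> E" using r lev_E by force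
    then show "norm (?\<phi> z) \<le> 0" using phi0 by simp
  qed simp
  then have "I (\<lambda>\<zeta>. u \<zeta> * cnj (u \<zeta>)) = 0" by (simp add: w_def)
  then have uS: "u y = 0" if "y \<in> S" for y using I_norm_sq_zero[OF cu _ that] by simp
  \<comment> \<open>The zeros of u contain the infinite compact support, which has a limit point in
    itself.\<close>
  obtain x where x: "x \<in> S" "x islimpt S"
    using Heine_Borel_imp_Bolzano_Weierstrass[OF compact_S infinite_support order_refl] by blast
  have SD: "S \<subseteq> \<D> \<rho>" using support_subset E_subset_domain by blast
  show ?thesis
    by (rule analytic_continuation[OF u open_domain[OF \<rho>] connected_domain[OF \<rho>] SD subsetD[OF SD x(1)] x(2) uS z])
qed

lemma cf_ser:
  assumes d: "decays \<rho> G" and \<rho>: "1 < \<rho>"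
  shows "cf (ser G) n = cf G n"
proof -
  obtain r where r: "1 < r" "ereal r < \<rho>"
    using \<rho> by (rule ereal_gt_1_real)
  have ul: "uniform_limit {z. lev z \<le> r} (\<lambda>N z. \<Sum>n<N. cf G n * poly (op n) z) (ser G) sequentially"
    by (rule ser_uniform_limit[OF d r])
  have cs: "continuous_on S (ser G)" by (rule cont_on_S[OF ser_hol[OF d \<rho>]])
  obtain C where C: "C \<ge> 0" "\<And>f B. continuous_on S f \<Longrightarrow> (\<And>z. z \<in> S \<Longrightarrow> norm (f z) \<le> B) \<Longrightarrow> B \<ge> 0 \<Longrightarrow> norm (cf f n) \<le> C * B"
    using cf_sup_bound[where n = n] by metis
  have cfp: "cf (\<lambda>z. \<Sum>k<N. cf G k * poly (op k) z) n = cf G n" if "N > n" for N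
  proof -
    have "cf (\<lambda>z. \<Sum>k<N. cf G k * poly (op k) z) n = (\<Sum>k<N. cf (\<lambda>z. cf G k * poly (op k) z) n)"
      by (rule cf_sum) (auto intro!: continuous_intros)
    also have "\<dots> = (\<Sum>k<N. if k = n then cf G k else 0)"
      by (rule sum.cong) (auto simp: cf_cmult cf_op)
    also have "\<dots> = cf G n" using that by (subst sum.delta) auto
    finally show ?thesis .
  qed
  have "norm (cf (ser G) n - cf G n) \<le> 0"
  proof (rule field_le_epsilon)
    fix e :: real assume e: "e > 0"
    \<comment> \<open>\<open>C + 1\<close> instead of \<open>C\<close>, as \<open>C\<close> may be
      0.\<close>
    have e': "e / (C + 1) > 0" using e C by simp
    have "\<forall>\<^sub>F N in sequentially. N > n \<and> (\<forall>z\<in>{z. lev z \<le> r}. dist (\<Sum>n<N. cf G n * poly (op n) z) (ser G z) < e / (C + 1))"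
      using uniform_limitD[OF ul e'] eventually_gt_at_top[of n] by eventually_elim auto
    then obtain N where N: "N > n" "\<And>z. lev z \<le> r \<Longrightarrow> dist (\<Sum>n<N. cf G n * poly (op n) z) (ser G z) < e / (C + 1)"
      by (auto simp: eventually_sequentially)
    let ?p = "\<lambda>z. \<Sum>k<N. cf G k * poly (op k) z"
    have "cf (\<lambda>z. ser G z - ?p z) n = cf (ser G) n - cf G n"
      by (subst cf_diff[OF cs]) (auto intro!: continuous_intros simp: cfp[OF N(1)])
    moreover have "norm (cf (\<lambda>z. ser G z - ?p z) n) \<le> C * (e / (C + 1))"
    proof (rule C(2))
      show "continuous_on S (\<lambda>z. ser G z - ?p z)" by (intro continuous_intros cs)
      fix z assume "z \<in> S"
      then have "lev z \<le> r" using lev_S r by simp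
      then show "norm (ser G z - ?p z) \<le> e / (C + 1)" using N(2)[of z] by (simp add: dist_norm norm_minus_commute)
    qed (use e' in simp)
    moreover have "C * (e / (C + 1)) \<le> e" using e C(1) by (simp add: field_simps)
    ultimately show "norm (cf (ser G) n - cf G n) \<le> 0 + e" by simp
  qed
  then show ?thesis by simp
qed

text \<open>h and its series are holomorphic with the same coefficients, and a holomorphic function
  on a canonical domain with vanishing coefficients is 0.\<close>

lemma ser_eq:
  assumes h: "h holomorphic_on \<D> \<rho>" and \<rho>: "1 < \<rho>" and z: "z \<in> \<D> \<rho>"
  shows "ser h z = h z"
proof -
  have d: "decays \<rho> h" by (rule hol_decays[OF h])
  have s: "ser h holomorphic_on \<D> \<rho>" by (rule ser_hol[OF d \<rho>])
  have "(\<lambda>z. ser h z - h z) z = 0"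
  proof (rule hol_cf_zero_imp_zero[OF _ \<rho> _ z])
    show "(\<lambda>z. ser h z - h z) holomorphic_on \<D> \<rho>" by (intro holomorphic_intros s h)
    show "cf (\<lambda>z. ser h z - h z) n = 0" for n
      by (subst cf_diff) (simp_all add: cont_on_S[OF s] cont_on_S[OF h] cf_ser[OF d \<rho>])
  qed
  then show ?thesis by simp
qed

lemma cf_germ: "same_germ E f g \<Longrightarrow> cf f n = cf g n"
  by (rule cf_cong) (use same_germ_on_E support_subset in blast)

lemma ser_germ: "same_germ E f g \<Longrightarrow> ser f = ser g"
  unfolding ser_def using cf_germ[of f g] by simp

lemma decays_germ: "same_germ E f g \<Longrightarrow> decays \<rho> f \<longleftrightarrow> decays \<rho> g"
  unfolding decays_def using cf_germ[of f g] by simp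

lemma hol_eq_on_same_germ:
  assumes "f holomorphic_on \<D> \<rho>" "g holomorphic_on \<D> \<rho>'" "same_germ E f g" "1 < \<rho>" "1 < \<rho>'" "z \<in> \<D> \<rho>" "z \<in> \<D> \<rho>'"
  shows "f z = g z"
  using ser_eq[OF assms(1,4,6)] ser_eq[OF assms(2,5,7)] ser_germ[OF assms(3)] by simp

text \<open>Replaces the existential continuation in \<open>hol_ext\<close> by the concrete function
  \<open>ser G\<close>.\<close>

lemma hol_ext_ser:
  assumes "hol_ext E \<rho> G" "1 < \<rho>"
  shows "ser G holomorphic_on \<D> \<rho>" "same_germ E (ser G) G" "decays \<rho> G"
proof -
  obtain h where h: "h holomorphic_on \<D> \<rho>" "same_germ E h G" using assms(1) by (auto simp: hol_ext_def)
  show d: "decays \<rho> G" using hol_decays[OF h(1)] decays_germ[OF h(2)] by simp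
  show "ser G holomorphic_on \<D> \<rho>" by (rule ser_hol[OF d assms(2)])
  have "same_germ E (ser G) h"
    unfolding same_germ_def ser_germ[OF h(2), symmetric]
    using open_domain[OF assms(2)] E_subset_domain ser_eq[OF h(1) assms(2)] by (intro exI[of _ "\<D> \<rho>"]) simp
  then show "same_germ E (ser G) G" using h(2) by (rule same_germ_trans)
qed

text \<open>The analogue of the Cauchy-Hadamard formula. The continuation to some \<rho>0 ties the
  series to G: decay alone concerns the values on the support, while \<open>hol_ext\<close> speaks
  of a neighbourhood of \<open>E\<close>.\<close>

lemma hol_ext_iff_decays:
  assumes "hol_ext E \<rho>0 G" "1 < \<rho>0" "1 < \<rho>"
  shows "hol_ext E \<rho> G \<longleftrightarrow> decays \<rho> G"
  using assms hol_ext_ser ser_hol[of \<rho> G] unfolding hol_ext_def by metis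

lemma analytic_hol_ext:
  assumes "G analytic_on E"
  obtains r where "1 < r" "hol_ext E (ereal r) G"
proof -
  obtain V where V: "open V" "E \<subseteq> V" "G holomorphic_on V"
    using assms unfolding analytic_on_holomorphic by blast
  have "{z. lev z \<le> 1} = E" using lev_gt_1 by (auto simp: lev_E not_le[symmetric])
  then obtain r where r: "1 < r" "{z. lev z < r} \<subseteq> V"
    using neighbourhood_contains_domain[OF V(1), of 1] V(2) by auto
  have "\<D> (ereal r) = {z. lev z < r}" using domain_eq[of "ereal r"] r(1) by simp
  then have "G holomorphic_on \<D> (ereal r)" using V(3) r(2) holomorphic_on_subset by metis
  then have "hol_ext E (ereal r) G" unfolding hol_ext_def using same_germ_refl by blast
  then show thesis using that r(1) by blast
qed

text \<open>Expand G in the p_\<nu>; each [q p_\<nu>]_k is at most B by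
  \<open>cf_mult_op_bound\<close>. The bound is uniform in k and depends on q only through its
  maximum on the support, so it applies to q varying with n.\<close>

lemma cf_poly_mult_bound:
  assumes G: "hol_ext E \<rho> G" "1 < \<rho>" and q: "\<And>z. z \<in> S \<Longrightarrow> norm (poly q z) \<le> B" "B \<ge> 0"
  shows "summable (\<lambda>\<nu>. norm (cf G \<nu>))" "norm (cf (\<lambda>z. poly q z * G z) k) \<le> B * (\<Sum>\<nu>. norm (cf G \<nu>))"
proof -
  obtain r where r: "1 < r" "ereal r < \<rho>"
    using G(2) by (rule ereal_gt_1_real)
  have d: "decays \<rho> G" by (rule hol_ext_ser[OF G])
  obtain C where C: "C \<ge> 0" "\<And>n. norm (cf G n) \<le> C * (1 / r) ^ n" using decaysD[OF d r] by blast
  show sm: "summable (\<lambda>\<nu>. norm (cf G \<nu>))"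
    by (rule summable_comparison_test'[where g = "\<lambda>n. C * (1 / r) ^ n" and N = 0])
       (use C r in \<open>auto intro!: summable_mult summable_geometric\<close>)
  have cf_eq: "cf (\<lambda>z. poly q z * G z) k = cf (\<lambda>z. poly q z * ser G z) k"
    by (rule cf_cong) (use same_germ_on_E[OF hol_ext_ser(2)[OF G]] support_subset in auto)
  have cs: "continuous_on S (ser G)" by (rule cont_on_S[OF hol_ext_ser(1)[OF G]])
  have ul: "uniform_limit {z. lev z \<le> r} (\<lambda>N z. \<Sum>n<N. cf G n * poly (op n) z) (ser G) sequentially"
    by (rule ser_uniform_limit[OF d r])
  obtain C where C: "C \<ge> 0" "\<And>f B. continuous_on S f \<Longrightarrow> (\<And>z. z \<in> S \<Longrightarrow> norm (f z) \<le> B) \<Longrightarrow> B \<ge> 0 \<Longrightarrow> norm (cf f k) \<le> C * B"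
    using cf_sup_bound[where n = k] by metis
  show "norm (cf (\<lambda>z. poly q z * G z) k) \<le> B * (\<Sum>\<nu>. norm (cf G \<nu>))"
  proof (rule field_le_epsilon)
    fix e :: real assume e: "e > 0"
    define \<epsilon> where "\<epsilon> = e / ((C + 1) * (B + 1))"
    have e': "\<epsilon> > 0" using e C(1) q(2) by (simp add: \<epsilon>_def)
    from uniform_limitD[OF ul e'] obtain N where N: "\<And>z. lev z \<le> r \<Longrightarrow> dist (\<Sum>n<N. cf G n * poly (op n) z) (ser G z) < \<epsilon>"
      by (auto simp: eventually_sequentially)
    let ?p = "\<lambda>z. \<Sum>\<nu><N. cf G \<nu> * poly (op \<nu>) z"
    have 1: "norm (cf (\<lambda>z. poly q z * (ser G z - ?p z)) k) \<le> C * (B * \<epsilon>)"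
    proof (rule C(2))
      show "continuous_on S (\<lambda>z. poly q z * (ser G z - ?p z))" by (intro continuous_intros cs)
      fix z assume z: "z \<in> S"
      then have "lev z \<le> r" using lev_S r by simp
      then have "norm (ser G z - ?p z) \<le> \<epsilon>" using N[of z] by (simp add: dist_norm norm_minus_commute)
      then show "norm (poly q z * (ser G z - ?p z)) \<le> B * \<epsilon>"
        unfolding norm_mult using q(1)[OF z] q(2) by (intro mult_mono) auto
    qed (use e' q in simp)
    have 2: "norm (cf (\<lambda>z. poly q z * ?p z) k) \<le> B * (\<Sum>\<nu>. norm (cf G \<nu>))"
    proof -
      have "cf (\<lambda>z. poly q z * ?p z) k = cf (\<lambda>z. \<Sum>\<nu><N. cf G \<nu> * (poly q z * poly (op \<nu>) z)) k"
        by (rule cf_cong) (simp add: sum_distrib_left mult_ac)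
      also have "\<dots> = (\<Sum>\<nu><N. cf G \<nu> * cf (\<lambda>z. poly q z * poly (op \<nu>) z) k)"
        by (subst cf_sum) (auto intro!: continuous_intros simp: cf_cmult)
      also have "norm \<dots> \<le> (\<Sum>\<nu><N. norm (cf G \<nu>) * B)"
        by (rule sum_norm_le) (auto simp: norm_mult intro!: mult_left_mono cf_mult_op_bound continuous_intros q)
      also have "\<dots> = B * (\<Sum>\<nu><N. norm (cf G \<nu>))" by (simp add: sum_distrib_left mult.commute)
      also have "\<dots> \<le> B * (\<Sum>\<nu>. norm (cf G \<nu>))" using q(2) sm by (intro mult_left_mono sum_le_suminf) auto
      finally show ?thesis .
    qed
    have "cf (\<lambda>z. poly q z * G z) k = cf (\<lambda>z. poly q z * (ser G z - ?p z) + poly q z * ?p z) k"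
      unfolding cf_eq by (rule cf_cong) (simp add: algebra_simps)
    also have "\<dots> = cf (\<lambda>z. poly q z * (ser G z - ?p z)) k + cf (\<lambda>z. poly q z * ?p z) k"
      by (rule cf_add) (intro continuous_intros cs)+
    finally have "norm (cf (\<lambda>z. poly q z * G z) k) \<le> norm (cf (\<lambda>z. poly q z * (ser G z - ?p z)) k) + norm (cf (\<lambda>z. poly q z * ?p z) k)"
      by (simp only: norm_triangle_ineq)
    then have "norm (cf (\<lambda>z. poly q z * G z) k) \<le> C * (B * \<epsilon>) + B * (\<Sum>\<nu>. norm (cf G \<nu>))"
      using 1 2 by linarith
    moreover have "C * (B * \<epsilon>) \<le> e"
    proof -
      have "C * (B * \<epsilon>) \<le> (C + 1) * ((B + 1) * \<epsilon>)" using C(1) q(2) e' by (intro mult_mono) auto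
      also have "\<dots> = e" using C(1) q(2) by (simp add: \<epsilon>_def)
      finally show ?thesis .
    qed
    ultimately show "norm (cf (\<lambda>z. poly q z * G z) k) \<le> B * (\<Sum>\<nu>. norm (cf G \<nu>)) + e" by simp
  qed
qed

end

section \<open>Hermite interpolation and dimension counts\<close>

text \<open>The i-th Taylor coefficient of q at \<xi>, read off from q(x + \<xi>).\<close>

definition jet :: "complex poly \<Rightarrow> complex \<Rightarrow> nat \<Rightarrow> complex" where
  "jet q \<xi> i = coeff (pcompose q [:\<xi>, 1:]) i"

lemma poly_altdef_le:
  fixes p :: "'a :: comm_semiring_1 poly"
  shows "degree p \<le> N \<Longrightarrow> poly p x = (\<Sum>i\<le>N. coeff p i * x ^ i)"
  unfolding poly_altdef by (rule sum.mono_neutral_left) (auto simp: coeff_eq_0)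

lemma poly_jet:
  assumes "degree q \<le> N"
  shows "poly q z = (\<Sum>i\<le>N. jet q \<xi> i * (z - \<xi>) ^ i)"
proof -
  have "poly q z = poly (pcompose q [:\<xi>, 1:]) (z - \<xi>)" by (simp add: poly_pcompose)
  also have "\<dots> = (\<Sum>i\<le>N. jet q \<xi> i * (z - \<xi>) ^ i)"
    unfolding jet_def by (rule poly_altdef_le) (use assms in \<open>simp add: degree_pcompose\<close>)
  finally show ?thesis .
qed

lemma jet_expand:
  assumes "degree q \<le> N"
  shows "q = (\<Sum>i\<le>N. smult (jet q \<xi> i) ([:- \<xi>, 1:] ^ i))"
proof -
  have "poly q = poly (\<Sum>i\<le>N. smult (jet q \<xi> i) ([:- \<xi>, 1:] ^ i))"
    by (rule ext) (simp add: poly_jet[OF assms, of _ \<xi>] poly_sum)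
  then show ?thesis by (simp only: poly_eq_poly_eq_iff)
qed

lemma jet_eq_0: "degree q < i \<Longrightarrow> jet q \<xi> i = 0"
  unfolding jet_def by (rule coeff_eq_0) (simp add: degree_pcompose)

lemma jet_diff: "jet (p - q) \<xi> i = jet p \<xi> i - jet q \<xi> i"
  by (simp add: jet_def pcompose_diff)

lemma jet_vanish:
  assumes "[:- \<xi>, 1:] ^ \<tau> dvd q" "i < \<tau>"
  shows "jet q \<xi> i = 0"
proof -
  obtain s where s: "q = [:- \<xi>, 1:] ^ \<tau> * s" using assms(1) by blast
  have "pcompose ([:- \<xi>, 1:] ^ \<tau>) [:\<xi>, 1:] = monom 1 \<tau>"
    unfolding poly_eq_poly_eq_iff[symmetric] by (rule ext) (simp add: poly_pcompose poly_monom)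
  then show ?thesis using assms(2) by (simp add: jet_def s pcompose_mult coeff_monom_mult)
qed

section \<open>The coefficient norm\<close>

lemma coeff_norm_eq: "degree p \<le> N \<Longrightarrow> coeff_norm p = (\<Sum>k\<le>N. norm (coeff p k))"
  unfolding coeff_norm_def by (rule sum.mono_neutral_left) (auto simp: coeff_eq_0)

lemma coeff_norm_nonneg: "0 \<le> coeff_norm p"
  by (simp add: coeff_norm_def sum_nonneg)

lemma coeff_le_coeff_norm: "norm (coeff p k) \<le> coeff_norm p"
proof (cases "k \<le> degree p")
  case True then show ?thesis unfolding coeff_norm_def by (intro member_le_sum) auto
qed (simp add: coeff_eq_0 coeff_norm_nonneg)

lemma coeff_norm_eq_0: "coeff_norm p = 0 \<longleftrightarrow> p = 0"
proof
  assume "coeff_norm p = 0"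
  then have "coeff p k = 0" for k using coeff_le_coeff_norm[of p k] by simp
  then show "p = 0" by (simp add: poly_eq_iff)
qed (simp add: coeff_norm_def)

lemma coeff_norm_triangle: "coeff_norm (p + q) \<le> coeff_norm p + coeff_norm q"
proof -
  let ?N = "max (degree p) (degree q)"
  have "coeff_norm (p + q) = (\<Sum>k\<le>?N. norm (coeff p k + coeff q k))"
    unfolding coeff_norm_eq[of "p + q" ?N, OF degree_add_le_max] coeff_add ..
  also have "\<dots> \<le> (\<Sum>k\<le>?N. norm (coeff p k)) + (\<Sum>k\<le>?N. norm (coeff q k))"
    unfolding sum.distrib[symmetric] by (intro sum_mono norm_triangle_ineq)
  also have "\<dots> = coeff_norm p + coeff_norm q"
    by (simp only: coeff_norm_eq[of p ?N, OF max.cobounded1] coeff_norm_eq[of q ?N, OF max.cobounded2])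
  finally show ?thesis .
qed

lemma coeff_norm_smult: "coeff_norm (smult c p) = norm c * coeff_norm p"
  unfolding coeff_norm_eq[of "smult c p" "degree p", OF degree_smult_le] coeff_norm_def[of p]
  by (simp add: norm_mult sum_distrib_left)

lemma coeff_norm_sum: "coeff_norm (\<Sum>i\<in>A. f i) \<le> (\<Sum>i\<in>A. coeff_norm (f i))"
proof (induction A rule: infinite_finite_induct)
  case (insert x A)
  have "coeff_norm (\<Sum>i\<in>insert x A. f i) \<le> coeff_norm (f x) + coeff_norm (\<Sum>i\<in>A. f i)"
    unfolding sum.insert[OF insert(1,2)] by (rule coeff_norm_triangle)
  also have "\<dots> \<le> coeff_norm (f x) + (\<Sum>i\<in>A. coeff_norm (f i))" using insert(3) by simp
  also have "\<dots> = (\<Sum>i\<in>insert x A. coeff_norm (f i))" unfolding sum.insert[OF insert(1,2)] ..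
  finally show ?case .
qed (simp_all add: coeff_norm_def)

lemma coeff_norm_minus_commute: "coeff_norm (p - q) = coeff_norm (q - p)"
  using coeff_norm_smult[of "-1" "p - q"] by simp

lemma poly_norm_le_coeff_norm:
  assumes "degree p \<le> N" "norm z \<le> B" "1 \<le> B"
  shows "norm (poly p z) \<le> B ^ N * coeff_norm p"
proof -
  have "norm (poly p z) \<le> (\<Sum>k\<le>N. norm (coeff p k) * B ^ N)"
    unfolding poly_altdef_le[OF assms(1)]
  proof (rule sum_norm_le)
    fix k assume k: "k \<in> {..N}"
    have "norm z ^ k \<le> B ^ k" using assms by (intro power_mono) auto
    also have "\<dots> \<le> B ^ N" using assms k by (intro power_increasing) auto
    finally show "norm (coeff p k * z ^ k) \<le> norm (coeff p k) * B ^ N"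
      by (simp add: norm_mult norm_power mult_left_mono)
  qed
  also have "\<dots> = B ^ N * coeff_norm p"
    by (simp add: coeff_norm_eq[OF assms(1)] sum_distrib_left mult.commute)
  finally show ?thesis .
qed

text \<open>The Bezout identity itself is recorded, because it provides the idempotents of the
  interpolation formula.\<close>

definition comaximal :: "complex poly \<Rightarrow> complex poly \<Rightarrow> bool" where
  "comaximal a b \<longleftrightarrow> (\<exists>u v. u * a + v * b = 1)"

lemma comaximal_commute: "comaximal a b \<Longrightarrow> comaximal b a"
  unfolding comaximal_def by (metis add.commute)

lemma comaximal_mult:
  assumes "comaximal a b" "comaximal a c"
  shows "comaximal a (b * c)"
proof -
  obtain u v u' v' where 1: "u * a + v * b = 1" "u' * a + v' * c = 1"
    using assms by (auto simp: comaximal_def)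
  have "(u * a * u' + u * v' * c + v * b * u') * a + (v * v') * (b * c) = (u * a + v * b) * (u' * a + v' * c)"
    by (simp add: algebra_simps)
  then show ?thesis unfolding comaximal_def 1 by auto
qed

lemma comaximal_one: "comaximal a 1"
  unfolding comaximal_def by (rule exI[of _ 0]) auto

lemma comaximal_power: "comaximal a b \<Longrightarrow> comaximal a (b ^ n)"
  by (induction n) (simp_all add: comaximal_one comaximal_mult)

lemma comaximal_prod:
  assumes "\<And>x. x \<in> X \<Longrightarrow> comaximal a (f x)"
  shows "comaximal a (prod f X)"
  using assms by (induction X rule: infinite_finite_induct) (simp_all add: comaximal_one comaximal_mult)

lemma comaximal_dvd:
  assumes "comaximal a b" "a dvd D" "b dvd D"
  shows "a * b dvd D"
proof -
  obtain u v where 1: "u * a + v * b = 1" using assms(1) by (auto simp: comaximal_def)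
  have "D = u * (a * D) + v * (D * b)" using arg_cong[OF 1, of "\<lambda>x. x * D"] by (simp add: algebra_simps)
  moreover have "a * b dvd a * D" "a * b dvd D * b" using assms(2,3) by (simp_all add: mult_dvd_mono)
  ultimately show ?thesis by (metis dvd_add dvd_mult)
qed

lemma comaximal_linear:
  assumes "(x::complex) \<noteq> y"
  shows "comaximal [:- x, 1:] [:- y, 1:]"
proof -
  define c where "c = 1 / (y - x)"
  have "[:c:] * [:- x, 1:] + [:- c:] * [:- y, 1:] = [:c * (y - x):]" by (simp add: algebra_simps)
  also have "c * (y - x) = 1" using assms by (simp add: c_def)
  finally show ?thesis unfolding comaximal_def one_pCons by blast
qed

lemma comaximal_linear_power:
  assumes "(x::complex) \<noteq> y"
  shows "comaximal ([:- x, 1:] ^ m) ([:- y, 1:] ^ n)"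
  using comaximal_linear[OF assms] by (intro comaximal_power) (metis comaximal_commute comaximal_power)

lemma prod_dvd_of_pairwise_comaximal:
  assumes "finite X" "\<And>x. x \<in> X \<Longrightarrow> f x dvd D" "\<And>x y. x \<noteq> y \<Longrightarrow> comaximal (f x) (f y)"
  shows "prod f X dvd D"
  using assms(1,2)
proof (induction X rule: finite_induct)
  case (insert x X)
  have "comaximal (f x) (prod f X)"
  proof (rule comaximal_prod)
    fix y assume "y \<in> X"
    then have "x \<noteq> y" using insert(2) by blast
    then show "comaximal (f x) (f y)" by (rule assms(3))
  qed
  moreover have "prod f X dvd D" using insert by simp
  ultimately have "f x * prod f X dvd D" using insert.prems by (intro comaximal_dvd) simp_all
  then show ?case unfolding prod.insert[OF insert(1,2)] .
qed simp

lemma degree_root_prod: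
  "finite X \<Longrightarrow> degree (\<Prod>x\<in>X. [:- x, 1:] ^ \<tau> x :: complex poly) = (\<Sum>x\<in>X. \<tau> x)"
  by (subst degree_prod_eq_sum_degree) (auto simp: degree_power_eq)

text \<open>The Chinese remainder theorem gives e_x congruent to 1 modulo (z - x)^\<tau>(x) and to 0
  modulo the other factors of L. So q and the sum of jet(q, x, i) e_x (z - x)^i are congruent modulo
  L. After reduction modulo L both have degree below that of L and are equal.\<close>

lemma hermite_interpolation_bound:
  fixes X :: "complex set" and \<tau> :: "complex \<Rightarrow> nat"
  assumes fin: "finite X"
  shows "\<exists>C\<ge>0. \<forall>q. degree q < (\<Sum>x\<in>X. \<tau> x) \<longrightarrow>
     coeff_norm q \<le> C * (\<Sum>x\<in>X. \<Sum>i<\<tau> x. norm (jet q x i))"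
proof -
  let ?f = "\<lambda>x. [:- x, 1:] ^ \<tau> x :: complex poly"
  define L where "L = (\<Prod>x\<in>X. ?f x)"
  have dL: "degree L = (\<Sum>x\<in>X. \<tau> x)" unfolding L_def by (rule degree_root_prod[OF fin])
  have cop: "comaximal (?f x) (?f y)" if "x \<noteq> y" for x y
    using that by (rule comaximal_linear_power)
  have "\<exists>e. ?f x dvd 1 - e \<and> (\<forall>y\<in>X - {x}. ?f y dvd e)" for x
  proof -
    let ?A = "\<Prod>y\<in>X - {x}. ?f y"
    have "comaximal (?f x) ?A" by (rule comaximal_prod) (rule cop, blast)
    then obtain u v where uv: "u * ?f x + v * ?A = 1" by (auto simp: comaximal_def)
    have "1 - v * ?A = u * ?f x" unfolding uv[symmetric] by simp
    then have "?f x dvd 1 - v * ?A" by simp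
    moreover have "?f y dvd v * ?A" if "y \<in> X - {x}" for y
      by (intro dvd_mult dvd_prodI) (use fin that in auto)
    ultimately show ?thesis by blast
  qed
  then obtain e where e: "\<And>x. ?f x dvd 1 - e x" "\<And>x y. y \<in> X - {x} \<Longrightarrow> ?f y dvd e x" by metis
  \<comment> \<open>The basis dual to the Taylor coefficients in question; its norms, summed, are
    the constant \<open>C\<close>.\<close>
  define B where "B x i = (e x * [:- x, 1:] ^ i) mod L" for x i
  define C where "C = (\<Sum>x\<in>X. \<Sum>i<\<tau> x. coeff_norm (B x i))"
  have C0: "C \<ge> 0" unfolding C_def by (intro sum_nonneg coeff_norm_nonneg)
  have "coeff_norm q \<le> C * (\<Sum>x\<in>X. \<Sum>i<\<tau> x. norm (jet q x i))" if q: "degree q < (\<Sum>x\<in>X. \<tau> x)" for q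
  proof -
    define r where "r x = (\<Sum>i<\<tau> x. smult (jet q x i) ([:- x, 1:] ^ i))" for x
    define s where "s = (\<Sum>x\<in>X. \<Sum>i<\<tau> x. smult (jet q x i) (B x i))"
    have qr: "?f x dvd q - r x" for x
    proof -
      let ?g = "\<lambda>i. smult (jet q x i) ([:- x, 1:] ^ i)"
      let ?N = "max (degree q) (\<tau> x)"
      have "q = (\<Sum>i\<le>?N. ?g i)" by (rule jet_expand) simp
      also have "\<dots> = (\<Sum>i\<in>{..<\<tau> x} \<union> {\<tau> x..?N}. ?g i)" by (rule sum.cong) auto
      also have "\<dots> = r x + (\<Sum>i\<in>{\<tau> x..?N}. ?g i)" unfolding r_def by (rule sum.union_disjoint) auto
      finally have "q - r x = (\<Sum>i\<in>{\<tau> x..?N}. ?g i)" by (simp add: algebra_simps)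
      also have "?f x dvd \<dots>" by (intro dvd_sum dvd_smult le_imp_power_dvd) auto
      finally show ?thesis .
    qed
    have 1: "L dvd q - (\<Sum>x\<in>X. e x * r x)"
      unfolding L_def
      proof (rule prod_dvd_of_pairwise_comaximal[OF fin _ cop])
      fix y assume y: "y \<in> X"
      have "q - (\<Sum>x\<in>X. e x * r x) = (q - r y) + (1 - e y) * r y - (\<Sum>x\<in>X - {y}. e x * r x)"
        by (simp add: sum.remove[OF fin y] algebra_simps)
      also have "?f y dvd \<dots>"
        by (intro dvd_diff dvd_add dvd_sum dvd_mult2 qr e) (use y in auto)
      finally show "?f y dvd q - (\<Sum>x\<in>X. e x * r x)" .
    qed
    have "(\<Sum>x\<in>X. e x * r x) - s = (\<Sum>x\<in>X. \<Sum>i<\<tau> x. smult (jet q x i) (e x * [:- x, 1:] ^ i - B x i))"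
      by (simp add: r_def s_def sum_distrib_left sum_subtractf smult_diff_right)
    also have "L dvd \<dots>"
      unfolding B_def by (intro dvd_sum dvd_smult) (simp add: minus_mod_eq_mult_div)
    finally have "L dvd (q - (\<Sum>x\<in>X. e x * r x)) + ((\<Sum>x\<in>X. e x * r x) - s)" using 1 by (rule dvd_add[rotated])
    then have Ld: "L dvd q - s" by simp
    have L0: "L \<noteq> 0" using q dL by auto
    have "degree s < degree L"
    proof -
      have dB: "degree (B x i) < degree L" for x i
        using degree_mod_less[OF L0, of "e x * [:- x, 1:] ^ i"] q dL by (auto simp: B_def)
      have "degree s \<le> degree L - 1"
        unfolding s_def
      proof (intro degree_sum_le fin finite_lessThan)
        fix x i
        have "degree (smult (jet q x i) (B x i)) \<le> degree (B x i)" by (rule degree_smult_le)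
        then show "degree (smult (jet q x i) (B x i)) \<le> degree L - 1" using dB[of x i] by simp
      qed
      then show ?thesis using q dL by linarith
    qed
    then have "degree (q - s) < degree L" using q dL by (intro degree_diff_less) auto
    then have "q = s" using Ld by (metis dvd_imp_degree_le eq_iff_diff_eq_0 not_le)
    then have "coeff_norm q \<le> (\<Sum>x\<in>X. coeff_norm (\<Sum>i<\<tau> x. smult (jet q x i) (B x i)))"
      unfolding s_def using coeff_norm_sum by metis
    also have "\<dots> \<le> (\<Sum>x\<in>X. \<Sum>i<\<tau> x. norm (jet q x i) * coeff_norm (B x i))"
      using coeff_norm_sum by (intro sum_mono order_trans[OF coeff_norm_sum]) (simp add: coeff_norm_smult)
    also have "\<dots> \<le> (\<Sum>x\<in>X. \<Sum>i<\<tau> x. norm (jet q x i) * C)"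
    proof (intro sum_mono mult_left_mono)
      fix x i assume x: "x \<in> X" and i: "i \<in> {..<\<tau> x}"
      have "coeff_norm (B x i) \<le> (\<Sum>i<\<tau> x. coeff_norm (B x i))"
        by (rule member_le_sum) (use i in \<open>auto simp: coeff_norm_nonneg\<close>)
      also have "\<dots> \<le> C" unfolding C_def
        by (rule member_le_sum[OF x _ fin]) (auto intro: sum_nonneg coeff_norm_nonneg)
      finally show "coeff_norm (B x i) \<le> C" .
    qed auto
    also have "\<dots> = C * (\<Sum>x\<in>X. \<Sum>i<\<tau> x. norm (jet q x i))"
      by (simp add: sum_distrib_left mult.commute)
    finally show ?thesis .
  qed
  then show ?thesis using C0 by blast
qed

section \<open>Dimension count along descending chains\<close>

interpretation poly_space: vector_space "smult :: complex \<Rightarrow> complex poly \<Rightarrow> complex poly"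
  by unfold_locales (auto simp: smult_add_right smult_add_left)

text \<open>Degree less than M, in a form that contains the zero polynomial for M = 0 as
  well.\<close>

definition below :: "nat \<Rightarrow> complex poly set" where
  "below M = {p. \<forall>i\<ge>M. coeff p i = 0}"

lemma below_degree: "p \<in> below M \<Longrightarrow> M > 0 \<Longrightarrow> degree p < M"
  unfolding below_def by (metis (mono_tags, lifting) degree_0 leading_coeff_0_iff mem_Collect_eq not_less)

lemma independent_monoms: "poly_space.independent ((\<lambda>i. monom 1 i :: complex poly) ` {..<M})"
proof
  let ?S = "(\<lambda>i. monom 1 i :: complex poly) ` {..<M}"
  assume "poly_space.dependent ?S"
  then obtain u where u: "\<exists>v\<in>?S. u v \<noteq> 0" "(\<Sum>v\<in>?S. smult (u v) v) = 0"
    by (subst (asm) poly_space.dependent_finite) auto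
  have inj: "inj_on (\<lambda>i. monom 1 i :: complex poly) {..<M}" by (auto simp: inj_on_def monom_eq_iff')
  have s: "(\<Sum>i<M. smult (u (monom 1 i)) (monom 1 i)) = 0" using u(2) by (simp add: sum.reindex[OF inj])
  have "u (monom 1 j) = 0" if "j < M" for j
  proof -
    have "0 = coeff (\<Sum>i<M. smult (u (monom 1 i)) (monom 1 i)) j" by (simp add: s)
    also have "\<dots> = (\<Sum>i<M. if i = j then u (monom 1 i) else 0)"
      unfolding coeff_sum by (rule sum.cong) auto
    also have "\<dots> = u (monom 1 j)" using that by (subst sum.delta) auto
    finally show ?thesis by simp
  qed
  then show False using u(1) by auto
qed

text \<open>Codimension at most one is expressed through pairs: some nontrivial combination of any
  two elements lies in the next set. Going up from \<open>W N = {0}\<close>, a strict step costs one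
  new spanning vector and an equality none.\<close>

lemma chain_spanning_set:
  fixes W :: "nat \<Rightarrow> complex poly set"
  assumes codim: "\<And>k a b. k < N \<Longrightarrow> a \<in> W k \<Longrightarrow> b \<in> W k \<Longrightarrow>
      \<exists>\<alpha> \<beta>. (\<alpha> \<noteq> 0 \<or> \<beta> \<noteq> 0) \<and> smult \<alpha> a + smult \<beta> b \<in> W (Suc k)"
    and scale: "\<And>k a c. k \<le> N \<Longrightarrow> a \<in> W k \<Longrightarrow> smult c a \<in> W k"
    and end0: "W N = {0}" and j: "j \<le> N"
  shows "\<exists>B. finite B \<and> card B \<le> card {k \<in> {N - j..<N}. \<not> W k \<subseteq> W (Suc k)} \<and> W (N - j) \<subseteq> poly_space.span B"
  using j
proof (induction j)
  case 0
  then show ?case using end0 by (intro exI[of _ "{}"]) auto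
next
  case (Suc j)
  define k where "k = N - Suc j"
  have k: "k < N" "Suc k = N - j" using Suc.prems by (auto simp: k_def)
  obtain B where B: "finite B" "card B \<le> card {i \<in> {N - j..<N}. \<not> W i \<subseteq> W (Suc i)}" "W (Suc k) \<subseteq> poly_space.span B"
    using Suc k by auto
  have set_eq: "{N - Suc j..<N} = insert k {N - j..<N}" using k Suc.prems by (auto simp: k_def)
  show ?case
  proof (cases "W k \<subseteq> W (Suc k)")
    case True
    then have "{i \<in> {N - Suc j..<N}. \<not> W i \<subseteq> W (Suc i)} = {i \<in> {N - j..<N}. \<not> W i \<subseteq> W (Suc i)}"
      unfolding set_eq by auto
    then show ?thesis using B True k_def by (intro exI[of _ B]) auto
  next
    case False
    then obtain a where a: "a \<in> W k" "a \<notin> W (Suc k)" by blast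
    have card: "card {i \<in> {N - Suc j..<N}. \<not> W i \<subseteq> W (Suc i)} = Suc (card {i \<in> {N - j..<N}. \<not> W i \<subseteq> W (Suc i)})"
    proof -
      have "{i \<in> {N - Suc j..<N}. \<not> W i \<subseteq> W (Suc i)} = insert k {i \<in> {N - j..<N}. \<not> W i \<subseteq> W (Suc i)}"
        unfolding set_eq using False by auto
      moreover have "k \<notin> {i \<in> {N - j..<N}. \<not> W i \<subseteq> W (Suc i)}" using k by auto
      ultimately show ?thesis by simp
    qed
    have "W k \<subseteq> poly_space.span (insert a B)"
    proof
      fix b assume b: "b \<in> W k"
      obtain \<alpha> \<beta> where ab: "\<alpha> \<noteq> 0 \<or> \<beta> \<noteq> 0" "smult \<alpha> a + smult \<beta> b \<in> W (Suc k)"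
        using codim[OF k(1) a(1) b] by blast
      \<comment> \<open>Otherwise a multiple of a, and after rescaling a itself, would lie in
        \<open>W (Suc k)\<close>.\<close>
      have "\<beta> \<noteq> 0"
      proof
        assume "\<beta> = 0"
        then have "smult \<alpha> a \<in> W (Suc k)" "\<alpha> \<noteq> 0" using ab by auto
        have "Suc k \<le> N" using k(1) by simp
        from scale[OF this \<open>smult \<alpha> a \<in> W (Suc k)\<close>]
        have "smult (1 / \<alpha>) (smult \<alpha> a) \<in> W (Suc k)" .
        then show False using a(2) \<open>\<alpha> \<noteq> 0\<close> by simp
      qed
      have "smult \<alpha> a + smult \<beta> b \<in> poly_space.span (insert a B)"
        using ab(2) B(3) poly_space.span_mono[of B "insert a B"] by blast
      moreover have "smult \<alpha> a \<in> poly_space.span (insert a B)"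
        by (intro poly_space.span_scale poly_space.span_base) simp
      ultimately have "(smult \<alpha> a + smult \<beta> b) - smult \<alpha> a \<in> poly_space.span (insert a B)"
        by (rule poly_space.span_diff)
      then have "smult \<beta> b \<in> poly_space.span (insert a B)" by simp
      from poly_space.span_scale[OF this, of "1 / \<beta>"]
      show "b \<in> poly_space.span (insert a B)" using \<open>\<beta> \<noteq> 0\<close> by simp
    qed
    moreover have "card (insert a B) \<le> Suc (card B)" by (rule card_insert_le_m1[THEN order_trans]) (auto simp: B)
    ultimately show ?thesis using B card k_def by (intro exI[of _ "insert a B"]) auto
  qed
qed

text \<open>\<open>W 0\<close> contains M independent monomials, so a spanning set needs M vectors;
  it has at most one for each strict step, and there are at most N \<le> M steps.\<close>

lemma chain_strict:
  fixes W :: "nat \<Rightarrow> complex poly set"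
  assumes codim: "\<And>k a b. k < N \<Longrightarrow> a \<in> W k \<Longrightarrow> b \<in> W k \<Longrightarrow>
      \<exists>\<alpha> \<beta>. (\<alpha> \<noteq> 0 \<or> \<beta> \<noteq> 0) \<and> smult \<alpha> a + smult \<beta> b \<in> W (Suc k)"
    and scale: "\<And>k a c. k \<le> N \<Longrightarrow> a \<in> W k \<Longrightarrow> smult c a \<in> W k"
    and end0: "W N = {0}" and start: "W 0 = below M" and "N \<le> M"
  shows "N = M" "\<And>k. k < N \<Longrightarrow> \<not> W k \<subseteq> W (Suc k)"
proof -
  let ?K = "{k \<in> {0..<N}. \<not> W k \<subseteq> W (Suc k)}"
  obtain B where B: "finite B" "card B \<le> card ?K" "W 0 \<subseteq> poly_space.span B"
    using chain_spanning_set[of N W N, OF codim scale end0] by auto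
  let ?S = "(\<lambda>i. monom 1 i :: complex poly) ` {..<M}"
  have "?S \<subseteq> W 0" unfolding start below_def by auto
  then have "?S \<subseteq> poly_space.span B" using B(3) by blast
  then have "card ?S \<le> card B"
    using poly_space.independent_span_bound[OF B(1) independent_monoms] by blast
  moreover have "card ?S = M" by (subst card_image) (auto simp: inj_on_def monom_eq_iff')
  ultimately have M: "M \<le> card ?K" using B(2) by simp
  have "card ?K \<le> card {0..<N}" by (rule card_mono) auto
  then show "N = M" using M \<open>N \<le> M\<close> by simp
  then have "card ?K = card {0..<N}" using M \<open>card ?K \<le> card {0..<N}\<close> by simp
  then have "?K = {0..<N}" by (intro card_subset_eq) auto
  then show "\<not> W k \<subseteq> W (Suc k)" if "k < N" for k using that by auto
qed

text \<open>If 0 were the only solution, the solution sets of the first k conditions would form a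
  chain from \<open>below M\<close> to {0} with \<open>card J\<close> < M steps of codimension at
  most one.\<close>

lemma underdetermined_system:
  fixes l :: "'a \<Rightarrow> complex poly \<Rightarrow> complex"
  assumes J: "finite J" "card J < M"
    and lin: "\<And>j p q. j \<in> J \<Longrightarrow> l j (p + q) = l j p + l j q" "\<And>j c p. j \<in> J \<Longrightarrow> l j (smult c p) = c * l j p"
  shows "\<exists>q\<in>below M. q \<noteq> 0 \<and> (\<forall>j\<in>J. l j q = 0)"
proof (rule ccontr)
  assume neg: "\<not> ?thesis"
  obtain e where e: "bij_betw e {0..<card J} J" using J ex_bij_betw_nat_finite by blast
  define W where "W k = {q \<in> below M. \<forall>i<k. l (e i) q = 0}" for k
  have eJ: "e i \<in> J" if "i < card J" for i using e that by (auto simp: bij_betw_def)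
  have l0: "l j 0 = 0" if "j \<in> J" for j using lin(2)[OF that, of 0 0] by simp
  have "card J = M"
  proof (rule chain_strict(1)[of "card J" W])
    fix k a b assume k: "k < card J" and a: "a \<in> W k" and b: "b \<in> W k"
    let ?l = "l (e k)"
    obtain \<alpha> \<beta> where ab: "\<alpha> \<noteq> 0 \<or> \<beta> \<noteq> 0" "\<alpha> * ?l a + \<beta> * ?l b = 0"
    proof (cases "?l a = 0")
      case True then show ?thesis using that[of 1 0] by simp
    next
      case False then show ?thesis using that[of "- ?l b / ?l a" 1] by simp
    qed
    have "l (e i) (smult \<alpha> a + smult \<beta> b) = 0" if "i < Suc k" for i
      using that a b ab(2) k eJ by (cases "i = k") (auto simp: W_def lin)
    moreover have "smult \<alpha> a + smult \<beta> b \<in> below M" using a b by (auto simp: W_def below_def)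
    ultimately show "\<exists>\<alpha> \<beta>. (\<alpha> \<noteq> 0 \<or> \<beta> \<noteq> 0) \<and> smult \<alpha> a + smult \<beta> b \<in> W (Suc k)"
      using ab(1) unfolding W_def by blast
  next
    fix k a c assume "k \<le> card J" "a \<in> W k"
    then show "smult c a \<in> W k" using eJ by (auto simp: W_def lin below_def)
  next
    have "q = 0" if "q \<in> W (card J)" for q
    proof (rule ccontr)
      assume "q \<noteq> 0"
      moreover have "q \<in> below M" "\<And>i. i < card J \<Longrightarrow> l (e i) q = 0" using that by (auto simp: W_def)
      moreover have "\<exists>i<card J. j = e i" if "j \<in> J" for j
      proof -
        have "j \<in> e ` {0..<card J}" using that bij_betw_imp_surj_on[OF e] by simp
        then show ?thesis by auto
      qed
      ultimately show False using neg by metis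
    qed
    moreover have "0 \<in> W (card J)" using eJ l0 by (auto simp: W_def below_def)
    ultimately show "W (card J) = {0}" by blast
  qed (use J in \<open>auto simp: W_def\<close>)
  then show False using J by simp
qed

section \<open>Removal of linear factors and polar parts\<close>

text \<open>Repeated splitting h = h(\<xi>) + (z - \<xi>) h1 with h1 again holomorphic on D. The
  first constant is the coefficient of the highest power, hence the last clause.\<close>

lemma holomorphic_pole_expansion:
  assumes D: "open D" "\<xi> \<in> D" and h: "h holomorphic_on D"
  shows "\<exists>a H. H holomorphic_on D \<and> (\<forall>z\<in>D - {\<xi>}. h z / (z - \<xi>) ^ k = H z + (\<Sum>j=1..k. a j / (z - \<xi>) ^ j)) \<and>
     (1 \<le> k \<longrightarrow> a k = h \<xi>)"
  using h
proof (induction k arbitrary: h)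
  case 0
  then show ?case by (intro exI[of _ "\<lambda>_. 0"] exI[of _ h]) simp
next
  case (Suc k)
  define h1 where "h1 = (\<lambda>z. if z = \<xi> then deriv h \<xi> else (h z - h \<xi>) / (z - \<xi>))"
  have "h1 holomorphic_on D"
    unfolding h1_def by (rule pole_lemma[OF Suc.prems]) (use D in \<open>simp add: interior_open\<close>)
  from Suc.IH[OF this] obtain a H where aH: "H holomorphic_on D"
    "\<And>z. z \<in> D - {\<xi>} \<Longrightarrow> h1 z / (z - \<xi>) ^ k = H z + (\<Sum>j=1..k. a j / (z - \<xi>) ^ j)"
    by blast
  have "h z / (z - \<xi>) ^ Suc k = H z + (\<Sum>j=1..Suc k. (a(Suc k := h \<xi>)) j / (z - \<xi>) ^ j)" if z: "z \<in> D - {\<xi>}" for z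
  proof -
    have nz: "z - \<xi> \<noteq> 0" using z by simp
    have "h z = h \<xi> + (z - \<xi>) * h1 z" using nz by (simp add: h1_def)
    then have "h z / (z - \<xi>) ^ Suc k = h \<xi> / (z - \<xi>) ^ Suc k + h1 z / (z - \<xi>) ^ k"
      using nz by (simp add: add_divide_distrib)
    also have "\<dots> = H z + ((\<Sum>j=1..k. a j / (z - \<xi>) ^ j) + h \<xi> / (z - \<xi>) ^ Suc k)"
      unfolding aH(2)[OF z] by (simp add: algebra_simps)
    also have "(\<Sum>j=1..k. a j / (z - \<xi>) ^ j) = (\<Sum>j=1..k. (a(Suc k := h \<xi>)) j / (z - \<xi>) ^ j)"
      by (rule sum.cong) auto
    finally show ?thesis by simp
  qed
  then show ?case using aH(1) by (intro exI[of _ "a(Suc k := h \<xi>)"] exI[of _ H]) simp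
qed

section \<open>Operations on germs that continue\<close>

lemma hol_extI: "h holomorphic_on canonical_domain E \<rho> \<Longrightarrow> same_germ E h G \<Longrightarrow> hol_ext E \<rho> G"
  unfolding hol_ext_def by blast

lemma hol_ext_mono: "hol_ext E \<rho> G \<Longrightarrow> \<rho>' \<le> \<rho> \<Longrightarrow> hol_ext E \<rho>' G"
proof -
  assume "hol_ext E \<rho> G" and le: "\<rho>' \<le> \<rho>"
  then obtain h where h: "h holomorphic_on canonical_domain E \<rho>" "same_germ E h G" by (auto simp: hol_ext_def)
  have "canonical_domain E \<rho>' \<subseteq> canonical_domain E \<rho>" using le by (auto simp: canonical_domain_def)
  then show ?thesis by (rule hol_extI[OF holomorphic_on_subset[OF h(1)] h(2)])
qed

lemma hol_ext_germ: "hol_ext E \<rho> G \<Longrightarrow> same_germ E G G' \<Longrightarrow> hol_ext E \<rho> G'"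
  unfolding hol_ext_def using same_germ_trans by blast

lemma hol_ext_add: "hol_ext E \<rho> f \<Longrightarrow> hol_ext E \<rho> g \<Longrightarrow> hol_ext E \<rho> (\<lambda>z. f z + g z)"
proof -
  assume "hol_ext E \<rho> f" "hol_ext E \<rho> g"
  then obtain h k where "h holomorphic_on canonical_domain E \<rho>" "same_germ E h f" "k holomorphic_on canonical_domain E \<rho>" "same_germ E k g"
    by (auto simp: hol_ext_def)
  then show ?thesis
    by (intro hol_extI[of "\<lambda>z. h z + k z"] holomorphic_on_add same_germ_compose2[where F = "\<lambda>z a b. a + b"])
qed

lemma hol_ext_mult_hol:
  assumes "hol_ext E \<rho> f" "k holomorphic_on canonical_domain E \<rho>"
  shows "hol_ext E \<rho> (\<lambda>z. k z * f z)"
proof -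
  obtain h where "h holomorphic_on canonical_domain E \<rho>" "same_germ E h f"
    using assms by (auto simp: hol_ext_def)
  then show ?thesis using assms(2)
    by (intro hol_extI[of "\<lambda>z. k z * h z"] holomorphic_on_mult same_germ_compose2[where F = "\<lambda>z a b. a * b"] same_germ_refl)
qed

lemma hol_ext_poly_mult: "hol_ext E \<rho> f \<Longrightarrow> hol_ext E \<rho> (\<lambda>z. poly q z * f z)"
  by (rule hol_ext_mult_hol) (auto intro!: holomorphic_intros)

lemma hol_ext_cmult: "hol_ext E \<rho> f \<Longrightarrow> hol_ext E \<rho> (\<lambda>z. c * f z)"
  by (rule hol_ext_mult_hol) (auto intro!: holomorphic_intros)

lemma hol_ext_zero: "hol_ext E \<rho> (\<lambda>z. 0)"
  by (rule hol_extI[of "\<lambda>z. 0"]) (auto intro!: holomorphic_intros same_germ_refl)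


context regular_measure
begin

lemma cont_S_hol_ext: "hol_ext E \<rho> G \<Longrightarrow> continuous_on S G"
proof -
  assume "hol_ext E \<rho> G"
  then obtain h where h: "h holomorphic_on \<D> \<rho>" "same_germ E h G" by (auto simp: hol_ext_def)
  show ?thesis
    by (rule continuous_on_eq[OF cont_on_S[OF h(1)]]) (use same_germ_on_E[OF h(2)] support_subset in blast)
qed

lemma cont_S_I: "continuous_on S G \<Longrightarrow> continuous_on S (\<lambda>z. poly q z * G z)"
  by (intro continuous_intros)

text \<open>For a zero inside a domain where G is known to continue: there the quotient is that
  continuation, elsewhere it is h / (z - a), and the two agree on the overlap.\<close>

lemma hol_ext_divide:
  assumes h: "hol_ext E R (\<lambda>z. (z - a) * G z)" and g: "hol_ext E \<rho> G" and a: "a \<in> \<D> \<rho>" and gt: "1 < R" "1 < \<rho>"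
  shows "hol_ext E R G"
proof -
  obtain h where h: "h holomorphic_on \<D> R" "same_germ E h (\<lambda>z. (z - a) * G z)" using h by (auto simp: hol_ext_def)
  obtain g where g: "g holomorphic_on \<D> \<rho>" "same_germ E g G" using g by (auto simp: hol_ext_def)
  have sg: "same_germ E h (\<lambda>z. (z - a) * g z)"
    using h(2) same_germ_compose2[OF same_germ_refl[of E "\<lambda>_. 0"] same_germ_sym[OF g(2)], of "\<lambda>z x y. (z - a) * y"]
    by (rule same_germ_trans)
  have gh: "(\<lambda>z. (z - a) * g z) holomorphic_on \<D> \<rho>" by (intro holomorphic_intros g)
  have eq: "h z = (z - a) * g z" if "z \<in> \<D> R" "z \<in> \<D> \<rho>" for z
    using hol_eq_on_same_germ[OF h(1) gh sg gt that] .
  define k where "k = (\<lambda>z. if z \<in> \<D> \<rho> then g z else h z / (z - a))"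
  have k1: "k holomorphic_on \<D> \<rho>"
    by (rule holomorphic_transform[OF g(1)]) (simp add: k_def)
  have "(\<lambda>z. h z / (z - a)) holomorphic_on (\<D> R - {a})"
    by (intro holomorphic_intros holomorphic_on_subset[OF h(1)]) auto
  then have k2: "k holomorphic_on (\<D> R - {a})"
    by (rule holomorphic_transform) (auto simp: k_def eq)
  have "k holomorphic_on (\<D> \<rho> \<union> (\<D> R - {a}))"
    by (rule holomorphic_on_Un[OF k1 k2]) (auto intro: open_domain gt open_delete)
  then have "k holomorphic_on \<D> R" by (rule holomorphic_on_subset) (use a in auto)
  moreover have "same_germ E k g"
    unfolding same_germ_def using open_domain[OF gt(2)] E_subset_domain by (intro exI[of _ "\<D> \<rho>"]) (simp add: k_def)
  ultimately show ?thesis using g(2) same_germ_trans hol_extI by blast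
qed

text \<open>For a zero outside \<open>E\<close>, about which nothing is known of G: the singularity
  at a is removable exactly because the continued product vanishes there. If a is outside the domain
  of index R, no condition arises.\<close>

lemma hol_ext_divide_zero:
  assumes h: "hol_ext E R (\<lambda>z. (z - a) * G z)" and a: "a \<notin> E" and gt: "1 < R"
    and z: "a \<in> \<D> R \<Longrightarrow> ser (\<lambda>z. (z - a) * G z) a = 0"
  shows "hol_ext E R G"
proof -
  define h' where "h' = ser (\<lambda>z. (z - a) * G z)"
  have h': "h' holomorphic_on \<D> R" "same_germ E h' (\<lambda>z. (z - a) * G z)"
    using hol_ext_ser[OF h gt] by (simp_all add: h'_def)
  define k where "k = (\<lambda>z. if z = a then deriv h' a else (h' z - 0) / (z - a))"
  have hk: "k holomorphic_on \<D> R"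
  proof (cases "a \<in> \<D> R")
    case True
    then have "h' a = 0" using z by (simp add: h'_def)
    moreover have "(\<lambda>z. if z = a then deriv h' a else (h' z - h' a) / (z - a)) holomorphic_on \<D> R"
      using pole_lemma[OF h'(1), of a] True open_domain[OF gt] by (simp add: interior_open)
    ultimately show ?thesis unfolding k_def by (simp only:)
  next
    case False
    have "(\<lambda>z. (h' z - 0) / (z - a)) holomorphic_on \<D> R"
      by (intro holomorphic_intros h') (use False in auto)
    then show ?thesis by (rule holomorphic_transform) (use False in \<open>auto simp: k_def\<close>)
  qed
  obtain V where V: "open V" "E \<subseteq> V" "\<And>z. z \<in> V \<Longrightarrow> h' z = (z - a) * G z"
    using h'(2) unfolding same_germ_def by blast
  have "same_germ E k G" unfolding same_germ_def
  proof (intro exI conjI ballI)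
    show "open (V - {a})" using V by auto
    show "E \<subseteq> V - {a}" using V a by auto
    show "k z = G z" if "z \<in> V - {a}" for z using that V by (auto simp: k_def)
  qed
  then show ?thesis using hk hol_extI by blast
qed

lemma hol_ext_divide_poly:
  assumes h: "hol_ext E R (\<lambda>z. (\<Prod>a\<leftarrow>xs. z - a) * G z)" and g: "hol_ext E \<rho> G"
    and xs: "\<And>a. a \<in> set xs \<Longrightarrow> a \<in> \<D> \<rho>" and gt: "1 < R" "1 < \<rho>"
  shows "hol_ext E R G"
  using h xs
proof (induction xs)
  case (Cons a xs)
  have "(\<lambda>z. (\<Prod>a\<leftarrow>xs. z - a)) holomorphic_on A" for A
    by (induction xs) (auto intro!: holomorphic_intros)
  then have "hol_ext E \<rho> (\<lambda>z. (\<Prod>a\<leftarrow>xs. z - a) * G z)" by (intro hol_ext_mult_hol g)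
  moreover have "hol_ext E R (\<lambda>z. (z - a) * ((\<Prod>a\<leftarrow>xs. z - a) * G z))"
    using Cons.prems(1) by (simp add: mult.assoc)
  ultimately have "hol_ext E R (\<lambda>z. (\<Prod>a\<leftarrow>xs. z - a) * G z)"
    using hol_ext_divide[of R a] Cons.prems(2) gt by simp
  then show ?case using Cons by simp
qed simp

lemma not_in_domain_level: "\<xi> \<notin> E \<Longrightarrow> z \<in> \<D> \<rho> \<Longrightarrow> \<rho> \<le> ereal (norm (\<Phi> \<xi>)) \<Longrightarrow> z \<noteq> \<xi>"
  unfolding canonical_domain_def by auto

lemma hol_ext_pole:
  assumes "\<xi> \<notin> E" "\<rho> \<le> ereal (norm (\<Phi> \<xi>))"
  shows "hol_ext E \<rho> (\<lambda>z. 1 / (z - \<xi>) ^ l)"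
  by (rule hol_extI[OF _ same_germ_refl]) (use not_in_domain_level[OF assms(1) _ assms(2)] in \<open>auto intro!: holomorphic_intros\<close>)

lemma cf_pole_bound:
  assumes \<xi>: "\<xi> \<notin> E" and r: "1 < r" "r < norm (\<Phi> \<xi>)"
  shows "\<exists>C\<ge>0. \<forall>n. norm (cf (\<lambda>z. 1 / (z - \<xi>) ^ l) n) \<le> C * (1 / r) ^ n"
proof -
  have "1 < ereal (norm (\<Phi> \<xi>))" using r by simp
  then have "decays (ereal (norm (\<Phi> \<xi>))) (\<lambda>z. 1 / (z - \<xi>) ^ l)"
    using hol_ext_ser(3)[OF hol_ext_pole[OF \<xi> order_refl]] by blast
  then show ?thesis using decaysD r by simp
qed

lemma cf_simple_pole: "\<xi> \<notin> E \<Longrightarrow> cf (\<lambda>z. 1 / (z - \<xi>) ^ 1) n = - second_type \<mu> n \<xi>"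
proof -
  assume \<xi>: "\<xi> \<notin> E"
  have "cf (\<lambda>z. 1 / (z - \<xi>) ^ 1) n = I (\<lambda>z. (-1) * (cnj (poly (op n) z) / (\<xi> - z)))"
    unfolding cf_I
  proof (rule I_cong)
    fix z assume "z \<in> S"
    then have "z - \<xi> \<noteq> 0" "\<xi> - z \<noteq> 0" using \<xi> support_subset by auto
    then show "1 / (z - \<xi>) ^ 1 * cnj (poly (op n) z) = (-1) * (cnj (poly (op n) z) / (\<xi> - z))"
      by (simp add: divide_simps) (simp add: algebra_simps)
  qed
  then show ?thesis by (simp only: I_cmult second_type_I) simp
qed

text \<open>Dividing the Taylor expansion of q at \<xi> by (z - \<xi>)^l leaves negative powers and
  a polynomial of degree at most M < n, whose n-th coefficient is 0.\<close>

lemma cf_poly_over_pole: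
  assumes \<xi>: "\<xi> \<notin> E" and q: "degree q \<le> M" "M < n"
  shows "cf (\<lambda>z. poly q z * (1 / (z - \<xi>) ^ l)) n = (\<Sum>i<l. jet q \<xi> i * cf (\<lambda>z. 1 / (z - \<xi>) ^ (l - i)) n)"
proof -
  define p where "p = (\<Sum>i\<in>{l..M}. smult (jet q \<xi> i) ([:- \<xi>, 1:] ^ (i - l)))"
  have nz: "z - \<xi> \<noteq> 0" if "z \<in> S" for z using that \<xi> support_subset by auto
  have dp: "degree p < n"
  proof -
    have "degree p \<le> M" unfolding p_def
    proof (rule degree_sum_le)
      fix i assume "i \<in> {l..M}"
      then have "i - l \<le> M" by auto
      then have "degree ([:- \<xi>, 1:] ^ (i - l)) \<le> M" by (simp add: degree_power_eq)
      then show "degree (smult (jet q \<xi> i) ([:- \<xi>, 1:] ^ (i - l))) \<le> M"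
        using degree_smult_le order_trans by blast
    qed simp
    then show ?thesis using q by simp
  qed
  let ?N = "max M l"
  have "cf (\<lambda>z. poly q z * (1 / (z - \<xi>) ^ l)) n
     = cf (\<lambda>z. (\<Sum>i<l. jet q \<xi> i * (1 / (z - \<xi>) ^ (l - i))) + poly p z) n"
  proof (rule cf_cong)
    fix z assume z: "z \<in> S"
    have "poly q z = (\<Sum>i\<le>M. jet q \<xi> i * (z - \<xi>) ^ i)" by (rule poly_jet[OF q(1)])
    also have "\<dots> = (\<Sum>i\<in>{..<l} \<union> {l..M}. jet q \<xi> i * (z - \<xi>) ^ i)"
      by (rule sum.mono_neutral_left) (auto intro!: jet_eq_0 order_le_less_trans[OF q(1)] simp: not_le)
    also have "\<dots> = (\<Sum>i<l. jet q \<xi> i * (z - \<xi>) ^ i) + (\<Sum>i\<in>{l..M}. jet q \<xi> i * (z - \<xi>) ^ i)"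
      by (rule sum.union_disjoint) auto
    finally have "poly q z * (1 / (z - \<xi>) ^ l) =
        (\<Sum>i<l. jet q \<xi> i * (z - \<xi>) ^ i * (1 / (z - \<xi>) ^ l)) + (\<Sum>i\<in>{l..M}. jet q \<xi> i * (z - \<xi>) ^ i * (1 / (z - \<xi>) ^ l))"
      by (simp only: distrib_right sum_distrib_right)
    also have "(\<Sum>i<l. jet q \<xi> i * (z - \<xi>) ^ i * (1 / (z - \<xi>) ^ l)) = (\<Sum>i<l. jet q \<xi> i * (1 / (z - \<xi>) ^ (l - i)))"
    proof (rule sum.cong)
      fix i assume i: "i \<in> {..<l}"
      then have "(z - \<xi>) ^ l = (z - \<xi>) ^ i * (z - \<xi>) ^ (l - i)" by (simp flip: power_add)
      then show "jet q \<xi> i * (z - \<xi>) ^ i * (1 / (z - \<xi>) ^ l) = jet q \<xi> i * (1 / (z - \<xi>) ^ (l - i))"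
        using nz[OF z] by simp
    qed simp
    also have "(\<Sum>i\<in>{l..M}. jet q \<xi> i * (z - \<xi>) ^ i * (1 / (z - \<xi>) ^ l)) = poly p z"
      unfolding p_def poly_sum
    proof (rule sum.cong)
      fix i assume i: "i \<in> {l..M}"
      then have "(z - \<xi>) ^ i = (z - \<xi>) ^ l * (z - \<xi>) ^ (i - l)" by (simp flip: power_add)
      then show "jet q \<xi> i * (z - \<xi>) ^ i * (1 / (z - \<xi>) ^ l) = poly (smult (jet q \<xi> i) ([:- \<xi>, 1:] ^ (i - l))) z"
        using nz[OF z] by simp
    qed simp
    finally show "poly q z * (1 / (z - \<xi>) ^ l) = (\<Sum>i<l. jet q \<xi> i * (1 / (z - \<xi>) ^ (l - i))) + poly p z" .
  qed
  also have "\<dots> = (\<Sum>i<l. jet q \<xi> i * cf (\<lambda>z. 1 / (z - \<xi>) ^ (l - i)) n) + cf (poly p) n"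
  proof (subst cf_add)
    have c: "continuous_on S (\<lambda>z. 1 / (z - \<xi>) ^ j)" for j
      by (rule cont_S_hol_ext[OF hol_ext_pole[OF \<xi> order_refl]])
    show "continuous_on S (\<lambda>z. \<Sum>i<l. jet q \<xi> i * (1 / (z - \<xi>) ^ (l - i)))"
      by (intro continuous_on_sum continuous_on_mult_left c)
    show "continuous_on S (poly p)" by (intro continuous_intros)
    show "cf (\<lambda>z. \<Sum>i<l. jet q \<xi> i * (1 / (z - \<xi>) ^ (l - i))) n + cf (poly p) n =
       (\<Sum>i<l. jet q \<xi> i * cf (\<lambda>z. 1 / (z - \<xi>) ^ (l - i)) n) + cf (poly p) n"
      by (subst cf_sum) (auto intro!: continuous_on_mult_left c simp only: cf_cmult finite_lessThan)
  qed
  also have "cf (poly p) n = 0" by (rule cf_low[OF dp])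
  finally show ?thesis by simp
qed

lemma cf_poly_mult_sum:
  assumes "continuous_on S G" "degree q \<le> N"
  shows "cf (\<lambda>z. poly q z * G z) n = (\<Sum>j\<le>N. coeff q j * cf (\<lambda>z. z ^ j * G z) n)"
proof -
  have "cf (\<lambda>z. poly q z * G z) n = cf (\<lambda>z. \<Sum>j\<le>N. coeff q j * (z ^ j * G z)) n"
    by (rule cf_cong) (simp add: poly_altdef_le[OF assms(2)] sum_distrib_right mult.assoc)
  also have "\<dots> = (\<Sum>j\<le>N. cf (\<lambda>z. coeff q j * (z ^ j * G z)) n)"
    by (rule cf_sum) (auto intro!: continuous_intros assms(1))
  finally show ?thesis by (simp only: cf_cmult)
qed

text \<open>The constant serves all q of degree at most N, since only the functions z^j H with j
  \<le> N have to be estimated.\<close>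

lemma cf_poly_mult_decay:
  assumes H: "hol_ext E \<rho> H" and r: "1 < r" "ereal r < \<rho>"
  shows "\<exists>C\<ge>0. \<forall>n q. degree q \<le> N \<longrightarrow> norm (cf (\<lambda>z. poly q z * H z) n) \<le> C * (1 / r) ^ n * coeff_norm q"
proof -
  have \<rho>: "1 < \<rho>" using ereal_gt_1[OF r] .
  have "\<exists>C\<ge>0. \<forall>n. norm (cf (\<lambda>z. z ^ j * H z) n) \<le> C * (1 / r) ^ n" for j
  proof -
    have "hol_ext E \<rho> (\<lambda>z. z ^ j * H z)" by (rule hol_ext_mult_hol[OF H]) (intro holomorphic_intros)
    then show ?thesis using decaysD[OF hol_ext_ser(3) r] \<rho> by blast
  qed
  then obtain C where C: "\<And>j. C j \<ge> 0" "\<And>j n. norm (cf (\<lambda>z. z ^ j * H z) n) \<le> C j * (1 / r) ^ n" by metis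
  let ?C = "\<Sum>j\<le>N. C j"
  have "norm (cf (\<lambda>z. poly q z * H z) n) \<le> ?C * (1 / r) ^ n * coeff_norm q" if q: "degree q \<le> N" for q n
  proof -
    have "norm (cf (\<lambda>z. poly q z * H z) n) \<le> (\<Sum>j\<le>N. norm (coeff q j) * (C j * (1 / r) ^ n))"
      unfolding cf_poly_mult_sum[OF cont_S_hol_ext[OF H] q]
      by (rule sum_norm_le) (auto simp: norm_mult intro!: mult_left_mono C)
    also have "\<dots> \<le> (\<Sum>j\<le>N. coeff_norm q * (C j * (1 / r) ^ n))"
      using C(1) r by (intro sum_mono mult_right_mono coeff_le_coeff_norm) auto
    also have "\<dots> = ?C * (1 / r) ^ n * coeff_norm q"
      by (simp add: sum_distrib_left sum_distrib_right mult_ac)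
    finally show ?thesis .
  qed
  moreover have "?C \<ge> 0" by (intro sum_nonneg C)
  ultimately show ?thesis by blast
qed

end

lemma pole_factorization:
  fixes g :: "complex \<Rightarrow> complex"
  assumes "g holomorphic_on U - {z}" "open U" "z \<in> U" "is_pole g z"
  shows "\<exists>e>0. \<exists>k. cball z e \<subseteq> U \<and> k holomorphic_on cball z e \<and> k z \<noteq> 0 \<and>
     (\<forall>w\<in>cball z e - {z}. g w = k w / (w - z) ^ pole_order g z)"
  using zorder_exist_pole[OF assms] unfolding pole_order_def by blast

context regular_measure
begin

text \<open>For \<xi> in the domain of index \<rho> and outside \<open>E\<close>: the germ continues
  to this domain with a single singularity, a pole at \<xi> of exact order t. In this form poles are
  handled by holomorphic continuations and their values.\<close>

definition pole_ext :: "ereal \<Rightarrow> complex \<Rightarrow> nat \<Rightarrow> (complex \<Rightarrow> complex) \<Rightarrow> bool" where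
  "pole_ext \<rho> \<xi> t G \<longleftrightarrow> hol_ext E \<rho> (\<lambda>z. (z - \<xi>) ^ t * G z) \<and> ser (\<lambda>z. (z - \<xi>) ^ t * G z) \<xi> \<noteq> 0"

lemma pole_ext_mono: "pole_ext \<rho> \<xi> t G \<Longrightarrow> \<rho>' \<le> \<rho> \<Longrightarrow> pole_ext \<rho>' \<xi> t G"
  unfolding pole_ext_def using hol_ext_mono by blast

lemma lev_pole: "\<xi> \<notin> E \<Longrightarrow> ereal (norm (\<Phi> \<xi>)) < \<rho> \<Longrightarrow> \<xi> \<in> \<D> \<rho> \<and> 1 < \<rho>"
proof
  assume \<xi>: "\<xi> \<notin> E" and \<rho>: "ereal (norm (\<Phi> \<xi>)) < \<rho>"
  then show "\<xi> \<in> \<D> \<rho>" by (simp add: canonical_domain_def)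
  show "1 < \<rho>" using Phi_gt_1[OF \<xi>] \<rho> by (rule ereal_gt_1)
qed

lemma pole_ext_extension:
  assumes h: "h holomorphic_on \<D> \<rho>" and t: "1 \<le> t" and \<xi>: "\<xi> \<in> \<D> \<rho>" "h \<xi> \<noteq> 0" and \<rho>: "1 < \<rho>"
  shows "(\<lambda>z. h z / (z - \<xi>) ^ t) holomorphic_on (\<D> \<rho> - {\<xi>})" "is_pole (\<lambda>z. h z / (z - \<xi>) ^ t) \<xi>"
    "pole_order (\<lambda>z. h z / (z - \<xi>) ^ t) \<xi> = t"
proof -
  show "(\<lambda>z. h z / (z - \<xi>) ^ t) holomorphic_on (\<D> \<rho> - {\<xi>})"
    by (intro holomorphic_intros holomorphic_on_subset[OF h]) auto
  have op: "open (\<D> \<rho>)" by (rule open_domain[OF \<rho>])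
  have c: "isCont h \<xi>"
    using holomorphic_on_imp_continuous_on[OF h] op \<xi> by (simp add: continuous_on_eq_continuous_at)
  show "is_pole (\<lambda>z. h z / (z - \<xi>) ^ t) \<xi>"
  proof (rule is_pole_divide[OF c _ \<xi>(2)])
    show "filterlim (\<lambda>z. (z - \<xi>) ^ t) (at 0) (at \<xi>)"
    proof (rule filterlim_atI)
      have "((\<lambda>z. (z - \<xi>) ^ t) \<longlongrightarrow> (\<xi> - \<xi>) ^ t) (at \<xi>)" by (intro tendsto_intros)
      then show "((\<lambda>z. (z - \<xi>) ^ t) \<longlongrightarrow> 0) (at \<xi>)" using t by (simp add: zero_power)
      show "\<forall>\<^sub>F z in at \<xi>. (z - \<xi>) ^ t \<noteq> 0"
        by (rule eventually_mono[OF eventually_neq_at_within[of \<xi>]]) simp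
    qed
  qed
  have "zorder (\<lambda>z. h z / (z - \<xi>) ^ t) \<xi> = - int t"
    by (rule zorder_eqI[OF op \<xi>(1) h \<xi>(2)]) (simp add: power_int_minus divide_inverse)
  then show "pole_order (\<lambda>z. h z / (z - \<xi>) ^ t) \<xi> = t" by (simp add: pole_order_def)
qed

lemma pole_ext_germ_quotient:
  assumes "pole_ext \<rho> \<xi> t G" and \<xi>: "\<xi> \<notin> E" and \<rho>: "1 < \<rho>"
  shows "same_germ E (\<lambda>z. ser (\<lambda>z. (z - \<xi>) ^ t * G z) z / (z - \<xi>) ^ t) G"
proof -
  have "same_germ E (ser (\<lambda>z. (z - \<xi>) ^ t * G z)) (\<lambda>z. (z - \<xi>) ^ t * G z)"
    using hol_ext_ser(2)[OF _ \<rho>] assms(1) by (simp add: pole_ext_def)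
  then obtain V where V: "open V" "E \<subseteq> V" "\<And>z. z \<in> V \<Longrightarrow> ser (\<lambda>z. (z - \<xi>) ^ t * G z) z = (z - \<xi>) ^ t * G z"
    unfolding same_germ_def by blast
  show ?thesis unfolding same_germ_def
  proof (intro exI conjI ballI)
    show "open (V - {\<xi>})" using V by (simp add: open_delete)
    show "E \<subseteq> V - {\<xi>}" using V \<xi> by blast
    fix z assume "z \<in> V - {\<xi>}"
    then show "ser (\<lambda>z. (z - \<xi>) ^ t * G z) z / (z - \<xi>) ^ t = G z" using V(3)[of z] by simp
  qed
qed

text \<open>By compactness the neighbourhood of the closed domain contains a canonical domain of
  some index r > |\<Phi>(\<xi>)|. There (z - \<xi>)^t g has a removable singularity, filled with the
  value of the factor k.\<close>

lemma pole_combinations_iff: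
  assumes \<xi>: "\<xi> \<notin> E" and t: "1 \<le> t"
  shows "G \<in> pole_combinations E d F m \<xi> t \<longleftrightarrow>
     G \<in> poly_combinations d F m \<and> (\<exists>r > norm (\<Phi> \<xi>). pole_ext (ereal r) \<xi> t G)"
proof (intro iffI conjI)
  assume G: "G \<in> pole_combinations E d F m \<xi> t"
  then show "G \<in> poly_combinations d F m" by (simp add: pole_combinations_def)
  obtain g U where g: "same_germ E g G" "open U" "{z. lev z \<le> norm (\<Phi> \<xi>)} \<subseteq> U"
      "g holomorphic_on (U - {\<xi>})" "is_pole g \<xi>" "pole_order g \<xi> = t"
    using G closure_domain[OF \<xi>] by (auto simp: pole_combinations_def)
  obtain r where r: "norm (\<Phi> \<xi>) < r" "{z. lev z < r} \<subseteq> U"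
    using neighbourhood_contains_domain[OF g(2,3)] by blast
  have \<rho>: "\<xi> \<in> \<D> (ereal r)" "1 < ereal r" using lev_pole[OF \<xi>, of "ereal r"] r(1) by auto
  have DU: "\<D> (ereal r) \<subseteq> U" using r(2) domain_eq[OF \<rho>(2)] by simp
  have "g holomorphic_on (\<D> (ereal r) - {\<xi>})" using g(4) by (rule holomorphic_on_subset) (use DU in blast)
  from pole_factorization[OF this open_domain[OF \<rho>(2)] \<rho>(1) g(5)]
  obtain e k where e: "e > 0" "k \<xi> \<noteq> 0" "k holomorphic_on cball \<xi> e"
      "\<And>w. w \<in> cball \<xi> e - {\<xi>} \<Longrightarrow> g w = k w / (w - \<xi>) ^ t"
    unfolding g(6) by blast
  define h where "h = (\<lambda>z. if z = \<xi> then k \<xi> else (z - \<xi>) ^ t * g z)"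
  have h1: "h holomorphic_on (\<D> (ereal r) - {\<xi>})"
  proof (rule holomorphic_transform)
    show "(\<lambda>z. (z - \<xi>) ^ t * g z) holomorphic_on (\<D> (ereal r) - {\<xi>})"
      by (intro holomorphic_intros holomorphic_on_subset[OF g(4)]) (use DU in blast)
  qed (simp add: h_def)
  have h2: "h holomorphic_on ball \<xi> e"
  proof (rule holomorphic_transform)
    show "k holomorphic_on ball \<xi> e" using e(3) by (rule holomorphic_on_subset) auto
    show "k z = h z" if "z \<in> ball \<xi> e" for z
    proof (cases "z = \<xi>")
      case False
      then have "g z = k z / (z - \<xi>) ^ t" using that e(4)[of z] by simp
      then show ?thesis using False by (simp add: h_def)
    qed (simp add: h_def)
  qed
  have "h holomorphic_on ((\<D> (ereal r) - {\<xi>}) \<union> ball \<xi> e)"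
    by (rule holomorphic_on_Un[OF h1 h2]) (auto intro: open_delete open_domain \<rho>)
  then have h: "h holomorphic_on \<D> (ereal r)" by (rule holomorphic_on_subset) (use e(1) in auto)
  have sg: "same_germ E h (\<lambda>z. (z - \<xi>) ^ t * G z)"
  proof -
    obtain V where V: "open V" "E \<subseteq> V" "\<And>z. z \<in> V \<Longrightarrow> g z = G z" using g(1) unfolding same_germ_def by blast
    show ?thesis unfolding same_germ_def
      by (intro exI[of _ "V - {\<xi>}"]) (use V \<xi> in \<open>auto simp: h_def open_delete\<close>)
  qed
  have ext: "hol_ext E (ereal r) (\<lambda>z. (z - \<xi>) ^ t * G z)" by (rule hol_extI[OF h sg])
  have "ser (\<lambda>z. (z - \<xi>) ^ t * G z) \<xi> = h \<xi>"
    using ser_eq[OF h \<rho>(2,1)] ser_germ[OF sg] by simp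
  also have "\<dots> \<noteq> 0" using e(2) by (simp add: h_def)
  finally show "\<exists>r > norm (\<Phi> \<xi>). pole_ext (ereal r) \<xi> t G"
    using ext r(1) unfolding pole_ext_def by blast
next
  assume "G \<in> poly_combinations d F m \<and> (\<exists>r > norm (\<Phi> \<xi>). pole_ext (ereal r) \<xi> t G)"
  then obtain r where G: "G \<in> poly_combinations d F m" and r: "norm (\<Phi> \<xi>) < r" and pe: "pole_ext (ereal r) \<xi> t G" by blast
  have \<rho>: "\<xi> \<in> \<D> (ereal r)" "1 < ereal r" using lev_pole[OF \<xi>, of "ereal r"] r(1) by auto
  let ?h = "ser (\<lambda>z. (z - \<xi>) ^ t * G z)"
  have h: "?h holomorphic_on \<D> (ereal r)" "?h \<xi> \<noteq> 0"
    using pe hol_ext_ser(1)[OF _ \<rho>(2)] by (auto simp: pole_ext_def)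
  have cl: "closure (\<D> (ereal (norm (\<Phi> \<xi>)))) \<subseteq> \<D> (ereal r)"
    unfolding closure_domain[OF \<xi>] domain_eq[OF \<rho>(2)] using r by auto
  show "G \<in> pole_combinations E d F m \<xi> t"
    unfolding pole_combinations_def
    using G pole_ext_germ_quotient[OF pe \<xi> \<rho>(2)] open_domain[OF \<rho>(2)] cl pole_ext_extension[OF h(1) t \<rho>(1) h(2) \<rho>(2)]
    by blast
qed

text \<open>A meromorphic g may have arbitrary values at isolated points, so the product with the
  clearing polynomial need not be holomorphic. h takes its limits and agrees with it where g is
  analytic.\<close>

lemma meromorphic_clear_poles:
  assumes g: "g meromorphic_on D" and D: "open D" and P: "finite P" "\<And>z. z \<in> D \<Longrightarrow> is_pole g z \<Longrightarrow> z \<in> P"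
  shows "\<exists>h. h holomorphic_on D \<and> (\<forall>z\<in>D. g analytic_on {z} \<longrightarrow> h z = (\<Prod>x\<in>P. (z - x) ^ pole_order g x) * g z)"
proof -
  define q where "q = (\<lambda>z. \<Prod>x\<in>P. (z - x) ^ pole_order g x)"
  have qan: "q analytic_on A" for A unfolding q_def by (intro analytic_intros)
  define f where "f = (\<lambda>z. q z * g z)"
  have fm: "f meromorphic_on D" unfolding f_def
    by (intro meromorphic_intros g analytic_on_imp_meromorphic_on qan)
  have lim: "\<exists>l. f \<midarrow>z\<rightarrow> l" if z: "z \<in> D" for z
  proof -
    have gz: "g meromorphic_on {z}" by (rule meromorphic_on_subset[OF g]) (use z in simp)
    have ne: "not_essential g z" using gz by (rule meromorphic_on_not_essential)
    have iso: "isolated_singularity_at g z" using gz by (rule meromorphic_on_isolated_singularity)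
    show ?thesis
    proof (cases "is_pole g z")
      case False
      then obtain l where l: "g \<midarrow>z\<rightarrow> l" using ne unfolding not_essential_def by blast
      have "q \<midarrow>z\<rightarrow> q z" using qan[of "{z}"] by (metis analytic_at_imp_isCont isContD)
      from tendsto_mult[OF this l] show ?thesis unfolding f_def by blast
    next
      case True
      then have zP: "z \<in> P" using P z by blast
      let ?n = "pole_order g z"
      obtain r where r: "r > 0" "g holomorphic_on ball z r - {z}"
        using iso unfolding isolated_singularity_at_def by (metis analytic_imp_holomorphic)
      have "z \<in> ball z r" using r(1) by simp
      from pole_factorization[OF r(2) open_ball this True]
      obtain e k where e: "k z \<noteq> 0" "e > 0" "k holomorphic_on cball z e"
          "\<And>w. w \<in> cball z e - {z} \<Longrightarrow> g w = k w / (w - z) ^ ?n"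
        by blast
      let ?q' = "\<lambda>w. \<Prod>x\<in>P - {z}. (w - x) ^ pole_order g x"
      have "isCont (k) z"
      proof -
        have "k holomorphic_on ball z e" using e(3) by (rule holomorphic_on_subset) auto
        then have "continuous_on (ball z e) (k)" by (rule holomorphic_on_imp_continuous_on)
        then show ?thesis using e(2) by (simp add: continuous_on_eq_continuous_at)
      qed
      moreover have "isCont ?q' z" by (intro continuous_intros)
      ultimately have "(\<lambda>w. ?q' w * k w) \<midarrow>z\<rightarrow> ?q' z * k z"
        by (intro tendsto_mult isContD)
      moreover have "\<forall>\<^sub>F w in at z. ?q' w * k w = f w"
        unfolding eventually_at
      proof (intro exI[of _ e] conjI e(2) ballI impI)
        fix w assume w: "w \<noteq> z \<and> dist w z < e"
        then have "g w = k w / (w - z) ^ ?n" using e(4)[of w] by (simp add: dist_commute)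
        then have "(w - z) ^ ?n * g w = k w" using w by simp
        moreover have "q w = (w - z) ^ ?n * ?q' w" unfolding q_def by (rule prod.remove[OF P(1) zP])
        ultimately show "?q' w * k w = f w" by (simp add: f_def mult_ac)
      qed
      ultimately have "f \<midarrow>z\<rightarrow> ?q' z * k z" by (rule Lim_transform_eventually)
      then show ?thesis by blast
    qed
  qed
  define h where "h = (\<lambda>z. Lim (at z) f)"
  have fh: "f \<midarrow>z\<rightarrow> h z" if "z \<in> D" for z
    using lim[OF that] unfolding h_def by (metis tendsto_Lim at_neq_bot)
  have h_eq: "h z = f z" if "z \<in> D" "f analytic_on {z}" for z
    using that fh[OF that(1)] LIM_unique by (metis analytic_at_imp_isCont isContD)
  have "h analytic_on {z}" if z: "z \<in> D" for z
  proof -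
    have "f meromorphic_on {z}" by (rule meromorphic_on_subset[OF fm]) (use z in simp)
    then have "isolated_singularity_at f z" by (rule meromorphic_on_isolated_singularity)
    then obtain r0 where r0: "r0 > 0" "f analytic_on ball z r0 - {z}" unfolding isolated_singularity_at_def by blast
    obtain r1 where r1: "r1 > 0" "ball z r1 \<subseteq> D" using D z openE by blast
    define r where "r = min r0 r1"
    have r: "r > 0" "f analytic_on ball z r - {z}" "ball z r \<subseteq> D"
      using r0 r1 by (auto simp: r_def intro: analytic_on_subset)
    have eq: "h w = f w" if "w \<in> ball z r - {z}" for w
      by (rule h_eq) (use that r in \<open>auto intro: analytic_on_subset\<close>)
    have h1: "h holomorphic_on ball z r - {z}"
      by (rule holomorphic_transform[OF analytic_imp_holomorphic[OF r(2)]]) (simp add: eq)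
    have "h \<midarrow>z\<rightarrow> h z"
    proof (rule Lim_transform_eventually[OF fh[OF z]])
      show "\<forall>\<^sub>F w in at z. f w = h w"
        unfolding eventually_at using r(1) eq by (intro exI[of _ r]) (auto simp: dist_commute)
    qed
    then have "isCont h z" by (simp add: isCont_def)
    have "continuous_on (ball z r) h"
      unfolding continuous_on_eq_continuous_at[OF open_ball]
    proof
      fix w assume w: "w \<in> ball z r"
      show "isCont h w"
      proof (cases "w = z")
        case False
        have "continuous_on (ball z r - {z}) h" by (rule holomorphic_on_imp_continuous_on[OF h1])
        moreover have "open (ball z r - {z})" by (simp add: open_delete)
        ultimately show ?thesis using w False by (simp add: continuous_on_eq_continuous_at)
      qed (use \<open>isCont h z\<close> in simp)
    qed
    then have "h holomorphic_on ball z r"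
      by (rule no_isolated_singularity[OF _ h1]) simp_all
    then show ?thesis using r(1) by (meson analytic_at open_ball centre_in_ball)
  qed
  then have "h analytic_on D" by (subst analytic_on_analytic_at) blast
  then have "h holomorphic_on D" by (rule analytic_imp_holomorphic)
  moreover have "h z = q z * g z" if "z \<in> D" "g analytic_on {z}" for z
  proof -
    have "f analytic_on {z}" unfolding f_def by (intro analytic_intros qan that)
    then show ?thesis using h_eq[OF that(1)] by (simp add: f_def)
  qed
  ultimately show ?thesis unfolding q_def by blast
qed

lemma meromorphic_ext_clear_poles:
  assumes g: "meromorphic_ext E G (\<D> \<rho>) g" and G: "G analytic_on E" and \<rho>: "1 < \<rho>"
    and P: "finite P" "\<And>z. z \<in> \<D> \<rho> \<Longrightarrow> is_pole g z \<Longrightarrow> z \<in> P"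
  shows "hol_ext E \<rho> (\<lambda>z. (\<Prod>x\<in>P. (z - x) ^ pole_order g x) * G z)"
proof -
  obtain V where V: "open V" "E \<subseteq> V" "\<And>z. z \<in> V \<Longrightarrow> g z = G z" and gm: "g meromorphic_on \<D> \<rho>"
    using g unfolding meromorphic_ext_def same_germ_def by blast
  obtain U where U: "open U" "E \<subseteq> U" "G holomorphic_on U" using G unfolding analytic_on_holomorphic by blast
  obtain h where h: "h holomorphic_on \<D> \<rho>"
     "\<And>z. z \<in> \<D> \<rho> \<Longrightarrow> g analytic_on {z} \<Longrightarrow> h z = (\<Prod>x\<in>P. (z - x) ^ pole_order g x) * g z"
    using meromorphic_clear_poles[OF gm open_domain[OF \<rho>] P] by blast
  have "same_germ E h (\<lambda>z. (\<Prod>x\<in>P. (z - x) ^ pole_order g x) * G z)"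
    unfolding same_germ_def
  proof (intro exI[of _ "V \<inter> U \<inter> \<D> \<rho>"] conjI ballI)
    show "open (V \<inter> U \<inter> \<D> \<rho>)" using V U open_domain[OF \<rho>] by (intro open_Int)
    show "E \<subseteq> V \<inter> U \<inter> \<D> \<rho>" using V U E_subset_domain by blast
    fix z assume z: "z \<in> V \<inter> U \<inter> \<D> \<rho>"
    have "g holomorphic_on V \<inter> U"
      by (rule holomorphic_transform[OF holomorphic_on_subset[OF U(3)]]) (use V in auto)
    then have "g analytic_on {z}" using z V U by (metis Int_iff analytic_at open_Int)
    then show "h z = (\<Prod>x\<in>P. (z - x) ^ pole_order g x) * G z" using h(2)[of z] z V(3)[of z] by simp
  qed
  then show ?thesis using h(1) hol_extI by blast
qed

end

section \<open>System poles and characteristic indices\<close>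

locale hp_setting = regular_measure E \<mu> for E \<mu> +
  fixes d :: nat and F :: "nat \<Rightarrow> complex \<Rightarrow> complex" and m :: "nat \<Rightarrow> nat"
  assumes d_pos: "1 \<le> d" and F_analytic: "\<forall>i\<in>{1..d}. F i analytic_on E" and m_pos: "\<forall>i\<in>{1..d}. 1 \<le> m i"
begin

abbreviation "M \<equiv> msize d m"
abbreviation "V \<equiv> poly_combinations d F m"
abbreviation "sp \<equiv> system_poles E d F m"
abbreviation "spo \<equiv> system_pole_order E d F m"
abbreviation "sys \<equiv> system_poly E d F m"

lemma poly_analytic: "poly (q :: complex poly) analytic_on A"
proof -
  have "poly q holomorphic_on UNIV" by (intro holomorphic_intros)
  then have "poly q analytic_on UNIV" by (simp add: analytic_on_open)
  then show ?thesis by (rule analytic_on_subset) simp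
qed

lemma V_analytic: "G \<in> V \<Longrightarrow> G analytic_on E"
proof -
  assume "G \<in> V"
  then obtain v :: "nat \<Rightarrow> complex poly" where v: "G = (\<lambda>z. \<Sum>i=1..d. poly (v i) z * F i z)"
    unfolding poly_combinations_def by blast
  show ?thesis unfolding v
    by (rule analytic_on_sum) (use F_analytic in \<open>auto intro!: analytic_on_mult poly_analytic\<close>)
qed

lemma M_pos: "1 \<le> M"
proof -
  have "m 1 \<le> M" unfolding msize_def by (rule member_le_sum) (use d_pos in auto)
  then show ?thesis using m_pos d_pos by force
qed

lemma merom_index_ge:
  assumes pe: "pole_ext R \<xi> t G" and \<xi>: "\<xi> \<notin> E" "ereal (norm (\<Phi> \<xi>)) < R" and t: "1 \<le> t"
  shows "R \<le> merom_index E t G"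
proof -
  have \<rho>: "\<xi> \<in> \<D> R" "1 < R" using lev_pole[OF \<xi>] by auto
  let ?h = "ser (\<lambda>z. (z - \<xi>) ^ t * G z)"
  let ?g = "\<lambda>z. ?h z / (z - \<xi>) ^ t"
  have h: "?h holomorphic_on \<D> R" "?h \<xi> \<noteq> 0"
    using pe hol_ext_ser(1)[OF _ \<rho>(2)] by (auto simp: pole_ext_def)
  note g = pole_ext_extension[OF h(1) t \<rho>(1) h(2) \<rho>(2)]
  have "?h analytic_on \<D> R" using h(1) open_domain[OF \<rho>(2)] by (simp add: analytic_on_open)
  then have "?g meromorphic_on \<D> R"
    by (intro meromorphic_intros analytic_on_imp_meromorphic_on analytic_intros)
  then have me: "meromorphic_ext E G (\<D> R) ?g"
    using pole_ext_germ_quotient[OF pe \<xi>(1) \<rho>(2)] by (simp add: meromorphic_ext_def)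
  have poles: "{z \<in> \<D> R. is_pole ?g z} = {\<xi>}"
  proof (intro equalityI subsetI)
    fix z assume z: "z \<in> {z \<in> \<D> R. is_pole ?g z}"
    have "open (\<D> R - {\<xi>})" using open_domain[OF \<rho>(2)] by (rule open_delete)
    then show "z \<in> {\<xi>}" using not_is_pole_holomorphic[OF _ _ g(1)] z by blast
  next
    fix z assume "z \<in> {\<xi>}"
    then show "z \<in> {z \<in> \<D> R. is_pole ?g z}" using \<rho>(1) g(2) by simp
  qed
  have "finite {z \<in> \<D> R. is_pole ?g z}" "(\<Sum>z | z \<in> \<D> R \<and> is_pole ?g z. pole_order ?g z) \<le> t"
    unfolding poles using g(3) by simp_all
  then have "R \<in> {\<rho>. 1 < \<rho> \<and> (\<exists>g. meromorphic_ext E G (\<D> \<rho>) g \<and> finite {z \<in> \<D> \<rho>. is_pole g z} \<and>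
        (\<Sum>z | z \<in> \<D> \<rho> \<and> is_pole g z. pole_order g z) \<le> t)}"
    using \<rho>(2) me by blast
  then show ?thesis unfolding merom_index_def by (rule Sup_upper)
qed

text \<open>The pole at \<xi>, of exact order t, uses up the whole allowance of t poles counted with
  multiplicity. So a continuation with at most t poles has no pole besides \<xi>.\<close>

lemma merom_index_gt_imp:
  assumes R: "R < merom_index E t G" and pe: "pole_ext \<rho>1 \<xi> t G" "ereal (norm (\<Phi> \<xi>)) < \<rho>1" and \<xi>: "\<xi> \<notin> E"
    and G: "G analytic_on E"
  shows "pole_ext R \<xi> t G"
proof -
  obtain \<rho> g where \<rho>: "R < \<rho>" "1 < \<rho>" "meromorphic_ext E G (\<D> \<rho>) g" "finite {z \<in> \<D> \<rho>. is_pole g z}"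
     "(\<Sum>z | z \<in> \<D> \<rho> \<and> is_pole g z. pole_order g z) \<le> t"
    using R unfolding merom_index_def less_Sup_iff by blast
  show ?thesis
  proof (cases "\<rho> \<le> \<rho>1")
    case True
    then have "R \<le> \<rho>1" using \<rho>(1) by simp
    then show ?thesis using pole_ext_mono[OF pe(1)] by blast
  next
    case False
    then have less: "\<rho>1 < \<rho>" by simp
    have \<rho>1: "\<xi> \<in> \<D> \<rho>1" "1 < \<rho>1" using lev_pole[OF \<xi> pe(2)] by auto
    have \<xi>\<rho>: "\<xi> \<in> \<D> \<rho>" using \<rho>1(1) domain_mono[OF less_imp_le[OF less]] by blast
    define P where "P = {z \<in> \<D> \<rho>. is_pole g z}"
    have fP: "finite P" using \<rho>(4) by (simp add: P_def)
    have sumP: "(\<Sum>z\<in>P. pole_order g z) \<le> t" using \<rho>(5) by (simp add: P_def)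
    define s where "s = (if \<xi> \<in> P then pole_order g \<xi> else 0)"
    define q' where "q' = (\<lambda>z. \<Prod>x\<in>P - {\<xi>}. (z - x) ^ pole_order g x)"
    have q: "(\<Prod>x\<in>P. (z - x) ^ pole_order g x) = (z - \<xi>) ^ s * q' z" for z
      unfolding s_def q'_def using prod.remove[OF fP, of \<xi> "\<lambda>x. (z - x) ^ pole_order g x"] by auto
    have he: "hol_ext E \<rho> (\<lambda>z. (z - \<xi>) ^ s * q' z * G z)"
      unfolding q[symmetric] by (rule meromorphic_ext_clear_poles[OF \<rho>(3) G \<rho>(2) fP]) (simp add: P_def)
    define h where "h = ser (\<lambda>z. (z - \<xi>) ^ s * q' z * G z)"
    define h1 where "h1 = ser (\<lambda>z. (z - \<xi>) ^ t * G z)"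
    have h: "h holomorphic_on \<D> \<rho>" "same_germ E h (\<lambda>z. (z - \<xi>) ^ s * q' z * G z)"
      unfolding h_def using hol_ext_ser[OF he \<rho>(2)] by auto
    have h1: "h1 holomorphic_on \<D> \<rho>1" "same_germ E h1 (\<lambda>z. (z - \<xi>) ^ t * G z)" "h1 \<xi> \<noteq> 0"
      using hol_ext_ser[OF _ \<rho>1(2)] pe(1) unfolding h1_def pole_ext_def by auto
    have q'nz: "q' \<xi> \<noteq> 0" unfolding q'_def using fP by auto
    have q'h: "q' holomorphic_on A" for A unfolding q'_def by (intro holomorphic_intros)
    \<comment> \<open>For s < t, (z - \<xi>)^(t - s) h and q' h1 would be the same function, but the
      first vanishes at \<xi> and the second does not.\<close>
    have st: "s \<ge> t"
    proof (rule ccontr)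
      assume "\<not> s \<ge> t"
      then have lt: "s < t" by simp
      have pw: "(z - \<xi>) ^ (t - s) * ((z - \<xi>) ^ s * q' z * G z) = q' z * ((z - \<xi>) ^ t * G z)" for z
      proof -
        have "(z - \<xi>) ^ t = (z - \<xi>) ^ (t - s) * (z - \<xi>) ^ s" using lt by (simp flip: power_add)
        then show ?thesis by simp
      qed
      have "same_germ E (\<lambda>z. (z - \<xi>) ^ (t - s) * h z) (\<lambda>z. (z - \<xi>) ^ (t - s) * ((z - \<xi>) ^ s * q' z * G z))"
        by (rule same_germ_compose2[OF same_germ_refl[of E "\<lambda>_. 0"] h(2), of "\<lambda>z x y. (z - \<xi>) ^ (t - s) * y"])
      moreover have "same_germ E (\<lambda>z. q' z * h1 z) (\<lambda>z. q' z * ((z - \<xi>) ^ t * G z))"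
        by (rule same_germ_compose2[OF same_germ_refl[of E "\<lambda>_. 0"] h1(2), of "\<lambda>z x y. q' z * y"])
      ultimately have "same_germ E (\<lambda>z. (z - \<xi>) ^ (t - s) * h z) (\<lambda>z. q' z * h1 z)"
        unfolding pw using same_germ_trans same_germ_sym by blast
      then have eq: "(\<lambda>z. (z - \<xi>) ^ (t - s) * h z) \<xi> = (\<lambda>z. q' z * h1 z) \<xi>"
        by (intro hol_eq_on_same_germ[OF _ _ _ \<rho>(2) \<rho>1(2) \<xi>\<rho> \<rho>1(1)] holomorphic_intros h(1) h1(1) q'h)
      have "(\<xi> - \<xi>) ^ (t - s) = 0" using lt by (simp add: zero_power)
      then have "q' \<xi> * h1 \<xi> = 0" using eq by (metis mult_zero_left)
      then show False using h1(3) q'nz by simp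
    qed
    have "s = t \<and> (\<forall>x\<in>P - {\<xi>}. pole_order g x = 0)"
    proof (cases "\<xi> \<in> P")
      case True
      then have "(\<Sum>z\<in>P. pole_order g z) = s + (\<Sum>x\<in>P - {\<xi>}. pole_order g x)"
        using sum.remove[OF fP True] by (simp add: s_def)
      then have "s = t" "(\<Sum>x\<in>P - {\<xi>}. pole_order g x) = 0" using st sumP by auto
      then show ?thesis using fP by (simp add: sum_eq_0_iff)
    next
      case False
      then have "s = 0" by (simp add: s_def)
      then have "t = 0" using st by simp
      then show ?thesis using \<open>s = 0\<close> sumP fP by (simp add: sum_eq_0_iff)
    qed
    then have "(\<lambda>z. (z - \<xi>) ^ s * q' z * G z) = (\<lambda>z. (z - \<xi>) ^ t * G z)"
      unfolding q'_def by (intro ext) simp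
    then have "pole_ext \<rho> \<xi> t G" using he pe(1) unfolding pole_ext_def by simp
    then show ?thesis using pole_ext_mono \<rho>(1) by (metis less_imp_le)
  qed
qed

lemma rho_pole_gt_imp:
  assumes R: "R < rho_pole E d F m \<xi> t" and \<xi>: "\<xi> \<notin> E" and t: "1 \<le> t"
  shows "\<exists>G\<in>V. pole_ext R \<xi> t G"
proof -
  obtain G where G: "G \<in> pole_combinations E d F m \<xi> t" "R < merom_index E t G"
    using R unfolding rho_pole_def less_Sup_iff by blast
  obtain r where r: "norm (\<Phi> \<xi>) < r" "pole_ext (ereal r) \<xi> t G" "G \<in> V"
    using G(1) pole_combinations_iff[OF \<xi> t] by blast
  have "pole_ext R \<xi> t G"
    by (rule merom_index_gt_imp[OF G(2) r(2) _ \<xi> V_analytic[OF r(3)]]) (use r(1) in simp)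
  then show ?thesis using r(3) by blast
qed

lemma rho_pole_ge:
  assumes pe: "pole_ext (ereal R) \<xi> t G" "G \<in> V" and R: "norm (\<Phi> \<xi>) < R" and \<xi>: "\<xi> \<notin> E" and t: "1 \<le> t"
  shows "ereal R \<le> rho_pole E d F m \<xi> t"
proof -
  have "G \<in> pole_combinations E d F m \<xi> t" using pole_combinations_iff[OF \<xi> t] pe R by blast
  then have "merom_index E t G \<le> rho_pole E d F m \<xi> t" unfolding rho_pole_def by (intro SUP_upper)
  moreover have "ereal R \<le> merom_index E t G" by (rule merom_index_ge[OF pe(1) \<xi> _ t]) (use R in simp)
  ultimately show ?thesis by (rule order_trans[rotated])
qed

section \<open>System poles and their orders\<close>

lemma system_pole_unique: "is_system_pole E d F m \<xi> \<tau> \<Longrightarrow> is_system_pole E d F m \<xi> \<tau>' \<Longrightarrow> \<tau> = \<tau>'"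
  unfolding is_system_pole_def by (meson antisym)

lemma system_pole_order_eq: "is_system_pole E d F m \<xi> \<tau> \<Longrightarrow> spo \<xi> = \<tau>"
  unfolding system_pole_order_def using system_pole_unique by blast

lemma system_poleD:
  assumes "\<xi> \<in> sp"
  shows "\<xi> \<notin> E" "1 \<le> spo \<xi>" "\<And>t. t \<in> {1..spo \<xi>} \<Longrightarrow> pole_combinations E d F m \<xi> t \<noteq> {}"
proof -
  obtain \<tau> where \<tau>: "is_system_pole E d F m \<xi> \<tau>" using assms by (auto simp: system_poles_def)
  then show "\<xi> \<notin> E" "1 \<le> spo \<xi>" "\<And>t. t \<in> {1..spo \<xi>} \<Longrightarrow> pole_combinations E d F m \<xi> t \<noteq> {}"
    unfolding system_pole_order_eq[OF \<tau>] is_system_pole_def by blast+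
qed

text \<open>The neighbourhood of the closed domain leaves a positive margin beyond |\<Phi>(\<xi>)|.
  The strictness makes all ratios in the formula for \<theta> smaller than 1.\<close>

lemma rho_pole_gt_level:
  assumes \<xi>: "\<xi> \<in> sp" and t: "t \<in> {1..spo \<xi>}"
  shows "ereal (norm (\<Phi> \<xi>)) < rho_pole E d F m \<xi> t"
proof -
  obtain G where "G \<in> pole_combinations E d F m \<xi> t" using system_poleD(3)[OF \<xi> t] by blast
  then obtain r where "norm (\<Phi> \<xi>) < r" "pole_ext (ereal r) \<xi> t G" "G \<in> V"
    using pole_combinations_iff[OF system_poleD(1)[OF \<xi>]] t by auto
  then have "ereal r \<le> rho_pole E d F m \<xi> t" "ereal (norm (\<Phi> \<xi>)) < ereal r"
    using rho_pole_ge system_poleD(1)[OF \<xi>] t by auto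
  then show ?thesis by (rule less_le_trans[rotated])
qed

lemma bold_rho_pole_le: "k \<in> {1..t} \<Longrightarrow> bold_rho_pole E d F m \<xi> t \<le> rho_pole E d F m \<xi> k"
  unfolding bold_rho_pole_def by (intro Min_le) auto

lemma bold_rho_pole_gt_level:
  assumes \<xi>: "\<xi> \<in> sp" and t: "t \<in> {1..spo \<xi>}"
  shows "ereal (norm (\<Phi> \<xi>)) < bold_rho_pole E d F m \<xi> t"
  unfolding bold_rho_pole_def using t rho_pole_gt_level[OF \<xi>] by (subst Min_gr_iff) auto

lemma poly_sys: "finite sp \<Longrightarrow> poly sys z = (\<Prod>x\<in>sp. (z - x) ^ spo x)"
  unfolding system_poly_def by (simp add: poly_prod)

lemma poly_sys_zero_iff: "finite sp \<Longrightarrow> poly sys z = 0 \<longleftrightarrow> z \<in> sp"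
  using system_poleD(2) unfolding poly_sys by (auto simp: not_less_eq_eq Suc_le_eq)

text \<open>On a connected domain f - g is either zero or nonzero off a sparse set, and near a point
  of \<open>E\<close> it is zero. The conclusion concerns punctured neighbourhoods because isolated
  values are arbitrary.\<close>

lemma meromorphic_germ_identity:
  assumes f: "f meromorphic_on \<D> \<rho>" and g: "g meromorphic_on \<D> \<rho>" and fg: "same_germ E f g"
    and \<rho>: "1 < \<rho>" and x: "x \<in> \<D> \<rho>"
  shows "\<forall>\<^sub>F z in at x. f z = g z"
proof -
  let ?u = "\<lambda>z. f z - g z"
  obtain V where U: "open V" "E \<subseteq> V" "\<And>z. z \<in> V \<Longrightarrow> f z = g z" using fg unfolding same_germ_def by blast
  obtain a where a: "a \<in> E" using nonempty_E by blast
  have "?u meromorphic_on \<D> \<rho>" by (intro meromorphic_intros f g)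
  from meromorphic_imp_constant_or_avoid[OF this open_domain[OF \<rho>] connected_domain[OF \<rho>], of 0]
  have "eventually (\<lambda>z. ?u z = 0) (cosparse (\<D> \<rho>))"
  proof
    assume "eventually (\<lambda>z. ?u z \<noteq> 0) (cosparse (\<D> \<rho>))"
    then have "\<forall>\<^sub>F z in at a. ?u z \<noteq> 0"
      by (rule eventually_cosparse_imp_eventually_at) (use a E_subset_domain in blast)
    moreover have "\<forall>\<^sub>F z in at a. z \<in> V" using U(1,2) a by (intro eventually_at_in_open') auto
    ultimately have "\<forall>\<^sub>F z in at a. False" by eventually_elim (use U(3) in simp)
    then show ?thesis by simp
  qed
  then have "\<forall>\<^sub>F z in at x. ?u z = 0" by (rule eventually_cosparse_imp_eventually_at) (rule x)
  then show ?thesis by eventually_elim simp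
qed

lemma rho_comp_gt_1:
  assumes i: "i \<in> {1..d}"
  shows "1 < rho_comp E d F m i k"
proof -
  have an: "(\<lambda>z. z ^ k * F i z) analytic_on E" using F_analytic i by (intro analytic_intros) auto
  obtain r where r: "1 < r" "hol_ext E (ereal r) (\<lambda>z. z ^ k * F i z)" using analytic_hol_ext[OF an] .
  have r1: "1 < ereal r" using r(1) by simp
  let ?g = "ser (\<lambda>z. z ^ k * F i z)"
  have g: "?g holomorphic_on \<D> (ereal r)" "same_germ E ?g (\<lambda>z. z ^ k * F i z)" using hol_ext_ser[OF r(2) r1] by auto
  have "?g meromorphic_on \<D> (ereal r)"
    using g(1) open_domain[OF r1] by (intro analytic_on_imp_meromorphic_on) (simp add: analytic_on_open)
  moreover have "\<not> is_pole ?g \<xi>" if "\<xi> \<in> \<D> (ereal r)" for \<xi>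
    using not_is_pole_holomorphic[OF open_domain[OF r1] that g(1)] .
  ultimately have "ereal r \<le> rho_comp E d F m i k"
    unfolding rho_comp_def meromorphic_ext_def using r1 g(2) by (intro Sup_upper) blast
  then show ?thesis using r1 by (rule less_le_trans[rotated])
qed

text \<open>\<open>rho_comp\<close> is a supremum, and the continuations for smaller indices come
  from different g. Their existence gives the decay of the coefficients for every smaller index,
  hence for the supremum, and decay gives back one continuation there.\<close>

lemma rho_comp_hol_ext:
  assumes i: "i \<in> {1..d}" and fin: "finite sp"
  shows "hol_ext E (rho_comp E d F m i k) (\<lambda>z. poly sys z * (z ^ k * F i z))"
proof -
  let ?G = "\<lambda>z. z ^ k * F i z" and ?\<rho> = "rho_comp E d F m i k"
  have an: "?G analytic_on E" using F_analytic i by (intro analytic_intros) auto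
  obtain r0 where r0: "1 < r0" "hol_ext E (ereal r0) ?G" using analytic_hol_ext[OF an] .
  have ex: "hol_ext E (ereal r) (\<lambda>z. poly sys z * ?G z)" if r: "ereal r < ?\<rho>" for r
  proof -
    obtain \<rho> g where \<rho>: "ereal r < \<rho>" "1 < \<rho>" "meromorphic_ext E ?G (\<D> \<rho>) g"
      "\<And>\<xi>. \<xi> \<in> \<D> \<rho> \<Longrightarrow> is_pole g \<xi> \<Longrightarrow> \<xi> \<in> sp \<and> pole_order g \<xi> \<le> spo \<xi>"
      using r unfolding rho_comp_def less_Sup_iff by blast
    define P where "P = {\<xi> \<in> \<D> \<rho>. is_pole g \<xi>}"
    have P: "P \<subseteq> sp" using \<rho>(4) by (auto simp: P_def)
    then have fP: "finite P" using fin by (rule finite_subset)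
    have he: "hol_ext E \<rho> (\<lambda>z. (\<Prod>x\<in>P. (z - x) ^ pole_order g x) * ?G z)"
      by (rule meromorphic_ext_clear_poles[OF \<rho>(3) an \<rho>(2) fP]) (simp add: P_def)
    define q where "q = (\<lambda>z. (\<Prod>x\<in>sp - P. (z - x) ^ spo x) * (\<Prod>x\<in>P. (z - x) ^ (spo x - pole_order g x)))"
    have "poly sys z = q z * (\<Prod>x\<in>P. (z - x) ^ pole_order g x)" for z
    proof -
      have "(\<Prod>x\<in>P. (z - x) ^ (spo x - pole_order g x)) * (\<Prod>x\<in>P. (z - x) ^ pole_order g x) = (\<Prod>x\<in>P. (z - x) ^ spo x)"
        unfolding prod.distrib[symmetric] by (rule prod.cong) (use \<rho>(4) in \<open>auto simp: P_def simp flip: power_add\<close>)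
      then show ?thesis unfolding poly_sys[OF fin] q_def
        using prod.subset_diff[OF P fin, of "\<lambda>x. (z - x) ^ spo x"] by (simp add: mult.assoc)
    qed
    then have "(\<lambda>z. poly sys z * ?G z) = (\<lambda>z. q z * ((\<Prod>x\<in>P. (z - x) ^ pole_order g x) * ?G z))"
      by (simp add: mult.assoc)
    then have "hol_ext E \<rho> (\<lambda>z. poly sys z * ?G z)"
      using hol_ext_mult_hol[OF he, of q] unfolding q_def by (simp add: holomorphic_intros)
    then show ?thesis by (rule hol_ext_mono) (use \<rho>(1) in simp)
  qed
  have "decays ?\<rho> (\<lambda>z. poly sys z * ?G z)"
    unfolding decays_def
  proof (intro allI impI)
    fix r :: real assume r: "1 < r" "ereal r < ?\<rho>"
    obtain r' where r': "r < r'" "ereal r' < ?\<rho>" using r(2) by (rule ereal_real_between)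
    have "decays (ereal r') (\<lambda>z. poly sys z * ?G z)" using hol_ext_ser(3)[OF ex[OF r'(2)]] r(1) r'(1) by simp
    then show "\<exists>C\<ge>0. \<forall>n. norm (cf (\<lambda>z. poly sys z * ?G z) n) \<le> C * (1 / r) ^ n"
      using decaysD[OF _ r(1)] r'(1) by simp
  qed
  moreover have "hol_ext E (ereal r0) (\<lambda>z. poly sys z * ?G z)" by (rule hol_ext_poly_mult[OF r0(2)])
  moreover have "1 < ereal r0" using r0(1) by simp
  ultimately show ?thesis using hol_ext_iff_decays rho_comp_gt_1[OF i] by blast
qed

lemma rho_comp_star_poles:
  assumes i: "i \<in> {1..d}" and fin: "finite sp"
  shows "1 < rho_comp_star E d F m i k"
    "\<exists>P o'. P \<subseteq> sp \<and> (\<forall>x\<in>P. 1 \<le> o' x \<and> rho_comp_star E d F m i k \<le> bold_rho_pole E d F m x (o' x)) \<and>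
       hol_ext E (rho_comp_star E d F m i k) (\<lambda>z. (\<Prod>x\<in>P. (z - x) ^ o' x) * (z ^ k * F i z))"
proof -
  let ?G = "\<lambda>z. z ^ k * F i z" and ?\<rho> = "rho_comp E d F m i k"
  have an: "?G analytic_on E" using F_analytic i by (intro analytic_intros) auto
  have \<rho>: "1 < ?\<rho>" by (rule rho_comp_gt_1[OF i])
  define h where "h = ser (\<lambda>z. poly sys z * ?G z)"
  have h: "h holomorphic_on \<D> ?\<rho>" "same_germ E h (\<lambda>z. poly sys z * ?G z)"
    unfolding h_def using hol_ext_ser[OF rho_comp_hol_ext[OF i fin] \<rho>] by auto
  define g where "g = (\<lambda>z. h z / poly sys z)"
  have closed_sp: "closed sp" using fin by (rule finite_imp_closed)
  have g_hol: "g holomorphic_on (\<D> ?\<rho> - sp)" unfolding g_def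
    by (intro holomorphic_intros holomorphic_on_subset[OF h(1)]) (auto simp: poly_sys_zero_iff[OF fin])
  have "h analytic_on \<D> ?\<rho>" using h(1) open_domain[OF \<rho>] by (simp add: analytic_on_open)
  then have gm: "g meromorphic_on \<D> ?\<rho>" unfolding g_def
    by (intro meromorphic_on_divide analytic_on_imp_meromorphic_on poly_analytic)
  have gs: "same_germ E g ?G"
  proof -
    obtain U where U: "open U" "E \<subseteq> U" "\<And>z. z \<in> U \<Longrightarrow> h z = poly sys z * ?G z" using h(2) unfolding same_germ_def by blast
    show ?thesis unfolding same_germ_def
    proof (intro exI[of _ "U - sp"] conjI ballI)
      show "open (U - sp)" using U closed_sp by (simp add: open_Diff)
      show "E \<subseteq> U - sp" using U system_poleD(1) by blast
      fix z assume z: "z \<in> U - sp"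
      then show "g z = ?G z" using U(3)[of z] poly_sys_zero_iff[OF fin] by (simp add: g_def)
    qed
  qed
  have me: "meromorphic_ext E ?G (\<D> ?\<rho>) g" using gm gs by (simp add: meromorphic_ext_def)
  define P where "P = {x \<in> \<D> ?\<rho>. is_pole g x}"
  have Psp: "P \<subseteq> sp"
  proof
    fix x assume x: "x \<in> P"
    have "open (\<D> ?\<rho> - sp)" using open_domain[OF \<rho>] closed_sp by (rule open_Diff)
    then show "x \<in> sp" using not_is_pole_holomorphic[OF _ _ g_hol] x by (auto simp: P_def)
  qed
  then have fP: "finite P" using fin by (rule finite_subset)
  \<comment> \<open>At the supremum no bound on orders is given. It is taken from an admissible
    index \<rho>' above the level of x, whose continuation agrees with g' near x.\<close>
  have ord: "x \<in> sp \<and> 1 \<le> pole_order g' x \<and> pole_order g' x \<le> spo x"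
    if me': "meromorphic_ext E ?G (\<D> ?\<rho>) g'" and x: "x \<in> \<D> ?\<rho>" "is_pole g' x" for g' x
  proof -
    obtain \<rho>' g1 where \<rho>': "1 < \<rho>'" "ereal (lev x) < \<rho>'" "meromorphic_ext E ?G (\<D> \<rho>') g1"
       "\<And>\<xi>. \<xi> \<in> \<D> \<rho>' \<Longrightarrow> is_pole g1 \<xi> \<Longrightarrow> \<xi> \<in> sp \<and> pole_order g1 \<xi> \<le> spo \<xi>"
    proof -
      have "ereal (lev x) < ?\<rho>" using x(1) domain_eq[OF \<rho>] by simp
      then show ?thesis using that unfolding rho_comp_def less_Sup_iff by blast
    qed
    have "\<rho>' \<le> ?\<rho>" unfolding rho_comp_def by (rule Sup_upper) (use \<rho>' in blast)
    then have sub: "\<D> \<rho>' \<subseteq> \<D> ?\<rho>" by (rule domain_mono)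
    have x': "x \<in> \<D> \<rho>'" using \<rho>'(1,2) by (simp add: domain_eq)
    have g'm: "g' meromorphic_on \<D> \<rho>'" using me' sub unfolding meromorphic_ext_def by (meson meromorphic_on_subset)
    have g1m: "g1 meromorphic_on \<D> \<rho>'" using \<rho>'(3) by (simp add: meromorphic_ext_def)
    have "same_germ E g' g1" using me' \<rho>'(3) unfolding meromorphic_ext_def by (meson same_germ_sym same_germ_trans)
    then have ev: "\<forall>\<^sub>F z in at x. g' z = g1 z"
      using meromorphic_germ_identity[OF g'm g1m _ \<rho>'(1) x'] by blast
    have pole: "is_pole g1 x" using x(2) is_pole_cong[OF ev refl] by simp
    have po: "pole_order g' x = pole_order g1 x" unfolding pole_order_def using zorder_cong[OF ev refl] by simp
    have "g' meromorphic_on {x}" by (rule meromorphic_on_subset[OF g'm]) (use x' in simp)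
    then have "zorder g' x < 0" using x(2) by (intro isolated_pole_imp_neg_zorder meromorphic_on_isolated_singularity)
    then show ?thesis using \<rho>'(4)[OF x' pole] po by (auto simp: pole_order_def)
  qed
  let ?B = "{bold_rho_pole E d F m \<xi> (pole_order g \<xi>) | \<xi> g.
        meromorphic_ext E ?G (\<D> ?\<rho>) g \<and> \<xi> \<in> \<D> ?\<rho> \<and> is_pole g \<xi>}"
  have star: "rho_comp_star E d F m i k = min ?\<rho> (Inf ?B)" by (simp add: rho_comp_star_def)
  have B_sub: "?B \<subseteq> (\<lambda>(x, o'). bold_rho_pole E d F m x o') ` (SIGMA x:sp. {1..spo x})"
  proof
    fix b assume "b \<in> ?B"
    then obtain x g' where "b = bold_rho_pole E d F m x (pole_order g' x)" "x \<in> sp" "pole_order g' x \<in> {1..spo x}"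
      using ord by fastforce
    then show "b \<in> (\<lambda>(x, o'). bold_rho_pole E d F m x o') ` (SIGMA x:sp. {1..spo x})"
      by (intro image_eqI[of _ _ "(x, pole_order g' x)"]) auto
  qed
  then have fB: "finite ?B" by (rule finite_subset) (use fin in auto)
  have gtB: "1 < b" if b: "b \<in> ?B" for b
  proof -
    obtain x t where x: "b = bold_rho_pole E d F m x t" "x \<in> sp" "t \<in> {1..spo x}"
    proof -
      have "b \<in> (\<lambda>(x, o'). bold_rho_pole E d F m x o') ` (SIGMA x:sp. {1..spo x})"
        using B_sub b by (rule subsetD)
      then show ?thesis using that by (elim imageE SigmaE) simp
    qed
    have "1 < ereal (norm (\<Phi> x))" using Phi_gt_1[OF system_poleD(1)[OF x(2)]] by simp
    then show ?thesis unfolding x(1) using bold_rho_pole_gt_level[OF x(2,3)] by (rule less_trans)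
  qed
  have "1 < Inf ?B"
  proof (cases "?B = {}")
    case True then show ?thesis unfolding True by (simp add: top_ereal_def)
  next
    case False
    then have "Inf ?B = Min ?B" using fB by (simp add: Min_Inf)
    then show ?thesis using gtB Min_in[OF fB False] by simp
  qed
  then show "1 < rho_comp_star E d F m i k" unfolding star using \<rho> by simp
  have "hol_ext E ?\<rho> (\<lambda>z. (\<Prod>x\<in>P. (z - x) ^ pole_order g x) * ?G z)"
    by (rule meromorphic_ext_clear_poles[OF me an \<rho> fP]) (simp add: P_def)
  then have he: "hol_ext E (rho_comp_star E d F m i k) (\<lambda>z. (\<Prod>x\<in>P. (z - x) ^ pole_order g x) * ?G z)"
    by (rule hol_ext_mono) (simp add: star)
  have "1 \<le> pole_order g x \<and> rho_comp_star E d F m i k \<le> bold_rho_pole E d F m x (pole_order g x)" if "x \<in> P" for x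
  proof
    have x: "x \<in> \<D> ?\<rho>" "is_pole g x" using that by (simp_all add: P_def)
    show "1 \<le> pole_order g x" using ord[OF me x] by simp
    have "Inf ?B \<le> bold_rho_pole E d F m x (pole_order g x)"
      by (rule Inf_lower) (use me x in blast)
    then show "rho_comp_star E d F m i k \<le> bold_rho_pole E d F m x (pole_order g x)"
      unfolding star by (rule min.coboundedI2)
  qed
  then show "\<exists>P o'. P \<subseteq> sp \<and> (\<forall>x\<in>P. 1 \<le> o' x \<and> rho_comp_star E d F m i k \<le> bold_rho_pole E d F m x (o' x)) \<and>
       hol_ext E (rho_comp_star E d F m i k) (\<lambda>z. (\<Prod>x\<in>P. (z - x) ^ o' x) * (z ^ k * F i z))"
    using Psp he by blast
qed

end

section \<open>From system poles to the denominators\<close>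

lemma limsup_root_le:
  fixes f :: "nat \<Rightarrow> real"
  assumes ev: "\<forall>\<^sub>F n in sequentially. f n \<le> C * a ^ n" and a: "0 < a"
  shows "limsup (\<lambda>n. ereal (root n (f n))) \<le> ereal a"
proof -
  \<comment> \<open>Made positive so that its n-th roots tend to 1.\<close>
  define C' where "C' = max C 1"
  have C': "C' > 0" by (simp add: C'_def)
  have "(\<lambda>n. root n C' * a) \<longlonglongrightarrow> 1 * a" by (intro tendsto_mult LIMSEQ_root_const C' tendsto_const)
  then have lim: "(\<lambda>n. ereal (root n C' * a)) \<longlonglongrightarrow> ereal a" by simp
  have "limsup (\<lambda>n. ereal (root n (f n))) \<le> limsup (\<lambda>n. ereal (root n C' * a))"
  proof (rule Limsup_mono)
    show "\<forall>\<^sub>F n in sequentially. ereal (root n (f n)) \<le> ereal (root n C' * a)"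
      using ev eventually_gt_at_top[of 0]
    proof eventually_elim
      case (elim n)
      have "f n \<le> C' * a ^ n" using elim a by (intro order_trans[OF elim(1)] mult_right_mono) (auto simp: C'_def)
      then have "root n (f n) \<le> root n (C' * a ^ n)" using elim by (intro real_root_le_mono)
      also have "\<dots> = root n C' * a" using elim a by (simp add: real_root_mult real_root_power_cancel)
      finally show ?case by simp
    qed
  qed
  also have "\<dots> = ereal a" by (rule lim_imp_Limsup[OF _ lim]) simp
  finally show ?thesis .
qed

lemma limsup_root_less_imp:
  fixes f :: "nat \<Rightarrow> real"
  assumes "limsup (\<lambda>n. ereal (root n (f n))) < ereal a" and f: "\<And>n. 0 \<le> f n"
  shows "\<forall>\<^sub>F n in sequentially. f n \<le> a ^ n"
  using Limsup_lessD[OF assms(1)] eventually_gt_at_top[of 0]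
proof eventually_elim
  case (elim n)
  then show ?case by (intro root_le_imp_le_power) (auto simp: f)
qed

context hp_setting
begin

text \<open>The denominators alone: the orthogonality relations with j < n only determine the
  numerators, and the one with j = n is this condition.\<close>

definition solves :: "nat \<Rightarrow> complex poly \<Rightarrow> bool" where
  "solves n q \<longleftrightarrow> degree q \<le> M \<and> (\<forall>G\<in>V. cf (\<lambda>z. poly q z * G z) n = 0)"

lemma V_hol_ext: "G \<in> V \<Longrightarrow> \<exists>r>1. hol_ext E (ereal r) G"
  using analytic_hol_ext[OF V_analytic] by blast

lemma V_cont: "G \<in> V \<Longrightarrow> continuous_on S G"
  using V_hol_ext cont_S_hol_ext by blast

lemma basis_in_V: "i \<in> {1..d} \<Longrightarrow> k < m i \<Longrightarrow> (\<lambda>z. z ^ k * F i z) \<in> V"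
proof -
  assume i: "i \<in> {1..d}" and k: "k < m i"
  define v :: "nat \<Rightarrow> complex poly" where "v j = (if j = i then monom 1 k else 0)" for j
  have "(\<lambda>z. \<Sum>j=1..d. poly (v j) z * F j z) = (\<lambda>z. z ^ k * F i z)"
  proof
    fix z
    have "(\<Sum>j=1..d. poly (v j) z * F j z) = (\<Sum>j=1..d. if j = i then z ^ k * F i z else 0)"
      by (rule sum.cong) (auto simp: v_def poly_monom)
    also have "\<dots> = z ^ k * F i z" using i by (subst sum.delta) auto
    finally show "(\<Sum>j=1..d. poly (v j) z * F j z) = z ^ k * F i z" .
  qed
  moreover have "\<forall>j\<in>{1..d}. degree (v j) < m j"
    using m_pos k by (auto simp: v_def degree_monom_eq Suc_le_eq)
  ultimately show ?thesis unfolding poly_combinations_def by (intro CollectI exI[of _ v]) auto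
qed

lemma basis_cont: "i \<in> {1..d} \<Longrightarrow> continuous_on S (F i)"
proof -
  assume i: "i \<in> {1..d}"
  then have "0 < m i" using m_pos by (simp add: Suc_le_eq)
  from V_cont[OF basis_in_V[OF i this]] show ?thesis by simp
qed

lemma solves_iff:
  "solves n q \<longleftrightarrow> degree q \<le> M \<and> (\<forall>i\<in>{1..d}. \<forall>k<m i. cf (\<lambda>z. poly q z * (z ^ k * F i z)) n = 0)"
proof
  assume "solves n q"
  then have s: "degree q \<le> M" "\<And>G. G \<in> V \<Longrightarrow> cf (\<lambda>z. poly q z * G z) n = 0" by (simp_all add: solves_def)
  show "degree q \<le> M \<and> (\<forall>i\<in>{1..d}. \<forall>k<m i. cf (\<lambda>z. poly q z * (z ^ k * F i z)) n = 0)"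
  proof (intro conjI ballI allI impI s(1))
    fix i k assume "i \<in> {1..d}" "k < m i"
    from s(2)[OF basis_in_V[OF this]] show "cf (\<lambda>z. poly q z * (z ^ k * F i z)) n = 0" .
  qed
next
  assume q: "degree q \<le> M \<and> (\<forall>i\<in>{1..d}. \<forall>k<m i. cf (\<lambda>z. poly q z * (z ^ k * F i z)) n = 0)"
  have "cf (\<lambda>z. poly q z * G z) n = 0" if G: "G \<in> V" for G
  proof -
    obtain v :: "nat \<Rightarrow> complex poly" where v: "G = (\<lambda>z. \<Sum>i=1..d. poly (v i) z * F i z)" "\<And>i. i \<in> {1..d} \<Longrightarrow> degree (v i) < m i"
      using G unfolding poly_combinations_def by blast
    have "cf (\<lambda>z. poly q z * G z) n = cf (\<lambda>z. \<Sum>i=1..d. poly (v i) z * (poly q z * F i z)) n"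
      by (rule cf_cong) (simp add: v(1) sum_distrib_left mult_ac)
    also have "\<dots> = (\<Sum>i=1..d. cf (\<lambda>z. poly (v i) z * (poly q z * F i z)) n)"
      by (rule cf_sum) (auto intro!: continuous_intros basis_cont)
    also have "\<dots> = (\<Sum>i=1..d. \<Sum>j\<le>degree (v i). coeff (v i) j * cf (\<lambda>z. z ^ j * (poly q z * F i z)) n)"
      by (rule sum.cong[OF refl], rule cf_poly_mult_sum) (auto intro!: continuous_intros basis_cont)
    also have "\<dots> = 0"
    proof (intro sum.neutral ballI)
      fix i j assume i: "i \<in> {1..d}" and "j \<in> {..degree (v i)}"
      then have "j < m i" using v(2)[OF i] by simp
      moreover have "(\<lambda>z. z ^ j * (poly q z * F i z)) = (\<lambda>z. poly q z * (z ^ j * F i z))" by (simp add: mult_ac)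
      ultimately show "coeff (v i) j * cf (\<lambda>z. z ^ j * (poly q z * F i z)) n = 0" using q i by simp
    qed
    finally show ?thesis .
  qed
  then show "solves n q" using q by (simp add: solves_def)
qed

lemma hermite_pade_imp_solves:
  assumes hp: "hermite_pade \<mu> d F m n q p" and n: "1 \<le> n"
  shows "solves n q" "lead_coeff q = 1" "q \<noteq> 0"
    and "\<And>i k j. i \<in> {1..d} \<Longrightarrow> k < m i \<Longrightarrow> j \<le> n \<Longrightarrow> cf (\<lambda>z. poly q z * (z ^ k * F i z)) j = cf (poly (p k i)) j"
    and "\<And>i k. i \<in> {1..d} \<Longrightarrow> k < m i \<Longrightarrow> degree (p k i) \<le> n - 1"
proof -
  show q: "lead_coeff q = 1" "q \<noteq> 0" using hp by (simp_all add: hermite_pade_def)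
  show dp: "degree (p k i) \<le> n - 1" if "i \<in> {1..d}" "k < m i" for i k
    using hp that unfolding hermite_pade_def by blast
  show eq: "cf (\<lambda>z. poly q z * (z ^ k * F i z)) j = cf (poly (p k i)) j" if i: "i \<in> {1..d}" "k < m i" "j \<le> n" for i k j
  proof -
    have "inner_prod \<mu> (\<lambda>z. poly q z * z ^ k * F i z - poly (p k i) z) (poly (op j)) = 0"
      using hp i unfolding hermite_pade_def by blast
    then have "cf (\<lambda>z. poly q z * (z ^ k * F i z) - poly (p k i) z) j = 0" by (simp add: cf_def mult.assoc)
    then show ?thesis by (subst (asm) cf_diff) (auto intro!: continuous_intros basis_cont i)
  qed
  have "cf (\<lambda>z. poly q z * (z ^ k * F i z)) n = 0" if i: "i \<in> {1..d}" "k < m i" for i k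
  proof -
    have "degree (p k i) < n" using dp[OF i] n by simp
    then show ?thesis using eq[OF i order_refl] cf_low by simp
  qed
  moreover have "degree q \<le> M" using hp by (simp add: hermite_pade_def)
  ultimately show "solves n q" unfolding solves_iff by blast
qed

lemma solves_imp_hermite_pade:
  assumes s: "solves n q" and q: "lead_coeff q = 1" and n: "1 \<le> n"
  shows "\<exists>p. hermite_pade \<mu> d F m n q p"
proof -
  \<comment> \<open>The partial sum of the orthogonal series; its next term, of index n, is 0
    because q solves the n-th conditions.\<close>
  define p where "p k i = (\<Sum>\<nu><n. smult (cf (\<lambda>z. poly q z * (z ^ k * F i z)) \<nu>) (op \<nu>))" for k i
  have "hermite_pade \<mu> d F m n q p"
    unfolding hermite_pade_def
  proof (intro conjI ballI allI impI)
    show "q \<noteq> 0" "lead_coeff q = 1" "degree q \<le> M" using q s by (auto simp: solves_def)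
    fix i k assume i: "i \<in> {1..d}" and k: "k < m i"
    show "degree (p k i) \<le> n - 1" unfolding p_def
    proof (rule degree_sum_le)
      fix \<nu> assume "\<nu> \<in> {..<n}"
      then show "degree (smult (cf (\<lambda>z. poly q z * (z ^ k * F i z)) \<nu>) (op \<nu>)) \<le> n - 1"
        using degree_smult_le[of "cf (\<lambda>z. poly q z * (z ^ k * F i z)) \<nu>" "op \<nu>"] by (simp add: degree_op)
    qed simp
    fix j assume j: "j \<le> n"
    have cp: "cf (poly (p k i)) j = (\<Sum>\<nu><n. if \<nu> = j then cf (\<lambda>z. poly q z * (z ^ k * F i z)) \<nu> else 0)"
    proof -
      have "cf (poly (p k i)) j = cf (\<lambda>z. \<Sum>\<nu><n. cf (\<lambda>z. poly q z * (z ^ k * F i z)) \<nu> * poly (op \<nu>) z) j"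
        by (rule cf_cong) (simp add: p_def poly_sum)
      also have "\<dots> = (\<Sum>\<nu><n. cf (\<lambda>z. cf (\<lambda>z. poly q z * (z ^ k * F i z)) \<nu> * poly (op \<nu>) z) j)"
        by (rule cf_sum) (auto intro!: continuous_intros)
      also have "\<dots> = (\<Sum>\<nu><n. if \<nu> = j then cf (\<lambda>z. poly q z * (z ^ k * F i z)) \<nu> else 0)"
        by (rule sum.cong) (auto simp: cf_cmult cf_op)
      finally show ?thesis .
    qed
    have "cf (poly (p k i)) j = cf (\<lambda>z. poly q z * (z ^ k * F i z)) j"
    proof (cases "j < n")
      case True then show ?thesis unfolding cp by (subst sum.delta) auto
    next
      case False
      then have "j = n" using j by simp
      moreover have "cf (\<lambda>z. poly q z * (z ^ k * F i z)) n = 0" using s i k unfolding solves_iff by blast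
      ultimately show ?thesis unfolding cp by (subst sum.delta) auto
    qed
    then have "cf (\<lambda>z. poly q z * (z ^ k * F i z) - poly (p k i) z) j = 0"
      by (subst cf_diff) (auto intro!: continuous_intros basis_cont i)
    then show "inner_prod \<mu> (\<lambda>z. poly q z * z ^ k * F i z - poly (p k i) z) (poly (op j)) = 0"
      by (simp add: cf_def mult.assoc)
  qed
  then show ?thesis by blast
qed

lemma solves_diff: "solves n p \<Longrightarrow> solves n q \<Longrightarrow> solves n (p - q)"
  and solves_add: "solves n p \<Longrightarrow> solves n q \<Longrightarrow> solves n (p + q)"
proof -
  assume p: "solves n p" and q: "solves n q"
  have "cf (\<lambda>z. poly (p - q) z * G z) n = 0" if G: "G \<in> V" for G
  proof -
    have "cf (\<lambda>z. poly (p - q) z * G z) n = cf (\<lambda>z. poly p z * G z - poly q z * G z) n"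
      by (rule cf_cong) (simp add: algebra_simps)
    also have "\<dots> = 0" using p q G by (subst cf_diff) (simp_all add: solves_def cont_S_I V_cont)
    finally show ?thesis .
  qed
  then show "solves n (p - q)" using p q unfolding solves_def by (auto intro: degree_diff_le)
  have "cf (\<lambda>z. poly (p + q) z * G z) n = 0" if G: "G \<in> V" for G
  proof -
    have "cf (\<lambda>z. poly (p + q) z * G z) n = cf (\<lambda>z. poly p z * G z + poly q z * G z) n"
      by (rule cf_cong) (simp add: algebra_simps)
    also have "\<dots> = 0" using p q G by (subst cf_add) (simp_all add: solves_def cont_S_I V_cont)
    finally show ?thesis .
  qed
  then show "solves n (p + q)" using p q unfolding solves_def by (auto intro: degree_add_le)
qed

lemma pole_ext_expansion:
  assumes pe: "pole_ext \<rho> \<xi> k G" and \<xi>: "\<xi> \<notin> E" "\<xi> \<in> \<D> \<rho>" and \<rho>: "1 < \<rho>" and k: "1 \<le> k"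
  shows "\<exists>a H. H holomorphic_on \<D> \<rho> \<and> a k \<noteq> 0 \<and>
    (\<forall>z\<in>E. G z = H z + (\<Sum>j=1..k. a j * (1 / (z - \<xi>) ^ j)))"
proof -
  let ?h = "ser (\<lambda>z. (z - \<xi>) ^ k * G z)"
  have h: "?h holomorphic_on \<D> \<rho>" "?h \<xi> \<noteq> 0"
    using pe hol_ext_ser(1)[OF _ \<rho>] by (auto simp: pole_ext_def)
  obtain a H where aH: "H holomorphic_on \<D> \<rho>" "a k = ?h \<xi>"
    "\<And>z. z \<in> \<D> \<rho> - {\<xi>} \<Longrightarrow> ?h z / (z - \<xi>) ^ k = H z + (\<Sum>j=1..k. a j / (z - \<xi>) ^ j)"
    using holomorphic_pole_expansion[OF open_domain[OF \<rho>] \<xi>(2) h(1), of k] k by blast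
  show ?thesis
  proof (intro exI conjI ballI)
    show "H holomorphic_on \<D> \<rho>" by (rule aH(1))
    show "a k \<noteq> 0" using aH(2) h(2) by simp
    fix z assume z: "z \<in> E"
    have "?h z / (z - \<xi>) ^ k = G z" using same_germ_on_E[OF pole_ext_germ_quotient[OF pe \<xi>(1) \<rho>] z] .
    moreover have "z \<in> \<D> \<rho> - {\<xi>}" using z \<xi> E_subset_domain by blast
    ultimately show "G z = H z + (\<Sum>j=1..k. a j * (1 / (z - \<xi>) ^ j))" using aH(3)[of z] by simp
  qed
qed

lemma pole_cont: "\<xi> \<notin> E \<Longrightarrow> continuous_on S (\<lambda>z. 1 / (z - \<xi>) ^ j)"
  by (rule cont_S_hol_ext[OF hol_ext_pole[OF _ order_refl]])

text \<open>Induction on k. For a combination G with a pole of order k, [q G]_n = 0 is solved for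
  the term of (z - \<xi>)^-k, whose coefficient \<open>a k\<close> is not 0; H is holomorphic up to
  R and the lower powers are known. The constant does not depend on the solution q.\<close>

lemma solution_pole_bound:
  assumes \<xi>: "\<xi> \<notin> E" and R: "norm (\<Phi> \<xi>) < R"
    and ex: "\<And>k. k \<in> {1..t} \<Longrightarrow> \<exists>G\<in>V. pole_ext (ereal R) \<xi> k G"
    and r: "1 < r" "r < R" and k: "k \<in> {1..t}"
  shows "\<exists>C\<ge>0. \<forall>n q. solves n q \<longrightarrow> norm (cf (\<lambda>z. poly q z * (1 / (z - \<xi>) ^ k)) n) \<le> C * (1 / r) ^ n * coeff_norm q"
  using k
proof (induction k rule: less_induct)
  case (less k)
  have \<rho>: "\<xi> \<in> \<D> (ereal R)" "1 < ereal R" using lev_pole[OF \<xi>, of "ereal R"] R by auto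
  obtain G where G: "G \<in> V" "pole_ext (ereal R) \<xi> k G" using ex[OF less.prems] by blast
  obtain a H where aH: "H holomorphic_on \<D> (ereal R)" "a k \<noteq> 0"
    "\<And>z. z \<in> E \<Longrightarrow> G z = H z + (\<Sum>j=1..k. a j * (1 / (z - \<xi>) ^ j))"
  proof -
    have "1 \<le> k" using less.prems by simp
    from pole_ext_expansion[OF G(2) \<xi> \<rho> this] show ?thesis using that by metis
  qed
  have "hol_ext E (ereal R) H" by (rule hol_extI[OF aH(1) same_germ_refl])
  from cf_poly_mult_decay[OF this r(1), of M] r(2)
  obtain CH where CH: "CH \<ge> 0" "\<And>n q. degree q \<le> M \<Longrightarrow> norm (cf (\<lambda>z. poly q z * H z) n) \<le> CH * (1 / r) ^ n * coeff_norm q"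
    by auto
  have "\<forall>j\<in>{1..<k}. \<exists>C\<ge>0. \<forall>n q. solves n q \<longrightarrow> norm (cf (\<lambda>z. poly q z * (1 / (z - \<xi>) ^ j)) n) \<le> C * (1 / r) ^ n * coeff_norm q"
    using less.IH less.prems by auto
  from bchoice[OF this] obtain C where C': "\<forall>j\<in>{1..<k}. C j \<ge> 0 \<and> (\<forall>n q. solves n q \<longrightarrow> norm (cf (\<lambda>z. poly q z * (1 / (z - \<xi>) ^ j)) n) \<le> C j * (1 / r) ^ n * coeff_norm q)"
    by blast
  have C: "\<And>j. j \<in> {1..<k} \<Longrightarrow> C j \<ge> 0"
     "\<And>j n q. j \<in> {1..<k} \<Longrightarrow> solves n q \<Longrightarrow> norm (cf (\<lambda>z. poly q z * (1 / (z - \<xi>) ^ j)) n) \<le> C j * (1 / r) ^ n * coeff_norm q"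
    using C' by blast+
  define C' where "C' = (CH + (\<Sum>j\<in>{1..<k}. norm (a j) * C j)) / norm (a k)"
  have C'0: "C' \<ge> 0" unfolding C'_def using CH(1) C(1) by (intro divide_nonneg_nonneg add_nonneg_nonneg sum_nonneg) auto
  have "norm (cf (\<lambda>z. poly q z * (1 / (z - \<xi>) ^ k)) n) \<le> C' * (1 / r) ^ n * coeff_norm q" if s: "solves n q" for n q
  proof -
    let ?A = "\<lambda>j. cf (\<lambda>z. poly q z * (1 / (z - \<xi>) ^ j)) n"
    have "0 = cf (\<lambda>z. poly q z * G z) n" using s G(1) by (simp add: solves_def)
    also have "\<dots> = cf (\<lambda>z. poly q z * H z + (\<Sum>j=1..k. a j * (poly q z * (1 / (z - \<xi>) ^ j)))) n"
    proof (rule cf_cong)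
      fix z assume "z \<in> S"
      then have "z \<in> E" using support_subset by blast
      then show "poly q z * G z = poly q z * H z + (\<Sum>j=1..k. a j * (poly q z * (1 / (z - \<xi>) ^ j)))"
        unfolding aH(3)[OF \<open>z \<in> E\<close>] by (simp only: distrib_left sum_distrib_left mult.left_commute)
    qed
    also have "\<dots> = cf (\<lambda>z. poly q z * H z) n + cf (\<lambda>z. \<Sum>j=1..k. a j * (poly q z * (1 / (z - \<xi>) ^ j))) n"
      by (rule cf_add) (intro continuous_on_sum continuous_on_mult pole_cont[OF \<xi>] cont_on_S[OF aH(1)] continuous_intros)+
    also have "cf (\<lambda>z. \<Sum>j=1..k. a j * (poly q z * (1 / (z - \<xi>) ^ j))) n = (\<Sum>j=1..k. cf (\<lambda>z. a j * (poly q z * (1 / (z - \<xi>) ^ j))) n)"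
      by (rule cf_sum) (intro finite_atLeastAtMost continuous_on_mult pole_cont[OF \<xi>] continuous_intros)+
    also have "\<dots> = (\<Sum>j=1..k. a j * ?A j)" by (simp only: cf_cmult)
    also have "{1..k} = insert k {1..<k}" using less.prems by auto
    also have "(\<Sum>j\<in>insert k {1..<k}. a j * ?A j) = a k * ?A k + (\<Sum>j\<in>{1..<k}. a j * ?A j)" by simp
    finally have "a k * ?A k = - (cf (\<lambda>z. poly q z * H z) n + (\<Sum>j\<in>{1..<k}. a j * ?A j))"
      by (simp add: algebra_simps eq_neg_iff_add_eq_0)
    then have "norm (a k * ?A k) = norm (- (cf (\<lambda>z. poly q z * H z) n + (\<Sum>j\<in>{1..<k}. a j * ?A j)))"
      by (rule arg_cong)
    then have "norm (a k) * norm (?A k) = norm (cf (\<lambda>z. poly q z * H z) n + (\<Sum>j\<in>{1..<k}. a j * ?A j))"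
      unfolding norm_minus_cancel norm_mult[of "a k"] .
    also have "\<dots> \<le> norm (cf (\<lambda>z. poly q z * H z) n) + (\<Sum>j\<in>{1..<k}. norm (a j * ?A j))"
      by (intro norm_triangle_le add_mono order_refl norm_sum)
    also have "\<dots> \<le> CH * (1 / r) ^ n * coeff_norm q + (\<Sum>j\<in>{1..<k}. norm (a j) * (C j * (1 / r) ^ n * coeff_norm q))"
      unfolding norm_mult using s C(2) by (intro add_mono CH(2) sum_mono mult_left_mono) (auto simp: solves_def)
    also have "\<dots> = (CH + (\<Sum>j\<in>{1..<k}. norm (a j) * C j)) * ((1 / r) ^ n * coeff_norm q)"
      by (simp add: distrib_right sum_distrib_right mult.assoc)
    finally have "norm (?A k) \<le> (CH + (\<Sum>j\<in>{1..<k}. norm (a j) * C j)) * ((1 / r) ^ n * coeff_norm q) / norm (a k)"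
      using aH(2) by (simp add: pos_le_divide_eq mult.commute)
    then show ?thesis by (simp add: C'_def mult.assoc)
  qed
  then show ?case using C'0 by blast
qed

text \<open>In the expansion of the \<open>n\<close>-th coefficient of \<open>q / (z - \<xi>)\<^sup>l\<^sup>+\<^sup>1\<close> over the Taylor coefficients of \<open>q\<close>, the
  \<open>l\<close>-th one is multiplied by a second type function, which is bounded below, and the previous ones
  are small by induction.\<close>

lemma solution_jet_bound:
  assumes \<xi>: "\<xi> \<notin> E" and R: "norm (\<Phi> \<xi>) < R"
    and ex: "\<And>k. k \<in> {1..t} \<Longrightarrow> \<exists>G\<in>V. pole_ext (ereal R) \<xi> k G"
    and l: "l < t" and \<eta>: "norm (\<Phi> \<xi>) / R < \<eta>"
  shows "\<exists>C\<ge>0. \<forall>\<^sub>F n in sequentially. \<forall>q. solves n q \<longrightarrow> norm (jet q \<xi> l) \<le> C * \<eta> ^ n * coeff_norm q"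
  using l \<eta>
proof (induction l arbitrary: \<eta> rule: less_induct)
  case (less l)
  define \<phi> where "\<phi> = norm (\<Phi> \<xi>)"
  have \<phi>: "1 < \<phi>" "\<phi> < R" using Phi_gt_1[OF \<xi>] R by (simp_all add: \<phi>_def)
  obtain \<eta>' where \<eta>': "\<phi> / R < \<eta>'" "\<eta>' < \<eta>" using dense[OF less.prems(2)] by (auto simp: \<phi>_def)
  have pos: "0 < \<phi> / R" using \<phi> by simp
  then have \<eta>'0: "0 < \<eta>'" "0 < \<eta>" using \<eta>' by linarith+
  \<comment> \<open>One factor s < 1 moves all rates off their limits: r1 = s \<phi>, r2 = s R, a =
    s / \<phi>. The bound s > 1 / \<phi> keeps r1 above 1, and s^2 \<ge> \<eta>' / \<eta> pays for
    the loss of 1 / s^2, which is why the induction hypothesis is used with \<eta>' <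
    \<eta>.\<close>
  define s where "s = max (sqrt (\<eta>' / \<eta>)) ((1 + 1 / \<phi>) / 2)"
  have s1: "s < 1" using \<eta>' \<eta>'0 \<phi> by (simp add: s_def)
  have s2: "1 / \<phi> < s"
  proof -
    have "1 / \<phi> < 1" using \<phi> by simp
    moreover have "x < (1 + x) / 2" if "x < 1" for x :: real using that by simp
    ultimately have "1 / \<phi> < (1 + 1 / \<phi>) / 2" by blast
    also have "\<dots> \<le> s" by (simp add: s_def)
    finally show ?thesis .
  qed
  have s0: "0 < s" using s2 \<phi> by (meson less_trans zero_less_divide_1_iff zero_less_one)
  have s3: "\<eta>' / s\<^sup>2 \<le> \<eta>"
  proof -
    have "\<eta>' / \<eta> = (sqrt (\<eta>' / \<eta>))\<^sup>2" using \<eta>'0 by simp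
    also have "\<dots> \<le> s\<^sup>2" by (rule power_mono) (use \<eta>'0 in \<open>auto simp: s_def\<close>)
    finally have "\<eta>' \<le> s\<^sup>2 * \<eta>" using \<eta>'0 by (simp add: pos_divide_le_eq)
    then show ?thesis using s0 by (simp add: divide_le_eq mult.commute)
  qed
  define r1 where "r1 = s * \<phi>"
  define r2 where "r2 = s * R"
  define a where "a = s / \<phi>"
  have r1: "1 < r1" "r1 < \<phi>" using s2 s1 \<phi> by (auto simp: r1_def divide_less_eq)
  have r2: "1 < r2" "r2 < R"
  proof -
    have "r1 < r2" using s0 \<phi> by (simp add: r1_def r2_def)
    then show "1 < r2" using r1 by simp
    show "r2 < R" using s1 \<phi> by (simp add: r2_def)
  qed
  have a: "0 < a" "a < 1 / norm (\<Phi> \<xi>)" using s0 s1 \<phi> by (auto simp: a_def divide_strict_right_mono simp flip: \<phi>_def)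
  \<comment> \<open>\<open>q1\<close> is the rate of the whole coefficient, \<open>q2\<close> that
    of the terms with lower Taylor coefficients, both divided by the lower rate a of the second type
    function.\<close>
  have q1: "(1 / r2) / a \<le> \<eta>"
  proof -
    have "(1 / r2) / a = (\<phi> / R) / s\<^sup>2" using s0 \<phi> by (simp add: r2_def a_def power2_eq_square)
    also have "\<dots> \<le> \<eta>' / s\<^sup>2" using \<eta>' by (intro divide_right_mono) auto
    finally show ?thesis using s3 by simp
  qed
  have q2: "\<eta>' * (1 / r1) / a \<le> \<eta>"
  proof -
    have "\<eta>' * (1 / r1) / a = \<eta>' / s\<^sup>2" using s0 \<phi> by (simp add: r1_def a_def power2_eq_square)
    then show ?thesis using s3 by (simp only:)
  qed
  obtain CA where CA: "CA \<ge> 0" "\<And>n q. solves n q \<Longrightarrow> norm (cf (\<lambda>z. poly q z * (1 / (z - \<xi>) ^ Suc l)) n) \<le> CA * (1 / r2) ^ n * coeff_norm q"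
  proof -
    have "Suc l \<in> {1..t}" using less.prems(1) by simp
    from solution_pole_bound[OF \<xi> R ex r2 this] show ?thesis using that by blast
  qed
  have "\<exists>C\<ge>0. \<forall>n. norm (cf (\<lambda>z. 1 / (z - \<xi>) ^ j) n) \<le> C * (1 / r1) ^ n" for j
    by (rule cf_pole_bound[OF \<xi> r1(1)]) (use r1(2) in \<open>simp add: \<phi>_def\<close>)
  then obtain B where B: "\<And>j. B j \<ge> 0" "\<And>j n. norm (cf (\<lambda>z. 1 / (z - \<xi>) ^ j) n) \<le> B j * (1 / r1) ^ n" by metis
  have "\<forall>i\<in>{..<l}. \<exists>C\<ge>0. \<forall>\<^sub>F n in sequentially. \<forall>q. solves n q \<longrightarrow> norm (jet q \<xi> i) \<le> C * \<eta>' ^ n * coeff_norm q"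
    using less.IH less.prems(1) \<eta>'(1) by (auto simp: \<phi>_def)
  from bchoice[OF this] obtain C where C': "\<forall>i\<in>{..<l}. C i \<ge> 0 \<and> (\<forall>\<^sub>F n in sequentially. \<forall>q. solves n q \<longrightarrow> norm (jet q \<xi> i) \<le> C i * \<eta>' ^ n * coeff_norm q)"
    by blast
  have C: "\<And>i. i < l \<Longrightarrow> C i \<ge> 0"
      "\<And>i. i < l \<Longrightarrow> \<forall>\<^sub>F n in sequentially. \<forall>q. solves n q \<longrightarrow> norm (jet q \<xi> i) \<le> C i * \<eta>' ^ n * coeff_norm q"
    using C' by simp_all
  define C' where "C' = CA + (\<Sum>i<l. C i * B (Suc l - i))"
  have C'0: "C' \<ge> 0" unfolding C'_def using CA(1) C(1) B(1) by (intro add_nonneg_nonneg sum_nonneg mult_nonneg_nonneg) auto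
  have evC: "\<forall>\<^sub>F n in sequentially. \<forall>i\<in>{..<l}. \<forall>q. solves n q \<longrightarrow> norm (jet q \<xi> i) \<le> C i * \<eta>' ^ n * coeff_norm q"
    by (rule eventually_ball_finite) (use C(2) in auto)
  have "\<forall>\<^sub>F n in sequentially. \<forall>q. solves n q \<longrightarrow> norm (jet q \<xi> l) \<le> C' * \<eta> ^ n * coeff_norm q"
    using evC second_type_lower_bound[OF \<xi> a] eventually_gt_at_top[of M]
  proof eventually_elim
    case (elim n)
    show ?case
    proof (intro allI impI)
      fix q assume s: "solves n q"
      then have dq: "degree q \<le> M" by (simp add: solves_def)
      let ?\<sigma> = "\<lambda>j. cf (\<lambda>z. 1 / (z - \<xi>) ^ j) n"
      let ?A = "cf (\<lambda>z. poly q z * (1 / (z - \<xi>) ^ Suc l)) n"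
      have "?A = (\<Sum>i<Suc l. jet q \<xi> i * ?\<sigma> (Suc l - i))"
        by (rule cf_poly_over_pole[OF \<xi> dq elim(3)])
      then have "jet q \<xi> l * ?\<sigma> 1 = ?A - (\<Sum>i<l. jet q \<xi> i * ?\<sigma> (Suc l - i))" by simp
      then have "norm (jet q \<xi> l * ?\<sigma> 1) = norm (?A - (\<Sum>i<l. jet q \<xi> i * ?\<sigma> (Suc l - i)))" by (rule arg_cong)
      also have "\<dots> \<le> norm ?A + norm (\<Sum>i<l. jet q \<xi> i * ?\<sigma> (Suc l - i))" by (rule norm_triangle_ineq4)
      also have "\<dots> \<le> norm ?A + (\<Sum>i<l. norm (jet q \<xi> i * ?\<sigma> (Suc l - i)))" by (intro add_left_mono norm_sum)
      finally have "norm (jet q \<xi> l) * norm (?\<sigma> 1) \<le> norm ?A + (\<Sum>i<l. norm (jet q \<xi> i * ?\<sigma> (Suc l - i)))"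
        unfolding norm_mult[of "jet q \<xi> l"] .
      also have "\<dots> \<le> CA * (1 / r2) ^ n * coeff_norm q + (\<Sum>i<l. (C i * \<eta>' ^ n * coeff_norm q) * (B (Suc l - i) * (1 / r1) ^ n))"
      proof (intro add_mono CA(2)[OF s] sum_mono)
        fix i assume i: "i \<in> {..<l}"
        have "0 \<le> C i * \<eta>' ^ n * coeff_norm q" using C(1) i \<eta>'0 by (simp add: coeff_norm_nonneg)
        then show "norm (jet q \<xi> i * ?\<sigma> (Suc l - i)) \<le> (C i * \<eta>' ^ n * coeff_norm q) * (B (Suc l - i) * (1 / r1) ^ n)"
          unfolding norm_mult using elim(1) i s B(2) by (intro mult_mono) auto
      qed
      also have "\<dots> \<le> C' * (\<eta> * a) ^ n * coeff_norm q"
      proof -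
        have e1: "(1 / r2) ^ n \<le> (\<eta> * a) ^ n"
          using q1 a(1) r2 by (intro power_mono) (simp_all only: pos_divide_le_eq, simp)
        have e2: "(\<eta>' * (1 / r1)) ^ n \<le> (\<eta> * a) ^ n"
          using q2 a(1) r1 \<eta>'0 by (intro power_mono) (simp_all only: pos_divide_le_eq, simp)
        have "CA * (1 / r2) ^ n * coeff_norm q \<le> CA * (\<eta> * a) ^ n * coeff_norm q"
          using CA(1) e1 by (intro mult_right_mono mult_left_mono) (auto simp: coeff_norm_nonneg)
        moreover have "(\<Sum>i<l. (C i * \<eta>' ^ n * coeff_norm q) * (B (Suc l - i) * (1 / r1) ^ n)) \<le> (\<Sum>i<l. C i * B (Suc l - i)) * (\<eta> * a) ^ n * coeff_norm q"
        proof -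
          have "(\<Sum>i<l. (C i * \<eta>' ^ n * coeff_norm q) * (B (Suc l - i) * (1 / r1) ^ n)) = (\<Sum>i<l. C i * B (Suc l - i) * (\<eta>' * (1 / r1)) ^ n * coeff_norm q)"
            by (rule sum.cong) (simp_all only: power_mult_distrib mult_ac)
          also have "\<dots> \<le> (\<Sum>i<l. C i * B (Suc l - i) * (\<eta> * a) ^ n * coeff_norm q)"
            using C(1) B(1) e2 by (intro sum_mono mult_right_mono mult_left_mono mult_nonneg_nonneg) (auto simp: coeff_norm_nonneg)
          finally show ?thesis by (simp add: sum_distrib_right)
        qed
        ultimately show ?thesis by (simp add: C'_def distrib_right)
      qed
      finally have main: "norm (jet q \<xi> l) * norm (?\<sigma> 1) \<le> C' * (\<eta> * a) ^ n * coeff_norm q" .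
      have "norm (?\<sigma> 1) = norm (second_type \<mu> n \<xi>)" using cf_simple_pole[OF \<xi>] by simp
      then have "norm (jet q \<xi> l) * a ^ n \<le> norm (jet q \<xi> l) * norm (?\<sigma> 1)"
        using elim(2) by (intro mult_left_mono) auto
      also note main
      finally have "norm (jet q \<xi> l) * a ^ n \<le> (C' * \<eta> ^ n * coeff_norm q) * a ^ n"
        by (simp add: power_mult_distrib mult_ac)
      then show "norm (jet q \<xi> l) \<le> C' * \<eta> ^ n * coeff_norm q" using a by simp
    qed
  qed
  then show ?case using C'0 by blast
qed

lemma ereal_ratio_between:
  fixes \<phi> \<eta> :: real
  assumes "0 < \<phi>" "0 < \<eta>" "ereal \<phi> < \<rho>" "ereal \<phi> / \<rho> < ereal \<eta>"
  obtains R where "\<phi> < R" "ereal R < \<rho>" "\<phi> / R < \<eta>"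
proof -
  have "ereal (\<phi> / \<eta>) < \<rho>"
  proof (cases \<rho>)
    case (real b)
    then have "0 < b" "\<phi> / b < \<eta>" using assms by auto
    then show ?thesis using assms(2) real by (simp add: field_simps)
  qed (use assms in auto)
  then have "ereal (max \<phi> (\<phi> / \<eta>)) < \<rho>" using assms(3) by (simp add: max_def)
  then obtain R where R: "max \<phi> (\<phi> / \<eta>) < R" "ereal R < \<rho>" by (rule ereal_real_between)
  then have R': "\<phi> < R" "\<phi> / \<eta> < R" by simp_all
  then have "\<phi> / R < \<eta>" using assms(1,2) by (simp add: field_simps)
  then show thesis by (rule that[OF R'(1) R(2)])
qed

lemma solution_jets_bound:
  assumes \<xi>: "\<xi> \<in> sp" and t: "t \<in> {1..spo \<xi>}" and l: "l < t" and \<eta>: "0 < \<eta>"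
    and less: "ereal (norm (\<Phi> \<xi>)) / bold_rho_pole E d F m \<xi> t < ereal \<eta>"
  shows "\<exists>C\<ge>0. \<forall>\<^sub>F n in sequentially. \<forall>q. solves n q \<longrightarrow> norm (jet q \<xi> l) \<le> C * \<eta> ^ n * coeff_norm q"
proof -
  have nE: "\<xi> \<notin> E" using system_poleD(1)[OF \<xi>] .
  have "0 < norm (\<Phi> \<xi>)" using Phi_gt_1[OF nE] by linarith
  then obtain R where R: "norm (\<Phi> \<xi>) < R" "ereal R < bold_rho_pole E d F m \<xi> t" "norm (\<Phi> \<xi>) / R < \<eta>"
    using ereal_ratio_between[OF _ \<eta> bold_rho_pole_gt_level[OF \<xi> t] less] by blast
  show ?thesis
  proof (rule solution_jet_bound[OF nE R(1) _ l R(3)])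
    fix k assume k: "k \<in> {1..t}"
    have "ereal R < rho_pole E d F m \<xi> k" using R(2) bold_rho_pole_le[OF k] by (rule less_le_trans)
    then show "\<exists>G\<in>V. pole_ext (ereal R) \<xi> k G" using rho_pole_gt_imp nE k by auto
  qed
qed

lemma system_poly_monic:
  assumes "finite sp"
  shows "degree sys = (\<Sum>\<xi>\<in>sp. spo \<xi>)" "lead_coeff sys = 1"
proof -
  show "degree sys = (\<Sum>\<xi>\<in>sp. spo \<xi>)" unfolding system_poly_def by (rule degree_root_prod[OF assms])
  show "lead_coeff sys = 1" unfolding system_poly_def by (simp add: lead_coeff_prod lead_coeff_power)
qed

text \<open>By interpolation a solution of degree below M has a norm at most K C1 \<eta>^n times
  itself, so it vanishes for large n. For a monic solution q, q - \<open>sys\<close> has degree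
  below M and the same Taylor coefficients at the system poles as q.\<close>

lemma direct_bound:
  assumes a: "has_exactly_system_poles E d F m M" and \<eta>: "0 < \<eta>" "\<eta> < 1"
    and less: "\<And>\<xi>. \<xi> \<in> sp \<Longrightarrow> ereal (norm (\<Phi> \<xi>)) / bold_rho E d F m \<xi> < ereal \<eta>"
  shows "\<forall>\<^sub>F n in sequentially. \<forall>q. solves n q \<longrightarrow> degree q < M \<longrightarrow> q = 0"
    "\<exists>C. \<forall>\<^sub>F n in sequentially. \<forall>q. solves n q \<longrightarrow> lead_coeff q = 1 \<longrightarrow> degree q = M \<and> coeff_norm (q - sys) \<le> C * \<eta> ^ n"
proof -
  have fin: "finite sp" and sum: "(\<Sum>\<xi>\<in>sp. spo \<xi>) = M" using a by (simp_all add: has_exactly_system_poles_def)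
  have "\<forall>x\<in>(SIGMA \<xi>:sp. {..<spo \<xi>}). \<exists>C\<ge>0. \<forall>\<^sub>F n in sequentially. \<forall>q. solves n q \<longrightarrow> norm (jet q (fst x) (snd x)) \<le> C * \<eta> ^ n * coeff_norm q"
  proof
    fix x assume "x \<in> (SIGMA \<xi>:sp. {..<spo \<xi>})"
    then obtain \<xi> l where x: "x = (\<xi>, l)" "\<xi> \<in> sp" "l < spo \<xi>" by auto
    show "\<exists>C\<ge>0. \<forall>\<^sub>F n in sequentially. \<forall>q. solves n q \<longrightarrow> norm (jet q (fst x) (snd x)) \<le> C * \<eta> ^ n * coeff_norm q"
      unfolding x(1) fst_conv snd_conv
      by (rule solution_jets_bound[OF x(2) _ x(3) \<eta>(1)])
         (use less[OF x(2)] system_poleD(2)[OF x(2)] in \<open>auto simp: bold_rho_def\<close>)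
  qed
  from bchoice[OF this] obtain C where C': "\<forall>x\<in>(SIGMA \<xi>:sp. {..<spo \<xi>}). C x \<ge> 0 \<and>
     (\<forall>\<^sub>F n in sequentially. \<forall>q. solves n q \<longrightarrow> norm (jet q (fst x) (snd x)) \<le> C x * \<eta> ^ n * coeff_norm q)"
    by blast
  have C: "\<And>x. x \<in> (SIGMA \<xi>:sp. {..<spo \<xi>}) \<Longrightarrow> C x \<ge> 0"
    "\<And>x. x \<in> (SIGMA \<xi>:sp. {..<spo \<xi>}) \<Longrightarrow> \<forall>\<^sub>F n in sequentially. \<forall>q. solves n q \<longrightarrow> norm (jet q (fst x) (snd x)) \<le> C x * \<eta> ^ n * coeff_norm q"
    using C' by blast+
  obtain K where K: "K \<ge> 0" "\<And>q. degree q < M \<Longrightarrow> coeff_norm q \<le> K * (\<Sum>\<xi>\<in>sp. \<Sum>l<spo \<xi>. norm (jet q \<xi> l))"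
    using hermite_interpolation_bound[OF fin, of spo] sum by auto
  define C1 where "C1 = (\<Sum>\<xi>\<in>sp. \<Sum>l<spo \<xi>. C (\<xi>, l))"
  have C1: "C1 \<ge> 0" unfolding C1_def using C(1) by (intro sum_nonneg) auto
  have fS: "finite (SIGMA \<xi>:sp. {..<spo \<xi>})" using fin by auto
  have ev: "\<forall>\<^sub>F n in sequentially. \<forall>x\<in>(SIGMA \<xi>:sp. {..<spo \<xi>}). \<forall>q. solves n q \<longrightarrow> norm (jet q (fst x) (snd x)) \<le> C x * \<eta> ^ n * coeff_norm q"
    by (rule eventually_ball_finite[OF fS]) (use C(2) in blast)
  then have evs: "\<forall>\<^sub>F n in sequentially. \<forall>q. solves n q \<longrightarrow> (\<Sum>\<xi>\<in>sp. \<Sum>l<spo \<xi>. norm (jet q \<xi> l)) \<le> C1 * \<eta> ^ n * coeff_norm q"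
  proof eventually_elim
    case (elim n)
    show ?case
    proof (intro allI impI)
      fix q assume s: "solves n q"
      have "(\<Sum>\<xi>\<in>sp. \<Sum>l<spo \<xi>. norm (jet q \<xi> l)) \<le> (\<Sum>\<xi>\<in>sp. \<Sum>l<spo \<xi>. C (\<xi>, l) * \<eta> ^ n * coeff_norm q)"
        using elim s by (intro sum_mono) force
      also have "\<dots> = C1 * \<eta> ^ n * coeff_norm q" by (simp add: C1_def sum_distrib_right)
      finally show "(\<Sum>\<xi>\<in>sp. \<Sum>l<spo \<xi>. norm (jet q \<xi> l)) \<le> C1 * \<eta> ^ n * coeff_norm q" .
    qed
  qed
  have "(\<lambda>n. K * C1 * \<eta> ^ n) \<longlonglongrightarrow> K * C1 * 0"
    using \<eta> by (intro tendsto_intros LIMSEQ_power_zero) auto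
  then have small: "\<forall>\<^sub>F n in sequentially. K * C1 * \<eta> ^ n < 1 / 2"
    by (rule order_tendstoD) simp
  show low: "\<forall>\<^sub>F n in sequentially. \<forall>q. solves n q \<longrightarrow> degree q < M \<longrightarrow> q = 0"
    using evs small
  proof eventually_elim
    case (elim n)
    show ?case
    proof (intro allI impI)
      fix q assume s: "solves n q" and d: "degree q < M"
      have "coeff_norm q \<le> K * (\<Sum>\<xi>\<in>sp. \<Sum>l<spo \<xi>. norm (jet q \<xi> l))" by (rule K(2)[OF d])
      also have "\<dots> \<le> K * (C1 * \<eta> ^ n * coeff_norm q)" using elim s K(1) by (intro mult_left_mono) auto
      also have "\<dots> = (K * C1 * \<eta> ^ n) * coeff_norm q" by simp
      also have "\<dots> \<le> 1 / 2 * coeff_norm q" using elim(2) by (intro mult_right_mono) (auto simp: coeff_norm_nonneg)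
      finally have "coeff_norm q = 0" using coeff_norm_nonneg[of q] by linarith
      then show "q = 0" by (simp add: coeff_norm_eq_0)
    qed
  qed
  have "\<forall>\<^sub>F n in sequentially. \<forall>q. solves n q \<longrightarrow> lead_coeff q = 1 \<longrightarrow> degree q = M \<and> coeff_norm (q - sys) \<le> 2 * K * C1 * coeff_norm sys * \<eta> ^ n"
    using evs small low
  proof eventually_elim
    case (elim n)
    show ?case
    proof (intro allI impI)
      fix q assume s: "solves n q" and lc: "lead_coeff q = 1"
      have "q \<noteq> 0" using lc by auto
      then have dq: "degree q = M" using elim(3) s by (force simp: solves_def)
      have dd: "degree (q - sys) < M"
      proof -
        have "degree (q - sys) \<le> M" using dq system_poly_monic[OF fin] sum by (intro degree_diff_le) auto
        moreover have "coeff (q - sys) M = 0" using dq lc system_poly_monic[OF fin] sum by simp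
        ultimately show ?thesis using M_pos by (metis le_neq_implies_less leading_coeff_0_iff degree_0 not_one_le_zero)
      qed
      have jets: "jet (q - sys) \<xi> l = jet q \<xi> l" if "\<xi> \<in> sp" "l < spo \<xi>" for \<xi> l
      proof -
        have "[:- \<xi>, 1:] ^ spo \<xi> dvd sys" unfolding system_poly_def by (rule dvd_prodI[OF fin that(1)])
        then have "jet sys \<xi> l = 0" using that(2) by (rule jet_vanish)
        then show ?thesis by (simp add: jet_diff)
      qed
      have "coeff_norm (q - sys) \<le> K * (\<Sum>\<xi>\<in>sp. \<Sum>l<spo \<xi>. norm (jet (q - sys) \<xi> l))" by (rule K(2)[OF dd])
      also have "\<dots> = K * (\<Sum>\<xi>\<in>sp. \<Sum>l<spo \<xi>. norm (jet q \<xi> l))" using jets by simp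
      also have "\<dots> \<le> K * (C1 * \<eta> ^ n * coeff_norm q)" using elim(1) s K(1) by (intro mult_left_mono) auto
      also have "\<dots> = (K * C1 * \<eta> ^ n) * coeff_norm q" by simp
      also have "\<dots> \<le> (K * C1 * \<eta> ^ n) * (coeff_norm (q - sys) + coeff_norm sys)"
      proof (rule mult_left_mono)
        show "coeff_norm q \<le> coeff_norm (q - sys) + coeff_norm sys" using coeff_norm_triangle[of "q - sys" sys] by simp
        show "0 \<le> K * C1 * \<eta> ^ n" using K(1) C1 \<eta> by simp
      qed
      \<comment> \<open>Since K C1 \<eta>^n < 1/2, half of the left side is absorbed; hence the
        factor 2 in the constant.\<close>
      also have "\<dots> \<le> 1 / 2 * coeff_norm (q - sys) + (K * C1 * \<eta> ^ n) * coeff_norm sys"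
      proof -
        have "(K * C1 * \<eta> ^ n) * coeff_norm (q - sys) \<le> 1 / 2 * coeff_norm (q - sys)"
          by (rule mult_right_mono[OF less_imp_le[OF elim(2)] coeff_norm_nonneg])
        then show ?thesis unfolding distrib_left by (rule add_right_mono)
      qed
      finally show "degree q = M \<and> coeff_norm (q - sys) \<le> 2 * K * C1 * coeff_norm sys * \<eta> ^ n"
        using dq by (simp add: mult_ac)
    qed
  qed
  then show "\<exists>C. \<forall>\<^sub>F n in sequentially. \<forall>q. solves n q \<longrightarrow> lead_coeff q = 1 \<longrightarrow> degree q = M \<and> coeff_norm (q - sys) \<le> C * \<eta> ^ n"
    by blast
qed

end

section \<open>From the denominators to system poles\<close>

abbreviation lin_prod :: "complex list \<Rightarrow> complex \<Rightarrow> complex" where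
  "lin_prod xs z \<equiv> (\<Prod>a\<leftarrow>xs. z - a)"

lemma lin_prod_hol [holomorphic_intros]: "(\<lambda>z. lin_prod xs z) holomorphic_on A"
  by (induction xs) (auto intro!: holomorphic_intros)

lemma lin_prod_eq_0_iff: "lin_prod xs z = 0 \<longleftrightarrow> z \<in> set xs"
  by (induction xs) auto

context hp_setting
begin

text \<open>Any order of the pairs (i, k) will do. It makes the coefficients of a single polynomial
  coordinates, so that the dimension count for polynomials applies to combinations.\<close>

definition basis_enum :: "nat \<Rightarrow> nat \<times> nat" where
  "basis_enum = (SOME e. bij_betw e {..<M} (SIGMA i:{1..d}. {..<m i}))"

lemma basis_enum_bij: "bij_betw basis_enum {..<M} (SIGMA i:{1..d}. {..<m i})"
proof -
  have "card (SIGMA i:{1..d}. {..<m i}) = M" by (simp add: msize_def card_SigmaI)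
  then have "\<exists>e. bij_betw e {..<M} (SIGMA i:{1..d}. {..<m i})"
    using ex_bij_betw_nat_finite[of "SIGMA i:{1..d}. {..<m i}"] by (simp add: atLeast0LessThan)
  then show ?thesis unfolding basis_enum_def by (rule someI_ex)
qed

definition basis_fun :: "nat \<Rightarrow> complex \<Rightarrow> complex" where
  "basis_fun j z = z ^ snd (basis_enum j) * F (fst (basis_enum j)) z"

text \<open>A combination is encoded by a polynomial of degree less than \<open>M\<close>, whose coefficients are the
  coordinates with respect to the functions \<open>z\<^sup>k F\<^sub>i\<close>.\<close>

definition comb :: "complex poly \<Rightarrow> complex \<Rightarrow> complex" where
  "comb c z = (\<Sum>j<M. coeff c j * basis_fun j z)"

lemma basis_fun_in_V: "j < M \<Longrightarrow> basis_fun j \<in> V"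
proof -
  assume "j < M"
  then have "basis_enum j \<in> (SIGMA i:{1..d}. {..<m i})" using basis_enum_bij by (auto simp: bij_betw_def)
  then have "fst (basis_enum j) \<in> {1..d}" "snd (basis_enum j) < m (fst (basis_enum j))" by auto
  from basis_in_V[OF this] show ?thesis unfolding basis_fun_def .
qed

lemma V_zero: "(\<lambda>z. 0) \<in> V"
  unfolding poly_combinations_def using m_pos by (intro CollectI exI[of _ "\<lambda>_. 0"]) (auto simp: Suc_le_eq)

lemma V_add: "f \<in> V \<Longrightarrow> g \<in> V \<Longrightarrow> (\<lambda>z. f z + g z) \<in> V"
proof -
  assume "f \<in> V" "g \<in> V"
  then obtain u v :: "nat \<Rightarrow> complex poly" where
    u: "f = (\<lambda>z. \<Sum>i=1..d. poly (u i) z * F i z)" "\<forall>i\<in>{1..d}. degree (u i) < m i" and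
    v: "g = (\<lambda>z. \<Sum>i=1..d. poly (v i) z * F i z)" "\<forall>i\<in>{1..d}. degree (v i) < m i"
    unfolding poly_combinations_def by blast
  have "(\<lambda>z. f z + g z) = (\<lambda>z. \<Sum>i=1..d. poly (u i + v i) z * F i z)"
    by (simp add: u(1) v(1) sum.distrib distrib_right)
  moreover have "\<forall>i\<in>{1..d}. degree (u i + v i) < m i" using u(2) v(2) by (auto intro: degree_add_less)
  ultimately show ?thesis unfolding poly_combinations_def by (intro CollectI exI[of _ "\<lambda>i. u i + v i"]) auto
qed

lemma V_cmult: "f \<in> V \<Longrightarrow> (\<lambda>z. c * f z) \<in> V"
proof -
  assume "f \<in> V"
  then obtain u :: "nat \<Rightarrow> complex poly" where
    u: "f = (\<lambda>z. \<Sum>i=1..d. poly (u i) z * F i z)" "\<forall>i\<in>{1..d}. degree (u i) < m i"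
    unfolding poly_combinations_def by blast
  have "(\<lambda>z. c * f z) = (\<lambda>z. \<Sum>i=1..d. poly (smult c (u i)) z * F i z)"
    by (simp add: u(1) sum_distrib_left mult.assoc)
  moreover have "\<forall>i\<in>{1..d}. degree (smult c (u i)) < m i"
    using u(2) by (auto intro: le_less_trans[OF degree_smult_le])
  ultimately show ?thesis unfolding poly_combinations_def by (intro CollectI exI[of _ "\<lambda>i. smult c (u i)"]) auto
qed

lemma V_sum: "finite A \<Longrightarrow> (\<And>j. j \<in> A \<Longrightarrow> f j \<in> V) \<Longrightarrow> (\<lambda>z. \<Sum>j\<in>A. f j z) \<in> V"
  by (induction A rule: finite_induct) (simp_all add: V_zero V_add)

lemma comb_in_V: "comb c \<in> V"
proof -
  have "(\<lambda>z. \<Sum>j<M. coeff c j * basis_fun j z) \<in> V"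
    by (rule V_sum) (auto intro: V_cmult basis_fun_in_V)
  then show ?thesis by (simp add: comb_def[abs_def])
qed

lemma comb_add: "comb (smult \<alpha> a + smult \<beta> b) z = \<alpha> * comb a z + \<beta> * comb b z"
  by (simp add: comb_def sum.distrib distrib_right sum_distrib_left mult.assoc)

lemma comb_smult: "comb (smult \<alpha> a) z = \<alpha> * comb a z"
  by (simp add: comb_def sum_distrib_left mult.assoc)

lemma solves_iff_basis: "solves n q \<longleftrightarrow> degree q \<le> M \<and> (\<forall>j<M. cf (\<lambda>z. poly q z * basis_fun j z) n = 0)"
proof -
  have "(\<forall>j<M. cf (\<lambda>z. poly q z * basis_fun j z) n = 0) \<longleftrightarrow> (\<forall>i\<in>{1..d}. \<forall>k<m i. cf (\<lambda>z. poly q z * (z ^ k * F i z)) n = 0)"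
  proof
    assume l: "\<forall>j<M. cf (\<lambda>z. poly q z * basis_fun j z) n = 0"
    show "\<forall>i\<in>{1..d}. \<forall>k<m i. cf (\<lambda>z. poly q z * (z ^ k * F i z)) n = 0"
    proof (intro ballI allI impI)
      fix i k assume "i \<in> {1..d}" "k < m i"
      then have "(i, k) \<in> basis_enum ` {..<M}" using bij_betw_imp_surj_on[OF basis_enum_bij] by simp
      then obtain j where j: "j < M" "basis_enum j = (i, k)" by auto
      have "basis_fun j = (\<lambda>z. z ^ k * F i z)" by (rule ext) (simp add: basis_fun_def j)
      then show "cf (\<lambda>z. poly q z * (z ^ k * F i z)) n = 0" using l j(1) by force
    qed
  next
    assume r: "\<forall>i\<in>{1..d}. \<forall>k<m i. cf (\<lambda>z. poly q z * (z ^ k * F i z)) n = 0"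
    show "\<forall>j<M. cf (\<lambda>z. poly q z * basis_fun j z) n = 0"
    proof (intro allI impI)
      fix j assume "j < M"
      then have "basis_enum j \<in> (SIGMA i:{1..d}. {..<m i})" using basis_enum_bij by (auto simp: bij_betw_def)
      then have "fst (basis_enum j) \<in> {1..d}" "snd (basis_enum j) < m (fst (basis_enum j))" by auto
      then show "cf (\<lambda>z. poly q z * basis_fun j z) n = 0" using r unfolding basis_fun_def by blast
    qed
  qed
  then show ?thesis unfolding solves_iff by simp
qed

lemma cf_poly_mult_add:
  assumes "continuous_on S G"
  shows "cf (\<lambda>z. poly (p + q) z * G z) n = cf (\<lambda>z. poly p z * G z) n + cf (\<lambda>z. poly q z * G z) n"
    "cf (\<lambda>z. poly (smult c q) z * G z) n = c * cf (\<lambda>z. poly q z * G z) n"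
proof -
  have "cf (\<lambda>z. poly (p + q) z * G z) n = cf (\<lambda>z. poly p z * G z + poly q z * G z) n"
    by (rule cf_cong) (simp add: algebra_simps)
  also have "\<dots> = cf (\<lambda>z. poly p z * G z) n + cf (\<lambda>z. poly q z * G z) n"
    using assms by (intro cf_add cont_S_I)
  finally show "cf (\<lambda>z. poly (p + q) z * G z) n = cf (\<lambda>z. poly p z * G z) n + cf (\<lambda>z. poly q z * G z) n" .
  have "cf (\<lambda>z. poly (smult c q) z * G z) n = cf (\<lambda>z. c * (poly q z * G z)) n"
    by (rule cf_cong) (simp add: mult.assoc)
  then show "cf (\<lambda>z. poly (smult c q) z * G z) n = c * cf (\<lambda>z. poly q z * G z) n" by (simp only: cf_cmult)
qed

text \<open>Applies \<open>cf_poly_mult_bound\<close> to G minus the first N terms of its series.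
  The bound is independent of n and holds for all q with the same maximum on the support.\<close>

lemma cf_tail:
  assumes G: "hol_ext E \<rho> G" "1 < \<rho>" and q: "\<And>z. z \<in> S \<Longrightarrow> norm (poly q z) \<le> B" "B \<ge> 0"
  shows "norm (cf (\<lambda>z. poly q z * G z) n - (\<Sum>k<N. cf G k * cf (poly (q * op k)) n)) \<le> B * (\<Sum>\<nu>. norm (cf G (\<nu> + N)))"
proof -
  let ?p = "\<Sum>k<N. smult (cf G k) (op k)"
  let ?G = "\<lambda>z. G z + (-1) * poly ?p z"
  have cG: "continuous_on S G" by (rule cont_S_hol_ext[OF G(1)])
  have "poly ?p holomorphic_on A" for A by (intro holomorphic_intros)
  then have "hol_ext E \<rho> (poly ?p)" by (intro hol_extI[OF _ same_germ_refl])
  then have hG: "hol_ext E \<rho> ?G" by (intro hol_ext_add hol_ext_cmult G)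
  have cfp: "cf (poly ?p) \<nu> = (if \<nu> < N then cf G \<nu> else 0)" for \<nu>
  proof -
    have "cf (poly ?p) \<nu> = cf (\<lambda>z. \<Sum>k<N. cf G k * poly (op k) z) \<nu>"
      by (rule cf_cong) (simp add: poly_sum)
    also have "\<dots> = (\<Sum>k<N. cf (\<lambda>z. cf G k * poly (op k) z) \<nu>)" by (rule cf_sum) (auto intro!: continuous_intros)
    also have "\<dots> = (\<Sum>k<N. if k = \<nu> then cf G k else 0)" by (rule sum.cong) (auto simp: cf_cmult cf_op)
    also have "\<dots> = (if \<nu> < N then cf G \<nu> else 0)" by (subst sum.delta) auto
    finally show ?thesis .
  qed
  have cfG: "cf ?G \<nu> = (if \<nu> < N then 0 else cf G \<nu>)" for \<nu>
  proof -
    have "cf ?G \<nu> = cf G \<nu> + cf (\<lambda>z. (-1) * poly ?p z) \<nu>" by (rule cf_add) (intro continuous_intros cG)+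
    also have "cf (\<lambda>z. (-1) * poly ?p z) \<nu> = (-1) * (if \<nu> < N then cf G \<nu> else 0)"
      by (simp only: cf_cmult cfp)
    finally show ?thesis by simp
  qed
  have "cf (\<lambda>z. poly q z * ?G z) n = cf (\<lambda>z. poly q z * G z) n - (\<Sum>k<N. cf G k * cf (poly (q * op k)) n)"
  proof -
    have "cf (\<lambda>z. poly q z * ?G z) n = cf (\<lambda>z. poly q z * G z - (\<Sum>k<N. cf G k * poly (q * op k) z)) n"
      by (rule cf_cong) (simp add: poly_sum algebra_simps sum_distrib_left sum_negf)
    also have "\<dots> = cf (\<lambda>z. poly q z * G z) n - cf (\<lambda>z. \<Sum>k<N. cf G k * poly (q * op k) z) n"
      by (rule cf_diff) (intro continuous_intros cG)+
    also have "cf (\<lambda>z. \<Sum>k<N. cf G k * poly (q * op k) z) n = (\<Sum>k<N. cf (\<lambda>z. cf G k * poly (q * op k) z) n)"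
      by (rule cf_sum) (auto intro!: continuous_intros)
    finally show ?thesis by (simp only: cf_cmult)
  qed
  moreover have "norm (cf (\<lambda>z. poly q z * ?G z) n) \<le> B * (\<Sum>\<nu>. norm (cf ?G \<nu>))"
    by (rule cf_poly_mult_bound(2)[OF hG G(2) q])
  moreover have "(\<Sum>\<nu>. norm (cf ?G \<nu>)) = (\<Sum>\<nu>. norm (cf G (\<nu> + N)))"
  proof -
    have "summable (\<lambda>\<nu>. norm (cf ?G \<nu>))" by (rule cf_poly_mult_bound(1)[OF hG G(2) q])
    then have "(\<Sum>\<nu>. norm (cf ?G \<nu>)) = (\<Sum>\<nu>. norm (cf ?G (\<nu> + N))) + (\<Sum>\<nu><N. norm (cf ?G \<nu>))"
      by (rule suminf_split_initial_segment)
    also have "(\<Sum>\<nu><N. norm (cf ?G \<nu>)) = 0" unfolding cfG by simp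
    finally show ?thesis unfolding cfG by simp
  qed
  ultimately show ?thesis by simp
qed

end

text \<open>Assertion (b) for one \<eta> < 1 above the limit \<theta>, in terms of
  \<open>solves\<close>. Uniqueness of the denominators takes the form that no nonzero solution has
  degree below M.\<close>

locale inverse_setting = hp_setting E \<mu> d F m for E \<mu> d F m +
  fixes Q :: "nat \<Rightarrow> complex poly" and L :: "complex poly" and \<eta> :: real
  assumes Q_solves: "\<forall>\<^sub>F n in sequentially. solves n (Q n) \<and> lead_coeff (Q n) = 1 \<and> degree (Q n) = msize d m"
    and Q_unique: "\<forall>\<^sub>F n in sequentially. \<forall>q. solves n q \<longrightarrow> degree q < msize d m \<longrightarrow> q = 0"
    and Q_conv: "\<forall>\<^sub>F n in sequentially. coeff_norm (Q n - L) \<le> \<eta> ^ n"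
    and eta: "0 < \<eta>" "\<eta> < 1"
    and L: "degree L = msize d m" "lead_coeff L = 1"
    and kap: "\<exists>c>0. \<exists>n0\<ge>msize d m. \<forall>n\<ge>n0. kappa \<mu> (n - msize d m) / kappa \<mu> n \<ge> c"
begin

lemma limit_mult_hol_ext:
  assumes G: "G \<in> V" "hol_ext E (ereal \<rho>) G" and \<rho>: "1 < \<rho>"
  shows "hol_ext E (ereal (\<rho> / \<eta>)) (\<lambda>z. poly L z * G z)"
proof -
  have \<rho>1: "1 < ereal \<rho>" using \<rho> by simp
  have "\<rho> < \<rho> / \<eta>" using eta \<rho> by (simp add: field_simps)
  then have \<rho>2: "1 < \<rho> / \<eta>" using \<rho> by simp
  have "decays (ereal (\<rho> / \<eta>)) (\<lambda>z. poly L z * G z)"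
    unfolding decays_def
  proof (intro allI impI)
    fix R :: real assume R: "1 < R" "ereal R < ereal (\<rho> / \<eta>)"
    then have "\<eta> * R < \<rho>" using eta by (simp add: field_simps)
    \<comment> \<open>R < \<rho> / \<eta> leaves room for an r < \<rho> with \<eta> / r \<le> 1 /
      R.\<close>
    then obtain r where r: "max 1 (\<eta> * R) < r" "r < \<rho>" using dense[of "max 1 (\<eta> * R)" \<rho>] \<rho> by auto
    then have r': "1 < r" "\<eta> / r \<le> 1 / R" using R by (auto simp: field_simps)
    have "ereal r < ereal \<rho>" using r(2) by simp
    from cf_poly_mult_decay[OF G(2) r'(1) this, of M]
    obtain C where C: "C \<ge> 0" "\<And>n q. degree q \<le> M \<Longrightarrow> norm (cf (\<lambda>z. poly q z * G z) n) \<le> C * (1 / r) ^ n * coeff_norm q"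
      by blast
    have "\<forall>\<^sub>F n in sequentially. norm (cf (\<lambda>z. poly L z * G z) n) \<le> C * (1 / R) ^ n"
      using Q_solves Q_conv
    proof eventually_elim
      case (elim n)
      have "cf (\<lambda>z. poly L z * G z) n = cf (\<lambda>z. poly (L - Q n) z * G z) n + cf (\<lambda>z. poly (Q n) z * G z) n"
        using cf_poly_mult_add(1)[OF V_cont[OF G(1)], of "L - Q n" "Q n"] by simp
      also have "cf (\<lambda>z. poly (Q n) z * G z) n = 0" using elim(1) G(1) by (simp add: solves_def)
      finally have "norm (cf (\<lambda>z. poly L z * G z) n) = norm (cf (\<lambda>z. poly (L - Q n) z * G z) n)" by simp
      also have "\<dots> \<le> C * (1 / r) ^ n * coeff_norm (L - Q n)"
        by (rule C(2)) (use elim(1) L in \<open>auto intro: degree_diff_le\<close>)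
      also have "\<dots> \<le> C * (1 / r) ^ n * \<eta> ^ n"
        using elim(2) C(1) r'(1) by (intro mult_left_mono) (auto simp: coeff_norm_minus_commute)
      also have "\<dots> = C * (\<eta> / r) ^ n" by (simp add: power_divide)
      also have "\<dots> \<le> C * (1 / R) ^ n" using C(1) r' eta by (intro mult_left_mono power_mono) auto
      finally show ?case .
    qed
    moreover have "1 / R > 0" using R by simp
    ultimately obtain C' where "C' \<ge> 0" "\<And>n. norm (cf (\<lambda>z. poly L z * G z) n) \<le> C' * (1 / R) ^ n"
      by (rule eventually_geometric_bound) blast
    then show "\<exists>C\<ge>0. \<forall>n. norm (cf (\<lambda>z. poly L z * G z) n) \<le> C * (1 / R) ^ n" by blast
  qed
  moreover have "hol_ext E (ereal \<rho>) (\<lambda>z. poly L z * G z)" by (rule hol_ext_poly_mult[OF G(2)])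
  moreover have "1 < ereal (\<rho> / \<eta>)" using \<rho>2 by simp
  ultimately show ?thesis using hol_ext_iff_decays \<rho>1 by blast
qed

text \<open>Choose a coordinate j0 of c that is not 0. The other M - 1 conditions have a nonzero
  common solution q of degree below M; if also [q comb c]_n = 0, then the condition of j0 holds and
  q contradicts uniqueness.\<close>

lemma coefficient_rank:
  assumes c: "c \<in> below M" "c \<noteq> 0"
  shows "\<forall>\<^sub>F n in sequentially. \<exists>q. degree q < M \<and> cf (\<lambda>z. poly q z * comb c z) n \<noteq> 0"
  using Q_unique
proof eventually_elim
  case (elim n)
  show ?case
  proof (rule ccontr)
    assume neg: "\<not> ?thesis"
    obtain j0 where j0: "j0 < M" "coeff c j0 \<noteq> 0"
      using c unfolding below_def by (metis (mono_tags, lifting) leading_coeff_0_iff mem_Collect_eq not_le)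
    let ?J = "{..<M} - {j0}"
    define l where "l j q = cf (\<lambda>z. poly q z * basis_fun j z) n" for j q
    have cont: "continuous_on S (basis_fun j)" if "j < M" for j using V_cont[OF basis_fun_in_V[OF that]] .
    have "\<exists>q\<in>below M. q \<noteq> 0 \<and> (\<forall>j\<in>?J. l j q = 0)"
    proof (rule underdetermined_system)
      show "card ?J < M" using j0 by simp
      show "finite ?J" by simp
      fix j p q assume "j \<in> ?J"
      then have "j < M" by simp
      then show "l j (p + q) = l j p + l j q" unfolding l_def by (rule cf_poly_mult_add(1)[OF cont])
    next
      fix j c q assume "j \<in> ?J"
      then have "j < M" by simp
      then show "l j (smult c q) = c * l j q" unfolding l_def by (rule cf_poly_mult_add(2)[OF cont])
    qed
    then obtain q where q: "q \<in> below M" "q \<noteq> 0" "\<And>j. j \<in> ?J \<Longrightarrow> l j q = 0" by blast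
    have dq: "degree q < M" using below_degree[OF q(1)] j0 by simp
    have "0 = cf (\<lambda>z. poly q z * comb c z) n" using neg dq by auto
    also have "\<dots> = cf (\<lambda>z. \<Sum>j<M. coeff c j * (poly q z * basis_fun j z)) n"
      by (rule cf_cong) (simp add: comb_def sum_distrib_left mult_ac)
    also have "\<dots> = (\<Sum>j<M. cf (\<lambda>z. coeff c j * (poly q z * basis_fun j z)) n)"
      by (rule cf_sum) (auto intro!: continuous_intros cont)
    also have "\<dots> = (\<Sum>j<M. coeff c j * l j q)" by (simp only: cf_cmult l_def)
    also have "\<dots> = coeff c j0 * l j0 q + (\<Sum>j\<in>?J. coeff c j * l j q)"
      by (rule sum.remove) (use j0 in auto)
    also have "(\<Sum>j\<in>?J. coeff c j * l j q) = 0" by (rule sum.neutral) (use q(3) in auto)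
    finally have "l j0 q = 0" using j0(2) by simp
    then have "l j q = 0" if "j < M" for j using q(3) that by (cases "j = j0") auto
    then have "solves n q" unfolding solves_iff_basis using dq by (simp add: l_def)
    then show False using elim dq q(2) by blast
  qed
qed

text \<open>The lower bound on \<open>\<kappa>\<^sub>n\<^sub>-\<^sub>M / \<kappa>\<^sub>n\<close> makes \<open>|[G]\<^sub>n\<^sub>-\<^sub>M|\<close> at most a constant times the tail sum
  of the later coefficients, so these cannot decay faster than every geometric sequence.\<close>

lemma entire_comb_zero:
  assumes c: "c \<in> below M" and ent: "\<And>R. 1 < R \<Longrightarrow> hol_ext E (ereal R) (comb c)"
  shows "c = 0"
proof (rule ccontr)
  assume c0: "c \<noteq> 0"
  let ?G = "comb c"
  obtain \<kappa>0 n0 where kap': "\<kappa>0 > 0" "n0 \<ge> M" "\<And>n. n \<ge> n0 \<Longrightarrow> kappa \<mu> (n - M) / kappa \<mu> n \<ge> \<kappa>0" using kap by blast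
  obtain B0 where B0: "B0 > 0" "\<And>z. z \<in> S \<Longrightarrow> norm z \<le> B0" using bounded_support by (auto simp: bounded_pos)
  define B1 where "B1 = max B0 1"
  have B1: "1 \<le> B1" "\<And>z. z \<in> S \<Longrightarrow> norm z \<le> B1" using B0(2) by (auto simp: B1_def le_max_iff_disj)
  define B where "B = B1 ^ M * (coeff_norm L + 1)"
  have B: "B \<ge> 0" using B1 coeff_norm_nonneg[of L] by (simp add: B_def)
  have G2: "hol_ext E (ereal 2) ?G" "1 < ereal 2" using ent by auto
  define T where "T N = (\<Sum>\<nu>. norm (cf ?G (\<nu> + N)))" for N
  have sm: "summable (\<lambda>\<nu>. norm (cf ?G \<nu>))"
    by (rule cf_poly_mult_bound(1)[OF G2, of 1 1]) auto
  then have smN: "summable (\<lambda>\<nu>. norm (cf ?G (\<nu> + N)))" for N by (rule summable_ignore_initial_segment)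
  have T0: "T N \<ge> 0" for N unfolding T_def by (rule suminf_nonneg[OF smN]) auto
  have Tsuc: "T N = norm (cf ?G N) + T (Suc N)" for N
    using suminf_split_head[OF smN[of N]] by (simp add: T_def)
  have "\<forall>\<^sub>F n in sequentially. norm (cf ?G (n - M)) \<le> (B / \<kappa>0) * T (Suc (n - M))"
    using Q_solves Q_conv eventually_ge_at_top[of n0]
  proof eventually_elim
    case (elim n)
    have nM: "M \<le> n" using elim kap' by simp
    have Qn: "degree (Q n) = M" "lead_coeff (Q n) = 1" using elim by auto
    have cn: "coeff_norm (Q n) \<le> coeff_norm L + 1"
    proof -
      have "coeff_norm (Q n) \<le> coeff_norm (Q n - L) + coeff_norm L" using coeff_norm_triangle[of "Q n - L" L] by simp
      also have "\<dots> \<le> \<eta> ^ n + coeff_norm L" using elim by simp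
      also have "\<eta> ^ n \<le> 1" using eta by (simp add: power_le_one)
      finally show ?thesis by simp
    qed
    have bQ: "norm (poly (Q n) z) \<le> B" if "z \<in> S" for z
    proof -
      have "norm (poly (Q n) z) \<le> B1 ^ M * coeff_norm (Q n)"
        by (rule poly_norm_le_coeff_norm) (use Qn B1 that in auto)
      also have "\<dots> \<le> B" unfolding B_def using cn B1 by (intro mult_left_mono) auto
      finally show ?thesis .
    qed
    let ?k = "n - M"
    \<comment> \<open>Q_n p_k has degree below n for k < n - M, so no such k contributes to
      [Q_n G]_n. For k = n - M only the leading coefficients count, which gives \<kappa>_(n-M) /
      \<kappa>_n.\<close>
    have low: "cf (poly (Q n * op k)) n = 0" if "k < ?k" for k
    proof (rule cf_low)
      have "degree (Q n * op k) \<le> M + k" using degree_mult_le[of "Q n" "op k"] Qn by (simp add: degree_op)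
      then show "degree (Q n * op k) < n" using that by simp
    qed
    have top: "cf (poly (Q n * op ?k)) n = of_real (kappa \<mu> ?k / kappa \<mu> n)"
    proof -
      have deg: "degree (Q n * op ?k) \<le> n" using degree_mult_le[of "Q n" "op ?k"] Qn nM by (simp add: degree_op)
      have cQ: "coeff (Q n * op ?k) n = of_real (kappa \<mu> ?k)"
        using coeff_mult_degree_sum[of "Q n" "op ?k"] Qn nM lead_op[of ?k] by (simp add: degree_op)
      let ?x = "cf (poly (Q n * op ?k)) n"
      have "coeff (Q n * op ?k) n = coeff (\<Sum>j\<le>n. smult (cf (poly (Q n * op ?k)) j) (op j)) n"
        using cf_expand[OF deg] by simp
      also have "\<dots> = (\<Sum>j\<le>n. if j = n then ?x * coeff (op n) n else 0)"
        unfolding coeff_sum by (rule sum.cong) (auto simp: degree_op intro!: coeff_eq_0)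
      also have "\<dots> = ?x * of_real (kappa \<mu> n)" using lead_op[of n] by (simp add: degree_op)
      finally have "of_real (kappa \<mu> ?k) = ?x * of_real (kappa \<mu> n)" using cQ by simp
      then show ?thesis using kappa_pos[of n] by (simp add: field_simps)
    qed
    have "norm (cf (\<lambda>z. poly (Q n) z * ?G z) n - (\<Sum>k<Suc ?k. cf ?G k * cf (poly (Q n * op k)) n)) \<le> B * T (Suc ?k)"
      unfolding T_def by (rule cf_tail[OF G2 bQ B])
    moreover have "cf (\<lambda>z. poly (Q n) z * ?G z) n = 0" using elim comb_in_V by (simp add: solves_def)
    moreover have "(\<Sum>k<Suc ?k. cf ?G k * cf (poly (Q n * op k)) n) = cf ?G ?k * of_real (kappa \<mu> ?k / kappa \<mu> n)"
      using low top by simp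
    ultimately have "norm (cf ?G ?k) * \<bar>kappa \<mu> ?k / kappa \<mu> n\<bar> \<le> B * T (Suc ?k)"
      by (simp only: diff_0 norm_minus_cancel norm_mult norm_of_real)
    moreover have "\<kappa>0 \<le> \<bar>kappa \<mu> ?k / kappa \<mu> n\<bar>" using kap'(3)[OF elim(3)] by linarith
    ultimately have "norm (cf ?G ?k) * \<kappa>0 \<le> B * T (Suc ?k)"
      by (meson mult_left_mono norm_ge_zero order_trans)
    then show ?case using kap'(1) by (simp add: field_simps)
  qed
  then obtain n1 where n1: "\<And>n. n \<ge> n1 \<Longrightarrow> norm (cf ?G (n - M)) \<le> (B / \<kappa>0) * T (Suc (n - M))"
    by (auto simp: eventually_sequentially)
  define A where "A = 1 + B / \<kappa>0"
  have A: "1 \<le> A" using B kap'(1) by (simp add: A_def)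
  have step: "T k \<le> A * T (Suc k)" if "k \<ge> n1" for k
    using n1[of "k + M"] that Tsuc[of k] by (simp add: A_def algebra_simps)
  have iter: "T n1 \<le> A ^ j * T (n1 + j)" for j
  proof (induction j)
    case (Suc j)
    have "A ^ j * T (n1 + j) \<le> A ^ j * (A * T (n1 + Suc j))"
      using step[of "n1 + j"] A by (intro mult_left_mono) auto
    then show ?case using Suc by (simp add: mult_ac)
  qed simp
  \<comment> \<open>\<open>iter\<close> lets T grow by at most A per step backwards, and an entire G
    has coefficients O(R^-n). With R = 2 A this leaves T n1 = O(2^-j) for every j.\<close>
  define R where "R = 2 * A"
  have R: "1 < R" using A by (simp add: R_def)
  have "decays (ereal (R + 1)) ?G" using hol_ext_ser(3)[OF ent[of "R + 1"]] R by simp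
  then obtain C where C: "C \<ge> 0" "\<And>n. norm (cf ?G n) \<le> C * (1 / R) ^ n"
    using decaysD[of "ereal (R + 1)" ?G R] R by auto
  have Tb: "T k \<le> C * (1 / R) ^ k * (1 / (1 - 1 / R))" for k
  proof -
    have sg: "summable (\<lambda>\<nu>. (1 / R) ^ \<nu>)" using R by (intro summable_geometric) auto
    have "T k \<le> (\<Sum>\<nu>. C * (1 / R) ^ k * (1 / R) ^ \<nu>)"
      unfolding T_def
    proof (rule suminf_le[OF _ smN summable_mult[OF sg]])
      fix \<nu> show "norm (cf ?G (\<nu> + k)) \<le> C * (1 / R) ^ k * (1 / R) ^ \<nu>"
        using C(2)[of "\<nu> + k"] by (simp add: power_add mult_ac)
    qed
    also have "\<dots> = C * (1 / R) ^ k * (\<Sum>\<nu>. (1 / R) ^ \<nu>)" by (rule suminf_mult[OF sg])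
    also have "(\<Sum>\<nu>. (1 / R) ^ \<nu>) = 1 / (1 - 1 / R)" using R by (intro suminf_geometric) auto
    finally show ?thesis .
  qed
  define C' where "C' = C * (1 / R) ^ n1 * (1 / (1 - 1 / R))"
  have le: "T n1 \<le> C' * (1 / 2) ^ j" for j
  proof -
    have "T n1 \<le> A ^ j * (C * (1 / R) ^ (n1 + j) * (1 / (1 - 1 / R)))"
      using iter[of j] mult_left_mono[OF Tb[of "n1 + j"], of "A ^ j"] A by simp
    also have "\<dots> = C' * (A / R) ^ j" by (simp add: C'_def power_add power_divide mult_ac)
    also have "A / R = 1 / 2" using A by (simp add: R_def)
    finally show ?thesis .
  qed
  have "(\<lambda>j. C' * (1 / 2) ^ j) \<longlonglongrightarrow> C' * 0" by (intro tendsto_intros LIMSEQ_power_zero) auto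
  then have "T n1 \<le> C' * 0" by (rule LIMSEQ_le_const) (use le in auto)
  then have Tn1: "T n1 = 0" using T0[of n1] by simp
  \<comment> \<open>All coefficients of G from index n1 on are 0, so [q G]_n = 0 for deg q < M and n
    \<ge> n1 + M, against \<open>coefficient_rank\<close>.\<close>
  have "\<forall>\<^sub>F n in sequentially. False"
    using coefficient_rank[OF c c0] eventually_ge_at_top[of "n1 + M"]
  proof eventually_elim
    case (elim n)
    then obtain q where q: "degree q < M" "cf (\<lambda>z. poly q z * ?G z) n \<noteq> 0" by blast
    have bq: "norm (poly q z) \<le> B1 ^ M * coeff_norm q" if "z \<in> S" for z
      by (rule poly_norm_le_coeff_norm) (use q B1 that in auto)
    have "norm (cf (\<lambda>z. poly q z * ?G z) n - (\<Sum>k<n1. cf ?G k * cf (poly (q * op k)) n)) \<le> (B1 ^ M * coeff_norm q) * T n1"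
      unfolding T_def by (rule cf_tail[OF G2 bq]) (use B1 in \<open>auto simp: coeff_norm_nonneg\<close>)
    moreover have "cf (poly (q * op k)) n = 0" if "k < n1" for k
    proof (rule cf_low)
      have "degree (q * op k) \<le> degree q + k" using degree_mult_le[of q "op k"] by (simp add: degree_op)
      then show "degree (q * op k) < n" using q(1) that elim(2) by simp
    qed
    ultimately have "cf (\<lambda>z. poly q z * ?G z) n = 0" by (simp add: Tn1)
    then show False using q(2) by simp
  qed
  then show False by simp
qed

end

section \<open>The chain of spaces attached to the zeros of L\<close>

lemma lin_prod_append: "lin_prod (xs @ ys) z = lin_prod xs z * lin_prod ys z"
  by simp

lemma lin_prod_mset: "mset xs = mset ys \<Longrightarrow> lin_prod xs z = lin_prod ys z"
  by (metis mset_map prod_mset_prod_list)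

lemma finite_gap:
  fixes A B :: "real set"
  assumes "finite A" "A \<noteq> {}" "finite B" "B \<noteq> {}" and \<eta>: "0 < \<eta>" and lt: "\<And>x y. x \<in> A \<Longrightarrow> y \<in> B \<Longrightarrow> \<eta> * x < y"
  shows "\<exists>R. (\<forall>x\<in>A. x < R) \<and> (\<forall>y\<in>B. \<eta> * R < y)"
proof -
  have "\<eta> * Max A < Min B" using assms by simp
  then have "Max A < Min B / \<eta>" using \<eta> by (simp add: field_simps)
  then obtain R where R: "Max A < R" "R < Min B / \<eta>" using dense by blast
  have "\<forall>x\<in>A. x < R" using R(1) assms(1,2) by auto
  moreover have "\<eta> * R < Min B" using R(2) \<eta> by (simp add: field_simps)
  then have "\<forall>y\<in>B. \<eta> * R < y" using assms(3,4) by auto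
  ultimately show ?thesis by blast
qed

context hp_setting
begin

lemma hol_ext_divide_nonzero:
  assumes h: "hol_ext E \<rho> (\<lambda>z. k z * G z)" and k: "k holomorphic_on \<D> \<rho>" "\<And>z. z \<in> \<D> \<rho> \<Longrightarrow> k z \<noteq> 0" and \<rho>: "1 < \<rho>"
  shows "hol_ext E \<rho> G"
proof (rule hol_ext_germ)
  show "hol_ext E \<rho> (\<lambda>z. (1 / k z) * (k z * G z))"
    by (rule hol_ext_mult_hol[OF h]) (use k in \<open>auto intro!: holomorphic_intros\<close>)
  show "same_germ E (\<lambda>z. (1 / k z) * (k z * G z)) G"
    unfolding same_germ_def using k(2)
    by (intro exI[of _ "\<D> \<rho>"]) (auto simp: open_domain[OF \<rho>] E_subset_domain[THEN subsetD])
qed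

lemma lev_imp_domain: "1 < \<rho> \<Longrightarrow> lev z < \<rho> \<Longrightarrow> z \<in> \<D> (ereal \<rho>)"
  by (subst domain_eq) auto

lemma domain_imp_lev: "1 < \<rho> \<Longrightarrow> z \<in> \<D> (ereal \<rho>) \<Longrightarrow> lev z < \<rho>"
  by (subst (asm) domain_eq) auto

end

context inverse_setting
begin

text \<open>The spaces W_k of the overview. A radius just above the levels of the first k zeros is
  all that is asked for; \<open>chain_hol_ext\<close> shows that it can be enlarged.\<close>

definition chain :: "complex list \<Rightarrow> nat \<Rightarrow> complex poly set" where
  "chain zs k = {c \<in> below M. \<exists>\<rho>>1. (\<forall>x\<in>set (take k zs). lev x < \<rho>) \<and>
     hol_ext E (ereal \<rho>) (\<lambda>z. lin_prod (drop k zs) z * comb c z)}"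

text \<open>A bootstrap. Below the levels of the remaining zeros their factors can be divided out,
  so the combination itself is holomorphic up to some \<sigma>. Multiplication by L carries it to
  \<sigma> / \<eta>, and the first k factors, with zeros inside the known domain, are removed. This
  repeats until R is reached.\<close>

lemma chain_hol_ext:
  assumes zs: "\<And>z. poly L z = lin_prod zs z" and c: "c \<in> chain zs k" and R: "1 < R"
    and lev_R: "\<And>x. x \<in> set (drop k zs) \<Longrightarrow> \<eta> * R < lev x"
  shows "hol_ext E (ereal R) (\<lambda>z. lin_prod (drop k zs) z * comb c z)"
proof -
  let ?g = "\<lambda>z. lin_prod (drop k zs) z * comb c z"
  obtain \<rho> where \<rho>: "1 < \<rho>" "\<And>x. x \<in> set (take k zs) \<Longrightarrow> lev x < \<rho>" "hol_ext E (ereal \<rho>) ?g"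
    using c unfolding chain_def by blast
  have step: "hol_ext E (ereal (\<sigma> / \<eta>)) ?g" if \<sigma>: "1 < \<sigma>" "hol_ext E (ereal \<sigma>) (comb c)" for \<sigma>
  proof -
    have "\<sigma> < \<sigma> / \<eta>" using \<sigma>(1) eta by (simp add: field_simps)
    then have gt: "1 < ereal (\<sigma> / \<eta>)" using \<sigma>(1) by simp
    have "hol_ext E (ereal (\<sigma> / \<eta>)) (\<lambda>z. poly L z * comb c z)"
      by (rule limit_mult_hol_ext[OF comb_in_V \<sigma>(2,1)])
    moreover have "poly L z = lin_prod (take k zs) z * lin_prod (drop k zs) z" for z
      by (metis append_take_drop_id lin_prod_append zs)
    ultimately have "hol_ext E (ereal (\<sigma> / \<eta>)) (\<lambda>z. lin_prod (take k zs) z * ?g z)"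
      by (simp add: mult.assoc)
    moreover have "x \<in> \<D> (ereal \<rho>)" if "x \<in> set (take k zs)" for x
      using \<rho>(1) \<rho>(2)[OF that] by (rule lev_imp_domain)
    ultimately show ?thesis using \<rho>(1) by (intro hol_ext_divide_poly[OF _ \<rho>(3) _ gt]) auto
  qed
  \<comment> \<open>If \<eta> R < 1, one step from the radius r > 1 of the germ already passes R.
    Otherwise 1 \<le> \<eta> R < \<beta>, so that the cap \<beta> exceeds 1.\<close>
  show ?thesis
  proof (cases "\<eta> * R < 1")
    case True
    obtain r where r: "1 < r" "hol_ext E (ereal r) (comb c)" using V_hol_ext[OF comb_in_V] by blast
    have "\<eta> * R \<le> r" using True r(1) by simp
    then have "ereal R \<le> ereal (r / \<eta>)" using eta by (simp add: field_simps)
    then show ?thesis by (rule hol_ext_mono[OF step[OF r]])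
  next
    case False
    \<comment> \<open>Up to this radius the remaining factors have no zeros. As \<eta> R < \<beta>,
      capping \<sigma> at \<beta> does not keep \<sigma> / \<eta> from reaching R.\<close>
    define \<beta> where "\<beta> = Min (insert R (lev ` set (drop k zs)))"
    have "\<eta> * R < R" using R eta by simp
    then have \<beta>: "\<eta> * R < \<beta>" "\<And>x. x \<in> set (drop k zs) \<Longrightarrow> \<beta> \<le> lev x" "1 < \<beta>"
      using lev_R False R by (auto simp: \<beta>_def not_less intro: le_less_trans)
    have "hol_ext E (ereal (min R (\<rho> / \<eta> ^ n))) ?g" for n
    proof (induction n)
      case 0
      show ?case by (rule hol_ext_mono[OF \<rho>(3)]) simp
    next
      case (Suc n)
      define \<sigma> where "\<sigma> = min \<beta> (min R (\<rho> / \<eta> ^ n))"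
      have "\<eta> ^ n \<le> 1" "0 < \<eta> ^ n" using eta by (auto simp: power_le_one)
      then have "1 < \<rho> / \<eta> ^ n" using \<rho>(1) by (simp add: field_simps)
      then have \<sigma>: "1 < \<sigma>" using \<beta> R by (simp add: \<sigma>_def)
      have "hol_ext E (ereal \<sigma>) ?g" unfolding \<sigma>_def
        by (rule hol_ext_mono[OF Suc]) (simp only: ereal_less_eq min.cobounded2)
      then have "hol_ext E (ereal \<sigma>) (comb c)"
      proof (rule hol_ext_divide_nonzero)
        show "(\<lambda>z. lin_prod (drop k zs) z) holomorphic_on \<D> (ereal \<sigma>)" by (rule lin_prod_hol)
        show "1 < ereal \<sigma>" using \<sigma> by simp
        fix z assume "z \<in> \<D> (ereal \<sigma>)"
        then have "lev z < \<beta>" using domain_imp_lev[OF \<sigma>] by (simp add: \<sigma>_def)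
        then show "lin_prod (drop k zs) z \<noteq> 0" using \<beta>(2)[of z] by (auto simp: lin_prod_eq_0_iff)
      qed
      then have "hol_ext E (ereal (\<sigma> / \<eta>)) ?g" by (rule step[OF \<sigma>])
      moreover have "min R (\<rho> / \<eta> ^ Suc n) \<le> \<sigma> / \<eta>"
      proof -
        let ?x = "min R (\<rho> / \<eta> ^ Suc n)"
        have "\<eta> * ?x \<le> \<eta> * R" using eta by (intro mult_left_mono) auto
        moreover have "\<eta> * ?x \<le> \<eta> * (\<rho> / \<eta> ^ Suc n)" using eta by (intro mult_left_mono) auto
        moreover have "\<eta> * (\<rho> / \<eta> ^ Suc n) = \<rho> / \<eta> ^ n" using eta by simp
        ultimately have "\<eta> * ?x \<le> \<beta>" "\<eta> * ?x \<le> R" "\<eta> * ?x \<le> \<rho> / \<eta> ^ n"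
          using \<beta>(1) \<open>\<eta> * R < R\<close> by linarith+
        then have "\<eta> * ?x \<le> \<sigma>" unfolding \<sigma>_def by (intro min.boundedI)
        then show ?thesis using eta by (simp add: field_simps)
      qed
      then have "ereal (min R (\<rho> / \<eta> ^ Suc n)) \<le> ereal (\<sigma> / \<eta>)" by (simp only: ereal_less_eq)
      ultimately show ?case by (rule hol_ext_mono)
    qed
    note ind = this
    obtain n where "(1 / \<eta>) ^ n > R" using real_arch_pow[of "1 / \<eta>" R] eta by auto
    moreover have "1 / \<eta> ^ n \<le> \<rho> / \<eta> ^ n" using \<rho>(1) eta by (intro divide_right_mono) auto
    ultimately have "R \<le> \<rho> / \<eta> ^ n" by (simp add: power_divide)
    then have "min R (\<rho> / \<eta> ^ n) = R" by simp
    with ind[of n] show ?thesis by (simp only:)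
  qed
qed

text \<open>This R serves twice: it is small enough for \<open>chain_hol_ext\<close> at k and large
  enough for membership at k + 1. The k-th zero belongs to both lists, which is consistent since
  \<eta> lev z < lev z.\<close>

lemma chain_radius:
  assumes k: "k < length zs" and ord: "sorted_wrt (\<lambda>x y. \<eta> * lev x < lev y) zs"
  shows "\<exists>R>1. (\<forall>x\<in>set (take (Suc k) zs). lev x < R) \<and> (\<forall>y\<in>set (drop k zs). \<eta> * R < lev y)"
proof -
  have "\<exists>R. (\<forall>x\<in>insert 1 (lev ` set (take (Suc k) zs)). x < R) \<and> (\<forall>y\<in>lev ` set (drop k zs). \<eta> * R < y)"
  proof (rule finite_gap[OF _ _ _ _ eta(1)])
    show "lev ` set (drop k zs) \<noteq> {}" using k by simp
    fix x y assume x: "x \<in> insert 1 (lev ` set (take (Suc k) zs))" and y: "y \<in> lev ` set (drop k zs)"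
    have self: "\<eta> * lev z < lev z" for z using lev_ge_1[of z] eta by simp
    have "sorted_wrt (\<lambda>x y. \<eta> * lev x < lev y) (take k zs @ zs ! k # drop (Suc k) zs)"
      using ord k by (simp add: Cons_nth_drop_Suc)
    then have "\<eta> * lev a < lev b" if "a \<in> set (take (Suc k) zs)" "b \<in> set (drop k zs)" for a b
      using that self[of a] k by (auto simp: sorted_wrt_append take_Suc_conv_app_nth Cons_nth_drop_Suc[symmetric])
    moreover have "\<eta> * 1 < lev b" for b using lev_ge_1[of b] eta by simp
    ultimately show "\<eta> * x < y" using x y by auto
  qed auto
  then obtain R where "\<forall>x\<in>insert 1 (lev ` set (take (Suc k) zs)). x < R" "\<forall>y\<in>lev ` set (drop k zs). \<eta> * R < y"
    by blast
  then show ?thesis by (intro exI[of _ R]) blast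
qed

text \<open>Near \<open>E\<close> the combination is holomorphic in any case, so the factor of a
  zero in \<open>E\<close> divides out at no cost. As no step of the chain can be trivial, this
  excludes zeros of L in \<open>E\<close> (\<open>root_notin_E\<close>).\<close>

lemma chain_subset_if_root_in_E:
  assumes zs: "\<And>z. poly L z = lin_prod zs z" and k: "k < length zs" and ord: "sorted_wrt (\<lambda>x y. \<eta> * lev x < lev y) zs"
    and E: "zs ! k \<in> E"
  shows "chain zs k \<subseteq> chain zs (Suc k)"
proof
  fix c assume c: "c \<in> chain zs k"
  obtain R where R: "R > 1" "\<forall>x\<in>set (take (Suc k) zs). lev x < R" "\<forall>y\<in>set (drop k zs). \<eta> * R < lev y"
    using chain_radius[OF k ord] by blast
  have "hol_ext E (ereal R) (\<lambda>z. lin_prod (drop k zs) z * comb c z)"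
    by (rule chain_hol_ext[OF zs c R(1)]) (use R(3) in blast)
  then have "hol_ext E (ereal R) (\<lambda>z. (z - zs ! k) * (lin_prod (drop (Suc k) zs) z * comb c z))"
    using k by (simp add: Cons_nth_drop_Suc[symmetric] mult.assoc)
  moreover obtain r where r: "1 < r" "hol_ext E (ereal r) (comb c)" using V_hol_ext[OF comb_in_V] by blast
  have "hol_ext E (ereal r) (\<lambda>z. lin_prod (drop (Suc k) zs) z * comb c z)"
    by (rule hol_ext_mult_hol[OF r(2) lin_prod_hol])
  moreover have "zs ! k \<in> \<D> (ereal r)" using E E_subset_domain by blast
  moreover have "1 < ereal R" "1 < ereal r" using R(1) r(1) by auto
  ultimately have "hol_ext E (ereal R) (\<lambda>z. lin_prod (drop (Suc k) zs) z * comb c z)"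
    by (rule hol_ext_divide)
  moreover have "c \<in> below M" using c by (simp add: chain_def)
  ultimately show "c \<in> chain zs (Suc k)" unfolding chain_def using R by (intro CollectI conjI exI[of _ R])
qed

lemma chain_Suc_if_ser_zero:
  assumes zs: "\<And>z. poly L z = lin_prod zs z" and k: "k < length zs"
    and c: "c \<in> below M" "zs ! k \<notin> E" and R: "1 < R" "\<forall>x\<in>set (take (Suc k) zs). lev x < R"
    and h: "hol_ext E (ereal R) (\<lambda>z. lin_prod (drop k zs) z * comb c z)"
    and 0: "ser (\<lambda>z. lin_prod (drop k zs) z * comb c z) (zs ! k) = 0"
  shows "c \<in> chain zs (Suc k)"
proof -
  have eq: "(\<lambda>z. lin_prod (drop k zs) z * comb c z) = (\<lambda>z. (z - zs ! k) * (lin_prod (drop (Suc k) zs) z * comb c z))"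
    unfolding Cons_nth_drop_Suc[OF k, symmetric] by (simp add: mult.assoc)
  have "hol_ext E (ereal R) (\<lambda>z. lin_prod (drop (Suc k) zs) z * comb c z)"
    by (rule hol_ext_divide_zero[OF h[unfolded eq] c(2) _ 0[unfolded eq]]) (use R in simp)
  then show ?thesis unfolding chain_def using c R by (intro CollectI conjI exI[of _ R])
qed

lemma below_comb: "a \<in> below M \<Longrightarrow> b \<in> below M \<Longrightarrow> smult \<alpha> a + smult \<beta> b \<in> below M"
  by (auto simp: below_def)

text \<open>The value of the continued product at the k-th zero is linear in the combination, and
  where it is 0 the factor of that zero can be removed.\<close>

lemma chain_codim:
  assumes zs: "\<And>z. poly L z = lin_prod zs z" and k: "k < length zs" and ord: "sorted_wrt (\<lambda>x y. \<eta> * lev x < lev y) zs"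
    and a: "a \<in> chain zs k" and b: "b \<in> chain zs k"
  shows "\<exists>\<alpha> \<beta>. (\<alpha> \<noteq> 0 \<or> \<beta> \<noteq> 0) \<and> smult \<alpha> a + smult \<beta> b \<in> chain zs (Suc k)"
proof (cases "zs ! k \<in> E")
  case True
  have "smult 1 a + smult 0 b \<in> chain zs (Suc k)"
    using chain_subset_if_root_in_E[OF zs k ord True] a by auto
  then show ?thesis by (intro exI[of _ 1] exI[of _ 0]) simp
next
  case False
  let ?w = "zs ! k" and ?g = "\<lambda>c z. lin_prod (drop k zs) z * comb c z"
  obtain R where R: "R > 1" "\<forall>x\<in>set (take (Suc k) zs). lev x < R" "\<forall>y\<in>set (drop k zs). \<eta> * R < lev y"
    using chain_radius[OF k ord] by blast
  have R1: "1 < ereal R" using R by simp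
  have ext: "hol_ext E (ereal R) (?g a)" "hol_ext E (ereal R) (?g b)"
    by (rule chain_hol_ext[OF zs _ R(1)]; use a b R(3) in blast)+
  have w: "?w \<in> \<D> (ereal R)"
    using R(1,2) k by (intro lev_imp_domain) (auto simp: take_Suc_conv_app_nth)
  have "\<exists>\<alpha> \<beta>. (\<alpha> \<noteq> 0 \<or> \<beta> \<noteq> 0) \<and> \<alpha> * ser (?g a) ?w + \<beta> * ser (?g b) ?w = 0"
  proof (cases "ser (?g a) ?w = 0")
    case True then show ?thesis by (intro exI[of _ 1] exI[of _ 0]) simp
  next
    case False then show ?thesis
      by (intro exI[of _ "- ser (?g b) ?w / ser (?g a) ?w"] exI[of _ 1]) simp
  qed
  then obtain \<alpha> \<beta> where ab: "\<alpha> \<noteq> 0 \<or> \<beta> \<noteq> 0" "\<alpha> * ser (?g a) ?w + \<beta> * ser (?g b) ?w = 0" by blast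
  let ?c = "smult \<alpha> a + smult \<beta> b"
  let ?h = "\<lambda>z. \<alpha> * ser (?g a) z + \<beta> * ser (?g b) z"
  have hol: "?h holomorphic_on \<D> (ereal R)"
    by (intro holomorphic_intros hol_ext_ser(1)[OF ext(1) R1] hol_ext_ser(1)[OF ext(2) R1])
  have "same_germ E ?h (\<lambda>z. \<alpha> * ?g a z + \<beta> * ?g b z)"
    by (rule same_germ_compose2[OF hol_ext_ser(2)[OF ext(1) R1] hol_ext_ser(2)[OF ext(2) R1]])
  moreover have "(\<lambda>z. \<alpha> * ?g a z + \<beta> * ?g b z) = ?g ?c"
    by (simp add: comb_add algebra_simps)
  ultimately have germ: "same_germ E ?h (?g ?c)" by simp
  have "ser (?g ?c) ?w = ser ?h ?w" by (simp add: ser_germ[OF germ])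
  also have "\<dots> = ?h ?w" by (rule ser_eq[OF hol R1 w])
  finally have "ser (?g ?c) ?w = 0" using ab(2) by simp
  moreover have "?c \<in> below M" using a b below_comb unfolding chain_def by blast
  ultimately have "?c \<in> chain zs (Suc k)"
    using chain_Suc_if_ser_zero[OF zs k _ False R(1,2) hol_extI[OF hol germ]] by blast
  then show ?thesis using ab(1) by blast
qed

lemma chain_smult:
  assumes "a \<in> chain zs k"
  shows "smult c a \<in> chain zs k"
proof -
  obtain \<rho> where \<rho>: "1 < \<rho>" "\<forall>x\<in>set (take k zs). lev x < \<rho>" "hol_ext E (ereal \<rho>) (\<lambda>z. lin_prod (drop k zs) z * comb a z)"
    using assms unfolding chain_def by blast
  have "hol_ext E (ereal \<rho>) (\<lambda>z. c * (lin_prod (drop k zs) z * comb a z))" by (rule hol_ext_cmult[OF \<rho>(3)])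
  then have h: "hol_ext E (ereal \<rho>) (\<lambda>z. lin_prod (drop k zs) z * comb (smult c a) z)"
    unfolding comb_smult by (simp only: mult.left_commute)
  have "a \<in> below M" using assms unfolding chain_def by simp
  then have "smult c a \<in> below M" by (simp add: below_def)
  then show ?thesis unfolding chain_def using \<rho>(1,2) h by (intro CollectI conjI exI[of _ \<rho>])
qed

text \<open>The chain has as many steps as the dimension M of its first member, so none of them is
  trivial.\<close>

lemma chain_strict_at:
  assumes zs: "\<And>z. poly L z = lin_prod zs z" "length zs = M" and ord: "sorted_wrt (\<lambda>x y. \<eta> * lev x < lev y) zs"
    and k: "k < M"
  shows "\<not> chain zs k \<subseteq> chain zs (Suc k)"
proof (rule chain_strict(2)[of M "chain zs" M, OF _ _ _ _ _ k])
  show "\<exists>\<alpha> \<beta>. (\<alpha> \<noteq> 0 \<or> \<beta> \<noteq> 0) \<and> smult \<alpha> a + smult \<beta> b \<in> chain zs (Suc k)"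
    if "k < M" "a \<in> chain zs k" "b \<in> chain zs k" for k a b
    using chain_codim[OF zs(1) _ ord that(2,3)] that(1) zs(2) by simp
  show "smult c a \<in> chain zs k" if "k \<le> M" "a \<in> chain zs k" for k a c
    using chain_smult that(2) .
  show "chain zs 0 = below M"
  proof
    show "below M \<subseteq> chain zs 0"
    proof
      fix c assume c: "c \<in> below M"
      obtain r where r: "1 < r" "hol_ext E (ereal r) (comb c)" using V_hol_ext[OF comb_in_V] by blast
      have "hol_ext E (ereal r) (\<lambda>z. lin_prod (drop 0 zs) z * comb c z)" by (rule hol_ext_mult_hol[OF r(2) lin_prod_hol])
      then show "c \<in> chain zs 0" using c r(1) unfolding chain_def by auto
    qed
  qed (auto simp: chain_def)
  \<comment> \<open>No factor remains after the last zero, so the combination continues to every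
    radius. The conclusion c = 0, rather than comb c = 0, contains the linear independence of the
    functions z^k F_i.\<close>
  have "c = 0" if c: "c \<in> chain zs M" for c
  proof (rule entire_comb_zero)
    show "c \<in> below M" using c by (simp add: chain_def)
    show "hol_ext E (ereal R) (comb c)" if "1 < R" for R
      using chain_hol_ext[OF zs(1) c that] zs(2) by (simp add: comb_def[abs_def])
  qed
  moreover have "0 \<in> chain zs M"
  proof -
    have "(\<lambda>z. lin_prod (drop M zs) z * comb 0 z) = (\<lambda>z. 0)" by (simp add: comb_def)
    then have h: "hol_ext E \<rho> (\<lambda>z. lin_prod (drop M zs) z * comb 0 z)" for \<rho> by (simp add: hol_ext_zero)
    obtain B where "\<forall>x\<in>lev ` set (take M zs). norm x \<le> B" using finite_imp_bounded[of "lev ` set (take M zs)"]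
      by (auto simp: bounded_iff)
    then have "\<forall>x\<in>set (take M zs). lev x < max B 1 + 1" by fastforce
    moreover have "max B 1 + 1 > 1" by simp
    ultimately show ?thesis using h unfolding chain_def
      by (intro CollectI conjI exI[of _ "max B 1 + 1"]) (simp_all add: below_def)
  qed
  ultimately show "chain zs M = {0}" by blast
qed simp

text \<open>All zeros behind the copies of \<xi> have level at least lev \<xi> / \<eta>, so their
  factors do not vanish in the domain of that index. The condition on \<eta> still holds, as lev x <
  lev \<xi> / \<eta> for the zeros in front.\<close>

lemma root_ordering:
  fixes \<xi> :: complex
  assumes ys: "\<And>z. poly L z = lin_prod ys z" "length ys = M"
  defines "A \<equiv> sort_key lev (filter (\<lambda>z. z \<noteq> \<xi> \<and> lev z < lev \<xi> / \<eta>) ys)"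
    and "B \<equiv> sort_key lev (filter (\<lambda>z. z \<noteq> \<xi> \<and> \<not> lev z < lev \<xi> / \<eta>) ys)"
  shows "\<And>z. poly L z = lin_prod (A @ replicate (count (mset ys) \<xi>) \<xi> @ B) z"
    "length (A @ replicate (count (mset ys) \<xi>) \<xi> @ B) = M"
    "sorted_wrt (\<lambda>x y. \<eta> * lev x < lev y) (A @ replicate (count (mset ys) \<xi>) \<xi> @ B)"
proof -
  let ?zs = "A @ replicate (count (mset ys) \<xi>) \<xi> @ B"
  have eq: "mset ?zs = mset ys"
    by (rule multiset_eqI) (auto simp: A_def B_def count_eq_zero_iff)
  show "poly L z = lin_prod ?zs z" for z using ys(1) lin_prod_mset[OF eq] by simp
  show "length ?zs = M" using eq ys(2) by (metis size_mset)
  have self: "\<eta> * lev z < lev z" for z using lev_ge_1[of z] eta by simp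
  have srt: "sorted_wrt (\<lambda>x y. \<eta> * lev x < lev y) xs" if "sorted (map lev xs)" for xs
    using that by (induction xs) (auto intro: less_le_trans[OF self])
  have rep: "sorted_wrt (\<lambda>x y. \<eta> * lev x < lev y) (replicate n \<xi>)" for n
    using self by (induction n) auto
  have A: "x \<noteq> \<xi>" "lev x < lev \<xi> / \<eta>" if "x \<in> set A" for x using that by (auto simp: A_def)
  have B: "x \<noteq> \<xi>" "lev \<xi> / \<eta> \<le> lev x" if "x \<in> set B" for x using that by (auto simp: B_def)
  have AB: "\<eta> * lev x < lev y" if "x \<in> set A" "y \<in> set B" for x y
    using self[of x] A(2)[OF that(1)] B(2)[OF that(2)] by linarith
  have A\<xi>: "\<eta> * lev x < lev \<xi>" if "x \<in> set A" for x
    using A(2)[OF that] eta by (simp add: field_simps)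
  have "lev \<xi> < lev \<xi> / \<eta>" using self[of \<xi>] eta by (simp add: field_simps)
  then have \<xi>B: "\<eta> * lev \<xi> < lev y" if "y \<in> set B" for y
    using self[of \<xi>] B(2)[OF that] by linarith
  have "sorted_wrt (\<lambda>x y. \<eta> * lev x < lev y) A" "sorted_wrt (\<lambda>x y. \<eta> * lev x < lev y) B"
    by (rule srt; simp add: A_def B_def)+
  then show "sorted_wrt (\<lambda>x y. \<eta> * lev x < lev y) ?zs"
    using rep AB A\<xi> \<xi>B by (auto simp: sorted_wrt_append)
qed

lemma root_notin_E:
  assumes ys: "\<And>z. poly L z = lin_prod ys z" "length ys = M" and \<xi>: "\<xi> \<in> set ys"
  shows "\<xi> \<notin> E"
proof
  assume E: "\<xi> \<in> E"
  note ord = root_ordering[OF ys, where \<xi> = \<xi>]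
  define \<tau> where "\<tau> = count (mset ys) \<xi>"
  define A where "A = sort_key lev (filter (\<lambda>z. z \<noteq> \<xi> \<and> lev z < lev \<xi> / \<eta>) ys)"
  define B where "B = sort_key lev (filter (\<lambda>z. z \<noteq> \<xi> \<and> \<not> lev z < lev \<xi> / \<eta>) ys)"
  have "\<tau> > 0" using \<xi> by (simp add: \<tau>_def)
  then have k: "length A < length (A @ replicate \<tau> \<xi> @ B)" "(A @ replicate \<tau> \<xi> @ B) ! length A = \<xi>"
    by (simp_all add: nth_append)
  note ord' = ord[folded A_def B_def \<tau>_def]
  show False
    using chain_strict_at[OF ord', of "length A"] chain_subset_if_root_in_E[OF ord'(1) k(1) ord'(3)] k ord'(2) E by simp
qed

text \<open>Take a combination that drops out of the chain when the first of the last t copies of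
  \<xi> is passed. Its product with the remaining factors continues beyond \<xi> with a nonzero
  value there, and the factors from \<open>B\<close> have no zeros in the domain. So the pole has
  exact order t.\<close>

lemma root_pole_ext:
  assumes ys: "\<And>z. poly L z = lin_prod ys z" "length ys = M" and \<xi>: "\<xi> \<in> set ys"
    and t: "1 \<le> t" "t \<le> count (mset ys) \<xi>" and R: "R < norm (\<Phi> \<xi>) / \<eta>"
  shows "\<exists>G\<in>V. pole_ext (ereal R) \<xi> t G"
proof -
  have \<xi>E: "\<xi> \<notin> E" by (rule root_notin_E[OF ys \<xi>])
  define \<tau> where "\<tau> = count (mset ys) \<xi>"
  define A where "A = sort_key lev (filter (\<lambda>z. z \<noteq> \<xi> \<and> lev z < lev \<xi> / \<eta>) ys)"
  define B where "B = sort_key lev (filter (\<lambda>z. z \<noteq> \<xi> \<and> \<not> lev z < lev \<xi> / \<eta>) ys)"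
  define zs where "zs = A @ replicate \<tau> \<xi> @ B"
  note ord = root_ordering[OF ys, where \<xi> = \<xi>, folded A_def B_def \<tau>_def, folded zs_def]
  \<comment> \<open>Chosen so that \<open>drop k zs\<close> begins with exactly t copies of
    \<xi>.\<close>
  define k where "k = length A + (\<tau> - t)"
  have "t \<le> \<tau>" using t by (simp add: \<tau>_def)
  then have rep: "replicate \<tau> \<xi> = replicate (\<tau> - t) \<xi> @ replicate t \<xi>"
    by (simp add: replicate_add[symmetric])
  have zs: "zs = (A @ replicate (\<tau> - t) \<xi>) @ replicate t \<xi> @ B" by (simp add: zs_def rep)
  have k: "k < length zs" "zs ! k = \<xi>" using t(1) by (simp_all add: zs k_def nth_append)
  have drop: "drop k zs = replicate t \<xi> @ B" by (simp add: zs k_def)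
  have take: "set (take (Suc k) zs) \<subseteq> insert \<xi> (set A)" using t(1) by (auto simp: zs k_def)
  obtain c where c: "c \<in> chain zs k" "c \<notin> chain zs (Suc k)"
    using chain_strict_at[OF ord, of k] k(1) unfolding ord(2) by blast
  let ?g = "\<lambda>z. lin_prod (drop k zs) z * comb c z"
  have A: "lev x < lev \<xi> / \<eta>" if "x \<in> set A" for x using that by (auto simp: A_def)
  have B: "lev \<xi> / \<eta> \<le> lev x" if "x \<in> set B" for x using that by (auto simp: B_def)
  have \<xi>1: "1 < lev \<xi>" using \<xi>E by (simp add: lev_gt_1)
  have \<xi>2: "lev \<xi> < lev \<xi> / \<eta>" using \<xi>1 eta by (simp add: field_simps)
  define R0 where "R0 = Max (insert R (insert 1 (lev ` insert \<xi> (set A))))"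
  have "R0 < lev \<xi> / \<eta>" using R A \<xi>1 \<xi>2 lev_notin[OF \<xi>E] by (auto simp: R0_def)
  then obtain R' where R': "R0 < R'" "R' < lev \<xi> / \<eta>" using dense by blast
  have "x \<le> R0" if "x \<in> insert R (insert 1 (lev ` insert \<xi> (set A)))" for x
    unfolding R0_def by (rule Max_ge) (use that in auto)
  then have "R \<le> R0" "1 \<le> R0" "\<And>x. x \<in> insert \<xi> (set A) \<Longrightarrow> lev x \<le> R0" by auto
  then have R'2: "R < R'" "1 < R'" "\<And>x. x \<in> insert \<xi> (set A) \<Longrightarrow> lev x < R'"
    using R'(1) by (auto intro: le_less_trans)
  have R'1: "1 < ereal R'" using R'2 by simp
  have \<xi>R: "\<xi> \<in> \<D> (ereal R')" using R'2 by (intro lev_imp_domain) auto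
  have h: "hol_ext E (ereal R') ?g"
  proof (rule chain_hol_ext[OF ord(1) c(1) R'2(2)])
    fix x assume "x \<in> set (drop k zs)"
    then consider "x = \<xi>" | "x \<in> set B" by (auto simp: drop split: if_splits)
    then show "\<eta> * R' < lev x"
    proof cases
      case 1 then show ?thesis using R'(2) eta by (simp add: field_simps)
    next
      case 2
      have "\<eta> * R' < R'" using R'2(2) eta by simp
      then show ?thesis using B[OF 2] R'(2) by simp
    qed
  qed
  have ser_g: "ser ?g \<xi> \<noteq> 0"
  proof
    assume "ser ?g \<xi> = 0"
    moreover have "c \<in> below M" using c by (simp add: chain_def)
    moreover have "\<forall>x\<in>set (take (Suc k) zs). lev x < R'" using take R'2(3) by blast
    ultimately have "c \<in> chain zs (Suc k)"
      using chain_Suc_if_ser_zero[OF ord(1) k(1) _ _ R'2(2) _ h] k(2) \<xi>E by simp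
    then show False using c(2) by simp
  qed
  let ?h = "\<lambda>z. (z - \<xi>) ^ t * comb c z"
  have lp: "lin_prod (replicate t \<xi>) z = (z - \<xi>) ^ t" for z by (induction t) auto
  have g: "?g = (\<lambda>z. lin_prod B z * ?h z)" by (simp add: drop lp mult.assoc mult.left_commute)
  have Bnz: "lin_prod B z \<noteq> 0" if "z \<in> \<D> (ereal R')" for z
    using domain_imp_lev[OF R'2(2) that] R'(2) B[of z] by (auto simp: lin_prod_eq_0_iff)
  have hh: "hol_ext E (ereal R') ?h"
    by (rule hol_ext_divide_nonzero[OF h[unfolded g] lin_prod_hol Bnz R'1])
  note s = hol_ext_ser[OF hh R'1]
  have hol: "(\<lambda>z. lin_prod B z * ser ?h z) holomorphic_on \<D> (ereal R')"
    by (intro holomorphic_intros s(1))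
  have "same_germ E (\<lambda>z. lin_prod B z * ser ?h z) ?g"
    unfolding g by (rule same_germ_compose2[OF same_germ_refl s(2)])
  then have "ser ?g \<xi> = ser (\<lambda>z. lin_prod B z * ser ?h z) \<xi>" by (simp add: ser_germ)
  also have "\<dots> = lin_prod B \<xi> * ser ?h \<xi>" by (rule ser_eq[OF hol R'1 \<xi>R])
  finally have "ser ?h \<xi> \<noteq> 0" using ser_g by auto
  then have "pole_ext (ereal R') \<xi> t (comb c)" using hh by (simp add: pole_ext_def)
  then have "pole_ext (ereal R) \<xi> t (comb c)" by (rule pole_ext_mono) (use R'2(1) in simp)
  then show ?thesis using comb_in_V by blast
qed

text \<open>G is holomorphic up to the level of \<xi>, so L G continues past \<xi>, to
  |\<Phi>(\<xi>)| / \<eta>. Then (z - \<xi>) L G vanishes at \<xi>; but it is also the product of (z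
  - \<xi>)^(\<tau>+1) G and the other factors of L, none of which is 0 there.\<close>

lemma no_higher_pole:
  assumes ys: "\<And>z. poly L z = lin_prod ys z" and \<xi>: "\<xi> \<notin> E" and G: "G \<in> V"
    and r: "norm (\<Phi> \<xi>) < r" and pe: "pole_ext (ereal r) \<xi> (Suc (count (mset ys) \<xi>)) G"
  shows False
proof -
  define \<tau> where "\<tau> = count (mset ys) \<xi>"
  define zs where "zs = filter (\<lambda>z. z \<noteq> \<xi>) ys"
  let ?\<phi> = "norm (\<Phi> \<xi>)" and ?h = "\<lambda>z. (z - \<xi>) ^ Suc \<tau> * G z"
  have "mset ys = mset (replicate \<tau> \<xi> @ zs)"
    by (rule multiset_eqI) (simp add: \<tau>_def zs_def count_eq_zero_iff)
  then have "lin_prod ys z = lin_prod (replicate \<tau> \<xi> @ zs) z" for z by (rule lin_prod_mset)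
  moreover have "lin_prod (replicate t \<xi>) z = (z - \<xi>) ^ t" for z t by (induction t) auto
  ultimately have L: "poly L z = (z - \<xi>) ^ \<tau> * lin_prod zs z" for z using ys by simp
  have h: "hol_ext E (ereal r) ?h" "ser ?h \<xi> \<noteq> 0" using pe by (simp_all add: pole_ext_def \<tau>_def)
  have \<phi>: "1 < ?\<phi>" by (rule Phi_gt_1[OF \<xi>])
  have r1: "1 < ereal r" "1 < ereal ?\<phi>" using r \<phi> by simp_all
  have "\<eta> * ?\<phi> < 1 * ?\<phi>" using \<phi> eta by (intro mult_strict_right_mono) auto
  then have "?\<phi> < ?\<phi> / \<eta>" using eta by (simp add: field_simps)
  then have \<phi>\<eta>: "1 < ereal (?\<phi> / \<eta>)" "lev \<xi> < ?\<phi> / \<eta>" using \<phi> lev_notin[OF \<xi>] by simp_all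
  have "hol_ext E (ereal ?\<phi>) ?h" by (rule hol_ext_mono[OF h(1)]) (use r in simp)
  then have "hol_ext E (ereal ?\<phi>) G"
  proof (rule hol_ext_divide_nonzero)
    show "(\<lambda>z. (z - \<xi>) ^ Suc \<tau>) holomorphic_on \<D> (ereal ?\<phi>)" by (intro holomorphic_intros)
    show "(z - \<xi>) ^ Suc \<tau> \<noteq> 0" if "z \<in> \<D> (ereal ?\<phi>)" for z
      using not_in_domain_level[OF \<xi> that] by simp
  qed (rule r1)
  then have LG: "hol_ext E (ereal (?\<phi> / \<eta>)) (\<lambda>z. poly L z * G z)"
    by (rule limit_mult_hol_ext[OF G _ \<phi>])
  note u = hol_ext_ser[OF LG \<phi>\<eta>(1)] and s = hol_ext_ser[OF h(1) r1(1)]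
  let ?u = "\<lambda>z. (z - \<xi>) * ser (\<lambda>z. poly L z * G z) z" and ?v = "\<lambda>z. lin_prod zs z * ser ?h z"
  have g1: "same_germ E ?u (\<lambda>z. (z - \<xi>) * (poly L z * G z))"
    by (rule same_germ_compose2[OF same_germ_refl u(2)])
  have g2: "same_germ E ?v (\<lambda>z. lin_prod zs z * ?h z)"
    by (rule same_germ_compose2[OF same_germ_refl s(2)])
  have "(\<lambda>z. (z - \<xi>) * (poly L z * G z)) = (\<lambda>z. lin_prod zs z * ?h z)"
    by (rule ext) (simp only: L power_Suc mult_ac)
  with g1 have "same_germ E ?u (\<lambda>z. lin_prod zs z * ?h z)" by (simp only:)
  then have germ: "same_germ E ?u ?v" by (rule same_germ_trans[OF _ same_germ_sym[OF g2]])
  have "?u \<xi> = ?v \<xi>"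
  proof (rule hol_eq_on_same_germ[OF _ _ germ \<phi>\<eta>(1) r1(1)])
    show "?u holomorphic_on \<D> (ereal (?\<phi> / \<eta>))" by (intro holomorphic_intros u(1))
    show "?v holomorphic_on \<D> (ereal r)" by (intro holomorphic_intros s(1))
    show "\<xi> \<in> \<D> (ereal (?\<phi> / \<eta>))" using \<phi>\<eta> by (intro lev_imp_domain) auto
    show "\<xi> \<in> \<D> (ereal r)" using r r1 lev_notin[OF \<xi>] by (intro lev_imp_domain) auto
  qed
  moreover have "lin_prod zs \<xi> \<noteq> 0" unfolding lin_prod_eq_0_iff by (simp add: zs_def)
  ultimately show False using h(2) by simp
qed

lemma root_is_system_pole:
  assumes ys: "\<And>z. poly L z = lin_prod ys z" "length ys = M" and \<xi>: "\<xi> \<in> set ys"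
  shows "is_system_pole E d F m \<xi> (count (mset ys) \<xi>)"
proof -
  let ?\<tau> = "count (mset ys) \<xi>"
  have \<xi>E: "\<xi> \<notin> E" by (rule root_notin_E[OF ys \<xi>])
  have "1 < norm (\<Phi> \<xi>)" by (rule Phi_gt_1[OF \<xi>E])
  then have "\<eta> * norm (\<Phi> \<xi>) < 1 * norm (\<Phi> \<xi>)" using eta by (intro mult_strict_right_mono) auto
  then have "norm (\<Phi> \<xi>) < norm (\<Phi> \<xi>) / \<eta>" using eta by (simp add: field_simps)
  then obtain R where R: "norm (\<Phi> \<xi>) < R" "R < norm (\<Phi> \<xi>) / \<eta>" using dense by blast
  have ne: "pole_combinations E d F m \<xi> t \<noteq> {}" if t: "t \<in> {1..?\<tau>}" for t
  proof -
    have t1: "1 \<le> t" "t \<le> ?\<tau>" using t by auto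
    obtain G where G: "G \<in> V" "pole_ext (ereal R) \<xi> t G" using root_pole_ext[OF ys \<xi> t1 R(2)] by blast
    then have "G \<in> pole_combinations E d F m \<xi> t" unfolding pole_combinations_iff[OF \<xi>E t1(1)] using R(1) by blast
    then show ?thesis by blast
  qed
  have max: "\<sigma> \<le> ?\<tau>" if \<sigma>: "\<forall>t\<in>{1..\<sigma>}. pole_combinations E d F m \<xi> t \<noteq> {}" for \<sigma>
  proof (rule ccontr)
    assume "\<not> \<sigma> \<le> ?\<tau>"
    then have "pole_combinations E d F m \<xi> (Suc ?\<tau>) \<noteq> {}" using \<sigma> by simp
    then obtain G where "G \<in> pole_combinations E d F m \<xi> (Suc ?\<tau>)" by blast
    then have "G \<in> V \<and> (\<exists>r > norm (\<Phi> \<xi>). pole_ext (ereal r) \<xi> (Suc ?\<tau>) G)"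
      by (subst (asm) pole_combinations_iff[OF \<xi>E]) simp_all
    then show False using no_higher_pole[OF ys(1) \<xi>E] by blast
  qed
  have "1 \<le> ?\<tau>" using \<xi> by (simp add: Suc_le_eq)
  then show ?thesis unfolding is_system_pole_def using \<xi>E ne max by simp
qed

lemma system_pole_is_root:
  assumes ys: "\<And>z. poly L z = lin_prod ys z" and \<xi>: "is_system_pole E d F m \<xi> \<tau>"
  shows "\<xi> \<in> set ys"
proof (rule ccontr)
  assume "\<xi> \<notin> set ys"
  then have 0: "count (mset ys) \<xi> = 0" by (simp add: count_eq_zero_iff)
  have \<xi>': "\<xi> \<notin> E" "pole_combinations E d F m \<xi> 1 \<noteq> {}"
    using \<xi> unfolding is_system_pole_def by (simp, metis atLeastAtMost_iff order_refl)
  then obtain G where "G \<in> pole_combinations E d F m \<xi> 1" by blast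
  then have "G \<in> V \<and> (\<exists>r > norm (\<Phi> \<xi>). pole_ext (ereal r) \<xi> 1 G)"
    by (subst (asm) pole_combinations_iff[OF \<xi>'(1)]) simp_all
  then obtain r where "G \<in> V" "norm (\<Phi> \<xi>) < r" "pole_ext (ereal r) \<xi> 1 G" by blast
  then show False using no_higher_pole[OF ys \<xi>'(1), of G r] 0 by simp
qed

lemma inverse_result:
  shows "has_exactly_system_poles E d F m M" "L = sys"
    "\<And>\<xi>. \<xi> \<in> sp \<Longrightarrow> ereal (norm (\<Phi> \<xi>)) / bold_rho E d F m \<xi> \<le> ereal \<eta>"
proof -
  obtain ys where ys: "mset ys = proots L" using ex_mset by blast
  have Leq: "(\<Prod>x\<in>#mset ys. [:- x, 1:]) = L"
    using complex_poly_decompose_multiset[of L] L(2) ys by simp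
  have len: "length ys = M"
    by (metis L(1) size_mset size_proots_complex ys)
  have zs: "poly L z = lin_prod ys z" for z
  proof -
    have "poly (\<Prod>a\<leftarrow>xs. [:- a, 1:]) z = lin_prod xs z" for xs by (induction xs) (auto simp: algebra_simps)
    moreover have "L = (\<Prod>a\<leftarrow>ys. [:- a, 1:])" using Leq by (metis mset_map prod_mset_prod_list)
    ultimately show ?thesis by simp
  qed
  note isp = root_is_system_pole[OF zs len]
  have sp: "sp = set ys" using isp system_pole_is_root[OF zs] by (auto simp: system_poles_def)
  have spo: "spo \<xi> = count (mset ys) \<xi>" if "\<xi> \<in> set ys" for \<xi> using system_pole_order_eq[OF isp[OF that]] .
  have "(\<Sum>\<xi>\<in>sp. spo \<xi>) = (\<Sum>\<xi>\<in>set_mset (mset ys). count (mset ys) \<xi>)"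
    unfolding sp by (rule sum.cong) (auto simp: spo)
  also have "\<dots> = M" using len size_multiset_overloaded_eq[of "mset ys"] by (simp only: size_mset)
  finally show "has_exactly_system_poles E d F m M" unfolding has_exactly_system_poles_def by (simp add: sp)
  have "sys = (\<Prod>\<xi>\<in>set_mset (mset ys). [:- \<xi>, 1:] ^ count (mset ys) \<xi>)"
    unfolding system_poly_def sp by (rule prod.cong) (auto simp: spo)
  also have "\<dots> = L" using Leq by (simp only: image_prod_mset_multiplicity)
  finally show "L = sys" by simp
  fix \<xi> assume "\<xi> \<in> sp"
  then have \<xi>: "\<xi> \<in> set ys" "\<xi> \<notin> E" using sp root_notin_E[OF zs len] by auto
  let ?\<phi> = "norm (\<Phi> \<xi>)"
  have \<phi>: "1 < ?\<phi>" by (rule Phi_gt_1[OF \<xi>(2)])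
  have \<tau>: "1 \<le> spo \<xi>" using \<xi>(1) by (simp add: spo Suc_le_eq)
  \<comment> \<open>\<open>root_pole_ext\<close> reaches all radii below |\<Phi>(\<xi>)| / \<eta>,
    and the supremum in \<open>rho_pole\<close> reaches this radius itself.\<close>
  have rho: "ereal (?\<phi> / \<eta>) \<le> rho_pole E d F m \<xi> t" if t: "t \<in> {1..spo \<xi>}" for t
  proof (rule dense_le_bounded)
    have "\<eta> * ?\<phi> < 1 * ?\<phi>" using \<phi> eta by (intro mult_strict_right_mono) auto
    then show "ereal ?\<phi> < ereal (?\<phi> / \<eta>)" using eta by (simp add: field_simps)
    fix x assume "ereal ?\<phi> < x" "x < ereal (?\<phi> / \<eta>)"
    then obtain R where R: "x = ereal R" "?\<phi> < R" "R < ?\<phi> / \<eta>" by (cases x) auto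
    have t1: "1 \<le> t" "t \<le> count (mset ys) \<xi>" using t spo[OF \<xi>(1)] by auto
    obtain G where G: "G \<in> V" "pole_ext (ereal R) \<xi> t G" using root_pole_ext[OF zs len \<xi>(1) t1 R(3)] by blast
    show "x \<le> rho_pole E d F m \<xi> t" unfolding R(1) by (rule rho_pole_ge[OF G(2,1) R(2) \<xi>(2) t1(1)])
  qed
  have "ereal (?\<phi> / \<eta>) \<le> bold_rho E d F m \<xi>"
    unfolding bold_rho_def bold_rho_pole_def using rho \<tau> by (subst Min_ge_iff) auto
  then show "ereal ?\<phi> / bold_rho E d F m \<xi> \<le> ereal \<eta>"
  proof (cases "bold_rho E d F m \<xi>")
    case (real r)
    then have r: "?\<phi> / \<eta> \<le> r" using \<open>ereal (?\<phi> / \<eta>) \<le> _\<close> by simp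
    moreover have "0 < ?\<phi> / \<eta>" using \<phi> eta by (intro divide_pos_pos) linarith+
    ultimately have "0 < r" by linarith
    then have "?\<phi> / r \<le> \<eta>" using r eta by (simp add: field_simps)
    then show ?thesis using \<open>0 < r\<close> by (simp add: real)
  qed (use eta in auto)
qed

end

section \<open>Convergence of the approximants\<close>

lemma power_mult_split:
  fixes x s :: real
  assumes "n \<le> \<nu>" "s \<noteq> 0"
  shows "x ^ n * (1 / s) ^ \<nu> = (x / s) ^ n * (1 / s) ^ (\<nu> - n)"
proof -
  have "(1 / s) ^ \<nu> = (1 / s) ^ n * (1 / s) ^ (\<nu> - n)" using assms(1) by (simp only: power_add[symmetric] le_add_diff_inverse)
  then show ?thesis by (simp add: power_divide)
qed

locale bounded_solutions = hp_setting E \<mu> d F m for E \<mu> d F m +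
  fixes Q :: "nat \<Rightarrow> complex poly" and B :: real
  assumes Q_solves: "\<forall>\<^sub>F n in sequentially. solves n (Q n)"
    and Q_bounded: "\<forall>\<^sub>F n in sequentially. coeff_norm (Q n) \<le> B" and B: "0 \<le> B"
begin

text \<open>Two rates: r^-n as for the index n itself, and a further geometric factor in \<nu> - n,
  which makes the sum over all \<nu> \<ge> n of the order of its first term. The factor b may depend
  on G.\<close>

definition tail_bound :: "real \<Rightarrow> (complex \<Rightarrow> complex) \<Rightarrow> bool" where
  "tail_bound r G \<longleftrightarrow> continuous_on S G \<and> (\<exists>C\<ge>0. \<exists>b. 0 < b \<and> b < 1 \<and>
     (\<forall>\<^sub>F n in sequentially. \<forall>\<nu>\<ge>n. norm (cf (\<lambda>z. poly (Q n) z * G z) \<nu>) \<le> C * (1 / r) ^ n * b ^ (\<nu> - n)))"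

lemma tail_bound_cong:
  assumes "tail_bound r G" "\<And>z. z \<in> E \<Longrightarrow> G z = G' z"
  shows "tail_bound r G'"
proof -
  have SE: "G z = G' z" if "z \<in> S" for z using assms(2) support_subset that by blast
  have "cf (\<lambda>z. poly q z * G z) \<nu> = cf (\<lambda>z. poly q z * G' z) \<nu>" for q \<nu> by (rule cf_cong) (simp add: SE)
  moreover have "continuous_on S G \<longleftrightarrow> continuous_on S G'" by (rule continuous_on_cong) (auto simp: SE)
  ultimately show ?thesis using assms(1) unfolding tail_bound_def by simp
qed

lemma tail_bound_add:
  assumes r: "0 < r" and f: "tail_bound r f" and g: "tail_bound r g"
  shows "tail_bound r (\<lambda>z. f z + c * g z)"
proof -
  obtain C b where C: "C \<ge> 0" "0 < b" "b < 1"
    "\<forall>\<^sub>F n in sequentially. \<forall>\<nu>\<ge>n. norm (cf (\<lambda>z. poly (Q n) z * f z) \<nu>) \<le> C * (1 / r) ^ n * b ^ (\<nu> - n)"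
    and cont_f: "continuous_on S f" using f unfolding tail_bound_def by blast
  obtain C' b' where C': "C' \<ge> 0" "0 < b'" "b' < 1"
    "\<forall>\<^sub>F n in sequentially. \<forall>\<nu>\<ge>n. norm (cf (\<lambda>z. poly (Q n) z * g z) \<nu>) \<le> C' * (1 / r) ^ n * b' ^ (\<nu> - n)"
    and cont_g: "continuous_on S g" using g unfolding tail_bound_def by blast
  define D where "D = C + norm c * C'"
  have D: "D \<ge> 0" using C(1) C'(1) by (simp add: D_def)
  let ?b = "max b b'"
  have "\<forall>\<^sub>F n in sequentially. \<forall>\<nu>\<ge>n. norm (cf (\<lambda>z. poly (Q n) z * (f z + c * g z)) \<nu>) \<le> D * (1 / r) ^ n * ?b ^ (\<nu> - n)"
    using C(4) C'(4)
  proof eventually_elim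
    case (elim n)
    show ?case
    proof (intro allI impI)
      fix \<nu> assume \<nu>: "n \<le> \<nu>"
      have "cf (\<lambda>z. poly (Q n) z * (f z + c * g z)) \<nu> = cf (\<lambda>z. poly (Q n) z * f z + c * (poly (Q n) z * g z)) \<nu>"
        by (rule cf_cong) (simp add: algebra_simps)
      also have "\<dots> = cf (\<lambda>z. poly (Q n) z * f z) \<nu> + cf (\<lambda>z. c * (poly (Q n) z * g z)) \<nu>"
        by (rule cf_add) (intro continuous_intros cont_f cont_g)+
      also have "cf (\<lambda>z. c * (poly (Q n) z * g z)) \<nu> = c * cf (\<lambda>z. poly (Q n) z * g z) \<nu>" by (rule cf_cmult)
      also have "norm (cf (\<lambda>z. poly (Q n) z * f z) \<nu> + c * cf (\<lambda>z. poly (Q n) z * g z) \<nu>)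
          \<le> norm (cf (\<lambda>z. poly (Q n) z * f z) \<nu>) + norm c * norm (cf (\<lambda>z. poly (Q n) z * g z) \<nu>)"
        by (metis norm_mult norm_triangle_ineq)
      also have "\<dots> \<le> C * (1 / r) ^ n * b ^ (\<nu> - n) + norm c * (C' * (1 / r) ^ n * b' ^ (\<nu> - n))"
        using elim \<nu> by (intro add_mono mult_left_mono) auto
      also have "\<dots> \<le> C * (1 / r) ^ n * ?b ^ (\<nu> - n) + norm c * (C' * (1 / r) ^ n * ?b ^ (\<nu> - n))"
        using C C' r by (intro add_mono mult_left_mono power_mono) auto
      also have "\<dots> = D * (1 / r) ^ n * ?b ^ (\<nu> - n)" by (simp add: D_def algebra_simps)
      finally show "norm (cf (\<lambda>z. poly (Q n) z * (f z + c * g z)) \<nu>) \<le> D * (1 / r) ^ n * ?b ^ (\<nu> - n)" .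
    qed
  qed
  moreover have "continuous_on S (\<lambda>z. f z + c * g z)" by (intro continuous_intros cont_f cont_g)
  moreover have "0 < ?b" "?b < 1" using C C' by auto
  ultimately show ?thesis unfolding tail_bound_def using D by blast
qed

lemma tail_bound_hol_ext:
  assumes G: "hol_ext E \<rho> G" and r: "1 < r" "ereal r < \<rho>"
  shows "tail_bound r G"
proof -
  obtain C where C: "C \<ge> 0" "\<And>n q. degree q \<le> M \<Longrightarrow> norm (cf (\<lambda>z. poly q z * G z) n) \<le> C * (1 / r) ^ n * coeff_norm q"
    using cf_poly_mult_decay[OF G r, of M] by blast
  have "\<forall>\<^sub>F n in sequentially. \<forall>\<nu>\<ge>n. norm (cf (\<lambda>z. poly (Q n) z * G z) \<nu>) \<le> (C * B) * (1 / r) ^ n * (1 / r) ^ (\<nu> - n)"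
    using Q_solves Q_bounded
  proof eventually_elim
    case (elim n)
    show ?case
    proof (intro allI impI)
      fix \<nu> assume \<nu>: "n \<le> \<nu>"
      have "norm (cf (\<lambda>z. poly (Q n) z * G z) \<nu>) \<le> C * (1 / r) ^ \<nu> * coeff_norm (Q n)"
        by (rule C(2)) (use elim in \<open>simp add: solves_def\<close>)
      also have "\<dots> \<le> C * (1 / r) ^ \<nu> * B" using elim C(1) r by (intro mult_left_mono) auto
      also have "\<dots> = (C * B) * (1 ^ n * (1 / r) ^ \<nu>)" by simp
      also have "1 ^ n * (1 / r) ^ \<nu> = (1 / r) ^ n * (1 / r) ^ (\<nu> - n)" by (rule power_mult_split[OF \<nu>]) (use r in simp)
      finally show "norm (cf (\<lambda>z. poly (Q n) z * G z) \<nu>) \<le> (C * B) * (1 / r) ^ n * (1 / r) ^ (\<nu> - n)"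
        by (simp only: mult.assoc)
    qed
  qed
  moreover have "0 \<le> C * B" "0 < 1 / r" "1 / r < 1" using C(1) B r by auto
  ultimately show ?thesis unfolding tail_bound_def using cont_S_hol_ext[OF G] by blast
qed

lemma tail_bound_pole:
  assumes \<xi>: "\<xi> \<notin> E" and R: "norm (\<Phi> \<xi>) < R" and r: "1 < r" "r < R"
    and ex: "\<And>k. k \<in> {1..t} \<Longrightarrow> \<exists>G\<in>V. pole_ext (ereal R) \<xi> k G"
  shows "tail_bound r (\<lambda>z. 1 / (z - \<xi>) ^ t)"
proof -
  let ?\<phi> = "norm (\<Phi> \<xi>)"
  have \<phi>: "1 < ?\<phi>" by (rule Phi_gt_1[OF \<xi>])
  have "r * ?\<phi> < R * ?\<phi>" using r \<phi> by (intro mult_strict_right_mono) linarith+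
  then have "max 1 (r * ?\<phi> / R) < ?\<phi>" using r \<phi> by (simp add: divide_less_eq mult.commute)
  \<comment> \<open>The powers of 1 / (z - \<xi>) have coefficients O(s^-\<nu>) as s <
    |\<Phi>(\<xi>)|, and the Taylor coefficients of Q_n are O(\<eta>^n). With \<eta> = s / r the
    product has rate \<eta> / s = 1 / r in n, and s > r |\<Phi>(\<xi>)| / R makes this \<eta>
    admissible.\<close>
  then obtain s where s0: "max 1 (r * ?\<phi> / R) < s" "s < ?\<phi>" using dense by blast
  then have s: "1 < s" "s < ?\<phi>" by auto
  define \<eta> where "\<eta> = s / r"
  have "?\<phi> / R < \<eta>" using s0 r by (simp add: \<eta>_def field_simps)
  have "\<exists>C\<ge>0. \<forall>\<^sub>F n in sequentially. \<forall>q. solves n q \<longrightarrow> norm (jet q \<xi> l) \<le> C * \<eta> ^ n * coeff_norm q" if "l < t" for l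
    by (rule solution_jet_bound[OF \<xi> R ex that \<open>?\<phi> / R < \<eta>\<close>])
  then have "\<forall>l\<in>{..<t}. \<exists>C. C \<ge> 0 \<and> (\<forall>\<^sub>F n in sequentially. \<forall>q. solves n q \<longrightarrow> norm (jet q \<xi> l) \<le> C * \<eta> ^ n * coeff_norm q)"
    by auto
  from bchoice[OF this] obtain C where C: "\<And>l. l < t \<Longrightarrow> C l \<ge> 0"
    "\<And>l. l < t \<Longrightarrow> \<forall>\<^sub>F n in sequentially. \<forall>q. solves n q \<longrightarrow> norm (jet q \<xi> l) \<le> C l * \<eta> ^ n * coeff_norm q" by auto
  have "\<forall>l\<in>{..t}. \<exists>C. C \<ge> 0 \<and> (\<forall>n. norm (cf (\<lambda>z. 1 / (z - \<xi>) ^ l) n) \<le> C * (1 / s) ^ n)"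
    using cf_pole_bound[OF \<xi> s] by blast
  from bchoice[OF this] obtain D where D: "\<And>l. l \<le> t \<Longrightarrow> D l \<ge> 0"
    "\<And>l n. l \<le> t \<Longrightarrow> norm (cf (\<lambda>z. 1 / (z - \<xi>) ^ l) n) \<le> D l * (1 / s) ^ n" by auto
  define K where "K = (\<Sum>i<t. C i * B * D (t - i))"
  have K: "0 \<le> K" unfolding K_def using C(1) D(1) B by (intro sum_nonneg mult_nonneg_nonneg) auto
  have "\<forall>\<^sub>F n in sequentially. \<forall>l\<in>{..<t}. \<forall>q. solves n q \<longrightarrow> norm (jet q \<xi> l) \<le> C l * \<eta> ^ n * coeff_norm q"
    by (rule eventually_ball_finite) (use C(2) in auto)
  then have "\<forall>\<^sub>F n in sequentially. \<forall>\<nu>\<ge>n. norm (cf (\<lambda>z. poly (Q n) z * (1 / (z - \<xi>) ^ t)) \<nu>) \<le> K * (1 / r) ^ n * (1 / s) ^ (\<nu> - n)"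
    using Q_solves Q_bounded eventually_gt_at_top[of M]
  proof eventually_elim
    case (elim n)
    show ?case
    proof (intro allI impI)
      fix \<nu> assume \<nu>: "n \<le> \<nu>"
      have "cf (\<lambda>z. poly (Q n) z * (1 / (z - \<xi>) ^ t)) \<nu> = (\<Sum>i<t. jet (Q n) \<xi> i * cf (\<lambda>z. 1 / (z - \<xi>) ^ (t - i)) \<nu>)"
        by (rule cf_poly_over_pole[OF \<xi>, where M = M]) (use elim \<nu> in \<open>auto simp: solves_def\<close>)
      also have "norm \<dots> \<le> (\<Sum>i<t. (C i * \<eta> ^ n * B) * (D (t - i) * (1 / s) ^ \<nu>))"
      proof (rule sum_norm_le)
        fix i assume i: "i \<in> {..<t}"
        then have "norm (jet (Q n) \<xi> i) \<le> C i * \<eta> ^ n * coeff_norm (Q n)" using elim by blast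
        also have "\<dots> \<le> C i * \<eta> ^ n * B" using elim C(1) i s r by (intro mult_left_mono) (auto simp: \<eta>_def)
        finally have "norm (jet (Q n) \<xi> i) \<le> C i * \<eta> ^ n * B" .
        moreover have "norm (cf (\<lambda>z. 1 / (z - \<xi>) ^ (t - i)) \<nu>) \<le> D (t - i) * (1 / s) ^ \<nu>" by (rule D(2)) simp
        moreover have "0 \<le> C i * \<eta> ^ n * B" using C(1) i s r B by (auto simp: \<eta>_def)
        ultimately show "norm (jet (Q n) \<xi> i * cf (\<lambda>z. 1 / (z - \<xi>) ^ (t - i)) \<nu>) \<le> (C i * \<eta> ^ n * B) * (D (t - i) * (1 / s) ^ \<nu>)"
          unfolding norm_mult by (intro mult_mono) auto
      qed
      also have "\<dots> = K * (\<eta> ^ n * (1 / s) ^ \<nu>)" unfolding K_def sum_distrib_right by (simp add: mult_ac)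
      also have "\<eta> ^ n * (1 / s) ^ \<nu> = (\<eta> / s) ^ n * (1 / s) ^ (\<nu> - n)" by (rule power_mult_split[OF \<nu>]) (use s in simp)
      also have "\<eta> / s = 1 / r" using s by (simp add: \<eta>_def)
      finally show "norm (cf (\<lambda>z. poly (Q n) z * (1 / (z - \<xi>) ^ t)) \<nu>) \<le> K * (1 / r) ^ n * (1 / s) ^ (\<nu> - n)"
        by (simp only: mult.assoc)
    qed
  qed
  moreover have "0 < 1 / s" "1 / s < 1" using s by auto
  ultimately show ?thesis unfolding tail_bound_def using pole_cont[OF \<xi>] K by blast
qed

text \<open>Subtracting the leading term of the principal part lowers the order of a pole by one.\<close>

lemma tail_bound_lin_prod:
  assumes r: "1 < r" "ereal r < \<rho>"
    and poles: "\<And>x t. x \<in> set xs \<Longrightarrow> x \<in> \<D> \<rho> \<Longrightarrow> t \<in> {1..count (mset xs) x} \<Longrightarrow> tail_bound r (\<lambda>z. 1 / (z - x) ^ t)"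
    and xs: "\<And>x. x \<in> set xs \<Longrightarrow> x \<notin> E"
    and G: "hol_ext E \<rho> (\<lambda>z. lin_prod xs z * G z)"
  shows "tail_bound r G"
  using poles xs G
proof (induction xs arbitrary: G)
  case Nil
  then show ?case using tail_bound_hol_ext[of \<rho> G r] r by simp
next
  case (Cons x xs)
  have \<rho>: "1 < \<rho>" by (rule ereal_gt_1[OF r])
  have xE: "x \<notin> E" using Cons.prems(2) by simp
  define t where "t = count (mset (x # xs)) x"
  have t1: "1 \<le> t" by (simp add: t_def)
  define ys where "ys = filter (\<lambda>z. z \<noteq> x) xs"
  have "mset (x # xs) = mset (replicate t x @ ys)"
    by (rule multiset_eqI) (simp add: t_def ys_def count_eq_zero_iff)
  then have "lin_prod (x # xs) z = lin_prod (replicate t x @ ys) z" for z by (rule lin_prod_mset)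
  moreover have "lin_prod (replicate t x) z = (z - x) ^ t" for z t by (induction t) auto
  ultimately have split: "(z - x) * lin_prod xs z = (z - x) ^ t * lin_prod ys z" for z by simp
  have ysx: "lin_prod ys x \<noteq> 0" unfolding lin_prod_eq_0_iff by (simp add: ys_def)
  let ?H = "\<lambda>z. lin_prod (x # xs) z * G z"
  have H: "hol_ext E \<rho> ?H" by (rule Cons.prems(3))
  \<comment> \<open>The value that makes \<open>?H1\<close> vanish at x, so that its factor z - x
    can be removed. Outside the domain of index \<rho> the factor comes off without a condition, and
    nothing is subtracted.\<close>
  define c where "c = (if x \<in> \<D> \<rho> then ser ?H x / lin_prod ys x else 0)"
  define G1 where "G1 z = G z - c * (1 / (z - x) ^ t)" for z
  let ?H1 = "\<lambda>z. (z - x) * (lin_prod xs z * G1 z)"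
  let ?h = "\<lambda>z. ser ?H z - c * lin_prod ys z"
  have hol: "?h holomorphic_on \<D> \<rho>" by (intro holomorphic_intros hol_ext_ser(1)[OF H \<rho>])
  have H1: "?H1 z = ?H z - c * lin_prod ys z" if "z \<noteq> x" for z
  proof -
    have "?H1 z = (z - x) * lin_prod xs z * G z - c * ((z - x) * lin_prod xs z) / (z - x) ^ t"
      by (simp add: G1_def algebra_simps)
    also have "c * ((z - x) * lin_prod xs z) / (z - x) ^ t = c * lin_prod ys z"
      unfolding split using that by simp
    finally show ?thesis by simp
  qed
  have "same_germ E ?H1 (\<lambda>z. ?H z - c * lin_prod ys z)"
    unfolding same_germ_def
  proof (intro exI conjI ballI)
    show "open (- {x})" by (intro open_Compl closed_singleton)
    show "E \<subseteq> - {x}" using xE by auto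
    fix z assume "z \<in> - {x}"
    then show "?H1 z = ?H z - c * lin_prod ys z" using H1 by simp
  qed
  moreover have "same_germ E ?h (\<lambda>z. ?H z - c * lin_prod ys z)"
    by (rule same_germ_compose2[OF hol_ext_ser(2)[OF H \<rho>] same_germ_refl])
  ultimately have germ: "same_germ E ?h ?H1" by (rule same_germ_trans[OF _ same_germ_sym, rotated])
  have ext: "hol_ext E \<rho> ?H1" by (rule hol_extI[OF hol germ])
  have "hol_ext E \<rho> (\<lambda>z. lin_prod xs z * G1 z)"
  proof (rule hol_ext_divide_zero[OF ext xE \<rho>])
    assume x: "x \<in> \<D> \<rho>"
    have "ser ?H1 x = ser ?h x" by (simp only: ser_germ[OF germ])
    also have "\<dots> = ?h x" by (rule ser_eq[OF hol \<rho> x])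
    also have "\<dots> = 0" using x ysx by (simp add: c_def)
    finally show "ser ?H1 x = 0" .
  qed
  then have G1: "tail_bound r G1"
  proof (rule Cons.IH[rotated 2])
    fix y t assume "y \<in> set xs" "y \<in> \<D> \<rho>" "t \<in> {1..count (mset xs) y}"
    then show "tail_bound r (\<lambda>z. 1 / (z - y) ^ t)" by (intro Cons.prems(1)) (auto split: if_splits)
  qed (use Cons.prems(2) in auto)
  show ?case
  proof (cases "x \<in> \<D> \<rho>")
    case True
    have "tail_bound r (\<lambda>z. 1 / (z - x) ^ t)"
      by (rule Cons.prems(1)) (use True t1 in \<open>auto simp: t_def\<close>)
    then have "tail_bound r (\<lambda>z. G1 z + c * (1 / (z - x) ^ t))" using r by (intro tail_bound_add[OF _ G1]) auto
    then show ?thesis by (rule tail_bound_cong) (simp add: G1_def)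
  next
    case False
    then have "c = 0" by (simp add: c_def)
    show ?thesis by (rule tail_bound_cong[OF G1]) (simp add: G1_def \<open>c = 0\<close>)
  qed
qed

text \<open>The inner minimum in \<open>rho_comp_star\<close> guarantees, at every pole of F_i and
  for every order up to that of the pole, combinations that continue to all radii below this index,
  as \<open>tail_bound_pole\<close> requires.\<close>

lemma tail_bound_component:
  assumes i: "i \<in> {1..d}" and fin: "finite sp" and r: "1 < r" "ereal r < rho_comp_star E d F m i 0"
  shows "tail_bound r (F i)"
proof -
  let ?\<rho> = "rho_comp_star E d F m i 0"
  obtain P o' where P: "P \<subseteq> sp" "\<And>x. x \<in> P \<Longrightarrow> 1 \<le> o' x" "\<And>x. x \<in> P \<Longrightarrow> ?\<rho> \<le> bold_rho_pole E d F m x (o' x)"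
    and ext: "hol_ext E ?\<rho> (\<lambda>z. (\<Prod>x\<in>P. (z - x) ^ o' x) * (z ^ 0 * F i z))"
    using rho_comp_star_poles(2)[OF i fin, of 0] by blast
  have finP: "finite P" by (rule finite_subset[OF P(1) fin])
  have "\<exists>A. \<forall>x. count A x = (if x \<in> P then o' x else 0)"
  proof -
    have "finite {x. 0 < (if x \<in> P then o' x else 0)}" by (rule finite_subset[OF _ finP]) auto
    then show ?thesis by (intro exI[of _ "Abs_multiset (\<lambda>x. if x \<in> P then o' x else 0)"]) (simp add: Abs_multiset_inverse)
  qed
  then obtain A where A: "\<And>x. count A x = (if x \<in> P then o' x else 0)" by blast
  obtain xs where xs: "mset xs = A" using ex_mset by blast
  have set_xs: "set xs = P" using P(2) A by (auto simp: set_mset_mset[symmetric] xs set_mset_def simp del: set_mset_mset split: if_splits)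
    (metis Suc_le_eq)
  have "lin_prod xs z = (\<Prod>x\<in>P. (z - x) ^ o' x)" for z
  proof -
    have "lin_prod xs z = prod_mset (image_mset (\<lambda>a. z - a) A)" by (metis mset_map prod_mset_prod_list xs)
    also have "\<dots> = (\<Prod>x\<in>set_mset A. (z - x) ^ count A x)" by (rule image_prod_mset_multiplicity)
    also have "\<dots> = (\<Prod>x\<in>P. (z - x) ^ o' x)" using set_xs xs A by (intro prod.cong) auto
    finally show ?thesis .
  qed
  then have ext': "hol_ext E ?\<rho> (\<lambda>z. lin_prod xs z * F i z)" using ext by simp
  show ?thesis
  proof (rule tail_bound_lin_prod[OF r _ _ ext'])
    show "x \<notin> E" if "x \<in> set xs" for x using that P(1) set_xs system_poleD(1) by blast
    fix x t assume x: "x \<in> set xs" "x \<in> \<D> ?\<rho>" and t: "t \<in> {1..count (mset xs) x}"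
    have xE: "x \<notin> E" using x P(1) set_xs system_poleD(1) by blast
    have "ereal (norm (\<Phi> x)) < ?\<rho>" using x(2) xE by (simp add: canonical_domain_def)
    then have "ereal (max r (norm (\<Phi> x))) < ?\<rho>" using r by (simp add: max_def)
    then obtain R where R: "max r (norm (\<Phi> x)) < R" "ereal R < ?\<rho>" by (rule ereal_real_between)
    show "tail_bound r (\<lambda>z. 1 / (z - x) ^ t)"
    proof (rule tail_bound_pole[OF xE _ r(1)])
      show "norm (\<Phi> x) < R" "r < R" using R(1) by auto
      fix k assume k: "k \<in> {1..t}"
      have xP: "x \<in> P" using x set_xs by simp
      have "k \<in> {1..o' x}" using k t xs A xP by auto
      then have "?\<rho> \<le> rho_pole E d F m x k" using P(3)[OF xP] bold_rho_pole_le order_trans by blast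
      then have "ereal R < rho_pole E d F m x k" using R(2) by simp
      then show "\<exists>G\<in>V. pole_ext (ereal R) x k G" using rho_pole_gt_imp xE k by simp
    qed
  qed
qed

lemma op_uniform_bound:
  assumes r: "1 < r" and a: "r < a"
  shows "\<exists>A\<ge>0. \<forall>k z. lev z \<le> r \<longrightarrow> norm (poly (op k) z) \<le> A * a ^ k"
proof -
  let ?K = "{z. lev z \<le> r}"
  define f where "f k = (SUP z\<in>?K. norm (poly (op k) z))" for k
  obtain z0 where "z0 \<in> E" using nonempty_E by blast
  then have "lev z0 \<le> r" using lev_E r by simp
  then have ne: "?K \<noteq> {}" by blast
  have bdd: "bdd_above ((\<lambda>z. norm (poly (op k) z)) ` ?K)" for k
    by (intro bounded_imp_bdd_above compact_imp_bounded compact_continuous_image compact_lev_le continuous_intros)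
  have le: "norm (poly (op k) z) \<le> f k" if "lev z \<le> r" for k z
    unfolding f_def by (rule cSUP_upper[OF _ bdd]) (use that in simp)
  have f0: "0 \<le> f k" for k
  proof -
    obtain z where "lev z \<le> r" using ne by blast
    then show ?thesis using le[of z k] norm_ge_zero order_trans by blast
  qed
  have "\<forall>\<^sub>F k in sequentially. norm (f k) \<le> 1 * a ^ k"
    using op_bound[OF r a]
  proof eventually_elim
    case (elim k)
    have "f k \<le> a ^ k" unfolding f_def by (rule cSUP_least[OF ne]) (use elim in simp)
    then show ?case using f0 by simp
  qed
  moreover have "0 < a" using r a by simp
  ultimately obtain A where A: "0 \<le> A" "\<And>k. norm (f k) \<le> A * a ^ k" by (rule eventually_geometric_bound) blast
  have "norm (poly (op k) z) \<le> A * a ^ k" if "lev z \<le> r" for k z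
    using le[OF that, of k] A(2)[of k] f0[of k] by simp
  then show ?thesis using A(1) by blast
qed

text \<open>The coefficients of the remainder \<open>Q\<^sub>n F - p\<close> vanish up to the index \<open>n\<close>, and multiplication by
  \<open>L\<close> makes it holomorphic; both ranges of coefficients are bounded by the same geometric sequence.\<close>

lemma remainder_bound:
  assumes \<rho>: "ereal \<sigma> < \<rho>" "1 < \<sigma>" and G: "G analytic_on E" and LG: "hol_ext E \<rho> (\<lambda>z. poly L z * G z)" and dL: "degree L \<le> N"
    and a: "\<sigma> < a" and tail: "\<And>r. 1 < r \<Longrightarrow> ereal r < \<rho> \<Longrightarrow> tail_bound r G"
    and \<eta>: "a < \<eta> * R" "1 < R" "ereal R < \<rho>" "a < R"
  shows "\<exists>C\<ge>0. \<forall>\<^sub>F n in sequentially. \<forall>p. degree p \<le> n - 1 \<longrightarrow>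
     (\<forall>k\<le>n. cf (\<lambda>z. poly (Q n) z * G z) k = cf (poly p) k) \<longrightarrow>
     (\<forall>z. lev z \<le> \<sigma> \<longrightarrow> norm (poly (Q n) z * ser (\<lambda>z. poly L z * G z) z - poly L z * poly p z) \<le> C * \<eta> ^ n)"
proof -
  let ?LG = "\<lambda>z. poly L z * G z"
  have \<rho>1: "1 < \<rho>" using ereal_gt_1[OF \<eta>(2,3)] .
  obtain r0 where r0: "1 < r0" "hol_ext E (ereal r0) G" using analytic_hol_ext[OF G] by blast
  have r01: "1 < ereal r0" using r0 by simp
  have contG: "continuous_on S G" by (rule cont_S_hol_ext[OF r0(2)])
  obtain B0 where B0: "B0 > 0" "\<And>z. z \<in> S \<Longrightarrow> norm z \<le> B0" using bounded_support by (auto simp: bounded_pos)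
  define B1 where "B1 = max B0 1"
  define BL where "BL = B1 ^ N * coeff_norm L"
  have BL: "0 \<le> BL" by (simp add: BL_def B1_def coeff_norm_nonneg)
  have L: "norm (poly L z) \<le> BL" if "z \<in> S" for z
    unfolding BL_def by (rule poly_norm_le_coeff_norm) (use dL B0 that in \<open>auto simp: B1_def le_max_iff_disj\<close>)

  have \<eta>0: "0 < \<eta>" using \<eta> a \<rho>(2) by (metis less_trans mult_less_0_iff mult_zero_left not_less_iff_gr_or_eq zero_less_one)
  \<comment> \<open>Above a, so that the sum of (a / a')^k converges; at most \<eta> R, so that a' /
    R \<le> \<eta>; and at most R, for the coefficients of high index.\<close>
  define a' where "a' = min (\<eta> * R) R"
  have a': "a < a'" "a' \<le> R" "a' / R \<le> \<eta>" "1 < a'" using \<eta> a \<rho>(2) by (auto simp: a'_def field_simps min_def)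
  obtain A where A: "A \<ge> 0" "\<And>k z. lev z \<le> \<sigma> \<Longrightarrow> norm (poly (op k) z) \<le> A * a ^ k"
    using op_uniform_bound[OF \<rho>(2) a] by blast
  obtain C1 b where C1: "C1 \<ge> 0" "0 < b" "b < 1"
    "\<forall>\<^sub>F n in sequentially. \<forall>\<nu>\<ge>n. norm (cf (\<lambda>z. poly (Q n) z * G z) \<nu>) \<le> C1 * (1 / R) ^ n * b ^ (\<nu> - n)"
    using tail[OF \<eta>(2,3)] unfolding tail_bound_def by blast
  obtain C2 where C2: "C2 \<ge> 0" "\<And>n q. degree q \<le> M \<Longrightarrow> norm (cf (\<lambda>z. poly q z * ?LG z) n) \<le> C2 * (1 / R) ^ n * coeff_norm q"
    using cf_poly_mult_decay[OF LG \<eta>(2,3), of M] by blast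
  define D where "D = BL * (C1 * (1 / (1 - b))) + C2 * B"
  have D: "0 \<le> D" using BL C1 C2 B by (simp add: D_def)
  define K where "K = D * a' ^ N * A * (1 / (1 - a / a'))"
  have "a / a' < 1" "0 < a / a'" using a' a \<rho>(2) by auto
  then have K: "0 \<le> K" unfolding K_def using D A a' by (intro mult_nonneg_nonneg) auto
  have "\<forall>\<^sub>F n in sequentially. \<forall>p. degree p \<le> n - 1 \<longrightarrow>
     (\<forall>k\<le>n. cf (\<lambda>z. poly (Q n) z * G z) k = cf (poly p) k) \<longrightarrow>
     (\<forall>z. lev z \<le> \<sigma> \<longrightarrow> norm (poly (Q n) z * ser ?LG z - poly L z * poly p z) \<le> K * \<eta> ^ n)"
    using C1(4) Q_solves Q_bounded eventually_gt_at_top[of 0]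
  proof eventually_elim
    case (elim n)
    show ?case
    proof (intro allI impI)
      fix p z
      assume p: "degree p \<le> n - 1" "\<forall>k\<le>n. cf (\<lambda>z. poly (Q n) z * G z) k = cf (poly p) k" and z: "lev z \<le> \<sigma>"
      have dQ: "degree (Q n) \<le> M" using elim by (simp add: solves_def)
      let ?D = "\<lambda>z. poly (Q n) z * G z - poly p z"
      let ?W = "\<lambda>z. poly L z * ?D z"
      have cfD: "cf ?D k = cf (\<lambda>z. poly (Q n) z * G z) k - cf (poly p) k" for k
        by (rule cf_diff) (intro continuous_intros contG)+
      have low: "cf ?D k = 0" if "k \<le> n" for k using p(2) that by (simp add: cfD)
      have high: "cf ?D k = cf (\<lambda>z. poly (Q n) z * G z) k" if "n < k" for k
        using cf_low[of p k] p(1) that by (simp add: cfD)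
      \<comment> \<open>k = 0 is the index n, where the remainder has no coefficient.\<close>
      have bD: "norm (cf ?D (k + n)) \<le> C1 * (1 / R) ^ n * b ^ k" for k
      proof (cases "k = 0")
        case True then show ?thesis using low[of n] C1 \<eta>(2) by simp
      next
        case False
        then show ?thesis using high[of "k + n"] elim(1)[rule_format, of "k + n"] by simp
      qed
      have pp: "hol_ext E \<rho>' (poly p)" for \<rho>' by (rule hol_extI[OF _ same_germ_refl]) (intro holomorphic_intros)
      have hD: "hol_ext E (ereal r0) ?D"
        using hol_ext_add[OF hol_ext_poly_mult[OF r0(2), of "Q n"] hol_ext_cmult[OF pp, of _ "-1"]] by simp
      have "summable (\<lambda>\<nu>. norm (cf ?D \<nu>))" by (rule cf_poly_mult_bound(1)[OF hD r01 L BL])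
      then have "(\<Sum>\<nu>. norm (cf ?D \<nu>)) = (\<Sum>k. norm (cf ?D (k + n))) + (\<Sum>\<nu><n. norm (cf ?D \<nu>))"
        by (rule suminf_split_initial_segment)
      also have "(\<Sum>\<nu><n. norm (cf ?D \<nu>)) = 0" using low by (intro sum.neutral) auto
      also have "(\<Sum>k. norm (cf ?D (k + n))) \<le> (\<Sum>k. C1 * (1 / R) ^ n * b ^ k)"
      proof (rule suminf_le[OF bD])
        show "summable (\<lambda>k. norm (cf ?D (k + n)))" by (rule summable_ignore_initial_segment) fact
        show "summable (\<lambda>k. C1 * (1 / R) ^ n * b ^ k)" using C1 by (intro summable_mult summable_geometric) auto
      qed
      also have "\<dots> = C1 * (1 / R) ^ n * (1 / (1 - b))" using C1 by (subst suminf_mult) (auto simp: suminf_geometric intro!: summable_geometric)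
      finally have sumD: "(\<Sum>\<nu>. norm (cf ?D \<nu>)) \<le> C1 * (1 / R) ^ n * (1 / (1 - b))" by simp
      have W1: "norm (cf ?W k) \<le> D * (1 / R) ^ n" for k
      proof -
        have "norm (cf ?W k) \<le> BL * (\<Sum>\<nu>. norm (cf ?D \<nu>))" by (rule cf_poly_mult_bound(2)[OF hD r01 L BL])
        also have "\<dots> \<le> BL * (C1 * (1 / R) ^ n * (1 / (1 - b)))" by (rule mult_left_mono[OF sumD BL])
        also have "\<dots> = BL * (C1 * (1 / (1 - b))) * (1 / R) ^ n" by simp
        also have "\<dots> \<le> D * (1 / R) ^ n" using C2(1) B \<eta>(2) by (intro mult_right_mono) (auto simp: D_def)
        finally show ?thesis .
      qed
      \<comment> \<open>Here the index exceeds the degree of L p, so only Q_n L G contributes, and L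
        G is holomorphic beyond R.\<close>
      have W2: "norm (cf ?W k) \<le> D * (1 / R) ^ k" if k: "n + N < k" for k
      proof -
        have "cf ?W k = cf (\<lambda>z. poly (Q n) z * ?LG z - poly (L * p) z) k" by (rule cf_cong) (simp add: algebra_simps)
        also have "\<dots> = cf (\<lambda>z. poly (Q n) z * ?LG z) k - cf (poly (L * p)) k"
          by (rule cf_diff) (intro continuous_intros contG)+
        also have "cf (poly (L * p)) k = 0"
          by (rule cf_low) (use degree_mult_le[of L p] dL p(1) k in linarith)
        finally have "norm (cf ?W k) \<le> C2 * (1 / R) ^ k * coeff_norm (Q n)" using C2(2)[OF dQ] by simp
        also have "\<dots> \<le> C2 * (1 / R) ^ k * B" using elim C2(1) \<eta>(2) by (intro mult_left_mono) auto
        also have "\<dots> = (C2 * B) * (1 / R) ^ k" by simp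
        also have "\<dots> \<le> D * (1 / R) ^ k" using BL C1 \<eta>(2) by (intro mult_right_mono) (auto simp: D_def)
        finally show ?thesis .
      qed
      \<comment> \<open>A common majorant: for k \<le> n + N the bound \<open>W1\<close> is
        multiplied by a power of a' > 1, for larger k the bound \<open>W2\<close> is weakened by a'
        \<le> R.\<close>
      have W: "norm (cf ?W k) \<le> D * a' ^ N * (a' / R) ^ n * (1 / a') ^ k" for k
      proof (cases "k \<le> n + N")
        case True
        then obtain j where j: "n + N = k + j" by (auto simp: le_iff_add)
        have "D * (1 / R) ^ n * 1 \<le> D * (1 / R) ^ n * a' ^ j" using a' D \<eta>(2) by (intro mult_left_mono) auto
        also have "a' ^ j = a' ^ (n + N) * (1 / a') ^ k" using a' unfolding j by (simp add: power_add power_divide)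
        also have "D * (1 / R) ^ n * \<dots> = D * a' ^ N * (a' / R) ^ n * (1 / a') ^ k" by (simp add: power_add power_divide mult_ac)
        finally show ?thesis using W1[of k] by simp
      next
        case False
        then obtain j where j: "k = n + j" by (metis le_add1 le_iff_add linear order_trans)
        have "(1 / R) ^ k = (1 / R) ^ n * (1 / R) ^ j" by (simp add: j power_add)
        also have "\<dots> \<le> (1 / R) ^ n * (1 / a') ^ j" using a' \<eta>(2) by (intro mult_left_mono power_mono divide_left_mono) auto
        also have "\<dots> = (a' / R) ^ n * (1 / a') ^ k" using a' by (simp add: j power_add power_divide)
        also have "\<dots> = 1 * ((a' / R) ^ n * (1 / a') ^ k)" by simp
        also have "\<dots> \<le> a' ^ N * ((a' / R) ^ n * (1 / a') ^ k)"
          using a' \<eta>(2) by (intro mult_right_mono one_le_power mult_nonneg_nonneg zero_le_power) auto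
        finally have "D * (1 / R) ^ k \<le> D * (a' ^ N * ((a' / R) ^ n * (1 / a') ^ k))" using D by (intro mult_left_mono)
        also have "\<dots> = D * a' ^ N * (a' / R) ^ n * (1 / a') ^ k" by (simp only: mult.assoc)
        finally show ?thesis using W2[of k] False by simp
      qed
      let ?h = "\<lambda>z. poly (Q n) z * ser ?LG z - poly L z * poly p z"
      have hol: "?h holomorphic_on \<D> \<rho>" by (intro holomorphic_intros hol_ext_ser(1)[OF LG \<rho>1])
      have "same_germ E ?h (\<lambda>z. poly (Q n) z * ?LG z - poly L z * poly p z)"
        by (rule same_germ_compose2[OF hol_ext_ser(2)[OF LG \<rho>1] same_germ_refl])
      moreover have "(\<lambda>z. poly (Q n) z * ?LG z - poly L z * poly p z) = ?W" by (simp add: algebra_simps)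
      ultimately have germ: "same_germ E ?h ?W" by simp
      have "ereal (lev z) \<le> ereal \<sigma>" using z by simp
      then have "ereal (lev z) < \<rho>" using \<rho>(1) by (rule le_less_trans)
      then have zD: "z \<in> \<D> \<rho>" by (simp add: domain_eq[OF \<rho>1])
      have "?h z = ser ?h z" by (rule ser_eq[OF hol \<rho>1 zD, symmetric])
      also have "\<dots> = ser ?W z" by (simp only: ser_germ[OF germ])
      also have "\<dots> = (\<Sum>k. cf ?W k * poly (op k) z)" by (simp only: ser_def)
      finally have hz: "?h z = (\<Sum>k. cf ?W k * poly (op k) z)" .
      define T where "T = D * a' ^ N * (a' / R) ^ n * A"
      have bnd: "norm (cf ?W k * poly (op k) z) \<le> T * (a / a') ^ k" for k
      proof -
        have "norm (cf ?W k * poly (op k) z) \<le> (D * a' ^ N * (a' / R) ^ n * (1 / a') ^ k) * (A * a ^ k)"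
          unfolding norm_mult by (rule mult_mono[OF W A(2)[OF z]]) (use D a' \<eta>(2) in auto)
        also have "\<dots> = T * (a / a') ^ k" by (simp add: T_def power_divide)
        finally show ?thesis .
      qed
      have sg: "summable (\<lambda>k. T * (a / a') ^ k)"
        using \<open>a / a' < 1\<close> \<open>0 < a / a'\<close> by (intro summable_mult summable_geometric) auto
      have "norm (?h z) \<le> (\<Sum>k. T * (a / a') ^ k)" unfolding hz by (rule norm_suminf_le[OF bnd sg])
      also have "\<dots> = T * (1 / (1 - a / a'))"
        using \<open>a / a' < 1\<close> \<open>0 < a / a'\<close> by (subst suminf_mult) (auto simp: suminf_geometric intro!: summable_geometric)
      also have "\<dots> = K * (a' / R) ^ n" by (simp add: T_def K_def)
      also have "\<dots> \<le> K * \<eta> ^ n" using K a' \<eta>(2) by (intro mult_left_mono power_mono) auto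
      finally show "norm (?h z) \<le> K * \<eta> ^ n" .
    qed
  qed
  then show ?thesis using K by blast
qed

end

context hp_setting
begin

lemma ext_map_norm_bounds:
  assumes K: "compact K" "K \<subseteq> \<D> \<rho>" and \<rho>: "1 < \<rho>"
  shows "1 \<le> ext_map_norm E K" "\<And>z. z \<in> K \<Longrightarrow> lev z \<le> ext_map_norm E K" "ereal (ext_map_norm E K) < \<rho>"
proof -
  have "1 \<le> ext_map_norm E K \<and> (\<forall>z\<in>K. lev z \<le> ext_map_norm E K) \<and> ereal (ext_map_norm E K) < \<rho>"
  proof (cases "K \<subseteq> E")
    case True
    then have "lev z = 1" if "z \<in> K" for z using that lev_E by blast
    then show ?thesis using True \<rho> by (simp add: ext_map_norm_def flip: one_ereal_def)
  next
    case False
    then have "K \<noteq> {}" by blast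
    then obtain z0 where z0: "z0 \<in> K" "\<And>z. z \<in> K \<Longrightarrow> lev z \<le> lev z0"
      using continuous_attains_sup[OF K(1) _ continuous_on_subset[OF lev_cont]] by blast
    obtain z1 where "z1 \<in> K" "z1 \<notin> E" using False by blast
    then have "1 < lev z0" using z0(2)[of z1] lev_gt_1[of z1] by simp
    then have z0E: "z0 \<notin> E" by (simp add: lev_gt_1)
    have "Sup (insert 0 ((\<lambda>z. norm (\<Phi> z)) ` (K - E))) = lev z0"
    proof (rule cSup_eq_maximum)
      show "lev z0 \<in> insert 0 ((\<lambda>z. norm (\<Phi> z)) ` (K - E))" using z0(1) z0E by (simp add: lev_notin)
      fix x assume "x \<in> insert 0 ((\<lambda>z. norm (\<Phi> z)) ` (K - E))"
      then consider "x = 0" | z where "z \<in> K" "z \<notin> E" "x = norm (\<Phi> z)" by blast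
      then show "x \<le> lev z0"
      proof cases
        case 1 then show ?thesis using \<open>1 < lev z0\<close> by simp
      next
        case 2 then show ?thesis using z0(2) by (simp add: lev_notin[symmetric])
      qed
    qed
    then have eq: "ext_map_norm E K = lev z0" using False by (simp add: ext_map_norm_def sup_norm_def)
    have "z0 \<in> \<D> \<rho>" using z0(1) K(2) by blast
    then have "ereal (lev z0) < \<rho>" by (simp add: domain_eq[OF \<rho>])
    then show ?thesis unfolding eq using \<open>1 < lev z0\<close> z0(2) by simp
  qed
  then show "1 \<le> ext_map_norm E K" "\<And>z. z \<in> K \<Longrightarrow> lev z \<le> ext_map_norm E K" "ereal (ext_map_norm E K) < \<rho>" by auto
qed

lemma system_ratio_bound:
  assumes fin: "finite sp"
  shows "\<exists>\<eta>. 0 < \<eta> \<and> \<eta> < 1 \<and> (\<forall>\<xi>\<in>sp. ereal (norm (\<Phi> \<xi>)) / bold_rho E d F m \<xi> < ereal \<eta>)"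
proof -
  let ?r = "\<lambda>\<xi>. ereal (norm (\<Phi> \<xi>)) / bold_rho E d F m \<xi>"
  have lt1: "?r \<xi> < 1" if \<xi>: "\<xi> \<in> sp" for \<xi>
  proof -
    have "spo \<xi> \<in> {1..spo \<xi>}" using system_poleD(2)[OF \<xi>] by simp
    then have "ereal (norm (\<Phi> \<xi>)) < bold_rho E d F m \<xi>"
      unfolding bold_rho_def by (rule bold_rho_pole_gt_level[OF \<xi>])
    then show ?thesis
    proof (cases "bold_rho E d F m \<xi>")
      case (real b)
      then have "norm (\<Phi> \<xi>) < b" using \<open>ereal (norm (\<Phi> \<xi>)) < bold_rho E d F m \<xi>\<close> by simp
      moreover have "0 \<le> norm (\<Phi> \<xi>)" by simp
      ultimately have "0 < b" by linarith
      with \<open>norm (\<Phi> \<xi>) < b\<close> have "0 < b" "norm (\<Phi> \<xi>) / b < 1" by simp_all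
      then show ?thesis by (simp add: real flip: one_ereal_def)
    qed auto
  qed
  \<comment> \<open>The added 0 keeps the maximum defined without system poles and makes \<eta>
    positive.\<close>
  have "Max (insert 0 (?r ` sp)) < 1" using fin lt1 by simp
  then obtain \<eta> where \<eta>: "Max (insert 0 (?r ` sp)) < ereal \<eta>" "ereal \<eta> < 1"
    using ereal_dense2 by blast
  then have "\<forall>x\<in>insert 0 (?r ` sp). x < ereal \<eta>" using fin by simp
  then show ?thesis using \<eta>(2) by (intro exI[of _ \<eta>]) (simp flip: one_ereal_def zero_ereal_def)
qed

lemma approximant_limsup:
  assumes a: "has_exactly_system_poles E d F m M" and hp: "\<forall>n\<ge>1. hermite_pade \<mu> d F m n (Q n) (P n)"
    and i: "i \<in> {1..d}"
  defines "\<rho> \<equiv> rho_comp_star E d F m i 0"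
  defines "f \<equiv> \<lambda>z. ser (\<lambda>z. poly sys z * F i z) z / poly sys z"
  shows "f holomorphic_on (\<D> \<rho> - sp)" "same_germ E f (F i)"
    "\<And>K. compact K \<Longrightarrow> K \<subseteq> \<D> \<rho> - sp \<Longrightarrow>
       limsup (\<lambda>n. ereal (root n (sup_norm K (\<lambda>z. poly (P n 0 i) z / poly (Q n) z - f z))))
         \<le> ereal (ext_map_norm E K) / \<rho>"
proof -
  have fin: "finite sp" using a by (simp add: has_exactly_system_poles_def)
  have \<rho>1: "1 < \<rho>" unfolding \<rho>_def by (rule rho_comp_star_poles(1)[OF i fin])
  have sys0: "poly sys z = 0 \<longleftrightarrow> z \<in> sp" for z by (rule poly_sys_zero_iff[OF fin])
  have spE: "z \<notin> E" if "z \<in> sp" for z using system_poleD(1)[OF that] .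
  have "hol_ext E (rho_comp E d F m i 0) (\<lambda>z. poly sys z * (z ^ 0 * F i z))" by (rule rho_comp_hol_ext[OF i fin])
  then have "hol_ext E \<rho> (\<lambda>z. poly sys z * (z ^ 0 * F i z))"
    by (rule hol_ext_mono) (simp only: \<rho>_def rho_comp_star_def min.cobounded1)
  then have LF: "hol_ext E \<rho> (\<lambda>z. poly sys z * F i z)" by simp
  note s = hol_ext_ser[OF LF \<rho>1]
  show "f holomorphic_on (\<D> \<rho> - sp)" unfolding f_def
    by (intro holomorphic_intros holomorphic_on_subset[OF s(1)]) (auto simp: sys0)
  obtain U where U: "open U" "E \<subseteq> U" "\<forall>z\<in>U. ser (\<lambda>z. poly sys z * F i z) z = poly sys z * F i z"
    using s(2) unfolding same_germ_def by blast
  have "open (U - sp)" by (intro open_Diff U(1) finite_imp_closed fin)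
  moreover have "E \<subseteq> U - sp" using U(2) spE by blast
  moreover have "\<forall>z\<in>U - sp. f z = F i z" using U(3) by (simp add: f_def sys0)
  ultimately show "same_germ E f (F i)" unfolding same_germ_def by blast
  fix K assume K: "compact K" "K \<subseteq> \<D> \<rho> - sp"
  define \<phi> where "\<phi> = ext_map_norm E K"
  have \<phi>: "1 \<le> \<phi>" "\<And>z. z \<in> K \<Longrightarrow> lev z \<le> \<phi>" "ereal \<phi> < \<rho>"
    unfolding \<phi>_def using ext_map_norm_bounds[OF K(1) _ \<rho>1] K(2) by blast+
  obtain \<eta>0 where \<eta>0: "0 < \<eta>0" "\<eta>0 < 1" "\<And>\<xi>. \<xi> \<in> sp \<Longrightarrow> ereal (norm (\<Phi> \<xi>)) / bold_rho E d F m \<xi> < ereal \<eta>0"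
    using system_ratio_bound[OF fin] by blast
  obtain C0 where C0: "\<forall>\<^sub>F n in sequentially. \<forall>q. solves n q \<longrightarrow> lead_coeff q = 1 \<longrightarrow> degree q = M \<and> coeff_norm (q - sys) \<le> C0 * \<eta>0 ^ n"
    using direct_bound(2)[OF a \<eta>0] by blast
  have sol: "solves n (Q n) \<and> lead_coeff (Q n) = 1 \<and> Q n \<noteq> 0" if "1 \<le> n" for n
    using hermite_pade_imp_solves(1,2,3)[OF _ that, of "Q n" "P n"] hp that by blast
  have Qc: "\<forall>\<^sub>F n in sequentially. degree (Q n) = M \<and> coeff_norm (Q n - sys) \<le> C0 * \<eta>0 ^ n"
    using C0 eventually_ge_at_top[of 1] by eventually_elim (use sol in blast)
  define B where "B = coeff_norm sys + \<bar>C0\<bar>"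
  interpret bounded_solutions E \<mu> d F m Q B
  proof
    show "\<forall>\<^sub>F n in sequentially. solves n (Q n)"
      using eventually_ge_at_top[of 1] by eventually_elim (use sol in blast)
    show "\<forall>\<^sub>F n in sequentially. coeff_norm (Q n) \<le> B"
      using Qc
    proof eventually_elim
      case (elim n)
      have "C0 * \<eta>0 ^ n \<le> \<bar>C0\<bar> * 1" using \<eta>0 by (intro mult_mono) (auto simp: power_le_one)
      then show ?case using coeff_norm_triangle[of "Q n - sys" sys] elim by (simp add: B_def)
    qed
    show "0 \<le> B" by (simp add: B_def coeff_norm_nonneg)
  qed
  \<comment> \<open>\<open>K\<close> avoids the zeros of \<open>sys\<close>, so \<open>sys\<close>
    and, for large n, also Q_n are bounded away from 0 on \<open>K\<close>. Division by both costs a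
    constant, which the n-th root removes.\<close>
  have "\<exists>\<delta>>0. \<forall>z\<in>K. \<delta> \<le> norm (poly sys z)"
  proof (cases "K = {}")
    case False
    have "continuous_on K (\<lambda>z. norm (poly sys z))" by (intro continuous_intros)
    then obtain z0 where z0: "z0 \<in> K" "\<And>z. z \<in> K \<Longrightarrow> norm (poly sys z0) \<le> norm (poly sys z)"
      using continuous_attains_inf[OF K(1) False] by blast
    have "poly sys z0 \<noteq> 0" using z0(1) K(2) sys0 by blast
    then show ?thesis using z0(2) by (intro exI[of _ "norm (poly sys z0)"]) simp
  qed (auto intro: exI[of _ 1])
  then obtain \<delta> where \<delta>: "0 < \<delta>" "\<And>z. z \<in> K \<Longrightarrow> \<delta> \<le> norm (poly sys z)" by blast
  obtain B0 where B0: "\<And>z. z \<in> K \<Longrightarrow> norm z \<le> B0" using compact_imp_bounded[OF K(1)] by (auto simp: bounded_iff)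
  define B1 where "B1 = max B0 1"
  have B1: "1 \<le> B1" "\<And>z. z \<in> K \<Longrightarrow> norm z \<le> B1" using B0 by (auto simp: B1_def le_max_iff_disj)
  have "(\<lambda>n. B1 ^ M * (C0 * \<eta>0 ^ n)) \<longlonglongrightarrow> B1 ^ M * (C0 * 0)" using \<eta>0 by (intro tendsto_intros LIMSEQ_power_zero) auto
  then have ev\<delta>: "\<forall>\<^sub>F n in sequentially. B1 ^ M * (C0 * \<eta>0 ^ n) < \<delta> / 2" using \<delta>(1) by (intro order_tendstoD) auto
  have Qlow: "\<forall>\<^sub>F n in sequentially. \<forall>z\<in>K. \<delta> / 2 \<le> norm (poly (Q n) z)"
    using ev\<delta> Qc
  proof eventually_elim
    case (elim n)
    show ?case
    proof
      fix z assume z: "z \<in> K"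
      have "norm (poly (Q n - sys) z) \<le> B1 ^ M * coeff_norm (Q n - sys)"
        by (rule poly_norm_le_coeff_norm)
          (use elim B1 z a system_poly_monic(1)[OF fin] in \<open>auto simp: has_exactly_system_poles_def intro: degree_diff_le\<close>)
      also have "\<dots> \<le> B1 ^ M * (C0 * \<eta>0 ^ n)" using elim B1 by (intro mult_left_mono) auto
      also have "\<dots> < \<delta> / 2" using elim by blast
      finally have "norm (poly (Q n) z - poly sys z) < \<delta> / 2" by simp
      moreover have "norm (poly sys z) - norm (poly (Q n) z) \<le> norm (poly (Q n) z - poly sys z)"
        by (metis norm_minus_commute norm_triangle_ineq2)
      ultimately show "\<delta> / 2 \<le> norm (poly (Q n) z)" using \<delta>(2)[OF z] by linarith
    qed
  qed
  let ?e = "\<lambda>n. sup_norm K (\<lambda>z. poly (P n 0 i) z / poly (Q n) z - f z)"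
  have bound: "limsup (\<lambda>n. ereal (root n (?e n))) \<le> ereal \<eta>" if \<eta>: "ereal \<phi> / \<rho> < ereal \<eta>" for \<eta>
  proof -
    have "0 \<le> ereal \<phi> / \<rho>" using \<phi>(1) \<rho>1 by (cases \<rho>) auto
    then have "0 < ereal \<eta>" using \<eta> by (rule le_less_trans)
    then have \<eta>pos: "0 < \<eta>" by simp
    obtain R where R: "\<phi> < R" "ereal R < \<rho>" "\<phi> / R < \<eta>"
      using ereal_ratio_between[OF _ \<eta>pos \<phi>(3) \<eta>] \<phi>(1) by auto
    \<comment> \<open>Room for \<open>remainder_bound\<close>: \<sigma> is the level of the
      estimate, b the growth of p_n there and R the decay of the coefficients, with b < \<eta>
      R.\<close>
    have "\<phi> < min R (\<eta> * R)" using R \<phi>(1) by (simp add: field_simps)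
    then obtain \<sigma> where \<sigma>: "\<phi> < \<sigma>" "\<sigma> < min R (\<eta> * R)" using dense by blast
    then obtain b where b: "\<sigma> < b" "b < min R (\<eta> * R)" using dense[OF \<sigma>(2)] by blast
    have "ereal \<sigma> < ereal R" using \<sigma> by simp
    then have \<sigma>\<rho>: "ereal \<sigma> < \<rho>" using R(2) by (rule less_trans)
    have bR: "b < \<eta> * R" "b < R" "1 < \<sigma>" "1 < R" using b \<sigma> \<phi>(1) R(1) by auto
    have Fan: "F i analytic_on E" using F_analytic i by blast
    obtain C where C: "C \<ge> 0" "\<forall>\<^sub>F n in sequentially. \<forall>p. degree p \<le> n - 1 \<longrightarrow>
       (\<forall>k\<le>n. cf (\<lambda>z. poly (Q n) z * F i z) k = cf (poly p) k) \<longrightarrow>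
       (\<forall>z. lev z \<le> \<sigma> \<longrightarrow> norm (poly (Q n) z * ser (\<lambda>z. poly sys z * F i z) z - poly sys z * poly p z) \<le> C * \<eta> ^ n)"
      using remainder_bound[OF \<sigma>\<rho> bR(3) Fan LF order_refl b(1) tail_bound_component[OF i fin, folded \<rho>_def] bR(1,4) R(2) bR(2)]
      by blast
    have "\<forall>\<^sub>F n in sequentially. ?e n \<le> (C / (\<delta> / 2 * \<delta>)) * \<eta> ^ n"
      using C(2) Qlow eventually_ge_at_top[of 1]
    proof eventually_elim
      case (elim n)
      have i0: "0 < m i" using m_pos i by (simp add: Suc_le_eq)
      have hn: "hermite_pade \<mu> d F m n (Q n) (P n)" using hp elim by blast
      have "degree (P n 0 i) \<le> n - 1" by (rule hermite_pade_imp_solves(5)[OF hn elim(3) i i0])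
      moreover have "\<forall>k\<le>n. cf (\<lambda>z. poly (Q n) z * F i z) k = cf (poly (P n 0 i)) k"
        using hermite_pade_imp_solves(4)[OF hn elim(3) i i0] by simp
      ultimately have rem: "norm (poly (Q n) z * ser (\<lambda>z. poly sys z * F i z) z - poly sys z * poly (P n 0 i) z) \<le> C * \<eta> ^ n"
        if "lev z \<le> \<sigma>" for z using elim(1) that by blast
      have pt: "norm (poly (P n 0 i) z / poly (Q n) z - f z) \<le> (C / (\<delta> / 2 * \<delta>)) * \<eta> ^ n" if z: "z \<in> K" for z
      proof -
        let ?s = "ser (\<lambda>z. poly sys z * F i z) z"
        have nz: "\<delta> / 2 \<le> norm (poly (Q n) z)" "\<delta> \<le> norm (poly sys z)" using elim(2) \<delta>(2) z by auto
        then have "poly (Q n) z \<noteq> 0" "poly sys z \<noteq> 0" using \<delta>(1) by auto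
        then have "poly (P n 0 i) z / poly (Q n) z - f z
            = - (poly (Q n) z * ?s - poly sys z * poly (P n 0 i) z) / (poly (Q n) z * poly sys z)"
          by (simp add: f_def field_simps)
        then have "norm (poly (P n 0 i) z / poly (Q n) z - f z)
            = norm (poly (Q n) z * ?s - poly sys z * poly (P n 0 i) z) / (norm (poly (Q n) z) * norm (poly sys z))"
          by (simp only: norm_divide norm_minus_cancel norm_mult)
        also have "\<dots> \<le> (C * \<eta> ^ n) / (\<delta> / 2 * \<delta>)"
        proof (rule frac_le)
          show "0 \<le> C * \<eta> ^ n" using C(1) \<eta>pos by simp
          show "norm (poly (Q n) z * ?s - poly sys z * poly (P n 0 i) z) \<le> C * \<eta> ^ n"
            by (rule rem) (use \<phi>(2)[OF z] \<sigma>(1) in linarith)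
          show "0 < \<delta> / 2 * \<delta>" using \<delta>(1) by simp
          show "\<delta> / 2 * \<delta> \<le> norm (poly (Q n) z) * norm (poly sys z)"
            using nz \<delta>(1) by (intro mult_mono) auto
        qed
        finally show ?thesis by (simp only: times_divide_eq_left)
      qed
      have "0 \<le> (C / (\<delta> / 2 * \<delta>)) * \<eta> ^ n" using C(1) \<delta>(1) \<eta>pos by simp
      then show ?case unfolding sup_norm_def using pt by (intro cSup_least) auto
    qed
    then show ?thesis by (rule limsup_root_le[OF _ \<eta>pos])
  qed
  show "limsup (\<lambda>n. ereal (root n (?e n))) \<le> ereal (ext_map_norm E K) / \<rho>"
  proof (rule dense_ge)
    fix x assume x: "ereal (ext_map_norm E K) / \<rho> < x"
    show "limsup (\<lambda>n. ereal (root n (?e n))) \<le> x"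
    proof (cases x)
      case (real \<eta>) then show ?thesis using bound x by (simp add: \<phi>_def)
    qed (use x in auto)
  qed
qed

end

section \<open>The equivalence\<close>

context hp_setting
begin

lemma system_ratio_nonneg:
  assumes "\<xi> \<in> sp"
  shows "0 \<le> ereal (norm (\<Phi> \<xi>)) / bold_rho E d F m \<xi>"
proof -
  have "spo \<xi> \<in> {1..spo \<xi>}" using system_poleD(2)[OF assms] by simp
  then have "ereal (norm (\<Phi> \<xi>)) < bold_rho E d F m \<xi>"
    unfolding bold_rho_def by (rule bold_rho_pole_gt_level[OF assms])
  moreover have "0 \<le> norm (\<Phi> \<xi>)" by simp
  ultimately have "0 \<le> bold_rho E d F m \<xi>" by (metis ereal_less_eq(5) less_imp_le order_trans)
  then show ?thesis unfolding divide_ereal_def by (intro ereal_0_le_mult) (simp_all add: ereal_inverse_nonneg_iff)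
qed

lemma direct_denominators:
  assumes a: "has_exactly_system_poles E d F m M" and hp: "\<forall>n\<ge>1. hermite_pade \<mu> d F m n (Q n) (P n)"
  shows "\<forall>\<^sub>F n in sequentially. \<exists>!q. \<exists>p. hermite_pade \<mu> d F m n q p"
    "\<And>\<eta>. 0 < \<eta> \<Longrightarrow> \<eta> < 1 \<Longrightarrow> (\<And>\<xi>. \<xi> \<in> sp \<Longrightarrow> ereal (norm (\<Phi> \<xi>)) / bold_rho E d F m \<xi> < ereal \<eta>) \<Longrightarrow>
       limsup (\<lambda>n. ereal (root n (coeff_norm (Q n - sys)))) \<le> ereal \<eta>"
    "denominators_limit Q M sys (limsup (\<lambda>n. ereal (root n (coeff_norm (Q n - sys)))))"
proof -
  have fin: "finite sp" using a by (simp add: has_exactly_system_poles_def)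
  obtain \<eta>0 where \<eta>0: "0 < \<eta>0" "\<eta>0 < 1" "\<And>\<xi>. \<xi> \<in> sp \<Longrightarrow> ereal (norm (\<Phi> \<xi>)) / bold_rho E d F m \<xi> < ereal \<eta>0"
    using system_ratio_bound[OF fin] by blast
  have sol: "solves n q \<and> lead_coeff q = 1" if "1 \<le> n" "hermite_pade \<mu> d F m n q p" for n q p
    using hermite_pade_imp_solves(1,2)[OF that(2,1)] by blast
  obtain C0 where C0: "\<forall>\<^sub>F n in sequentially. \<forall>q. solves n q \<longrightarrow> lead_coeff q = 1 \<longrightarrow> degree q = M \<and> coeff_norm (q - sys) \<le> C0 * \<eta>0 ^ n"
    using direct_bound(2)[OF a \<eta>0] by blast
  have U0: "\<forall>\<^sub>F n in sequentially. \<forall>q. solves n q \<longrightarrow> degree q < M \<longrightarrow> q = 0"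
    by (rule direct_bound(1)[OF a \<eta>0])
  show "\<forall>\<^sub>F n in sequentially. \<exists>!q. \<exists>p. hermite_pade \<mu> d F m n q p"
    using U0 C0 eventually_ge_at_top[of 1]
  proof eventually_elim
    case (elim n)
    show ?case
    proof (rule ex1I[of _ "Q n"])
      show "\<exists>p. hermite_pade \<mu> d F m n (Q n) p" using hp elim(3) by blast
      fix q assume "\<exists>p. hermite_pade \<mu> d F m n q p"
      then have q: "solves n q" "lead_coeff q = 1" "degree q = M" using sol elim by blast+
      have Q: "solves n (Q n)" "lead_coeff (Q n) = 1" "degree (Q n) = M" using sol hp elim by blast+
      have "degree (q - Q n) < M"
      proof (rule degree_lessI)
        show "\<forall>k\<ge>M. coeff (q - Q n) k = 0"
        proof (intro allI impI)
          fix k assume "M \<le> k"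
          then show "coeff (q - Q n) k = 0" using q Q by (cases "k = M") (auto simp: coeff_eq_0)
        qed
      qed (use M_pos in simp)
      then have "q - Q n = 0" using elim(1) solves_diff[OF q(1) Q(1)] by blast
      then show "q = Q n" by simp
    qed
  qed
  show lim: "limsup (\<lambda>n. ereal (root n (coeff_norm (Q n - sys)))) \<le> ereal \<eta>"
    if \<eta>: "0 < \<eta>" "\<eta> < 1" "\<And>\<xi>. \<xi> \<in> sp \<Longrightarrow> ereal (norm (\<Phi> \<xi>)) / bold_rho E d F m \<xi> < ereal \<eta>" for \<eta>
  proof -
    obtain C where C: "\<forall>\<^sub>F n in sequentially. \<forall>q. solves n q \<longrightarrow> lead_coeff q = 1 \<longrightarrow> degree q = M \<and> coeff_norm (q - sys) \<le> C * \<eta> ^ n"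
      using direct_bound(2)[OF a \<eta>] by blast
    have "\<forall>\<^sub>F n in sequentially. coeff_norm (Q n - sys) \<le> C * \<eta> ^ n"
      using C eventually_ge_at_top[of 1] by eventually_elim (use sol hp in blast)
    then show ?thesis by (rule limsup_root_le[OF _ \<eta>(1)])
  qed
  have "limsup (\<lambda>n. ereal (root n (coeff_norm (Q n - sys)))) < 1"
  proof (rule le_less_trans)
    show "limsup (\<lambda>n. ereal (root n (coeff_norm (Q n - sys)))) \<le> ereal \<eta>0" by (rule lim[OF \<eta>0])
    show "ereal \<eta>0 < 1" using \<eta>0(2) by simp
  qed
  then show "denominators_limit Q M sys (limsup (\<lambda>n. ereal (root n (coeff_norm (Q n - sys)))))"
    using a system_poly_monic(1)[OF fin] by (simp add: denominators_limit_def has_exactly_system_poles_def)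
qed

text \<open>L has degree M, so convergence of the coefficients forces deg Q_n = M for large n and
  then the leading coefficient 1 of L. A nonzero solution q of degree below M would make Q_n + q a
  second monic solution.\<close>

lemma limit_inverse_setting:
  assumes hp: "\<forall>n\<ge>1. hermite_pade \<mu> d F m n (Q n) (P n)"
    and uniq: "\<forall>\<^sub>F n in sequentially. \<exists>!q. \<exists>p. hermite_pade \<mu> d F m n q p"
    and L: "denominators_limit Q M L \<theta>" and \<eta>: "\<theta> < ereal \<eta>" "0 < \<eta>" "\<eta> < 1"
    and kap: "\<exists>c>0. \<exists>n0\<ge>M. \<forall>n\<ge>n0. kappa \<mu> (n - M) / kappa \<mu> n \<ge> c"
  shows "inverse_setting E \<mu> d F m Q L \<eta>"
proof -
  have dL: "degree L = M" and lim: "limsup (\<lambda>n. ereal (root n (coeff_norm (Q n - L)))) < ereal \<eta>"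
    using L \<eta>(1) by (simp_all add: denominators_limit_def)
  have conv: "\<forall>\<^sub>F n in sequentially. coeff_norm (Q n - L) \<le> \<eta> ^ n"
    by (rule limsup_root_less_imp[OF lim]) (rule coeff_norm_nonneg)
  have sol: "solves n (Q n) \<and> lead_coeff (Q n) = 1" if "1 \<le> n" for n
    using hermite_pade_imp_solves(1,2)[OF _ that] hp that by blast
  have "L \<noteq> 0" using dL M_pos by auto
  then have L0: "lead_coeff L \<noteq> 0" by (simp only: leading_coeff_0_iff not_False_eq_True)
  have pow: "(\<lambda>n. \<eta> ^ n) \<longlonglongrightarrow> 0" using \<eta> by (intro LIMSEQ_power_zero) auto
  have L1: "0 < norm (lead_coeff L)" using L0 by (simp only: zero_less_norm_iff not_False_eq_True)
  have deg: "\<forall>\<^sub>F n in sequentially. degree (Q n) = M"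
    using order_tendstoD(2)[OF pow L1] conv eventually_ge_at_top[of 1]
  proof eventually_elim
    case (elim n)
    have "norm (coeff (Q n - L) M) < norm (coeff L M)"
      using coeff_le_coeff_norm[of "Q n - L" M] elim dL by simp
    then have "coeff (Q n) M \<noteq> 0" by auto
    then have "M \<le> degree (Q n)" by (rule le_degree)
    then show ?case using sol[of n] elim by (simp add: solves_def)
  qed
  have "norm (1 - lead_coeff L) \<le> 0"
  proof (rule tendsto_lowerbound[OF pow])
    show "\<forall>\<^sub>F n in sequentially. norm (1 - lead_coeff L) \<le> \<eta> ^ n"
      using conv deg eventually_ge_at_top[of 1]
    proof eventually_elim
      case (elim n)
      then show ?case using coeff_le_coeff_norm[of "Q n - L" M] sol[of n] dL by simp
    qed
  qed simp
  then have lL: "lead_coeff L = 1" by simp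
  show ?thesis
  proof unfold_locales
    show "\<forall>\<^sub>F n in sequentially. solves n (Q n) \<and> lead_coeff (Q n) = 1 \<and> degree (Q n) = M"
      using deg eventually_ge_at_top[of 1] by eventually_elim (use sol in blast)
    show "\<forall>\<^sub>F n in sequentially. \<forall>q. solves n q \<longrightarrow> degree q < M \<longrightarrow> q = 0"
      using uniq deg eventually_ge_at_top[of 1]
    proof eventually_elim
      case (elim n)
      show ?case
      proof (intro allI impI)
        fix q assume q: "solves n q" "degree q < M"
        have "degree (Q n + q) = M" using elim(2) q(2) by (simp add: degree_add_eq_left)
        then have "lead_coeff (Q n + q) = 1" using sol[OF elim(3)] elim(2) q(2) by (simp add: coeff_eq_0)
        moreover have "solves n (Q n + q)" using sol[OF elim(3)] q(1) by (intro solves_add) auto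
        ultimately have "\<exists>p. hermite_pade \<mu> d F m n (Q n + q) p" by (intro solves_imp_hermite_pade elim(3))
        moreover have "\<exists>p. hermite_pade \<mu> d F m n (Q n) p" using hp elim(3) by blast
        ultimately have "Q n + q = Q n" using elim(1) by blast
        then show "q = 0" by simp
      qed
    qed
  qed (use conv \<eta> dL lL kap in simp_all)
qed

end

theorem theorem1p2:
  fixes E :: "complex set"
    and d :: nat
    and F :: "nat \<Rightarrow> complex \<Rightarrow> complex"
    and m :: "nat \<Rightarrow> nat"
    and \<mu> :: "complex measure"
    and Q :: "nat \<Rightarrow> complex poly"
    and P :: "nat \<Rightarrow> nat \<Rightarrow> nat \<Rightarrow> complex poly"
  assumes "compact E" and "infinite E"
    and "simply_connected_space (sphere_complement E)"
    and "1 \<le> d"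
    and "\<forall>i\<in>{1..d}. F i analytic_on E"
    and "\<forall>i\<in>{1..d}. 1 \<le> m i"
    and "\<mu> \<in> Reg12m E (msize d m)"
    and "\<forall>n\<ge>1. hermite_pade \<mu> d F m n (Q n) (P n)"
  defines "cond_a \<equiv> has_exactly_system_poles E d F m (msize d m)"
    and "cond_b \<equiv>
      (\<forall>\<^sub>F n in sequentially. \<exists>!q. \<exists>p. hermite_pade \<mu> d F m n q p) \<and>
      (\<exists>L \<theta>. denominators_limit Q (msize d m) L \<theta>)"
  shows "(cond_a \<longleftrightarrow> cond_b) \<and>
    (cond_a \<or> cond_b \<longrightarrow>
      (\<forall>L \<theta>. denominators_limit Q (msize d m) L \<theta> \<longrightarrow>
         L = system_poly E d F m \<and>
         \<theta> = Max ((\<lambda>\<xi>. ereal (norm (ext_map E \<xi>)) / bold_rho E d F m \<xi>) ` system_poles E d F m)) \<and>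
      (\<forall>i\<in>{1..d}. \<exists>f.
         f holomorphic_on (canonical_domain E (rho_comp_star E d F m i 0) - system_poles E d F m) \<and>
         same_germ E f (F i) \<and>
         (\<forall>K. compact K \<and>
              K \<subseteq> canonical_domain E (rho_comp_star E d F m i 0) - system_poles E d F m \<longrightarrow>
            limsup (\<lambda>n. ereal (root n (sup_norm K
                (\<lambda>z. poly (P n 0 i) z / poly (Q n) z - f z))))
            \<le> ereal (ext_map_norm E K) / rho_comp_star E d F m i 0)))"
proof -
  have "is_exterior_map E (ext_map E)" using assms(1-3) by (rule exists_exterior_map)
  moreover have "\<mu> \<in> Reg12 E" using assms(7) by (simp add: Reg12m_def)
  moreover have "E \<noteq> {}" using assms(2) by auto
  ultimately interpret hp_setting E \<mu> d F m
    using assms(1,4-6) by unfold_locales simp_all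
  have kap: "\<exists>c>0. \<exists>n0\<ge>M. \<forall>n\<ge>n0. kappa \<mu> (n - M) / kappa \<mu> n \<ge> c"
    using assms(7) by (simp add: Reg12m_def)
  note hp = assms(8)
  let ?uniq = "\<forall>\<^sub>F n in sequentially. \<exists>!q. \<exists>p. hermite_pade \<mu> d F m n q p"
  let ?ratio = "\<lambda>\<xi>. ereal (norm (\<Phi> \<xi>)) / bold_rho E d F m \<xi>"
  have \<theta>0: "0 \<le> \<theta>" if L: "denominators_limit Q M L \<theta>" for L \<theta>
  proof -
    have "0 = limsup (\<lambda>n. 0 :: ereal)" by (simp add: Limsup_const)
    also have "\<dots> \<le> limsup (\<lambda>n. ereal (root n (coeff_norm (Q n - L))))"
      by (intro Limsup_mono always_eventually allI) (simp add: coeff_norm_nonneg real_root_ge_zero)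
    finally show ?thesis using L by (simp add: denominators_limit_def)
  qed
  \<comment> \<open>\<eta> stays free between \<theta> and 1, which yields the bound of the ratios
    by \<theta> itself when \<eta> tends to \<theta>.\<close>
  have inv: "cond_a \<and> L = sys \<and> (\<forall>\<xi>\<in>sp. ?ratio \<xi> \<le> ereal \<eta>)"
    if "?uniq" "denominators_limit Q M L \<theta>" "\<theta> < ereal \<eta>" "ereal \<eta> < 1" for L \<theta> \<eta>
  proof -
    have "0 < ereal \<eta>" using \<theta>0[OF that(2)] that(3) by (rule le_less_trans)
    then interpret inverse_setting E \<mu> d F m Q L \<eta>
      using that(4) by (intro limit_inverse_setting[OF hp that(1-3) _ _ kap]) (simp_all flip: one_ereal_def)
    show ?thesis unfolding cond_a_def using inverse_result by blast
  qed
  have inv_a: "cond_a \<and> L = sys" if "?uniq" "denominators_limit Q M L \<theta>" for L \<theta>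
  proof -
    have "\<theta> < 1" using that(2) by (simp add: denominators_limit_def)
    then obtain \<eta> where "\<theta> < ereal \<eta>" "ereal \<eta> < 1" using ereal_dense2 by blast
    then show ?thesis using inv[OF that] by blast
  qed
  have ab: "cond_a \<longleftrightarrow> cond_b"
  proof
    assume "cond_a"
    then show "cond_b" unfolding cond_a_def cond_b_def using direct_denominators(1,3)[OF _ hp] by blast
  next
    assume "cond_b"
    then show "cond_a" unfolding cond_b_def using inv_a by blast
  qed
  have limit: "L = sys \<and> \<theta> = Max (?ratio ` sp)" if a: "cond_a" and L: "denominators_limit Q M L \<theta>" for L \<theta>
  proof -
    note a' = a[unfolded cond_a_def]
    have uniq: "?uniq" by (rule direct_denominators(1)[OF a' hp])
    have Ls: "L = sys" using inv_a[OF uniq L] by blast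
    have fin: "finite sp" and sum: "(\<Sum>\<xi>\<in>sp. spo \<xi>) = M" using a' by (simp_all add: has_exactly_system_poles_def)
    have ne: "sp \<noteq> {}" using sum M_pos by auto
    have \<theta>: "\<theta> = limsup (\<lambda>n. ereal (root n (coeff_norm (Q n - sys))))" "\<theta> < 1"
      using L unfolding Ls by (simp_all add: denominators_limit_def)
    have "Max (?ratio ` sp) < 1"
    proof -
      obtain \<eta> where "\<eta> < 1" "\<forall>\<xi>\<in>sp. ?ratio \<xi> < ereal \<eta>" using system_ratio_bound[OF fin] by blast
      then have "Max (?ratio ` sp) < ereal \<eta>" "ereal \<eta> < 1" using fin ne by (simp_all flip: one_ereal_def)
      then show ?thesis by (rule less_trans)
    qed
    have Max0: "0 \<le> Max (?ratio ` sp)"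
    proof -
      obtain \<xi> where \<xi>: "\<xi> \<in> sp" using ne by blast
      then have "?ratio \<xi> \<le> Max (?ratio ` sp)" using fin by (intro Max_ge) auto
      then show ?thesis using system_ratio_nonneg[OF \<xi>] by (rule order_trans[rotated])
    qed
    \<comment> \<open>The direct estimate needs an \<eta> strictly above all ratios, so the maximum
      is approached from above.\<close>
    have "\<theta> \<le> Max (?ratio ` sp)"
    proof (rule dense_ge_bounded[OF \<open>Max (?ratio ` sp) < 1\<close>])
      fix x assume x: "Max (?ratio ` sp) < x" "x < 1"
      then obtain \<eta> where \<eta>: "x = ereal \<eta>" using Max0 by (cases x) auto
      have "0 < ereal \<eta>" using Max0 x(1) unfolding \<eta> by (rule le_less_trans)
      moreover have "?ratio \<xi> < ereal \<eta>" if "\<xi> \<in> sp" for \<xi>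
        using x(1) fin ne that unfolding \<eta> by (simp add: Max_less_iff)
      ultimately show "\<theta> \<le> x"
        unfolding \<theta>(1) \<eta> using x(2) by (intro direct_denominators(2)[OF a' hp]) (simp_all add: \<eta> flip: one_ereal_def)
    qed
    moreover have "Max (?ratio ` sp) \<le> \<theta>"
    proof (rule dense_ge_bounded[OF \<theta>(2)])
      fix x assume x: "\<theta> < x" "x < 1"
      then obtain \<eta> where \<eta>: "x = ereal \<eta>" using \<theta>0[OF L] by (cases x) auto
      have "\<forall>\<xi>\<in>sp. ?ratio \<xi> \<le> x" using inv[OF uniq L] x unfolding \<eta> by blast
      then show "Max (?ratio ` sp) \<le> x" using fin ne by simp
    qed
    ultimately show ?thesis using Ls by simp
  qed
  have approx: "\<exists>f. f holomorphic_on (\<D> (rho_comp_star E d F m i 0) - sp) \<and> same_germ E f (F i) \<and>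
      (\<forall>K. compact K \<and> K \<subseteq> \<D> (rho_comp_star E d F m i 0) - sp \<longrightarrow>
        limsup (\<lambda>n. ereal (root n (sup_norm K (\<lambda>z. poly (P n 0 i) z / poly (Q n) z - f z))))
          \<le> ereal (ext_map_norm E K) / rho_comp_star E d F m i 0)"
    if a: "cond_a" and i: "i \<in> {1..d}" for i
    using approximant_limsup[OF a[unfolded cond_a_def] hp i]
    by (intro exI[of _ "\<lambda>z. ser (\<lambda>z. poly sys z * F i z) z / poly sys z"]) blast
  show ?thesis using ab limit approx by blast
qed

end
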